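(* Let $r\in\mathbb{Z}_{\ge0}$ be even, let $k$ be a field not of characteristic $2$, let $\mathcal{S}$ be the symmetric monoidal category of super vector spaces over $k$, and let $\mathcal{Z}_{C\ell(1)}:\mathcal{B}ord_2^{\,r}\to\mathcal{S}$ be the state-sum $r$-spin topological field theory of the Clifford algebra $C\ell(1)=k\oplus k\theta$ in one odd generator $\theta$. Let $\Sigma$ be a (compact connected) $r$-spin surface of genus $g$ with $b$ ingoing boundary components of $r$-spin structures $\lambda_1,\dots,\lambda_b\in\mathbb{Z}_r$ and no outgoing boundary components. Then $$\mathcal{Z}_{C\ell(1)}(\Sigma)(\theta^{\lambda_1}\otimes\cdots\otimes\theta^{\lambda_b})=2^{1-g}\,(-1)^{\mathrm{Arf}(\Sigma)},$$ where $\mathrm{Arf}(\Sigma)\in\mathbb{Z}_2$ is the Arf invariant of the $r$-spin structure of $\Sigma$.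
   Context: **r-spin surfaces.** $\mathbb{Z}_r=\mathbb{Z}/r\mathbb{Z}$ (so $\mathbb{Z}_0=\mathbb{Z}$). A surface is an oriented smooth 2-manifold (possibly with boundary); $F_{GL}\Sigma$ is its bundle of oriented frames. $p_{GL}:\widetilde{GL}\to GL_2^+(\mathbb{R})$ is the $r$-fold connected cover ($r>0$) or the universal cover ($r=0$), with fibres isomorphic to $\mathbb{Z}_r$. An $r$-spin structure on $\Sigma$ is a principal $\widetilde{GL}$-bundle $P\to\Sigma$ with a bundle map $p:P\to F_{GL}\Sigma$ over $\Sigma$ intertwining the (right) actions; $p$ is a principal $\mathbb{Z}_r$-bundle. A morphism of $r$-spin surfaces is a bundle map covering the map $df_*$ of frame bundles for a local diffeomorphism $f$ of the surfaces. For $\kappa\in\mathbb{Z}_r$ (using a fixed set of integer representatives) $\mathbb{C}^\kappa$ is the $r$-spin structure on $\mathbb{C}^\times$ with trivial bundle $\widetilde{GL}\times\mathbb{C}^\times$ and $p^\kappa(g,z)=(z^\kappa.p_{GL}(g),z)$, where $z$ acts by left multiplication with the real $2\times2$ matrix of multiplication by $z$. **Boundary parametrisations.** An ingoing (outgoing) collar is the intersection of an open neighbourhood of the unit circle in $\mathbb{C}^\times$ with $\{|z|\ge1\}$ ($\{|z|\le1\}$). A boundary parametrisation of $\Sigma$ is a decomposition $\pi_0(\partial\Sigma)=B_{in}\sqcup B_{out}$ and orientation preserving embeddings $\phi_{in}$ of ingoing collars $U_b$, $b\in B_{in}$, and $\phi_{out}$ of outgoing collars $V_c$, $c\in B_{out}$,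 into $\Sigma$, mapping the unit circle diffeomorphically to the respective boundary component. An $r$-spin boundary parametrisation consists in addition of maps $\lambda:B_{in}\to\mathbb{Z}_r$, $\mu:B_{out}\to\mathbb{Z}_r$ and morphisms of $r$-spin surfaces $\varphi_{in}:\bigsqcup_b\mathbb{C}^{\lambda_b}|_{U_b}\to\Sigma$, $\varphi_{out}:\bigsqcup_c\mathbb{C}^{\mu_c}|_{V_c}\to\Sigma$ covering $\phi_{in},\phi_{out}$. Diffeomorphisms of $r$-spin surfaces with boundary parametrisation are diffeomorphisms of $r$-spin surfaces preserving $B_{in},B_{out},\lambda,\mu$ and the germs of $\varphi_{in},\varphi_{out}$. In the theorem $\Sigma$ carries an $r$-spin boundary parametrisation. **Bordism category $\mathcal{B}ord_2^{\,r}$.** Objects are pairs $(X,\rho)$, $X$ a finite set, $\rho:X\to\mathbb{Z}_r$. Morphisms $(X,\rho)\to(Y,\sigma)$ are compact $r$-spin surfaces with $r$-spin boundary parametrisation and bijections $\beta_{in}:X\to B_{in}$, $\beta_{out}:Y\to B_{out}$ with $\lambda\circ\beta_{in}=\rho$, $\mu\circ\beta_{out}=\sigma$, modulo diffeomorphisms of $r$-spin surfaces with boundary parametrisation compatible with $\beta_{in},\beta_{out}$. Composition is gluing, the tensor product is disjoint union. The surface $\Sigma$ of the theorem is regarded as a morphism from $(\{1,\dots,b\},j\mapsto\lambda_j)$ to $\emptyset$. **Marked PLCW decompositions.** A PLCW decomposition of a compact surface $\Sigma$ presents $\Sigma$ as glued from finitely many polygons ($n$-gons, $n\ge1$) along sides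 (sides of the same polygon may be glued to each other); $\Sigma_2,\Sigma_1,\Sigma_0$ are the sets of faces, edges, vertices. Only decompositions with exactly one vertex and one edge on each boundary component are considered; boundary components are identified with boundary edges and with boundary vertices. A marking consists of a marked side for each face, an orientation of each edge, and an edge index $s_e\in\mathbb{Z}_r$ for each $e\in\Sigma_1$. Faces are oriented as $\Sigma$. For $v\in\Sigma_0$ let $D_v$ be the number of faces whose marked side has $v$ as its boundary vertex in clockwise direction (with respect to the face); $N_v$ the number of edges starting at $v$ plus the number of edges ending at $v$; for an edge $e$ at $v$ let $\hat s_e=-1$ if $e$ starts and ends at $v$, $\hat s_e=s_e$ if $e$ points out of $v$, $\hat s_e=-1-s_e$ if $e$ points into $v$. Put $R_u=\lambda_u-1$ for $u\in B_{in}$ and $R_u=1-\mu_u$ for $u\in B_{out}$. The marking is admissible (for $\lambda,\mu$) if, in $\mathbb{Z}_r$, $\sum_{e\ni v}\hat s_e=D_v-N_v+1$ for each inner vertex $v$ and $\sum_{e\ni u}\hat s_e=D_u-N_u+1-R_u$ for each boundary vertex $u$ (sums over the set of edges having the vertex in their boundary). **The $r$-spin structure $\Sigma(s,\lambda,\mu)$.** A marking defines an $r$-spin structure with $r$-spin boundary parametrisation on $\Sigma$ minus its vertices: take the trivial $r$-spin structure on each face (the marked side recording how a standard polygon is embedded into the surface), use the edge indices to fix the ($\mathbb{Z}_r$-valued, constant) transition functions across edges, and parametrise the boundary by the inclusion of the $r$-spin collars prescribed by $\lambda,\mu$ over the collars of the boundary parametrisation. It extends uniquely to the vertices if and only if the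 marking is admissible; the extension is $\Sigma(s,\lambda,\mu)$. Conventions are fixed by the holonomy $\zeta(\gamma)\in\mathbb{Z}_r$ of closed curves $\gamma$ (defined below, and normalised to be $1$ for a curve running counter-clockwise around an embedded disc): $\zeta(\gamma)=\sum_a(\hat s_a+\hat\delta_a)$, the sum being over the arcs $a$ into which the edges cut $\gamma$. Here, if $a$ lies in the face $f$ and leaves it through the edge $e$, then $\hat s_a=s_e$ if $e$ and $a$ cross positively (as for a curve going counter-clockwise around a vertex and crossing an edge pointing out of that vertex) and $\hat s_a=-s_e-1$ otherwise, and $\hat\delta_a=1$ if the clockwise vertex of the marked side of $f$ lies on the right of $a$ and $0$ otherwise. **State-sum construction.** For a Frobenius algebra $(A,\mu,\eta,\Delta,\varepsilon)$ in $\mathcal{S}$, with braiding $c$ and unit object $\mathbb{I}$, the window element is $\tau=\mu\circ\Delta\circ\eta$ (assumed invertible with respect to $\mu$) and the Nakayama automorphism is $N=(\mathrm{id}_A\otimes(\varepsilon\circ\mu))\circ(c_{A,A}\otimes\mathrm{id}_A)\circ(\mathrm{id}_A\otimes(\Delta\circ\eta))$ (assumed to satisfy $N^r=\mathrm{id}$). For $\lambda\in\mathbb{Z}_r$ the idempotent $P_\lambda=(\tau^{-1}\cdot(-))\circ\mu\circ c_{A,A}\circ(\mathrm{id}\otimes N^{1-\lambda})\circ\Delta$ is split as $P_\lambda=\iota_\lambda\circ\pi_\lambda$, $\pi_\lambda:A\to Z_\lambda$, $\iota_\lambda:Z_\lambda\to A$, $\pi_\lambda\circ\iota_\lambda=\mathrm{id}$.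 On objects, $\mathcal{Z}_A(X,\rho)=\bigotimes_{x\in X}Z_{\rho_x}$. For a bordism $\Sigma:(X,\rho)\to(Y,\sigma)$ choose a PLCW decomposition with admissible marking such that $\Sigma(s,\lambda,\mu)$ is isomorphic to the $r$-spin structure with parametrised boundary of $\Sigma$. Let $S$ be the set of sides $(f,k)$ of all faces, $(f,1)$ being the marked side of $f$ and numbering being counter-clockwise, and $E\subset\Sigma_1\times\{l,r\}$ the set of $(e,l)$ (resp. $(e,r)$) such that a face is attached on the left (resp. right) of $e$; let $\Phi:E\to S$ be the resulting bijection. Choose a map $V$ from the set of vertices not on outgoing boundary components to $E$ with $V(v)=(e,x)$, $v\in\partial(e)$. Let $\mathcal{A}_S,\mathcal{A}_E,\mathcal{A}_{in},\mathcal{A}_{out}$ be the tensor products of copies of $A$ indexed by $S,E,B_{in},B_{out}$ (copies written $A^{(f,k)},A^{(e,x)},A^{(e,in)},A^{(e,out)}$). (i) $\mathcal{C}=\bigotimes_{e\in\Sigma_1}g_e:\mathcal{A}_{in}\to\mathcal{A}_E\otimes\mathcal{A}_{out}$, where $g_e=N^{-s_e-1}$ on $A^{(e,in)}$ for $e$ ingoing (its target being the factor of $\mathcal{A}_E$ belonging to $e$), and otherwise $g_e=(\mathrm{id}_A\otimes N^{s_e+1})\circ\Delta\circ\eta$ with target $A^{(e,l)}\otimes A^{(e,r)}$ for inner $e$, $A^{(e,l)}\otimes A^{(e,out)}$ for outgoing $e$ with the surface on its left, $A^{(e,out)}\otimes A^{(e,r)}$ for outgoing $e$ with the surface on its right.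 (ii) $\mathcal{Y}:\mathcal{A}_E\to\mathcal{A}_E$ is multiplication by the product, over all vertices $v$ not on outgoing boundary components, of $\tau^{-1}$ inserted in the factor $V(v)$. (iii) $\mathcal{F}=\bigotimes_{f\in\Sigma_2}\varepsilon\circ\mu^{(n_f)}:\mathcal{A}_S\to\mathbb{I}$, where $f$ is an $n_f$-gon, $\mu^{(n)}$ is the $n$-fold product ($\mu^{(1)}=\mathrm{id}_A$), and factors are ordered $(f,1),\dots,(f,n_f)$. (iv) $\mathcal{L}=\big((\mathcal{F}\circ\Pi_\Phi\circ\mathcal{Y})\otimes\mathrm{id}\big)\circ\mathcal{C}:\mathcal{A}_{in}\to\mathcal{A}_{out}$, where $\Pi_\Phi$ permutes tensor factors according to $\Phi$. (v) $\mathcal{Z}_A(\Sigma)=\mathcal{E}_{out}\circ\mathcal{L}\circ\mathcal{E}_{in}$, where $\mathcal{E}_{in}$ is the permutation induced by $\beta_{in}$ followed by $\bigotimes_b\iota_{\lambda_b}$ and $\mathcal{E}_{out}$ is $\bigotimes_c\pi_{\mu_c}$ followed by the permutation induced by $\beta_{out}$. This defines a symmetric monoidal functor. **The Clifford algebra.** $C\ell(1)=k\oplus k\theta$ with $\theta$ odd, $\theta^2=1$, $\varepsilon(1)=2$, $\varepsilon(\theta)=0$, $\Delta(1)=\tfrac12(1\otimes1+\theta\otimes\theta)$, $\Delta(\theta)=\tfrac12(\theta\otimes1+1\otimes\theta)$. One has $\tau=\eta$, $N(\theta^m)=(-1)^m\theta^m$, and $Z_\lambda=k\theta^\lambda$ for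 $\lambda\in\mathbb{Z}_r$ (well defined since $r$ is even). **Holonomies.** A curve in $\Sigma$ is a smooth immersion $\gamma:[0,1]\to\Sigma$ which is either closed with equal tangent vectors at start and end, or starts and ends on the boundary; in the latter case the start and end points are the images of $1\in\mathbb{C}$ under the boundary parametrisation maps and the tangent vector of the curve there is the same as that of the boundary curve. Completing the tangent vector to an oriented frame gives a lift of $\gamma$ to $F_{GL}\Sigma$ (unique up to homotopy), which is lifted further to $\tilde\gamma$ in $P$. For closed $\gamma$, $\zeta(\gamma)\in\mathbb{Z}_r$ is the holonomy of $\tilde\gamma$. For non-closed $\gamma$, the fibres over the start and end point are identified using, on a disc $D$ around $1\in\mathbb{C}^\times$, the isomorphism of $r$-spin structures $\mathbb{C}^0|_D\to\mathbb{C}^\kappa|_D$ which is the identity on the fibre over $1$, and $\zeta(\gamma)\in\mathbb{Z}_r$ is the resulting holonomy of $\tilde\gamma$. **Arf invariant.** Let $r$ be even and $\Sigma$ be connected of genus $g$ with $b$ boundary components. Then $$\mathrm{Arf}(\Sigma)=\sum_{i=1}^g(\zeta(a_i)+1)(\zeta(b_i)+1)+\sum_{j=1}^{b-1}(\zeta(c_j)+1)(\zeta(\partial_j)+1)\in\mathbb{Z}_2$$ (empty sums being zero), for the following standard set of curves. For $g+b\ge1$, $\Sigma$ is decomposed into a single $(4g+3b)$-gon with edges $s_i,t_i$ ($i=1,\dots,g$), $r_j,u_j$ ($j=1,\dots,b$): there are one inner vertex $v_0$ and boundary vertices $v_1,\dots,v_b$; $u_j$ is the $j$-th boundary edge, starting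 and ending at $v_j$; $r_j$ runs from $v_0$ to $v_j$; $s_i,t_i$ are loops at $v_0$, the four sides of the polygon belonging to the $i$-th handle being alternately $s_i,t_i,s_i,t_i$. The curves $a_i$ and $b_i$ are the closed curves of the $i$-th handle crossing only $s_i$, respectively only $t_i$, once; $\partial_j$ is the closed curve parallel to the $j$-th boundary component, crossing only $r_j$, once; and $c_j$ ($1\le j\le b-1$) runs inside the polygon from the $b$-th boundary component to the $j$-th. (In terms of the edge indices, denoted like the edges, for only ingoing boundary components these have $\zeta(a_i)=s_i$, $\zeta(b_i)=t_i$, $\zeta(c_j)=u_j-u_b+1$, $\zeta(\partial_j)=1-\lambda_j$.) *)

theory Defs
  imports "HOL-Analysis.Analysis" "HOL-Number_Theory.Cong"
begin

section \<open>Smooth oriented surfaces with boundary\<close>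

primrec Ck_on :: "nat \<Rightarrow> 'a::euclidean_space set \<Rightarrow> ('a \<Rightarrow> 'b::real_normed_vector) \<Rightarrow> bool" where
  "Ck_on 0 U f \<longleftrightarrow> continuous_on U f"
| "Ck_on (Suc n) U f \<longleftrightarrow> (\<forall>x\<in>U. f differentiable (at x)) \<and>
     (\<forall>v\<in>Basis. Ck_on n U (\<lambda>x. frechet_derivative f (at x) v))"

text \<open>On a set \<open>S\<close> that need not be open, smooth means that near each point of \<open>S\<close> there is a smooth
  extension to an open set.\<close>

definition smooth_on :: "'a::euclidean_space set \<Rightarrow> ('a \<Rightarrow> 'b::real_normed_vector) \<Rightarrow> bool" where
  "smooth_on S f \<longleftrightarrow> (\<forall>x\<in>S. \<exists>U g. open U \<and> x \<in> U \<and> (\<forall>n. Ck_on n U g) \<and> (\<forall>y\<in>S \<inter> U. g y = f y))"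

definition det2 :: "complex \<Rightarrow> complex \<Rightarrow> real" where
  "det2 v w = Im (cnj v * w)"

type_synonym 'p chart = "'p set \<times> ('p \<Rightarrow> complex)"

record 'p surface =
  topo :: "'p topology"
  atlas :: "'p chart set"

abbreviation half_plane :: "complex set" where
  "half_plane \<equiv> {z. 0 \<le> Im z}"

definition transition :: "'p chart \<Rightarrow> 'p chart \<Rightarrow> complex \<Rightarrow> complex" where
  "transition c c' = snd c' \<circ> inv_into (fst c) (snd c)"

definition dtransition :: "'p chart \<Rightarrow> 'p chart \<Rightarrow> complex \<Rightarrow> complex \<Rightarrow> complex" where
  "dtransition c c' z =
     frechet_derivative (transition c c') (at z within snd c ` (fst c \<inter> fst c'))"

text \<open>Second countability is not listed: only compact surfaces occur below.\<close>

definition oriented_surface :: "('p, 'm) surface_scheme \<Rightarrow> bool" where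
  "oriented_surface M \<longleftrightarrow>
     Hausdorff_space (topo M) \<and>
     (\<Union>c\<in>atlas M. fst c) = topspace (topo M) \<and>
     (\<forall>c\<in>atlas M. openin (topo M) (fst c) \<and>
        openin (top_of_set half_plane) (snd c ` fst c) \<and>
        homeomorphic_map (subtopology (topo M) (fst c)) (top_of_set (snd c ` fst c)) (snd c)) \<and>
     (\<forall>c\<in>atlas M. \<forall>c'\<in>atlas M.
        smooth_on (snd c ` (fst c \<inter> fst c')) (transition c c') \<and>
        (\<forall>z\<in>snd c ` (fst c \<inter> fst c'). 0 < det2 (dtransition c c' z 1) (dtransition c c' z \<i>)))"

definition boundary :: "('p, 'm) surface_scheme \<Rightarrow> 'p set" where
  "boundary M = {x. \<exists>c\<in>atlas M. x \<in> fst c \<and> Im (snd c x) = 0}"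

definition smooth_into :: "('p, 'm) surface_scheme \<Rightarrow> 'a::euclidean_space set \<Rightarrow> ('a \<Rightarrow> 'p) \<Rightarrow> bool" where
  "smooth_into M S h \<longleftrightarrow> continuous_map (top_of_set S) (topo M) h \<and>
     (\<forall>c\<in>atlas M. smooth_on {z\<in>S. h z \<in> fst c} (snd c \<circ> h))"

definition push :: "complex set \<Rightarrow> (complex \<Rightarrow> 'p) \<Rightarrow> 'p chart \<Rightarrow> complex \<Rightarrow> complex \<Rightarrow> complex" where
  "push S h c z = frechet_derivative (snd c \<circ> h) (at z within S)"

definition orientation_preserving :: "('p, 'm) surface_scheme \<Rightarrow> complex set \<Rightarrow> (complex \<Rightarrow> 'p) \<Rightarrow> bool" where
  "orientation_preserving M S h \<longleftrightarrow>
     (\<forall>c\<in>atlas M. \<forall>z\<in>S. h z \<in> fst c \<longrightarrow> 0 < det2 (push S h c z 1) (push S h c z \<i>))"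


section \<open>The coverings of \<open>GL\<^sub>2\<^sup>+(\<real>)\<close>\<close>

text \<open>A real \<open>2 \<times> 2\<close> matrix, and likewise a frame in a chart, is the pair of its columns.
  An element of the universal covering group is a matrix \<open>g\<close> together with a choice \<open>t\<close> of the argument
  of its first column. In the product, the argument of the first column of \<open>gh\<close> is obtained by
  continuity: \<open>g\<close> rotates every vector by \<open>t\<close> up to an angle of absolute value less than \<open>\<pi>\<close>.
  The \<open>r\<close>-fold covering is the quotient by the central subgroup generated by \<open>deck r\<close>; for
  \<open>r = 0\<close> this is the universal covering itself.\<close>

type_synonym mat2 = "complex \<times> complex"
type_synonym glt = "mat2 \<times> real"

definition mapply :: "mat2 \<Rightarrow> complex \<Rightarrow> complex" where
  "mapply g z = Re z *\<^sub>R fst g + Im z *\<^sub>R snd g"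

definition mmul :: "mat2 \<Rightarrow> mat2 \<Rightarrow> mat2" where
  "mmul g h = (mapply g (fst h), mapply g (snd h))"

definition GLt :: "glt set" where
  "GLt = {(g, t). 0 < det2 (fst g) (snd g) \<and> sgn (fst g) = cis t}"

definition gmul :: "glt \<Rightarrow> glt \<Rightarrow> glt" where
  "gmul = (\<lambda>(g, t) (h, u). (mmul g h, t + u + Arg (mapply g (cis u) * cnj (cis (t + u)))))"

definition rot :: "real \<Rightarrow> glt" where
  "rot \<alpha> = ((cis \<alpha>, \<i> * cis \<alpha>), \<alpha>)"

definition deck :: "int \<Rightarrow> glt" where
  "deck k = rot (2 * pi * of_int k)"


section \<open>\<open>r\<close>-spin surfaces with parametrised boundary\<close>

text \<open>Only ingoing boundary components are considered; they are numbered by \<open>{1..nin}\<close>.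
  \<open>frm q c\<close> is the image of \<open>q\<close> in the bundle of oriented frames, read in the chart \<open>c\<close>.
  \<open>lam j\<close> is the fixed integer representative of an element of \<open>\<int>\<^sub>r\<close>.\<close>

record ('p, 'q) rspin_surface = "'p surface" +
  tot :: "'q topology"
  proj :: "'q \<Rightarrow> 'p"
  act :: "'q \<Rightarrow> glt \<Rightarrow> 'q"
  frm :: "'q \<Rightarrow> 'p chart \<Rightarrow> mat2"
  nin :: nat
  collar :: "nat \<Rightarrow> complex set"
  bpar :: "nat \<Rightarrow> complex \<Rightarrow> 'p"
  lam :: "nat \<Rightarrow> int"
  blift :: "nat \<Rightarrow> glt \<times> complex \<Rightarrow> 'q"

text \<open>A right action of the \<open>r\<close>-fold covering group is a right action of the universal one under which
  \<open>deck r\<close> acts trivially. In the local triviality condition, the map \<open>(y, g) \<mapsto> \<sigma>(y)g\<close> is required to be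
  a continuous open surjection whose fibres are the cosets of the group generated by \<open>deck r\<close>, that
  is, to induce a homeomorphism after passing to the \<open>r\<close>-fold covering.\<close>

definition principal_bundle :: "nat \<Rightarrow> ('p, 'q) rspin_surface \<Rightarrow> bool" where
  "principal_bundle r M \<longleftrightarrow>
     continuous_map (tot M) (topo M) (proj M) \<and>
     continuous_map (prod_topology (tot M) (top_of_set GLt)) (tot M) (\<lambda>(q, g). act M q g) \<and>
     (\<forall>q\<in>topspace (tot M).
        act M q (rot 0) = q \<and> act M q (deck (int r)) = q \<and>
        (\<forall>g\<in>GLt. proj M (act M q g) = proj M q \<and>
          (\<forall>h\<in>GLt. act M (act M q g) h = act M q (gmul g h)))) \<and>
     (\<forall>x\<in>topspace (topo M). \<exists>U \<sigma>. openin (topo M) U \<and> x \<in> U \<and>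
        continuous_map (subtopology (topo M) U) (tot M) \<sigma> \<and>
        (\<forall>y\<in>U. proj M (\<sigma> y) = y) \<and>
        (let A = prod_topology (subtopology (topo M) U) (top_of_set GLt);
             B = subtopology (tot M) {q \<in> topspace (tot M). proj M q \<in> U};
             F = (\<lambda>(y, g). act M (\<sigma> y) g)
         in continuous_map A B F \<and> open_map A B F \<and> F ` topspace A = topspace B) \<and>
        (\<forall>y\<in>U. \<forall>g\<in>GLt. \<forall>h\<in>GLt. act M (\<sigma> y) g = act M (\<sigma> y) h \<longleftrightarrow>
           fst g = fst h \<and> (\<exists>k::int. snd g = snd h + 2 * pi * of_int (k * int r))))"

definition frame_map :: "('p, 'q) rspin_surface \<Rightarrow> bool" where
  "frame_map M \<longleftrightarrow>
     (\<forall>c\<in>atlas M.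
        continuous_map (subtopology (tot M) {q \<in> topspace (tot M). proj M q \<in> fst c}) euclidean
          (\<lambda>q. frm M q c) \<and>
        (\<forall>q\<in>topspace (tot M). proj M q \<in> fst c \<longrightarrow>
           0 < det2 (fst (frm M q c)) (snd (frm M q c)) \<and>
           (\<forall>g\<in>GLt. frm M (act M q g) c = mmul (frm M q c) (fst g)) \<and>
           (\<forall>c'\<in>atlas M. proj M q \<in> fst c' \<longrightarrow>
              frm M q c' = map_prod (dtransition c c' (snd c (proj M q)))
                                    (dtransition c c' (snd c (proj M q))) (frm M q c))))"

text \<open>A morphism from the restriction of \<open>\<complex>\<^sup>\<kappa>\<close> to \<open>S\<close> (from the trivial \<open>r\<close>-spin structure if
  \<open>\<kappa> = 0\<close>; then \<open>0 \<in> S\<close> is allowed) into \<open>M\<close>, covering \<open>h\<close>.\<close>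

definition rspin_morphism ::
  "('p, 'q) rspin_surface \<Rightarrow> complex set \<Rightarrow> int \<Rightarrow> (complex \<Rightarrow> 'p) \<Rightarrow> (glt \<times> complex \<Rightarrow> 'q) \<Rightarrow> bool" where
  "rspin_morphism M S \<kappa> h \<Psi> \<longleftrightarrow>
     continuous_map (top_of_set (GLt \<times> S)) (tot M) \<Psi> \<and>
     (\<forall>g\<in>GLt. \<forall>z\<in>S.
        proj M (\<Psi> (g, z)) = h z \<and>
        (\<forall>g'\<in>GLt. \<Psi> (gmul g g', z) = act M (\<Psi> (g, z)) g') \<and>
        (\<forall>c\<in>atlas M. h z \<in> fst c \<longrightarrow>
           frm M (\<Psi> (g, z)) c = (push S h c z (z powi \<kappa> * fst (fst g)),
                                  push S h c z (z powi \<kappa> * snd (fst g)))))"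

definition boundary_parametrisation :: "nat \<Rightarrow> ('p, 'q) rspin_surface \<Rightarrow> bool" where
  "boundary_parametrisation r M \<longleftrightarrow>
     bij_betw (\<lambda>j. bpar M j ` sphere 0 1) {1..nin M}
       (connected_components_of (subtopology (topo M) (boundary M))) \<and>
     (\<forall>j\<in>{1..nin M}.
        (\<exists>W. open W \<and> 0 \<notin> W \<and> sphere 0 1 \<subseteq> W \<and> collar M j = W \<inter> {z. 1 \<le> norm z}) \<and>
        embedding_map (top_of_set (collar M j)) (topo M) (bpar M j) \<and>
        smooth_into M (collar M j) (bpar M j) \<and>
        orientation_preserving M (collar M j) (bpar M j) \<and>
        lam M j mod int r = lam M j \<and>
        rspin_morphism M (collar M j) (lam M j) (bpar M j) (blift M j))"

definition rspin :: "nat \<Rightarrow> ('p, 'q) rspin_surface \<Rightarrow> bool" where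
  "rspin r M \<longleftrightarrow> oriented_surface M \<and> principal_bundle r M \<and> frame_map M \<and>
     boundary_parametrisation r M"


section \<open>Curves and holonomies\<close>

definition velocity :: "(real \<Rightarrow> 'p) \<Rightarrow> 'p chart \<Rightarrow> real \<Rightarrow> complex" where
  "velocity \<gamma> c t = vector_derivative (snd c \<circ> \<gamma>) (at t within {0..1})"

definition immersed_curve :: "('p, 'm) surface_scheme \<Rightarrow> (real \<Rightarrow> 'p) \<Rightarrow> bool" where
  "immersed_curve M \<gamma> \<longleftrightarrow> smooth_into M {0..1} \<gamma> \<and>
     (\<forall>c\<in>atlas M. \<forall>t\<in>{0..1}. \<gamma> t \<in> fst c \<longrightarrow> velocity \<gamma> c t \<noteq> 0)"

definition tangent_lift :: "('p, 'q) rspin_surface \<Rightarrow> (real \<Rightarrow> 'p) \<Rightarrow> (real \<Rightarrow> 'q) \<Rightarrow> bool" where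
  "tangent_lift M \<gamma> \<Gamma> \<longleftrightarrow> continuous_map (top_of_set {0..1}) (tot M) \<Gamma> \<and>
     (\<forall>t\<in>{0..1}. proj M (\<Gamma> t) = \<gamma> t \<and>
        (\<forall>c\<in>atlas M. \<gamma> t \<in> fst c \<longrightarrow> fst (frm M (\<Gamma> t) c) = velocity \<gamma> c t))"

text \<open>\<open>closed_holonomy M \<gamma> k\<close>: the curve is closed and \<open>\<zeta>(\<gamma>)\<close> is the class of \<open>k\<close> in \<open>\<int>\<^sub>r\<close>.\<close>

definition closed_holonomy :: "('p, 'q) rspin_surface \<Rightarrow> (real \<Rightarrow> 'p) \<Rightarrow> int \<Rightarrow> bool" where
  "closed_holonomy M \<gamma> k \<longleftrightarrow> immersed_curve M \<gamma> \<and> \<gamma> 0 = \<gamma> 1 \<and>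
     (\<forall>c\<in>atlas M. \<gamma> 0 \<in> fst c \<longrightarrow> velocity \<gamma> c 0 = velocity \<gamma> c 1) \<and>
     (\<exists>\<Gamma>. tangent_lift M \<gamma> \<Gamma> \<and> \<Gamma> 1 = act M (\<Gamma> 0) (deck k))"

text \<open>The analogue for a curve from the \<open>i\<close>-th to the \<open>j\<close>-th boundary component. Boundary curves carry
  the orientation induced from the surface, which lies outside the unit disc; hence the tangent
  vector \<open>-\<i>\<close> at \<open>1\<close>. The fibres over the end points are identified through the fibre over \<open>1\<close>
  of \<open>\<complex>\<^sup>\<kappa>\<close>, which does not depend on \<open>\<kappa>\<close>.\<close>

definition arc_holonomy ::
  "('p, 'q) rspin_surface \<Rightarrow> nat \<Rightarrow> nat \<Rightarrow> (real \<Rightarrow> 'p) \<Rightarrow> int \<Rightarrow> bool" where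
  "arc_holonomy M i j \<gamma> k \<longleftrightarrow> immersed_curve M \<gamma> \<and> \<gamma> 0 = bpar M i 1 \<and> \<gamma> 1 = bpar M j 1 \<and>
     (\<forall>c\<in>atlas M. \<gamma> 0 \<in> fst c \<longrightarrow> velocity \<gamma> c 0 = push (collar M i) (bpar M i) c 1 (- \<i>)) \<and>
     (\<forall>c\<in>atlas M. \<gamma> 1 \<in> fst c \<longrightarrow> velocity \<gamma> c 1 = push (collar M j) (bpar M j) c 1 (- \<i>)) \<and>
     (\<exists>\<Gamma>. tangent_lift M \<gamma> \<Gamma> \<and>
        (\<exists>g\<in>GLt. \<Gamma> 0 = blift M i (g, 1) \<and> \<Gamma> 1 = blift M j (gmul g (deck k), 1)))"


section \<open>Marked PLCW decompositions\<close>

text \<open>An \<open>n\<close>-gon is the closed unit disc with \<open>n\<close> vertices on its boundary (so that \<open>n = 1, 2\<close> need no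
  special treatment). Its sides are numbered counter-clockwise from \<open>1\<close>, the marked side, whose
  clockwise vertex is the point \<open>1\<close>. The orientation of an edge is that of its parametrisation by
  \<open>{0..1}\<close>; \<open>side_dir (f, k)\<close> says that the counter-clockwise direction of the side agrees with it,
  equivalently that the face \<open>f\<close> is attached on the left of the edge at this side.\<close>

record 'p mplcw =
  faces :: "nat set"
  nsides :: "nat \<Rightarrow> nat"
  fmap :: "nat \<Rightarrow> complex \<Rightarrow> 'p"
  edges :: "nat set"
  emap :: "nat \<Rightarrow> real \<Rightarrow> 'p"
  side_edge :: "nat \<times> nat \<Rightarrow> nat"
  side_dir :: "nat \<times> nat \<Rightarrow> bool"
  eidx :: "nat \<Rightarrow> int"

definition verts :: "'p mplcw \<Rightarrow> 'p set" where
  "verts D = (\<Union>e\<in>edges D. {emap D e 0, emap D e 1})"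

definition sides :: "'p mplcw \<Rightarrow> (nat \<times> nat) set" where
  "sides D = (SIGMA f:faces D. {1..nsides D f})"

text \<open>The arguments of the points of an open side\<close>

definition side_arc :: "'p mplcw \<Rightarrow> nat \<times> nat \<Rightarrow> real set" where
  "side_arc D = (\<lambda>(f, k). {2 * pi * (real k - 1) / real (nsides D f) <..< 2 * pi * real k / real (nsides D f)})"

definition punctured_face :: "'p mplcw \<Rightarrow> nat \<Rightarrow> complex set" where
  "punctured_face D f = cball 0 1 - (\<lambda>k. cis (2 * pi * real k / real (nsides D f))) ` {..<nsides D f}"

definition side_label :: "'p mplcw \<Rightarrow> nat \<times> nat \<Rightarrow> nat \<times> bool" where
  "side_label D x = (side_edge D x, side_dir D x)"

text \<open>The set \<open>E\<close> of the state-sum construction, with \<open>True\<close> for left and \<open>False\<close> for right; the map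
  \<open>\<Phi>\<close> is the inverse of \<open>side_label D\<close> on \<open>sides D\<close>.\<close>

definition attached :: "'p mplcw \<Rightarrow> (nat \<times> bool) set" where
  "attached D = side_label D ` sides D"

definition inner_edge :: "'p mplcw \<Rightarrow> nat \<Rightarrow> bool" where
  "inner_edge D e \<longleftrightarrow> (e, True) \<in> attached D \<and> (e, False) \<in> attached D"

definition bedge :: "('p, 'q) rspin_surface \<Rightarrow> 'p mplcw \<Rightarrow> nat \<Rightarrow> nat" where
  "bedge M D j = (THE e. e \<in> edges D \<and> emap D e ` {0..1} = bpar M j ` sphere 0 1)"

definition plcw_cells :: "('p, 'q) rspin_surface \<Rightarrow> 'p mplcw \<Rightarrow> bool" where
  "plcw_cells M D \<longleftrightarrow>
     finite (faces D) \<and> finite (edges D) \<and>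
     (\<forall>f\<in>faces D. 1 \<le> nsides D f \<and>
        continuous_map (top_of_set (cball 0 1)) (topo M) (fmap D f) \<and>
        inj_on (fmap D f) (ball 0 1) \<and>
        smooth_into M (punctured_face D f) (fmap D f) \<and>
        orientation_preserving M (punctured_face D f) (fmap D f)) \<and>
     (\<forall>e\<in>edges D. continuous_map (top_of_set {0..1}) (topo M) (emap D e) \<and>
        inj_on (emap D e) {0<..<1}) \<and>
     disjoint_family_on (\<lambda>f. fmap D f ` ball 0 1) (faces D) \<and>
     disjoint_family_on (\<lambda>e. emap D e ` {0<..<1}) (edges D) \<and>
     (let F = (\<Union>f\<in>faces D. fmap D f ` ball 0 1); E = (\<Union>e\<in>edges D. emap D e ` {0<..<1})
      in F \<union> E \<union> verts D = topspace (topo M) \<and>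
         F \<inter> E = {} \<and> F \<inter> verts D = {} \<and> E \<inter> verts D = {})"

definition plcw_gluing :: "('p, 'q) rspin_surface \<Rightarrow> 'p mplcw \<Rightarrow> bool" where
  "plcw_gluing M D \<longleftrightarrow>
     (\<forall>x\<in>sides D. side_edge D x \<in> edges D \<and>
        (\<exists>h. (if side_dir D x then strict_mono_on (side_arc D x) h
              else strict_antimono_on (side_arc D x) h) \<and>
             h ` side_arc D x = {0<..<1} \<and>
             (\<forall>\<tau>\<in>side_arc D x. fmap D (fst x) (cis \<tau>) = emap D (side_edge D x) (h \<tau>)))) \<and>
     inj_on (side_label D) (sides D) \<and>
     (\<forall>e\<in>edges D. inner_edge D e \<and> emap D e ` {0<..<1} \<inter> boundary M = {} \<or>
        (e, True) \<in> attached D \<and> (e, False) \<notin> attached D \<and> emap D e ` {0..1} \<subseteq> boundary M)"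

text \<open>Each boundary component consists of one vertex and one edge, which is oriented as the boundary of
  the surface. Its vertex is different from the base point of the boundary parametrisation.\<close>

definition plcw :: "('p, 'q) rspin_surface \<Rightarrow> 'p mplcw \<Rightarrow> bool" where
  "plcw M D \<longleftrightarrow> plcw_cells M D \<and> plcw_gluing M D \<and>
     (\<forall>j\<in>{1..nin M}. \<exists>e\<in>edges D. emap D e ` {0..1} = bpar M j ` sphere 0 1 \<and>
        emap D e 0 = emap D e 1 \<and> emap D e 0 \<noteq> bpar M j 1)"

definition genus :: "('p, 'q) rspin_surface \<Rightarrow> nat \<Rightarrow> bool" where
  "genus M g \<longleftrightarrow> (\<exists>D. plcw M D) \<and>
     (\<forall>D. plcw M D \<longrightarrow>
        int (card (verts D)) - int (card (edges D)) + int (card (faces D)) = 2 - 2 * int g - int (nin M))"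

definition hat_s :: "'p mplcw \<Rightarrow> 'p \<Rightarrow> nat \<Rightarrow> int" where
  "hat_s D v e =
     (if emap D e 0 = v \<and> emap D e 1 = v then - 1
      else if emap D e 0 = v then eidx D e
      else - 1 - eidx D e)"

definition edges_at :: "'p mplcw \<Rightarrow> 'p \<Rightarrow> nat set" where
  "edges_at D v = {e\<in>edges D. v \<in> {emap D e 0, emap D e 1}}"

definition vertex_D :: "'p mplcw \<Rightarrow> 'p \<Rightarrow> int" where
  "vertex_D D v = int (card {f\<in>faces D. fmap D f 1 = v})"

definition vertex_N :: "'p mplcw \<Rightarrow> 'p \<Rightarrow> int" where
  "vertex_N D v = int (card {e\<in>edges D. emap D e 0 = v}) + int (card {e\<in>edges D. emap D e 1 = v})"

definition admissible :: "nat \<Rightarrow> ('p, 'q) rspin_surface \<Rightarrow> 'p mplcw \<Rightarrow> bool" where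
  "admissible r M D \<longleftrightarrow>
     (\<forall>v\<in>verts D - boundary M.
        [(\<Sum>e\<in>edges_at D v. hat_s D v e) = vertex_D D v - vertex_N D v + 1] (mod int r)) \<and>
     (\<forall>j\<in>{1..nin M}. \<forall>u\<in>verts D \<inter> bpar M j ` sphere 0 1.
        [(\<Sum>e\<in>edges_at D u. hat_s D u e) = vertex_D D u - vertex_N D u + 1 - (lam M j - 1)] (mod int r))"


section \<open>The \<open>r\<close>-spin structure of a marking\<close>

text \<open>Two points of the bundle over the same point of the surface are aligned if they can be
  joined through lifts of frames whose first vectors have the same direction.\<close>

definition aligned :: "('p, 'q) rspin_surface \<Rightarrow> 'q \<Rightarrow> 'q \<Rightarrow> bool" where
  "aligned M q q' \<longleftrightarrow> (\<exists>g. (g, 0) \<in> GLt \<and> q' = act M q (g, 0))"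

text \<open>For the trivialisation \<open>\<Psi>\<close> over the face \<open>f\<close>: the lift of the frame at the point \<open>cis \<tau>\<close> whose first vector
  is the counter-clockwise tangent vector of the boundary of the polygon, where the angle is
  counted from the clockwise vertex of the marked side (\<open>0 < \<tau> < 2\<pi>\<close>).\<close>

definition side_lift :: "(nat \<Rightarrow> glt \<times> complex \<Rightarrow> 'q) \<Rightarrow> nat \<Rightarrow> real \<Rightarrow> 'q" where
  "side_lift \<Psi> f \<tau> = \<Psi> f (rot (\<tau> + pi / 2), cis \<tau>)"

text \<open>The \<open>r\<close>-spin structure of \<open>M\<close> with its boundary parametrisation is isomorphic to the one defined by
  the marking: there are isomorphisms \<open>\<Psi> f\<close> from the trivial \<open>r\<close>-spin structures on the faces such that
  the transition functions are those given by the edge indices. Across an edge \<open>e\<close>, the two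
  tangent lifts point in opposite directions and the one on the right is obtained from the one on
  the left by rotation through \<open>\<pi> + 2\<pi>s\<^sub>e\<close>. Along a curve arriving in a polygon at the boundary
  point of argument \<open>\<tau>\<close> and leaving it at that of argument \<open>\<tau>'\<close>, the tangent turns by
  \<open>\<tau>' - \<tau> - \<pi> + 2\<pi>\<delta>\<close>, where \<open>\<delta> = 1\<close> if the point \<open>1\<close> lies on the right of the curve and \<open>\<delta> = 0\<close>
  otherwise, so this is the normalisation with holonomy \<open>\<zeta>(\<gamma>) = \<Sum>\<^sub>a (s\<^sub>a + \<delta>\<^sub>a)\<close>, with contribution
  \<open>s\<^sub>e\<close> for crossing \<open>e\<close> from the right to the left and \<open>-1 - s\<^sub>e\<close> for crossing it from the left to
  the right. At the boundary the collar takes the place of the face on the right; since transition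
  functions are constant along an edge, it suffices to compare at the base point.\<close>

definition presents :: "nat \<Rightarrow> ('p, 'q) rspin_surface \<Rightarrow> 'p mplcw \<Rightarrow> bool" where
  "presents r M D \<longleftrightarrow> plcw M D \<and> admissible r M D \<and>
     (\<exists>\<Psi>. (\<forall>f\<in>faces D. rspin_morphism M (punctured_face D f) 0 (fmap D f) (\<Psi> f)) \<and>
        (\<forall>x\<in>sides D. \<forall>y\<in>sides D. \<forall>\<tau>\<in>side_arc D x. \<forall>\<tau>'\<in>side_arc D y.
           side_edge D x = side_edge D y \<and> side_dir D x \<and> \<not> side_dir D y \<and>
           fmap D (fst x) (cis \<tau>) = fmap D (fst y) (cis \<tau>') \<longrightarrow>
           aligned M
             (act M (side_lift \<Psi> (fst x) \<tau>) (rot (pi + 2 * pi * of_int (eidx D (side_edge D x)))))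
             (side_lift \<Psi> (fst y) \<tau>')) \<and>
        (\<forall>j\<in>{1..nin M}. \<forall>x\<in>sides D. \<forall>\<tau>\<in>side_arc D x.
           side_edge D x = bedge M D j \<and> fmap D (fst x) (cis \<tau>) = bpar M j 1 \<longrightarrow>
           aligned M
             (act M (side_lift \<Psi> (fst x) \<tau>) (rot (pi + 2 * pi * of_int (eidx D (bedge M D j)))))
             (blift M j (rot (pi / 2), 1))))"


section \<open>Frobenius algebras in super vector spaces\<close>

text \<open>Structure constants with respect to a finite homogeneous basis: \<open>fmul i j k\<close> is the coefficient of
  \<open>e\<^sub>k\<close> in \<open>e\<^sub>i e\<^sub>j\<close>, and \<open>fcomul i j k\<close> that of \<open>e\<^sub>j \<otimes> e\<^sub>k\<close> in \<open>\<Delta>(e\<^sub>i)\<close>. Elements of the algebra are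
  coefficient functions.\<close>

record ('i, 'k) frobenius =
  parity :: "'i \<Rightarrow> nat"
  funit :: "'i \<Rightarrow> 'k"
  fmul :: "'i \<Rightarrow> 'i \<Rightarrow> 'i \<Rightarrow> 'k"
  fcounit :: "'i \<Rightarrow> 'k"
  fcomul :: "'i \<Rightarrow> 'i \<Rightarrow> 'i \<Rightarrow> 'k"

definition basis_vec :: "'i \<Rightarrow> 'i \<Rightarrow> 'k::field" where
  "basis_vec i = (\<lambda>j. if j = i then 1 else 0)"

definition vmul :: "('i::finite, 'k::field) frobenius \<Rightarrow> ('i \<Rightarrow> 'k) \<Rightarrow> ('i \<Rightarrow> 'k) \<Rightarrow> 'i \<Rightarrow> 'k" where
  "vmul A x y = (\<lambda>k. \<Sum>i\<in>UNIV. \<Sum>j\<in>UNIV. x i * y j * fmul A i j k)"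

definition counit :: "('i::finite, 'k::field) frobenius \<Rightarrow> ('i \<Rightarrow> 'k) \<Rightarrow> 'k" where
  "counit A x = (\<Sum>i\<in>UNIV. x i * fcounit A i)"

definition comul :: "('i::finite, 'k::field) frobenius \<Rightarrow> ('i \<Rightarrow> 'k) \<Rightarrow> 'i \<Rightarrow> 'i \<Rightarrow> 'k" where
  "comul A x = (\<lambda>j k. \<Sum>i\<in>UNIV. x i * fcomul A i j k)"

definition window :: "('i::finite, 'k::field) frobenius \<Rightarrow> 'i \<Rightarrow> 'k" where
  "window A = (\<lambda>l. \<Sum>j\<in>UNIV. \<Sum>k\<in>UNIV. comul A (funit A) j k * fmul A j k l)"

definition window_inv :: "('i::finite, 'k::field) frobenius \<Rightarrow> 'i \<Rightarrow> 'k" where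
  "window_inv A = (THE y. vmul A (window A) y = funit A \<and> vmul A y (window A) = funit A)"

text \<open>Here \<open>x \<otimes> e\<^sub>j \<otimes> e\<^sub>k\<close> is sent to \<open>e\<^sub>j\<close> times the counit of \<open>x e\<^sub>k\<close>, with the Koszul sign of the
  exchange of \<open>x\<close> and \<open>e\<^sub>j\<close>.\<close>

definition nakayama :: "('i::finite, 'k::field) frobenius \<Rightarrow> ('i \<Rightarrow> 'k) \<Rightarrow> 'i \<Rightarrow> 'k" where
  "nakayama A x = (\<lambda>j. \<Sum>i\<in>UNIV. \<Sum>k\<in>UNIV.
     x i * comul A (funit A) j k * (- 1) ^ (parity A i * parity A j) *
     counit A (vmul A (basis_vec i) (basis_vec k)))"

definition nak_pow :: "('i::finite, 'k::field) frobenius \<Rightarrow> int \<Rightarrow> ('i \<Rightarrow> 'k) \<Rightarrow> 'i \<Rightarrow> 'k" where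
  "nak_pow A n = (if 0 \<le> n then nakayama A ^^ nat n else inv (nakayama A) ^^ nat (- n))"

definition proj_lambda :: "('i::finite, 'k::field) frobenius \<Rightarrow> int \<Rightarrow> ('i \<Rightarrow> 'k) \<Rightarrow> 'i \<Rightarrow> 'k" where
  "proj_lambda A l x = vmul A (window_inv A)
     (\<lambda>m. \<Sum>j\<in>UNIV. \<Sum>k\<in>UNIV. \<Sum>k'\<in>UNIV.
        comul A x j k * nak_pow A (1 - l) (basis_vec k) k' *
        (- 1) ^ (parity A j * parity A k') * fmul A k' j m)"


section \<open>The state sum\<close>

text \<open>An element of a tensor product of copies of \<open>A\<close> is given by its coefficients, functions of
  assignments of basis indices to the factors. The order of the factors enters through the Koszul
  sign of a reordering of the list \<open>xs\<close> to the list \<open>ys\<close>, where \<open>p\<close> is the parity at each factor.\<close>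

definition before :: "'l list \<Rightarrow> 'l \<Rightarrow> 'l \<Rightarrow> bool" where
  "before xs a b \<longleftrightarrow> (\<exists>i j. i < j \<and> j < length xs \<and> xs ! i = a \<and> xs ! j = b)"

definition koszul :: "('l \<Rightarrow> nat) \<Rightarrow> 'l list \<Rightarrow> 'l list \<Rightarrow> 'k::field" where
  "koszul p xs ys = (- 1) ^ card {(a, b). before xs a b \<and> before ys b a \<and> odd (p a) \<and> odd (p b)}"

definition edge_list :: "'p mplcw \<Rightarrow> nat list" where
  "edge_list D = sorted_list_of_set (edges D)"

definition boundary_of_edge :: "('p, 'q) rspin_surface \<Rightarrow> 'p mplcw \<Rightarrow> nat \<Rightarrow> nat" where
  "boundary_of_edge M D e = (THE j. j \<in> {1..nin M} \<and> bedge M D j = e)"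

definition in_list :: "('p, 'q) rspin_surface \<Rightarrow> 'p mplcw \<Rightarrow> nat list" where
  "in_list M D = map (boundary_of_edge M D) (filter (\<lambda>e. \<not> inner_edge D e) (edge_list D))"

definition E_list :: "'p mplcw \<Rightarrow> (nat \<times> bool) list" where
  "E_list D = concat (map (\<lambda>e. if inner_edge D e then [(e, True), (e, False)] else [(e, True)])
     (edge_list D))"

definition face_list :: "'p mplcw \<Rightarrow> nat list" where
  "face_list D = sorted_list_of_set (faces D)"

definition face_labels :: "'p mplcw \<Rightarrow> nat \<Rightarrow> (nat \<times> bool) list" where
  "face_labels D f = map (\<lambda>k. side_label D (f, k)) [1..<Suc (nsides D f)]"

definition edge_factor ::
  "('i::finite, 'k::field) frobenius \<Rightarrow> ('p, 'q) rspin_surface \<Rightarrow> 'p mplcw \<Rightarrow>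
   (nat \<Rightarrow> 'i) \<Rightarrow> (nat \<times> bool \<Rightarrow> 'i) \<Rightarrow> nat \<Rightarrow> 'k" where
  "edge_factor A M D i y e =
     (if inner_edge D e
      then \<Sum>m\<in>UNIV. comul A (funit A) (y (e, True)) m *
             nak_pow A (eidx D e + 1) (basis_vec m) (y (e, False))
      else nak_pow A (- eidx D e - 1) (basis_vec (i (boundary_of_edge M D e))) (y (e, True)))"

definition vertex_factor ::
  "('i::finite, 'k::field) frobenius \<Rightarrow> 'p mplcw \<Rightarrow> ('p \<Rightarrow> nat \<times> bool) \<Rightarrow>
   (nat \<times> bool \<Rightarrow> 'i) \<Rightarrow> (nat \<times> bool \<Rightarrow> 'i) \<Rightarrow> nat \<times> bool \<Rightarrow> 'k" where
  "vertex_factor A D V y z x =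
     (vmul A (window_inv A) ^^ card {v\<in>verts D. V v = x}) (basis_vec (y x)) (z x)"

definition face_factor ::
  "('i::finite, 'k::field) frobenius \<Rightarrow> 'p mplcw \<Rightarrow> (nat \<times> bool \<Rightarrow> 'i) \<Rightarrow> nat \<Rightarrow> 'k" where
  "face_factor A D z f =
     (let xs = map (\<lambda>x. basis_vec (z x)) (face_labels D f)
      in counit A (foldl (vmul A) (hd xs) (tl xs)))"

text \<open>The functional \<open>\<L>\<close> on the tensor product of \<open>nin M\<close> copies of \<open>A\<close>, ordered \<open>1, \<dots>, nin M\<close>: first the
  permutation to the order of the boundary edges in \<open>edge_list D\<close>, then \<open>\<C>\<close>, \<open>\<Y>\<close>, \<open>\<Pi>\<^sub>\<Phi>\<close> and \<open>\<F>\<close>.\<close>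

definition state_sum ::
  "('i::finite, 'k::field) frobenius \<Rightarrow> ('p, 'q) rspin_surface \<Rightarrow> 'p mplcw \<Rightarrow> ('p \<Rightarrow> nat \<times> bool) \<Rightarrow>
   ((nat \<Rightarrow> 'i) \<Rightarrow> 'k) \<Rightarrow> 'k" where
  "state_sum A M D V T =
     (\<Sum>i \<in> {1..nin M} \<rightarrow>\<^sub>E UNIV. \<Sum>y \<in> attached D \<rightarrow>\<^sub>E UNIV. \<Sum>z \<in> attached D \<rightarrow>\<^sub>E UNIV.
        T i * koszul (parity A \<circ> i) [1..<Suc (nin M)] (in_list M D) *
        (\<Prod>e\<in>edges D. edge_factor A M D i y e) *
        (\<Prod>x\<in>attached D. vertex_factor A D V y z x) *
        koszul (parity A \<circ> z) (E_list D) (concat (map (face_labels D) (face_list D))) *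
        (\<Prod>f\<in>faces D. face_factor A D z f))"

definition vertex_choice :: "'p mplcw \<Rightarrow> ('p \<Rightarrow> nat \<times> bool) \<Rightarrow> bool" where
  "vertex_choice D V \<longleftrightarrow> (\<forall>v\<in>verts D. V v \<in> attached D \<and>
     v \<in> {emap D (fst (V v)) 0, emap D (fst (V v)) 1})"

text \<open>The state space is the tensor product of the images of the idempotents (each idempotent is split
  through its image), inside the tensor power of \<open>A\<close>.\<close>

definition state_space ::
  "('i::finite, 'k::field) frobenius \<Rightarrow> ('p, 'q) rspin_surface \<Rightarrow> ((nat \<Rightarrow> 'i) \<Rightarrow> 'k) set" where
  "state_space A M = {T. \<forall>i \<in> {1..nin M} \<rightarrow>\<^sub>E UNIV.
     T i = (\<Sum>i' \<in> {1..nin M} \<rightarrow>\<^sub>E UNIV.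
       T i' * (\<Prod>j\<in>{1..nin M}. proj_lambda A (lam M j) (basis_vec (i' j)) (i j)))}"

text \<open>\<open>Z\<close> is the value of the state-sum topological field theory of \<open>A\<close> on \<open>M\<close>, viewed as a bordism from
  its ingoing boundary to the empty set: the map on the state space obtained from the state sum by
  choosing a marked decomposition presenting \<open>M\<close> and a map \<open>V\<close>, independently of these choices.\<close>

definition state_sum_value ::
  "nat \<Rightarrow> ('i::finite, 'k::field) frobenius \<Rightarrow> ('p, 'q) rspin_surface \<Rightarrow> (((nat \<Rightarrow> 'i) \<Rightarrow> 'k) \<Rightarrow> 'k) \<Rightarrow> bool" where
  "state_sum_value r A M Z \<longleftrightarrow>
     (\<exists>D V. presents r M D \<and> vertex_choice D V) \<and>
     (\<forall>D V. presents r M D \<and> vertex_choice D V \<longrightarrow>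
        (\<forall>T\<in>state_space A M. Z T = state_sum A M D V T))"

text \<open>The basis of the Clifford algebra is \<open>1\<close> (index \<open>False\<close>), \<open>\<theta>\<close> (index \<open>True\<close>).\<close>

definition clifford :: "(bool, 'k::field) frobenius" where
  "clifford = \<lparr>
     parity = of_bool,
     funit = (\<lambda>i. if i then 0 else 1),
     fmul = (\<lambda>i j k. if k = (i \<noteq> j) then 1 else 0),
     fcounit = (\<lambda>i. if i then 0 else 2),
     fcomul = (\<lambda>i j k. if i = (j \<noteq> k) then 1 / 2 else 0)\<rparr>"

text \<open>Since \<open>\<theta>\<^sup>2 = 1\<close>, the power \<open>\<theta>\<^sup>n\<close> depends only on the parity of the integer \<open>n\<close>.\<close>

definition theta_pow :: "int \<Rightarrow> bool \<Rightarrow> 'k::field" where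
  "theta_pow n = (if even n then funit clifford else basis_vec True)"


section \<open>The Arf invariant\<close>

text \<open>A single polygon with word \<open>s\<^sub>i t\<^sub>i s\<^sub>i t\<^sub>i\<close> (\<open>i = 1, \<dots>, g\<close>), \<open>r\<^sub>j u\<^sub>j r\<^sub>j\<close> (\<open>j = 1, \<dots>, b\<close>) read
  counter-clockwise from the side \<open>m + 1\<close>, where \<open>u\<^sub>j\<close> is the \<open>j\<close>-th boundary edge. That the two
  sides of \<open>s\<^sub>i\<close>, and those of \<open>t\<^sub>i\<close>, are traversed in opposite directions, that all these edges are
  distinct and that \<open>v\<^sub>0\<close> and the \<open>v\<^sub>j\<close> are as they should be follows from the conditions on a
  decomposition.\<close>

definition standard_polygon ::
  "('p, 'q) rspin_surface \<Rightarrow> 'p mplcw \<Rightarrow> nat \<Rightarrow> nat \<Rightarrow> nat \<Rightarrow> (nat \<Rightarrow> nat) \<Rightarrow> (nat \<Rightarrow> nat) \<Rightarrow> (nat \<Rightarrow> nat) \<Rightarrow> bool" where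
  "standard_polygon M D f m g se te re \<longleftrightarrow>
     faces D = {f} \<and> nsides D f = 4 * g + 3 * nin M \<and>
     (let side = (\<lambda>p. (f, (m + p) mod (4 * g + 3 * nin M) + 1)) in
       (\<forall>i\<in>{1..g}. let p = 4 * (i - 1) in
          side_edge D (side p) = se i \<and> side_edge D (side (p + 1)) = te i \<and>
          side_edge D (side (p + 2)) = se i \<and> side_edge D (side (p + 3)) = te i) \<and>
       (\<forall>j\<in>{1..nin M}. let p = 4 * g + 3 * (j - 1) in
          side_edge D (side p) = re j \<and> side_dir D (side p) \<and>
          side_edge D (side (p + 1)) = bedge M D j \<and>
          side_edge D (side (p + 2)) = re j \<and> \<not> side_dir D (side (p + 2))))"

text \<open>\<open>\<gamma>\<close> runs inside the face \<open>f\<close>, without self-intersections, from a side belonging to the edge \<open>e\<close> to a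
  side belonging to the edge \<open>e'\<close>; \<open>\<eta>\<close> is the same curve in the polygon.\<close>

definition polygon_curve ::
  "'p mplcw \<Rightarrow> nat \<Rightarrow> nat \<Rightarrow> nat \<Rightarrow> (real \<Rightarrow> complex) \<Rightarrow> (real \<Rightarrow> 'p) \<Rightarrow> bool" where
  "polygon_curve D f e e' \<eta> \<gamma> \<longleftrightarrow>
     smooth_on {0..1} \<eta> \<and> inj_on \<eta> {0..1} \<and> \<eta> ` {0<..<1} \<subseteq> ball 0 1 \<and>
     (\<forall>t\<in>{0..1}. vector_derivative \<eta> (at t within {0..1}) \<noteq> 0) \<and>
     (\<exists>x\<in>sides D. fst x = f \<and> side_edge D x = e \<and> \<eta> 0 \<in> cis ` side_arc D x) \<and>
     (\<exists>x\<in>sides D. fst x = f \<and> side_edge D x = e' \<and> \<eta> 1 \<in> cis ` side_arc D x) \<and>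
     (\<forall>t\<in>{0..1}. \<gamma> t = fmap D f (\<eta> t))"

text \<open>A closed curve that crosses the edge \<open>e\<close> once, transversally, at its base point, and no other edge:\<close>

definition crossing_curve :: "'p mplcw \<Rightarrow> nat \<Rightarrow> nat \<Rightarrow> (real \<Rightarrow> 'p) \<Rightarrow> bool" where
  "crossing_curve D f e \<gamma> \<longleftrightarrow> \<gamma> 0 = \<gamma> 1 \<and>
     (\<exists>\<eta>. polygon_curve D f e e \<eta> \<gamma> \<and>
        (\<forall>t\<in>{0, 1}. Re (cnj (\<eta> t) * vector_derivative \<eta> (at t within {0..1})) \<noteq> 0))"

text \<open>\<open>arf r M g x\<close>: the Arf invariant of the connected surface \<open>M\<close> of genus \<open>g\<close>, computed from a standard
  set of curves, is the class of \<open>x \<in> {0, 1}\<close>. The standard decomposition is marked so as to present \<open>M\<close>;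
  the curves and their holonomies depend on neither the marking nor the trivialisations. The integers \<open>\<zeta>a i\<close> etc. represent elements of \<open>\<int>\<^sub>r\<close>, and
  \<open>r\<close> is even.\<close>

definition arf :: "nat \<Rightarrow> ('p, 'q) rspin_surface \<Rightarrow> nat \<Rightarrow> nat \<Rightarrow> bool" where
  "arf r M g x \<longleftrightarrow> x < 2 \<and>
     (if g + nin M = 0 then x = 0 else
      (\<exists>D f m se te re ca cb cc cd \<zeta>a \<zeta>b \<zeta>c \<zeta>d.
         presents r M D \<and> standard_polygon M D f m g se te re \<and>
         (\<forall>i\<in>{1..g}.
            crossing_curve D f (se i) (ca i) \<and> closed_holonomy M (ca i) (\<zeta>a i) \<and>
            crossing_curve D f (te i) (cb i) \<and> closed_holonomy M (cb i) (\<zeta>b i)) \<and>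
         (\<forall>j\<in>{1..<nin M}.
            crossing_curve D f (re j) (cd j) \<and> closed_holonomy M (cd j) (\<zeta>d j) \<and>
            (\<exists>\<eta>. polygon_curve D f (bedge M D (nin M)) (bedge M D j) \<eta> (cc j)) \<and>
            arc_holonomy M (nin M) j (cc j) (\<zeta>c j)) \<and>
         [int x = (\<Sum>i\<in>{1..g}. (\<zeta>a i + 1) * (\<zeta>b i + 1)) +
                  (\<Sum>j\<in>{1..<nin M}. (\<zeta>c j + 1) * (\<zeta>d j + 1))] (mod 2)))"

end

theory Submission
  imports Defs "HOL-Library.Z2"
begin

text \<open>
  In the state sum of the Clifford algebra only the parities of the basis elements on the edges matter: it is a power
  of \<open>2\<close> times the sum of \<open>(-1)\<^bsup>q(y)\<^esup>\<close> over the \<open>\<int>\<^sub>2\<close>-cochains \<open>y\<close> that are closed on every face and equal to the \<open>\<lambda>\<^sub>j\<close> on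
  the boundary edges. The exponent \<open>q\<close> is a quadratic function whose linear part contains the edge indices and whose
  quadratic part comes from the Koszul signs.

  On the standard polygon every cochain with these boundary values is closed, the coefficients of the edges to the
  holes vanish by admissibility, and each handle contributes a Gauss sum
  \<open>\<Sum>\<^sub>x\<^sub>,\<^sub>y (-1)\<^bsup>xA + yB + xy\<^esup> = 2 (-1)\<^bsup>AB\<^esup>\<close>. The coefficients are holonomies modulo \<open>2\<close> because the tangent of an arc
  in a polygon turns by an angle that is determined by its end points; this yields the Arf invariant. The term of the
  last hole is absorbed by \<open>\<Sum>\<^sub>j \<lambda>\<^sub>j = 0\<close>.

  For the sphere the Arf invariant is \<open>0\<close> by convention and the decomposition is arbitrary. The closed cochains are
  then the coboundaries of sets of vertices, and \<open>q\<close> vanishes on them since it is additive on them and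
  vanishes on the coboundary of one vertex by admissibility.
\<close>

section \<open>The universal covering group\<close>

text \<open>Only parities of holonomies are computed. Trivialisations are compared across an edge by
  the direction of first vectors alone, so the angle of a transversal curve is known up to a strip
  of length \<pi>; this suffices to read off an integer. The turning of the tangent inside a polygon
  is Hopf's argument for turning tangents: secants have a continuous argument, and convexity of the
  disc keeps the secants from an end point in a half-plane. That the vertices of the standard
  polygon are distinct is not part of its definition; the Euler characteristic in
  \<open>genus\<close> forces it. For the sphere the obstacle is that the corners at a vertex should
  form a single cycle, a local property of surfaces. It is obtained globally: a function on the
  corners that is invariant under rotation about the vertices is determined by its coboundary and
  one value, and Euler's formula leaves no room for more such functions than there are functions on
  the vertices. The same count shows that closed cochains are coboundaries.\<close>

lemma mapply_scale: "mapply g (of_real c * x) = of_real c * mapply g x"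
  by (simp add: mapply_def algebra_simps scaleR_conv_of_real)

lemma mapply_one [simp]: "mapply g 1 = fst g"
  by (simp add: mapply_def)

lemma mapply_inj:
  assumes "0 < det2 (fst g) (snd g)" "mapply g x = mapply g y"
  shows "x = y"
proof -
  define z where "z = x - y"
  have z: "mapply g z = 0"
    using assms(2) by (simp add: z_def mapply_def algebra_simps)
  have 1: "Re z * Re (fst g) + Im z * Re (snd g) = 0" "Re z * Im (fst g) + Im z * Im (snd g) = 0"
    using z by (simp_all add: mapply_def complex_eq_iff)
  have d: "Re (fst g) * Im (snd g) - Im (fst g) * Re (snd g) > 0"
    using assms(1) by (simp add: det2_def)
  have "Re z * (Re (fst g) * Im (snd g) - Im (fst g) * Re (snd g)) = 0"
    "Im z * (Re (fst g) * Im (snd g) - Im (fst g) * Re (snd g)) = 0"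
    using 1 by algebra+
  then have "Re z = 0" "Im z = 0"
    using d by auto
  then show ?thesis
    by (simp add: z_def complex_eq_iff)
qed

lemma mapply_eq_0_iff:
  assumes "0 < det2 (fst g) (snd g)"
  shows "mapply g x = 0 \<longleftrightarrow> x = 0"
  using mapply_inj[OF assms, of x 0] by (auto simp: mapply_def)

lemma mmul_cancel:
  assumes "0 < det2 (fst g) (snd g)" "mmul g h = mmul g h'"
  shows "h = h'"
  using assms mapply_inj[OF assms(1)] by (auto simp: mmul_def prod_eq_iff)

lemma det2_mmul: "det2 (fst (mmul g h)) (snd (mmul g h)) = det2 (fst g) (snd g) * det2 (fst h) (snd h)"
  by (simp add: det2_def mmul_def mapply_def algebra_simps)

lemma GLt_D:
  assumes "g \<in> GLt"
  shows "0 < det2 (fst (fst g)) (snd (fst g))" "sgn (fst (fst g)) = cis (snd g)"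
    "fst (fst g) = of_real (norm (fst (fst g))) * cis (snd g)" "fst (fst g) \<noteq> 0"
proof -
  show 1: "0 < det2 (fst (fst g)) (snd (fst g))" "sgn (fst (fst g)) = cis (snd g)"
    using assms by (auto simp: GLt_def)
  show "fst (fst g) \<noteq> 0"
    using 1(1) by (auto simp: det2_def)
  show "fst (fst g) = of_real (norm (fst (fst g))) * cis (snd g)"
    using 1(2) by (metis mult.commute sgn_eq nonzero_eq_divide_eq norm_eq_zero of_real_eq_0_iff \<open>fst (fst g) \<noteq> 0\<close>)
qed

lemma GLt_I:
  assumes "0 < det2 (fst (fst g)) (snd (fst g))" "sgn (fst (fst g)) = cis (snd g)"
  shows "g \<in> GLt"
  using assms by (cases g) (auto simp: GLt_def)

lemma gmul_fst [simp]: "fst (gmul g h) = mmul (fst g) (fst h)"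
  by (simp add: gmul_def split: prod.splits)

lemma gmul_snd: "snd (gmul g h) =
    snd g + snd h + Arg (mapply (fst g) (cis (snd h)) * cnj (cis (snd g + snd h)))"
  by (simp add: gmul_def split: prod.splits)

text \<open>The second component of \<open>gmul\<close> has this form: to a guess \<open>a\<close>
  for the argument of \<open>w\<close> one adds the argument of \<open>w\<close> as seen from the
  direction \<open>a\<close>; the sum is correct whatever the guess.\<close>

lemma sgn_cis_cnj_Arg:
  assumes "w \<noteq> 0"
  shows "sgn w = cis (a + Arg (w * cnj (cis a)))"
proof -
  have "cis (Arg (w * cnj (cis a))) = sgn (w * cnj (cis a))"
    by (rule cis_Arg) (use assms in auto)
  also have "\<dots> = sgn w * cnj (cis a)"
    by (simp add: sgn_mult sgn_eq norm_mult)
  finally have "cis a * cis (Arg (w * cnj (cis a))) = sgn w * (cis a * cnj (cis a))"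
    by simp
  then show ?thesis
    by (simp add: cis_mult cis_cnj)
qed

lemma cis_gmul_snd:
  assumes "g \<in> GLt"
  shows "sgn (mapply (fst g) (cis (snd h))) = cis (snd (gmul g h))"
  unfolding gmul_snd
  by (rule sgn_cis_cnj_Arg) (use GLt_D(1)[OF assms] in \<open>simp add: mapply_eq_0_iff\<close>)

text \<open>The first column of the product is a positive multiple of the image of
  \<open>cis (snd h)\<close>, whose direction is the one recorded by \<open>gmul\<close>.\<close>

lemma gmul_GLt [simp, intro]:
  assumes "g \<in> GLt" "h \<in> GLt"
  shows "gmul g h \<in> GLt"
proof -
  have "fst (fst (gmul g h)) = mapply (fst g) (of_real (norm (fst (fst h))) * cis (snd h))"
    using GLt_D(3)[OF assms(2)] by (simp add: mmul_def)
  also have "\<dots> = of_real (norm (fst (fst h))) * mapply (fst g) (cis (snd h))"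
    by (rule mapply_scale)
  finally have "sgn (fst (fst (gmul g h))) = sgn (mapply (fst g) (cis (snd h)))"
    using GLt_D(4)[OF assms(2)] by (simp add: sgn_mult sgn_of_real sgn_eq norm_mult)
  moreover have "0 < det2 (fst (fst (gmul g h))) (snd (fst (gmul g h)))"
    using GLt_D(1)[OF assms(1)] GLt_D(1)[OF assms(2)] by (simp add: det2_mmul)
  ultimately show ?thesis
    using cis_gmul_snd[OF assms(1), of h] by (auto intro: GLt_I)
qed

lemma rot_GLt [simp, intro]: "rot a \<in> GLt"
proof (rule GLt_I)
  have "det2 (cis a) (\<i> * cis a) = (cos a)\<^sup>2 + (sin a)\<^sup>2"
    by (simp add: det2_def power2_eq_square)
  then show "0 < det2 (fst (fst (rot a))) (snd (fst (rot a)))"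
    by (simp add: rot_def)
qed (simp add: rot_def sgn_eq)

lemma fst_rot [simp]: "fst (rot a) = (cis a, \<i> * cis a)"
  and snd_rot [simp]: "snd (rot a) = a"
  by (simp_all add: rot_def)

lemma mapply_rot [simp]: "mapply (cis a, \<i> * cis a) z = cis a * z"
  by (simp add: mapply_def complex_eq_iff algebra_simps)

lemma gmul_rot_snd [simp]: "snd (gmul (rot a) h) = a + snd h"
  by (simp add: gmul_snd cis_mult cis_cnj)

lemma cis_2pi_int [simp]: "cis (2 * pi * of_int k) = 1"
  by (simp add: complex_eq_iff)

text \<open>The image of the direction 1 is the first column of \<open>g\<close>, which already
  points along \<open>snd g\<close>, so the correcting \<open>Arg\<close> vanishes. In particular,
  angles add under deck transformations.\<close>

lemma gmul_snd_int:
  assumes "g \<in> GLt" "snd h = 2 * pi * of_int k"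
  shows "snd (gmul g h) = snd g + snd h"
proof -
  have "fst (fst g) * cnj (cis (snd g + snd h)) = of_real (norm (fst (fst g))) * (cis (snd g) * cnj (cis (snd g)))"
    using GLt_D(3)[OF assms(1)] by (simp add: assms(2) flip: cis_mult)
  then have "fst (fst g) * cnj (cis (snd g + snd h)) = of_real (norm (fst (fst g)))"
    by (simp add: cis_cnj cis_mult)
  then show ?thesis
    using assms(2) Arg_of_real[of "norm (fst (fst g))"] GLt_D(4)[OF assms(1)]
    by (simp add: gmul_snd)
qed

lemma gmul_snd_diff:
  assumes "fst h = fst h'" "snd h' = snd h + 2 * pi * of_int k"
  shows "snd (gmul g h') = snd (gmul g h) + 2 * pi * of_int k"
proof -
  have "cis (snd h') = cis (snd h)" "cis (snd g + snd h') = cis (snd g + snd h)"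
    by (simp_all add: assms(2) flip: cis_mult)
  then show ?thesis
    by (simp add: gmul_snd assms(2))
qed

lemma cis_eq_iff: "cis a = cis b \<longleftrightarrow> (\<exists>k::int. a = b + 2 * pi * of_int k)"
proof
  assume "cis a = cis b"
  then have "sin a = sin b \<and> cos a = cos b"
    by (simp add: complex_eq_iff)
  then show "\<exists>k::int. a = b + 2 * pi * of_int k"
    by (metis add.commute mult.assoc mult.commute sin_cos_eq_iff)
qed (auto simp flip: cis_mult)

lemma GLt_snd_cong:
  assumes "g \<in> GLt" "h \<in> GLt" "fst g = fst h"
  obtains k :: int where "snd g = snd h + 2 * pi * of_int k"
  using GLt_D(2)[OF assms(1)] GLt_D(2)[OF assms(2)] assms(3) cis_eq_iff by metis

text \<open>The matrix equation is solved, any argument is chosen for the solution, and the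
  remaining multiple of 2\<pi> is repaired afterwards.\<close>

lemma GLt_divide:
  assumes "a \<in> GLt" "b \<in> GLt"
  obtains h where "h \<in> GLt" "gmul a h = b"
proof -
  define d where "d = det2 (fst (fst a)) (snd (fst a))"
  have d: "d > 0"
    using GLt_D(1)[OF assms(1)] by (simp add: d_def)
  \<comment> \<open>The inverse of the matrix of \<open>a\<close>, by Cramer's rule.\<close>
  define f where "f = (\<lambda>z. Complex (det2 z (snd (fst a)) / d) (det2 (fst (fst a)) z / d))"
  have f: "mapply (fst a) (f z) = z" for z
  proof -
    have "det2 z (snd (fst a)) * Re (fst (fst a)) + det2 (fst (fst a)) z * Re (snd (fst a)) = Re z * d"
      "det2 z (snd (fst a)) * Im (fst (fst a)) + det2 (fst (fst a)) z * Im (snd (fst a)) = Im z * d"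
      by (simp_all add: det2_def d_def algebra_simps)
    then show ?thesis
      using d unfolding f_def mapply_def complex_eq_iff
      by (simp add: add_divide_distrib[symmetric])
  qed
  define m where "m = (f (fst (fst b)), f (snd (fst b)))"
  have m: "mmul (fst a) m = fst b"
    by (simp add: mmul_def m_def f)
  have dm: "0 < det2 (fst m) (snd m)"
    using det2_mmul[of "fst a" m] m GLt_D(1)[OF assms(1)] GLt_D(1)[OF assms(2)] zero_less_mult_pos
    by auto
  then have nz: "fst m \<noteq> 0"
    by (auto simp: det2_def)
  define u where "u = Arg (fst m)"
  have mu: "(m, u) \<in> GLt"
    using dm cis_Arg[OF nz] by (auto simp: GLt_def u_def)
  obtain k :: int where k: "snd b = snd (gmul a (m, u)) + 2 * pi * of_int k"
    by (rule GLt_snd_cong[OF assms(2) gmul_GLt[OF assms(1) mu]]) (use m in auto)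
  show ?thesis
  proof
    show "(m, u + 2 * pi * of_int k) \<in> GLt"
      using mu by (auto simp: GLt_def simp flip: cis_mult)
    show "gmul a (m, u + 2 * pi * of_int k) = b"
      using gmul_snd_diff[of "(m, u)" "(m, u + 2 * pi * of_int k)" k a] k m
      by (auto simp: prod_eq_iff)
  qed
qed

text \<open>A group element with angle 0 preserves the positive real axis and the orientation, hence
  also the upper and the lower half-plane. \<open>aligned\<close> leaves exactly such an element
  undetermined; the integer \<open>k\<close> survives it.\<close>

lemma gmul_positive_interval:
  assumes p: "(p, 0) \<in> GLt" and u: "of_int k * pi < u" "u < (of_int k + 1) * pi" and h: "snd h = u"
  shows "of_int k * pi < snd (gmul (p, 0) h)" "snd (gmul (p, 0) h) < (of_int k + 1) * pi"
proof -
  define v where "v = snd (gmul (p, 0) h)"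
  have r: "Im (fst p) = 0"
    using GLt_D(3)[OF p] by (metis fst_conv snd_conv cis_zero mult_1_right Im_complex_of_real)
  have rp: "Re (fst p) > 0"
    using GLt_D(3,4)[OF p]
    by (metis fst_conv snd_conv cis_zero mult_1_right Re_complex_of_real norm_eq_zero zero_less_norm_iff)
  have ip: "Im (snd p) > 0"
    using GLt_D(1)[OF p] r rp by (simp add: det2_def zero_less_mult_iff)
  have s: "sgn (mapply p (cis u)) = cis v"
    using cis_gmul_snd[OF p, of h] h by (simp add: v_def)
  have nz: "mapply p (cis u) \<noteq> 0"
    using GLt_D(1)[OF p] by (simp add: mapply_eq_0_iff)
  have sv: "sin v = sin u * Im (snd p) / norm (mapply p (cis u))"
  proof -
    have "sin v = Im (sgn (mapply p (cis u)))"
      by (simp add: s)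
    also have "\<dots> = Im (mapply p (cis u)) / norm (mapply p (cis u))"
      by (simp add: sgn_eq)
    finally show ?thesis
      by (simp add: mapply_def r)
  qed
  \<comment> \<open>Hence \<open>v\<close> could leave the strip of \<open>u\<close> only into a
    neighbouring one, where the sine has the wrong sign.\<close>
  have "\<bar>v - u\<bar> \<le> pi"
    unfolding v_def gmul_snd using h
    by (simp add: abs_le_iff) (smt (verit, best) Arg_bounded)
  define u' v' where "u' = u - of_int k * pi" and "v' = v - of_int k * pi"
  have u': "0 < u'" "u' < pi"
    using u by (auto simp: u'_def algebra_simps)
  have b: "\<bar>v' - u'\<bar> \<le> pi"
    using \<open>\<bar>v - u\<bar> \<le> pi\<close> by (simp add: u'_def v'_def)
  define c where "c = Im (snd p) / norm (mapply p (cis u))"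
  have c: "c > 0"
    using ip nz by (simp add: c_def)
  have sc: "sin (x - of_int k * pi) = sin x * (if even k then 1 else -1)" for x
    by (cases "even k") (auto simp: sin_diff cos_npi_int sin_npi_int mult.commute[of _ pi])
  have sv': "sin v' = sin u' * c"
    by (simp add: u'_def v'_def sc sv c_def)
  have "sin u' > 0"
    using u' by (simp add: sin_gt_zero)
  then have pos: "sin v' > 0"
    using sv' c by simp
  have "0 < v' \<and> v' < pi"
  proof (rule ccontr)
    assume "\<not> ?thesis"
    then consider "v' \<le> 0" "v' > - pi" | "v' \<ge> pi" "v' < 2 * pi"
      using b u' by linarith
    then show False
    proof cases
      case 1
      then have "sin (- v') \<ge> 0"
        by (intro sin_ge_zero) auto
      with pos show False by simp
    next
      case 2
      then have "sin (v' - pi) \<ge> 0"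
        by (intro sin_ge_zero) auto
      with pos show False by (simp add: sin_diff)
    qed
  qed
  then show "of_int k * pi < snd (gmul (p, 0) h)" "snd (gmul (p, 0) h) < (of_int k + 1) * pi"
    by (auto simp: v'_def v_def algebra_simps)
qed

text \<open>The complement to the open strips: the negative real axis is preserved as well. This
  case occurs for curves tangent to the boundary.\<close>

lemma gmul_positive_odd:
  assumes p: "(p, 0) \<in> GLt" and h: "snd h = pi + 2 * pi * of_int k"
  shows "snd (gmul (p, 0) h) = snd h"
proof -
  have r: "Im (fst p) = 0"
    using GLt_D(3)[OF p] by (metis fst_conv snd_conv cis_zero mult_1_right Im_complex_of_real)
  have rp: "Re (fst p) > 0"
    using GLt_D(3,4)[OF p]
    by (metis fst_conv snd_conv cis_zero mult_1_right Re_complex_of_real norm_eq_zero zero_less_norm_iff)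
  have c: "cis (snd h) = -1"
    by (simp add: h flip: cis_mult)
  have "fst p = of_real (Re (fst p))"
    using r by (simp add: complex_eq_iff)
  then have "Arg (fst p) = 0"
    using rp by (metis Arg_of_real order.asym)
  moreover have "mapply p (-1) * cnj (-1) = fst p"
    by (simp add: mapply_def)
  ultimately show ?thesis
    by (simp add: gmul_snd c)
qed

section \<open>Lifts of paths in the spin bundle\<close>

lemma act_continuous:
  assumes "principal_bundle r M"
  shows "continuous_map (prod_topology (tot M) (top_of_set GLt)) (tot M) (\<lambda>(q, g). act M q g)"
  using assms by (simp add: principal_bundle_def)

lemma act_in_tot:
  assumes "principal_bundle r M" "q \<in> topspace (tot M)" "g \<in> GLt"
  shows "act M q g \<in> topspace (tot M)"
  using continuous_map_image_subset_topspace[OF act_continuous[OF assms(1)]] assms(2,3)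
  by (auto simp: image_subset_iff)

lemma proj_in_topspace:
  assumes "principal_bundle r M" "q \<in> topspace (tot M)"
  shows "proj M q \<in> topspace (topo M)"
  using assms by (auto simp: principal_bundle_def continuous_map_def)

lemma proj_act:
  assumes "principal_bundle r M" "q \<in> topspace (tot M)" "g \<in> GLt"
  shows "proj M (act M q g) = proj M q"
  using assms by (simp add: principal_bundle_def)

lemma act_act:
  assumes "principal_bundle r M" "q \<in> topspace (tot M)" "g \<in> GLt" "h \<in> GLt"
  shows "act M (act M q g) h = act M q (gmul g h)"
  using assms by (simp add: principal_bundle_def)

lemma principal_bundle_chart:
  assumes "principal_bundle r M" "x \<in> topspace (topo M)"
  obtains U \<sigma> where "openin (topo M) U" "x \<in> U"
    "\<And>y. y \<in> U \<Longrightarrow> \<sigma> y \<in> topspace (tot M)" "\<And>y. y \<in> U \<Longrightarrow> proj M (\<sigma> y) = y"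
    "open_map (prod_topology (subtopology (topo M) U) (top_of_set GLt))
       (subtopology (tot M) {q \<in> topspace (tot M). proj M q \<in> U}) (\<lambda>(y, g). act M (\<sigma> y) g)"
    "\<And>q. q \<in> topspace (tot M) \<Longrightarrow> proj M q \<in> U \<Longrightarrow> \<exists>g\<in>GLt. q = act M (\<sigma> (proj M q)) g"
    "\<And>y g h. y \<in> U \<Longrightarrow> g \<in> GLt \<Longrightarrow> h \<in> GLt \<Longrightarrow> act M (\<sigma> y) g = act M (\<sigma> y) h \<longleftrightarrow>
       fst g = fst h \<and> (\<exists>k::int. snd g = snd h + 2 * pi * of_int (k * int r))"
proof -
  obtain U \<sigma> where U: "openin (topo M) U" "x \<in> U"
    and c: "continuous_map (subtopology (topo M) U) (tot M) \<sigma>"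
    and p: "\<forall>y\<in>U. proj M (\<sigma> y) = y"
    and o: "open_map (prod_topology (subtopology (topo M) U) (top_of_set GLt))
       (subtopology (tot M) {q \<in> topspace (tot M). proj M q \<in> U}) (\<lambda>(y, g). act M (\<sigma> y) g)"
    and i: "(\<lambda>(y, g). act M (\<sigma> y) g) ` topspace (prod_topology (subtopology (topo M) U) (top_of_set GLt))
      = topspace (subtopology (tot M) {q \<in> topspace (tot M). proj M q \<in> U})"
    and f: "\<forall>y\<in>U. \<forall>g\<in>GLt. \<forall>h\<in>GLt. act M (\<sigma> y) g = act M (\<sigma> y) h \<longleftrightarrow>
           fst g = fst h \<and> (\<exists>k::int. snd g = snd h + 2 * pi * of_int (k * int r))"
    using conjunct2[OF conjunct2[OF conjunct2[OF assms(1)[unfolded principal_bundle_def Let_def]]],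
        rule_format, OF assms(2)]
    by blast
  have UM: "U \<subseteq> topspace (topo M)"
    using U(1) openin_subset by blast
  have t: "\<sigma> y \<in> topspace (tot M)" if "y \<in> U" for y
    using continuous_map_image_subset_topspace[OF c] that UM by auto
  show ?thesis
  proof (rule that[of U \<sigma>])
    fix q assume q: "q \<in> topspace (tot M)" "proj M q \<in> U"
    then have "q \<in> (\<lambda>(y, g). act M (\<sigma> y) g) ` topspace (prod_topology (subtopology (topo M) U) (top_of_set GLt))"
      unfolding i by simp
    then obtain y g where yg: "y \<in> U" "g \<in> GLt" "q = act M (\<sigma> y) g"
      by auto
    then have "proj M q = y"
      using proj_act[OF assms(1) t[OF yg(1)] yg(2)] p by simp
    with yg show "\<exists>g\<in>GLt. q = act M (\<sigma> (proj M q)) g"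
      by metis
  qed (use U t p o f in auto)
qed

lemma act_transitive:
  assumes "principal_bundle r M" "q \<in> topspace (tot M)" "q' \<in> topspace (tot M)" "proj M q = proj M q'"
  obtains h where "h \<in> GLt" "q' = act M q h"
proof -
  obtain U \<sigma> where U: "openin (topo M) U" "proj M q \<in> U"
    and \<sigma>: "\<And>y. y \<in> U \<Longrightarrow> \<sigma> y \<in> topspace (tot M)" "\<And>y. y \<in> U \<Longrightarrow> proj M (\<sigma> y) = y"
    and op: "open_map (prod_topology (subtopology (topo M) U) (top_of_set GLt))
       (subtopology (tot M) {q \<in> topspace (tot M). proj M q \<in> U}) (\<lambda>(y, g). act M (\<sigma> y) g)"
    and ex: "\<And>q. q \<in> topspace (tot M) \<Longrightarrow> proj M q \<in> U \<Longrightarrow> \<exists>g\<in>GLt. q = act M (\<sigma> (proj M q)) g"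
    and fr: "\<And>y g h. y \<in> U \<Longrightarrow> g \<in> GLt \<Longrightarrow> h \<in> GLt \<Longrightarrow> act M (\<sigma> y) g = act M (\<sigma> y) h \<longleftrightarrow>
       fst g = fst h \<and> (\<exists>k::int. snd g = snd h + 2 * pi * of_int (k * int r))"
    by (rule principal_bundle_chart[OF assms(1) proj_in_topspace[OF assms(1,2)]]) (rule that)
  obtain a b where a: "a \<in> GLt" "q = act M (\<sigma> (proj M q)) a" and b: "b \<in> GLt" "q' = act M (\<sigma> (proj M q)) b"
    using ex[OF assms(2)] ex[OF assms(3)] U(2) unfolding assms(4) by blast
  obtain h where h: "h \<in> GLt" "gmul a h = b"
    using GLt_divide[OF a(1) b(1)] by blast
  then have "act M q h = q'"
    using act_act[OF assms(1) \<sigma>(1)[OF U(2)] a(1) h(1)] a b by metis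
  with h that show ?thesis by blast
qed

text \<open>In a local trivialisation the fibres are explicit. The element \<open>a\<close> leading
  from the section to \<open>q\<close> is cancelled from the matrices by injectivity and from the
  angles by \<open>gmul_snd_diff\<close>.\<close>

lemma act_free:
  assumes "principal_bundle r M" "q \<in> topspace (tot M)" "g \<in> GLt" "h \<in> GLt" "act M q g = act M q h"
  obtains k :: int where "fst g = fst h" "snd g = snd h + 2 * pi * of_int (k * int r)"
proof -
  obtain U \<sigma> where U: "openin (topo M) U" "proj M q \<in> U"
    and \<sigma>: "\<And>y. y \<in> U \<Longrightarrow> \<sigma> y \<in> topspace (tot M)" "\<And>y. y \<in> U \<Longrightarrow> proj M (\<sigma> y) = y"
    and op: "open_map (prod_topology (subtopology (topo M) U) (top_of_set GLt))
       (subtopology (tot M) {q \<in> topspace (tot M). proj M q \<in> U}) (\<lambda>(y, g). act M (\<sigma> y) g)"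
    and ex: "\<And>q. q \<in> topspace (tot M) \<Longrightarrow> proj M q \<in> U \<Longrightarrow> \<exists>g\<in>GLt. q = act M (\<sigma> (proj M q)) g"
    and fr: "\<And>y g h. y \<in> U \<Longrightarrow> g \<in> GLt \<Longrightarrow> h \<in> GLt \<Longrightarrow> act M (\<sigma> y) g = act M (\<sigma> y) h \<longleftrightarrow>
       fst g = fst h \<and> (\<exists>k::int. snd g = snd h + 2 * pi * of_int (k * int r))"
    by (rule principal_bundle_chart[OF assms(1) proj_in_topspace[OF assms(1,2)]]) (rule that)
  obtain a where a: "a \<in> GLt" "q = act M (\<sigma> (proj M q)) a"
    using ex[OF assms(2)] U(2) by blast
  have "act M (\<sigma> (proj M q)) (gmul a g) = act M (\<sigma> (proj M q)) (gmul a h)"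
    using act_act[OF assms(1) \<sigma>(1)[OF U(2)] a(1)] assms(3-5) a(2) by metis
  then have 1: "mmul (fst a) (fst g) = mmul (fst a) (fst h)"
    and "\<exists>k::int. snd (gmul a g) = snd (gmul a h) + 2 * pi * of_int (k * int r)"
    using fr[OF U(2) gmul_GLt[OF a(1) assms(3)] gmul_GLt[OF a(1) assms(4)]] by auto
  then obtain k :: int where k: "snd (gmul a g) = snd (gmul a h) + 2 * pi * of_int (k * int r)"
    by auto
  have fst: "fst g = fst h"
    using mmul_cancel[OF GLt_D(1)[OF a(1)] 1] .
  obtain l :: int where l: "snd g = snd h + 2 * pi * of_int l"
    using GLt_snd_cong[OF assms(3,4) fst] .
  have "2 * pi * of_int l = 2 * pi * (of_int (k * int r) :: real)"
    using gmul_snd_diff[OF fst[symmetric] l, of a] k by simp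
  with that[OF fst, of k] l show ?thesis by simp
qed

text \<open>Two lifts of the same path that differ by integral rotations: the difference is locally constant
  modulo \<open>r\<close>, since the rotation angle depends continuously on the point in a local trivialisation up
  to multiples of \<open>2\<pi>r\<close>.\<close>

lemma lift_rotation_locally_constant:
  fixes M :: "('p, 'q) rspin_surface" and k :: "real \<Rightarrow> int"
  assumes pb: "principal_bundle r M"
    and c: "continuous_map (top_of_set S) (tot M) \<Gamma>" and c0: "continuous_map (top_of_set S) (tot M) \<Gamma>0"
    and h: "\<And>t. t \<in> S \<Longrightarrow> h t \<in> GLt \<and> \<Gamma> t = act M (\<Gamma>0 t) (h t) \<and> snd (h t) = 2 * pi * of_int (k t)"
    and t0: "t0 \<in> S"
  shows "\<exists>T. openin (top_of_set S) T \<and> t0 \<in> T \<and> (\<forall>t\<in>T. [k t = k t0] (mod int r))"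
proof -
  have tot0: "\<Gamma>0 t \<in> topspace (tot M)" if "t \<in> S" for t
    using continuous_map_image_subset_topspace[OF c0] that by auto
  have tot1: "\<Gamma> t \<in> topspace (tot M)" if "t \<in> S" for t
    using continuous_map_image_subset_topspace[OF c] that by auto
  have same: "proj M (\<Gamma> t) = proj M (\<Gamma>0 t)" if "t \<in> S" for t
    using proj_act[OF pb tot0[OF that]] h[OF that] by metis
  define x where "x = proj M (\<Gamma>0 t0)"
  obtain U \<sigma> where U0: "openin (topo M) U" "proj M (\<Gamma>0 t0) \<in> U"
    and \<sigma>: "\<And>y. y \<in> U \<Longrightarrow> \<sigma> y \<in> topspace (tot M)" "\<And>y. y \<in> U \<Longrightarrow> proj M (\<sigma> y) = y"
    and op: "open_map (prod_topology (subtopology (topo M) U) (top_of_set GLt))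
       (subtopology (tot M) {q \<in> topspace (tot M). proj M q \<in> U}) (\<lambda>(y, g). act M (\<sigma> y) g)"
    and ex: "\<And>q. q \<in> topspace (tot M) \<Longrightarrow> proj M q \<in> U \<Longrightarrow> \<exists>g\<in>GLt. q = act M (\<sigma> (proj M q)) g"
    and fr: "\<And>y g h. y \<in> U \<Longrightarrow> g \<in> GLt \<Longrightarrow> h \<in> GLt \<Longrightarrow> act M (\<sigma> y) g = act M (\<sigma> y) h \<longleftrightarrow>
       fst g = fst h \<and> (\<exists>k::int. snd g = snd h + 2 * pi * of_int (k * int r))"
    by (rule principal_bundle_chart[OF pb proj_in_topspace[OF pb tot0[OF t0]]]) (rule that)
  note U = U0[folded x_def]
  define B where "B = {q \<in> topspace (tot M). proj M q \<in> U}"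
  have "continuous_map (tot M) (topo M) (proj M)"
    using pb by (simp add: principal_bundle_def)
  then have B: "openin (tot M) B"
    unfolding B_def by (rule openin_continuous_map_preimage) (rule U)
  \<comment> \<open>Openness of the trivialisation supplies the angle: the image of a product
    neighbourhood is open, so points near \<open>G t0\<close> are written with a group element whose
    angle is close to that of \<open>a\<close>.\<close>
  have nbhd: "\<exists>T. openin (top_of_set S) T \<and> t0 \<in> T \<and>
      (\<forall>t\<in>T. \<exists>b\<in>GLt. \<bar>snd b - snd a\<bar> < pi / 2 \<and> G t = act M (\<sigma> (proj M (G t))) b)"
    if G: "continuous_map (top_of_set S) (tot M) G" "\<And>t. t \<in> S \<Longrightarrow> proj M (G t) = proj M (\<Gamma>0 t)"
      and a: "a \<in> GLt" "G t0 = act M (\<sigma> x) a" for G a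
  proof -
    define N where "N = GLt \<inter> snd -` ball (snd a) (pi / 2)"
    have N: "openin (top_of_set GLt) N"
      unfolding N_def by (intro continuous_openin_preimage_gen) (auto intro: continuous_intros)
    have "openin (prod_topology (subtopology (topo M) U) (top_of_set GLt)) (U \<times> N)"
    proof -
      have "openin (subtopology (topo M) U) U"
        using U(1) by (metis openin_subset openin_subtopology_refl)
      with N show ?thesis
        by (simp add: openin_prod_Times_iff)
    qed
    then have "openin (subtopology (tot M) B) ((\<lambda>(y, g). act M (\<sigma> y) g) ` (U \<times> N))"
      using op by (auto simp: open_map_def B_def)
    then have W: "openin (tot M) ((\<lambda>(y, g). act M (\<sigma> y) g) ` (U \<times> N))"
      using B openin_trans_full by blast
    define T where "T = {t \<in> topspace (top_of_set S). G t \<in> (\<lambda>(y, g). act M (\<sigma> y) g) ` (U \<times> N)}"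
    have "openin (top_of_set S) T"
      unfolding T_def by (rule openin_continuous_map_preimage[OF G(1) W])
    moreover have "t0 \<in> T"
      using a t0 U(2) pi_gt_zero by (auto simp: T_def N_def intro!: image_eqI[of _ _ "(x, a)"])
    moreover have "\<exists>b\<in>GLt. \<bar>snd b - snd a\<bar> < pi / 2 \<and> G t = act M (\<sigma> (proj M (G t))) b" if tT: "t \<in> T" for t
    proof -
      obtain y b where yb: "y \<in> U" "b \<in> N" "G t = act M (\<sigma> y) b"
        using tT unfolding T_def by auto
      then have b: "b \<in> GLt" "dist (snd a) (snd b) < pi / 2"
        by (auto simp: N_def)
      have "proj M (G t) = y"
        using proj_act[OF pb \<sigma>(1)[OF yb(1)] b(1)] \<sigma>(2)[OF yb(1)] yb(3) by simp
      then show ?thesis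
        using yb b by (intro bexI[of _ b]) (auto simp: dist_real_def abs_minus_commute)
    qed
    ultimately show ?thesis by blast
  qed
  obtain a where a: "a \<in> GLt" "\<Gamma>0 t0 = act M (\<sigma> x) a"
    using ex[OF tot0[OF t0]] U(2) unfolding x_def by blast
  have h0: "h t0 \<in> GLt" "\<Gamma> t0 = act M (\<Gamma>0 t0) (h t0)" "snd (h t0) = 2 * pi * of_int (k t0)"
    using h[OF t0] by auto
  have a1: "gmul a (h t0) \<in> GLt" "\<Gamma> t0 = act M (\<sigma> x) (gmul a (h t0))"
    using a h0 act_act[OF pb \<sigma>(1)[OF U(2)] a(1) h0(1)] by auto
  obtain T0 where T0: "openin (top_of_set S) T0" "t0 \<in> T0"
    "\<And>t. t \<in> T0 \<Longrightarrow> \<exists>b\<in>GLt. \<bar>snd b - snd a\<bar> < pi / 2 \<and> \<Gamma>0 t = act M (\<sigma> (proj M (\<Gamma>0 t))) b"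
    using nbhd[OF c0 refl a] by blast
  obtain T1 where T1: "openin (top_of_set S) T1" "t0 \<in> T1"
    "\<And>t. t \<in> T1 \<Longrightarrow> \<exists>b\<in>GLt. \<bar>snd b - snd (gmul a (h t0))\<bar> < pi / 2 \<and> \<Gamma> t = act M (\<sigma> (proj M (\<Gamma> t))) b"
    using nbhd[OF c same a1] by blast
  have T2: "openin (top_of_set S) {t \<in> topspace (top_of_set S). \<Gamma>0 t \<in> B}"
    by (rule openin_continuous_map_preimage[OF c0 B])
  define T where "T = T0 \<inter> T1 \<inter> {t \<in> topspace (top_of_set S). \<Gamma>0 t \<in> B}"
  have "[k t = k t0] (mod int r)" if t: "t \<in> T" for t
  proof -
    have tS: "t \<in> S" "\<Gamma>0 t \<in> B"
      using t by (auto simp: T_def)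
    define y where "y = proj M (\<Gamma>0 t)"
    have y: "y \<in> U"
      using tS by (simp add: B_def y_def)
    obtain b0 where b0: "b0 \<in> GLt" "\<bar>snd b0 - snd a\<bar> < pi / 2" "\<Gamma>0 t = act M (\<sigma> y) b0"
      using T0(3)[of t] t unfolding T_def y_def by blast
    obtain b1 where b1: "b1 \<in> GLt" "\<bar>snd b1 - snd (gmul a (h t0))\<bar> < pi / 2" "\<Gamma> t = act M (\<sigma> y) b1"
      using T1(3)[of t] t unfolding T_def y_def same[OF tS(1)] by blast
    have ht: "h t \<in> GLt" "\<Gamma> t = act M (\<Gamma>0 t) (h t)" "snd (h t) = 2 * pi * of_int (k t)"
      using h[OF tS(1)] by auto
    have "act M (\<sigma> y) b1 = act M (\<sigma> y) (gmul b0 (h t))"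
      using b0 b1 ht act_act[OF pb \<sigma>(1)[OF y] b0(1) ht(1)] by simp
    then obtain m :: int where "snd b1 = snd (gmul b0 (h t)) + 2 * pi * of_int (m * int r)"
      using fr[OF y b1(1) gmul_GLt[OF b0(1) ht(1)]] by auto
    then have 1: "snd b1 = snd b0 + 2 * pi * of_int (k t + m * int r)"
      using gmul_snd_int[OF b0(1) ht(3)] ht(3) by (simp add: algebra_simps)
    have 2: "snd (gmul a (h t0)) = snd a + 2 * pi * of_int (k t0)"
      using gmul_snd_int[OF a(1) h0(3)] h0(3) by simp
    \<comment> \<open>Each of the two angles has moved by less than \<pi>/2, while \<open>d\<close>
      full turns measure the discrepancy; so \<open>d\<close> vanishes.\<close>
    define d where "d = k t + m * int r - k t0"
    have "k t + m * int r = k t0 + d"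
      by (simp add: d_def)
    then have "snd b1 = snd b0 + 2 * pi * (of_int (k t0) + of_int d)"
      unfolding 1 by (metis of_int_add)
    then have "2 * pi * of_int d = (snd b1 - snd (gmul a (h t0))) - (snd b0 - snd a)"
      unfolding 2 by (simp only: distrib_left)
    then have "\<bar>2 * pi * of_int d\<bar> < pi"
      using b0(2) b1(2) by linarith
    moreover have "2 * pi * 1 \<le> \<bar>2 * pi * real_of_int d\<bar>" if "d \<noteq> 0"
      unfolding abs_mult using that by (intro mult_mono) auto
    ultimately have "d = 0"
      using pi_gt_zero by force
    then have "k t - k t0 = - (m * int r)"
      by (simp add: d_def)
    then show ?thesis
      by (simp add: cong_iff_dvd_diff)
  qed
  moreover have "openin (top_of_set S) T" "t0 \<in> T"
    using T0(1,2) T1(1,2) T2 t0 tot0[OF t0] U(2) by (auto simp: T_def B_def x_def)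
  ultimately show ?thesis by blast
qed

lemma lift_rotation_constant:
  fixes M :: "('p, 'q) rspin_surface" and k :: "real \<Rightarrow> int"
  assumes pb: "principal_bundle r M"
    and c: "continuous_map (top_of_set {0..1}) (tot M) \<Gamma>" "continuous_map (top_of_set {0..1}) (tot M) \<Gamma>0"
    and h: "\<And>t. t \<in> {0..1} \<Longrightarrow> h t \<in> GLt \<and> \<Gamma> t = act M (\<Gamma>0 t) (h t) \<and> snd (h t) = 2 * pi * of_int (k t)"
  shows "[k 1 = k 0] (mod int r)"
proof -
  have "(\<lambda>t. k t mod int r) constant_on {0..1::real}"
  proof (rule locally_constant_imp_constant)
    show "\<exists>T. openin (top_of_set {0..1}) T \<and> a \<in> T \<and> (\<forall>x\<in>T. k x mod int r = k a mod int r)"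
      if "a \<in> {0..1}" for a
      using lift_rotation_locally_constant[OF pb c h that] unfolding cong_def by blast
  qed simp
  then show ?thesis
    unfolding constant_on_def cong_def by (metis atLeastAtMost_iff order_refl zero_le_one)
qed

section \<open>Turning of the tangent of a simple arc in the disc\<close>

lemma smooth_on_differentiable:
  assumes "smooth_on S f" "x \<in> S"
  shows "f differentiable (at x within S)"
proof -
  obtain U g where U: "open U" "x \<in> U" "\<And>n. Ck_on n U g" "\<And>y. y \<in> S \<inter> U \<Longrightarrow> g y = f y"
    using assms unfolding smooth_on_def by meson
  have "g differentiable (at x)"
    using U(3)[of 1] U(2) by simp
  then obtain g' where "(g has_derivative g') (at x within S)"
    unfolding differentiable_def using has_derivative_at_withinI by blast
  then have "(f has_derivative g') (at x within S)"
  proof (rule has_derivative_transform_eventually)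
    show "\<forall>\<^sub>F z in at x within S. g z = f z"
      unfolding eventually_at_topological using U(1,2,4) by (intro exI[of _ U]) simp
  qed (use U(2,4) assms(2) in simp_all)
  then show ?thesis
    unfolding differentiable_def by blast
qed

lemma smooth_on_has_derivative:
  assumes "smooth_on S f" "x \<in> S"
  shows "(f has_derivative frechet_derivative f (at x within S)) (at x within S)"
  using smooth_on_differentiable[OF assms] frechet_derivative_works by blast

text \<open>Near each parameter the derivative within the interval is that of a smooth extension,
  whence its continuity up to the end points.\<close>

lemma smooth_arc_derivative:
  fixes \<eta> :: "real \<Rightarrow> complex"
  assumes "smooth_on {0..1} \<eta>"
  defines "D \<equiv> \<lambda>t. vector_derivative \<eta> (at t within {0..1})"
  shows "\<And>t. t \<in> {0..1} \<Longrightarrow> (\<eta> has_vector_derivative D t) (at t within {0..1})"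
    and "continuous_on {0..1} D"
proof -
  show 1: "(\<eta> has_vector_derivative D t) (at t within {0..1})" if "t \<in> {0..1}" for t
    using smooth_on_differentiable[OF assms(1) that] unfolding D_def
    by (simp add: vector_derivative_works)
  have "continuous (at x within {0..1}) D" if x: "x \<in> {0..1}" for x
  proof -
    obtain U g where U: "open U" "x \<in> U" "\<And>n. Ck_on n U g" "\<And>y. y \<in> {0..1} \<inter> U \<Longrightarrow> g y = \<eta> y"
      using assms(1) \<open>x \<in> {0..1}\<close> unfolding smooth_on_def by meson
    have g: "\<And>y. y \<in> U \<Longrightarrow> g differentiable (at y)"
      and c: "continuous_on U (\<lambda>y. frechet_derivative g (at y) 1)"
      using U(3)[of 1] by simp_all
    have eq: "D y = frechet_derivative g (at y) 1" if y: "y \<in> {0..1} \<inter> U" for y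
    proof -
      have "(g has_vector_derivative frechet_derivative g (at y) 1) (at y)"
        using g[of y] y by (simp add: frechet_derivative_eq_vector_derivative vector_derivative_works[symmetric])
      then have "(g has_vector_derivative frechet_derivative g (at y) 1) (at y within {0..1})"
        by (rule has_vector_derivative_at_within)
      moreover have "\<forall>\<^sub>F z in at y within {0..1}. g z = \<eta> z"
        unfolding eventually_at_topological using U(1,4) y by (intro exI[of _ U]) simp
      ultimately have "(\<eta> has_vector_derivative frechet_derivative g (at y) 1) (at y within {0..1})"
        using has_derivative_transform_eventually U(4)[OF y] y unfolding has_vector_derivative_def by blast
      then show ?thesis
        unfolding D_def using y by (intro vector_derivative_within_closed_interval) auto
    qed
    have "continuous_on ({0..1} \<inter> U) (\<lambda>y. frechet_derivative g (at y) 1)"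
      using continuous_on_subset[OF c] by blast
    then have "continuous_on ({0..1} \<inter> U) D"
      by (subst continuous_on_cong[OF refl eq])
    then have "continuous (at x within {0..1} \<inter> U) D"
      using U(2) x by (simp add: continuous_on_eq_continuous_within)
    moreover have "at x within {0..1} \<inter> U = at x within {0..1}"
      by (rule at_within_nhd[OF U(2,1)]) auto
    ultimately show ?thesis by simp
  qed
  then show "continuous_on {0..1} D"
    by (simp add: continuous_on_eq_continuous_within)
qed



text \<open>Near the diagonal, the mean value inequality for \<open>\<eta>\<close> minus its linear
  part at \<open>a\<close> bounds the distance from secant to tangent by the oscillation of
  \<open>D\<close>.\<close>

lemma secant_continuous:
  fixes \<eta> D :: "real \<Rightarrow> complex"
  assumes d: "\<And>t. t \<in> {0..1} \<Longrightarrow> (\<eta> has_vector_derivative D t) (at t within {0..1})"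
    and c: "continuous_on {0..1} D"
  defines "F \<equiv> \<lambda>(s, t). if s = t then D t else (\<eta> t - \<eta> s) /\<^sub>R (t - s)"
  shows "continuous_on ({0..1} \<times> {0..1}) F"
proof -
  have \<eta>: "continuous_on {0..1} \<eta>"
    unfolding continuous_on_eq_continuous_within by (intro ballI has_vector_derivative_continuous[OF d])
  have "continuous (at (a, b) within {0..1} \<times> {0..1}) F" if ab: "a \<in> {0..1}" "b \<in> {0..1}" for a b
  proof (cases "a = b")
    case False
    define U where "U = {p :: real \<times> real. fst p \<noteq> snd p}"
    have U: "open U" "(a, b) \<in> U"
      unfolding U_def using False by (auto intro!: open_Collect_neq continuous_intros)
    have "continuous_on (({0..1} \<times> {0..1}) \<inter> U) (\<lambda>p. (\<eta> (snd p) - \<eta> (fst p)) /\<^sub>R (snd p - fst p))"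
      by (intro continuous_intros continuous_on_compose2[OF \<eta>]) (auto simp: U_def)
    then have "continuous_on (({0..1} \<times> {0..1}) \<inter> U) F"
      by (rule continuous_on_eq) (auto simp: F_def U_def)
    then have "continuous (at (a, b) within ({0..1} \<times> {0..1}) \<inter> U) F"
      using U(2) ab by (simp add: continuous_on_eq_continuous_within)
    moreover have "at (a, b) within ({0..1} \<times> {0..1}) \<inter> U = at (a, b) within {0..1} \<times> {0..1}"
      by (rule at_within_nhd[OF U(2,1)]) auto
    ultimately show ?thesis by simp
  next
    case True
    have "\<exists>e>0. \<forall>x\<in>{0..1} \<times> {0..1}. dist x (a, b) < e \<longrightarrow> dist (F x) (F (a, b)) < \<epsilon>" if "\<epsilon> > 0" for \<epsilon>
    proof -
      have "\<epsilon> / 2 > 0"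
        using that by simp
      then obtain \<delta> where \<delta>: "\<delta> > 0" "\<And>u. u \<in> {0..1} \<Longrightarrow> dist u a < \<delta> \<Longrightarrow> dist (D u) (D a) < \<epsilon> / 2"
        using c ab(1) unfolding continuous_on_iff by metis
      have "dist (F (s, t)) (F (a, b)) < \<epsilon>" if st: "s \<in> {0..1}" "t \<in> {0..1}" "dist (s, t) (a, b) < \<delta>" for s t
      proof (cases "s = t")
        case eq: True
        have "dist t b < \<delta>"
          using st(3) dist_snd_le[of "(s, t)" "(a, b)"] by simp
        then show ?thesis
          using \<delta>(2)[OF st(2)] True eq \<open>\<epsilon> > 0\<close> by (simp add: F_def)
      next
        case neq: False
        define I where "I = {0..1} \<inter> ball a \<delta>"
        have I: "s \<in> I" "t \<in> I" "convex I"
          using st(1,2) True dist_fst_le[of "(s, t)" "(a, b)"] dist_snd_le[of "(s, t)" "(a, b)"] st(3)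
          by (auto simp: I_def dist_commute intro!: convex_Int)
        have "norm ((\<eta> t - t *\<^sub>R D a) - (\<eta> s - s *\<^sub>R D a)) \<le> \<epsilon> / 2 * norm (t - s)"
        proof (rule differentiable_bound[OF I(3)])
          fix u assume u: "u \<in> I"
          then have u1: "u \<in> {0..1}"
            by (simp add: I_def)
          have "((\<lambda>u. \<eta> u - u *\<^sub>R D a) has_vector_derivative (D u - 1 *\<^sub>R D a)) (at u within {0..1})"
            using d[OF u1] by (auto intro!: derivative_eq_intros simp: has_vector_derivative_def algebra_simps)
          then have "((\<lambda>u. \<eta> u - u *\<^sub>R D a) has_vector_derivative (D u - D a)) (at u within I)"
            by (auto simp: I_def intro: has_vector_derivative_within_subset)
          then show "((\<lambda>u. \<eta> u - u *\<^sub>R D a) has_derivative (\<lambda>h. h *\<^sub>R (D u - D a))) (at u within I)"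
            by (simp add: has_vector_derivative_def)
          have "norm (D u - D a) \<le> \<epsilon> / 2"
            using \<delta>(2)[OF u1] u by (auto simp: I_def dist_norm norm_minus_commute less_imp_le)
          then show "onorm (\<lambda>h. h *\<^sub>R (D u - D a)) \<le> \<epsilon> / 2"
            using \<open>\<epsilon> / 2 > 0\<close> mult_left_mono[OF \<open>norm (D u - D a) \<le> \<epsilon> / 2\<close> abs_ge_zero]
            by (intro onorm_bound) (simp_all add: mult.commute)
        qed (use I in auto)
        moreover have "(\<eta> t - t *\<^sub>R D a) - (\<eta> s - s *\<^sub>R D a) = (t - s) *\<^sub>R (F (s, t) - D a)"
        proof -
          have "(t - s) *\<^sub>R F (s, t) = \<eta> t - \<eta> s"
            using neq by (simp add: F_def)
          then show ?thesis
            by (simp add: algebra_simps)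
        qed
        ultimately have "\<bar>t - s\<bar> * norm (F (s, t) - D a) \<le> \<bar>t - s\<bar> * (\<epsilon> / 2)"
          by (simp add: mult.commute)
        then have "norm (F (s, t) - D a) \<le> \<epsilon> / 2"
          using neq by simp
        then show ?thesis
          using True that \<open>\<epsilon> > 0\<close> by (simp add: F_def dist_norm)
      qed
      then show ?thesis
        using \<delta>(1) by auto
    qed
    then show ?thesis
      unfolding continuous_within_eps_delta by blast
  qed
  then show ?thesis
    by (auto simp: continuous_on_eq_continuous_within)
qed

text \<open>Secants and tangents of a simple immersed arc never vanish, and the square is
  contractible, so they have a continuous logarithm; \<open>L\<close> is its imaginary part.\<close>

lemma secant_argument:
  fixes \<eta> :: "real \<Rightarrow> complex"
  assumes sm: "smooth_on {0..1} \<eta>" and inj: "inj_on \<eta> {0..1}"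
    and nz: "\<And>t. t \<in> {0..1} \<Longrightarrow> vector_derivative \<eta> (at t within {0..1}) \<noteq> 0"
  obtains L :: "real \<times> real \<Rightarrow> real" where "continuous_on ({0..1} \<times> {0..1}) L"
    "\<And>s t. 0 \<le> s \<Longrightarrow> s < t \<Longrightarrow> t \<le> 1 \<Longrightarrow> \<exists>c>0. \<eta> t - \<eta> s = of_real c * cis (L (s, t))"
    "\<And>t. t \<in> {0..1} \<Longrightarrow> \<exists>c>0. vector_derivative \<eta> (at t within {0..1}) = of_real c * cis (L (t, t))"
proof -
  define D where "D = (\<lambda>t. vector_derivative \<eta> (at t within {0..1}))"
  define F where "F = (\<lambda>(s, t). if s = t then D t else (\<eta> t - \<eta> s) /\<^sub>R (t - s))"
  have F: "continuous_on ({0..1} \<times> {0..1}) F"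
    unfolding F_def D_def by (rule secant_continuous) (use smooth_arc_derivative[OF sm] in auto)
  have "F z \<noteq> 0" if "z \<in> {0..1} \<times> {0..1}" for z
    using that nz inj by (auto simp: F_def D_def inj_on_def split: prod.splits)
  moreover have "contractible ({0..1::real} \<times> {0..1::real})"
    by (rule convex_imp_contractible[OF convex_Times]) auto
  ultimately obtain g where g: "continuous_on ({0..1} \<times> {0..1}) g"
      "\<And>z. z \<in> {0..1} \<times> {0..1} \<Longrightarrow> F z = exp (g z)"
    using continuous_logarithm_on_contractible[OF F] by blast
  have e: "exp z = of_real (exp (Re z)) * cis (Im z)" for z
    by (simp add: exp_eq_polar)
  show ?thesis
  proof (rule that[of "\<lambda>z. Im (g z)"])
    show "continuous_on ({0..1} \<times> {0..1}) (\<lambda>z. Im (g z))"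
      by (intro continuous_intros g)
    show "\<exists>c>0. \<eta> t - \<eta> s = of_real c * cis (Im (g (s, t)))" if "0 \<le> s" "s < t" "t \<le> 1" for s t
    proof (intro exI conjI)
      have "(\<eta> t - \<eta> s) /\<^sub>R (t - s) = of_real (exp (Re (g (s, t)))) * cis (Im (g (s, t)))"
        using g(2)[of "(s, t)"] that by (simp add: F_def e)
      then have "(t - s) *\<^sub>R ((\<eta> t - \<eta> s) /\<^sub>R (t - s)) = (t - s) *\<^sub>R (of_real (exp (Re (g (s, t)))) * cis (Im (g (s, t))))"
        by simp
      then show "\<eta> t - \<eta> s = of_real ((t - s) * exp (Re (g (s, t)))) * cis (Im (g (s, t)))"
        using that by (simp only: scaleR_scaleR) (simp add: scaleR_conv_of_real mult.assoc)
      show "0 < (t - s) * exp (Re (g (s, t)))"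
        using that by simp
    qed
    show "\<exists>c>0. vector_derivative \<eta> (at t within {0..1}) = of_real c * cis (Im (g (t, t)))" if "t \<in> {0..1}" for t
      using g(2)[of "(t, t)"] that by (intro exI[of _ "exp (Re (g (t, t)))"]) (simp add: F_def D_def e)
  qed
qed

section \<open>Angles confined to an interval\<close>

lemma connected_avoiding:
  fixes X :: "real set"
  assumes "connected X" "a \<notin> X" "b \<notin> X" "x \<in> X" "a < x" "x < b"
  shows "X \<subseteq> {a<..<b}"
proof
  fix y assume "y \<in> X"
  moreover have "convex X"
    using assms(1) is_interval_connected_1 is_interval_convex_1 by blast
  ultimately have "closed_segment x y \<subseteq> X"
    using assms(4) by (simp add: closed_segment_subset)
  then show "y \<in> {a<..<b}"
    using assms by (auto simp: closed_segment_eq_real_ivl subset_iff split: if_splits)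
      (smt (verit))+
qed

text \<open>The zeros of the cosine are barriers for the connected set of values of the
  angle.\<close>

lemma cos_avoiding_interval:
  fixes \<phi> :: "real \<Rightarrow> real"
  assumes c: "continuous_on S \<phi>" and S: "connected S"
    and nz: "\<And>t. t \<in> S \<Longrightarrow> cos (\<phi> t - \<tau>) \<noteq> 0"
    and t0: "t0 \<in> S" "\<tau> + pi / 2 + pi * of_int k < \<phi> t0" "\<phi> t0 < \<tau> + pi / 2 + pi * of_int (k + 1)"
    and t: "t \<in> S"
  shows "\<tau> + pi / 2 + pi * of_int k < \<phi> t \<and> \<phi> t < \<tau> + pi / 2 + pi * of_int (k + 1)"
proof -
  have z: "cos (\<tau> + pi / 2 + pi * of_int j - \<tau>) = 0" for j
    by (simp add: cos_add)
  have nz: "\<tau> + pi / 2 + pi * of_int j \<notin> \<phi> ` S" for j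
    using nz z[of j] by (metis imageE)
  have "\<phi> ` S \<subseteq> {\<tau> + pi / 2 + pi * of_int k <..< \<tau> + pi / 2 + pi * of_int (k + 1)}"
    by (rule connected_avoiding[OF connected_continuous_image[OF c S] nz nz imageI[OF t0(1)] t0(2,3)])
  then show ?thesis
    using t by auto
qed

lemma cos_neg_interval:
  assumes "cos x < 0"
  obtains m :: int where "pi / 2 < x - 2 * pi * of_int m" "x - 2 * pi * of_int m < 3 * pi / 2"
proof -
  define m where "m = \<lfloor>(x + pi / 2) / (2 * pi)\<rfloor>"
  define y where "y = x - 2 * pi * of_int m"
  have "of_int m \<le> (x + pi / 2) / (2 * pi)" "(x + pi / 2) / (2 * pi) < of_int m + 1"
    unfolding m_def by linarith+
  then have y: "- (pi / 2) \<le> y" "y < 3 * pi / 2"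
    unfolding y_def by (simp_all add: field_simps)
  have "cos y = cos x"
    unfolding y_def by (simp only: cos_diff cos_int_2pin sin_int_2pin)
  then have "\<not> y \<le> pi / 2"
    using cos_ge_zero[of y] y assms by auto
  with that[of m] y show ?thesis
    by (simp add: y_def)
qed

text \<open>The half-angle form of a chord; the sign of the sine decides whether the chord points
  along \<open>(a + b) / 2 + pi / 2\<close> or against it.\<close>

lemma unit_circle_chord:
  "cis b - cis a = of_real (2 * sin ((b - a) / 2)) * cis ((a + b) / 2 + pi / 2)"
proof -
  define u v where "u = (a + b) / 2" and "v = (b - a) / 2"
  have ab: "a = u - v" "b = u + v"
    by (simp_all add: u_def v_def field_simps)
  have "cis (u + v) - cis (u - v) = of_real (2 * sin v) * cis (u + pi / 2)"
    by (simp add: complex_eq_iff cos_add sin_add cos_diff sin_diff)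
  then show ?thesis
    unfolding ab by (simp add: u_def v_def)
qed

text \<open>The argument of the secant \<open>\<eta> t - \<eta> s\<close> is a continuous function on the triangle \<open>s \<le> t\<close>; the tangent
  turns along the diagonal as the secant does along the two legs, where it stays in a half-plane.\<close>

lemma turning_of_chordal_arc:
  fixes \<eta> :: "real \<Rightarrow> complex"
  assumes sm: "smooth_on {0..1} \<eta>" and inj: "inj_on \<eta> {0..1}"
    and nz: "\<And>t. t \<in> {0..1} \<Longrightarrow> vector_derivative \<eta> (at t within {0..1}) \<noteq> 0"
    and ball: "\<eta> ` {0<..<1} \<subseteq> ball 0 1"
    and ends: "\<eta> 0 = cis \<tau>" "\<eta> 1 = cis \<tau>'"
    and \<tau>: "0 < \<tau>" "\<tau> < 2 * pi" and \<tau>': "0 < \<tau>'" "\<tau>' < 2 * pi"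
  obtains \<theta> :: "real \<Rightarrow> real" where "continuous_on {0..1} \<theta>"
    "\<And>t. t \<in> {0..1} \<Longrightarrow> \<exists>c>0. vector_derivative \<eta> (at t within {0..1}) = of_real c * cis (\<theta> t)"
    "\<theta> 0 \<in> {\<tau> + pi / 2 .. \<tau> + 3 * pi / 2}"
    "\<theta> 1 - 2 * pi * of_bool (\<tau>' < \<tau>) \<in> {\<tau>' - pi / 2 .. \<tau>' + pi / 2}"
proof -
  obtain L where L: "continuous_on ({0..1} \<times> {0..1}) L"
    and sec: "\<And>s t. 0 \<le> s \<Longrightarrow> s < t \<Longrightarrow> t \<le> 1 \<Longrightarrow> \<exists>c>0. \<eta> t - \<eta> s = of_real c * cis (L (s, t))"
    and tan: "\<And>t. t \<in> {0..1} \<Longrightarrow> \<exists>c>0. vector_derivative \<eta> (at t within {0..1}) = of_real c * cis (L (t, t))"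
    using secant_argument[OF sm inj nz] by blast
  have ne: "cis \<tau> \<noteq> cis \<tau>'"
    using inj ends by (auto simp: inj_on_def) (metis atLeastAtMost_iff order_refl zero_le_one zero_neq_one)
  then have "\<tau> \<noteq> \<tau>'" by auto
  have re: "Re (w * cnj (cis a)) = c * cos (x - a)" if "w = of_real c * cis x" for w c x a
    unfolding that by (simp add: cos_diff algebra_simps)
  have in_disc: "Re (\<eta> t * cnj (cis a)) < 1" if "t \<in> {0<..<1}" for t a
  proof -
    have "Re (\<eta> t * cnj (cis a)) \<le> norm (\<eta> t * cnj (cis a))"
      by (rule complex_Re_le_cmod)
    also have "\<dots> < 1"
      using ball that by (auto simp: norm_mult image_subset_iff)
    finally show ?thesis .
  qed
  have on_circle: "Re (cis b * cnj (cis a)) < 1" if "cis a \<noteq> cis b" for a b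
  proof -
    have "Re (cis b * cnj (cis a)) = cos (b - a)"
      by (simp add: cos_diff)
    moreover have "cos (b - a) \<noteq> 1"
      using that by (metis cis_eq_iff cos_one_2pi_int add.commute diff_add_cancel mult.assoc mult.commute)
    ultimately show ?thesis
      using cos_le_one[of "b - a"] by linarith
  qed
  have cis1: "Re (cis a * cnj (cis a)) = 1" for a
    by (simp add: cis_cnj cis_mult)
  \<comment> \<open>By convexity of the disc a chord starting on the unit circle points strictly
    inwards, and one ending there strictly outwards (\<open>pos\<close>).\<close>
  have neg: "cos (L (0, t) - \<tau>) < 0" if t: "t \<in> {0<..1}" for t
  proof -
    obtain c where c: "c > 0" "\<eta> t - \<eta> 0 = of_real c * cis (L (0, t))"
      using sec[of 0 t] t by auto
    have "Re (\<eta> t * cnj (cis \<tau>)) < 1"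
      using in_disc[of t \<tau>] on_circle[OF ne] ends(2) t by (cases "t = 1") auto
    then have "Re ((\<eta> t - \<eta> 0) * cnj (cis \<tau>)) < 0"
      using cis1[of \<tau>] unfolding ends(1) left_diff_distrib minus_complex.sel by linarith
    then show ?thesis
      using re[OF c(2), of \<tau>] c(1) by (simp add: mult_less_0_iff)
  qed
  have pos: "cos (L (s, 1) - \<tau>') > 0" if s: "s \<in> {0..<1}" for s
  proof -
    obtain c where c: "c > 0" "\<eta> 1 - \<eta> s = of_real c * cis (L (s, 1))"
      using sec[of s 1] s by auto
    have "Re (\<eta> s * cnj (cis \<tau>')) < 1"
      using in_disc[of s \<tau>'] on_circle[OF ne[symmetric]] ends(1) s by (cases "s = 0") auto
    then have "Re ((\<eta> 1 - \<eta> s) * cnj (cis \<tau>')) > 0"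
      using cis1[of \<tau>'] unfolding ends(2) left_diff_distrib minus_complex.sel by linarith
    then show ?thesis
      using re[OF c(2), of \<tau>'] c(1) by (simp add: zero_less_mult_iff)
  qed
  have "cos (L (0, 1) - \<tau>) < 0"
    by (rule neg) auto
  then obtain m :: int where m: "pi / 2 < L (0, 1) - \<tau> - 2 * pi * of_int m" "L (0, 1) - \<tau> - 2 * pi * of_int m < 3 * pi / 2"
    by (rule cos_neg_interval)
  \<comment> \<open>The branch of the argument is fixed by the chord from start to end, where the
    two legs meet.\<close>
  define K where "K = (\<lambda>z. L z - 2 * pi * of_int m)"
  have K: "continuous_on ({0..1} \<times> {0..1}) K"
    unfolding K_def by (intro continuous_intros L)
  have cosK: "cos (K z - a) = cos (L z - a)" for z a
  proof -
    have "K z - a = (L z - a) - 2 * pi * of_int m"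
      by (simp add: K_def)
    then show ?thesis
      by (simp only: cos_diff[of "L z - a"] cos_int_2pin sin_int_2pin)
  qed
  have cisK: "cis (K z) = cis (L z)" for z
    unfolding cis_eq_iff by (rule exI[of _ "- m"]) (simp add: K_def)
  define n :: int where "n = of_bool (\<tau>' < \<tau>)"
  \<comment> \<open>The direction of that chord. Compared with the half-angle formula it gains \<pi>
    if \<open>\<tau>' < \<tau>\<close>, because the sine is then negative.\<close>
  define v where "v = (\<tau> + \<tau>') / 2 + pi / 2 + pi * of_int n"
  have cK: "continuous_on {0..1} (\<lambda>t. K (0, t))" "continuous_on {0..1} (\<lambda>t. K (t, 1))" "continuous_on {0..1} (\<lambda>t. K (t, t))"
    by (rule continuous_on_compose2[OF K]; auto intro!: continuous_intros)+
  have leg1: "\<tau> + pi / 2 < K (0, t) \<and> K (0, t) < \<tau> + 3 * pi / 2" if "t \<in> {0<..1}" for t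
  proof -
    have "\<tau> + pi / 2 + pi * of_int 0 < K (0, t) \<and> K (0, t) < \<tau> + pi / 2 + pi * of_int (0 + 1)"
    proof (rule cos_avoiding_interval[where S = "{0<..1}" and ?t0.0 = 1 and \<phi> = "\<lambda>t. K (0, t)"])
      show "continuous_on {0<..1} (\<lambda>t. K (0, t))"
        by (rule continuous_on_subset[OF cK(1)]) auto
      show "cos (K (0, t) - \<tau>) \<noteq> 0" if "t \<in> {0<..1}" for t
        using neg[OF that] by (simp add: cosK)
      show "\<tau> + pi / 2 + pi * of_int 0 < K (0, 1)" "K (0, 1) < \<tau> + pi / 2 + pi * of_int (0 + 1)"
        using m by (simp_all add: K_def)
    qed (use that in auto)
    then show ?thesis by simp
  qed
  \<comment> \<open>Only the closed interval: at its end points the arc may be tangent to the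
    circle, as arcs between boundary components are.\<close>
  have "K (0, 0) \<in> {\<tau> + pi / 2 .. \<tau> + 3 * pi / 2}"
  proof -
    have "(\<lambda>t. K (0, t)) ` closure {0<..1} \<subseteq> {\<tau> + pi / 2 .. \<tau> + 3 * pi / 2}"
      by (rule image_closure_subset) (use cK(1) leg1 in \<open>auto simp: less_imp_le\<close>)
    then show ?thesis
      by (auto simp: image_subset_iff)
  qed
  moreover have K01: "K (0, 1) = v"
  proof -
    obtain c where c: "c > 0" "cis \<tau>' - cis \<tau> = of_real c * cis (K (0, 1))"
      using sec[of 0 1] by (auto simp: cisK ends)
    define e where "e = 2 * \<bar>sin ((\<tau>' - \<tau>) / 2)\<bar>"
    have "cis \<tau>' - cis \<tau> = of_real e * cis v \<and> \<tau> + pi / 2 < v \<and> v < \<tau> + 3 * pi / 2"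
    proof (cases "\<tau>' < \<tau>")
      case True
      have "sin ((\<tau> - \<tau>') / 2) > 0"
        using True \<tau> \<tau>' by (intro sin_gt_zero) auto
      then have "sin ((\<tau>' - \<tau>) / 2) < 0"
        by (metis minus_diff_eq minus_divide_left neg_less_0_iff_less sin_minus)
      moreover have "cis v = - cis ((\<tau> + \<tau>') / 2 + pi / 2)"
      proof -
        have "v = ((\<tau> + \<tau>') / 2 + pi / 2) + pi"
          using True by (simp add: v_def n_def)
        then show ?thesis
          by (simp only: cis_mult[symmetric, of _ pi]) simp
      qed
      ultimately show ?thesis
        using True \<tau> \<tau>' unit_circle_chord[of \<tau>' \<tau>]
        by (simp add: e_def v_def n_def field_simps)
    next
      case False
      then have "sin ((\<tau>' - \<tau>) / 2) > 0"
        using \<tau> \<tau>' \<open>\<tau> \<noteq> \<tau>'\<close> by (intro sin_gt_zero) auto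
      then show ?thesis
        using False \<tau> \<tau>' \<open>\<tau> \<noteq> \<tau>'\<close> unit_circle_chord[of \<tau>' \<tau>]
        by (simp add: e_def v_def n_def field_simps)
    qed
    then have e: "of_real e * cis v = of_real c * cis (K (0, 1))" and v: "\<tau> + pi / 2 < v" "v < \<tau> + 3 * pi / 2"
      using c(2) by auto
    have "norm (of_real e * cis v) = norm (of_real c * cis (K (0, 1)))"
      by (simp only: e)
    then have "e = c"
      using c(1) by (simp add: norm_mult e_def)
    then have "cis v = cis (K (0, 1))"
      using e c(1) by simp
    then obtain j :: int where j: "v = K (0, 1) + 2 * pi * of_int j"
      unfolding cis_eq_iff by blast
    have "\<bar>2 * pi * of_int j\<bar> < pi"
      using j v leg1[of 1, simplified] by linarith
    then have "j = 0"
      using mult_mono[of "2 * pi" "2 * pi" 1 "\<bar>real_of_int j\<bar>"] by (cases "j = 0") (auto simp: abs_mult)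
    then show ?thesis
      using j by simp
  qed
  moreover have "K (1, 1) - 2 * pi * of_bool (\<tau>' < \<tau>) \<in> {\<tau>' - pi / 2 .. \<tau>' + pi / 2}"
  proof -
    have leg2: "\<tau>' - pi / 2 + 2 * pi * n < K (s, 1) \<and> K (s, 1) < \<tau>' + pi / 2 + 2 * pi * n" if "s \<in> {0..<1}" for s
    proof -
      \<comment> \<open>The index \<open>2 * n - 1\<close> selects the strip centred at
        \<open>\<tau>' + 2 * pi * n\<close>, where the cosine is positive.\<close>
      have "\<tau>' + pi / 2 + pi * of_int (2 * n - 1) < K (s, 1) \<and> K (s, 1) < \<tau>' + pi / 2 + pi * of_int (2 * n - 1 + 1)"
      proof (rule cos_avoiding_interval[where S = "{0..<1}" and ?t0.0 = 0 and \<phi> = "\<lambda>t. K (t, 1)"])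
        show "continuous_on {0..<1} (\<lambda>t. K (t, 1))"
          by (rule continuous_on_subset[OF cK(2)]) auto
        show "cos (K (t, 1) - \<tau>') \<noteq> 0" if "t \<in> {0..<1}" for t
          using pos[OF that] by (simp add: cosK)
        show "\<tau>' + pi / 2 + pi * of_int (2 * n - 1) < K (0, 1)" "K (0, 1) < \<tau>' + pi / 2 + pi * of_int (2 * n - 1 + 1)"
          using \<tau> \<tau>' \<open>\<tau> \<noteq> \<tau>'\<close> unfolding K01 v_def n_def
          by (auto simp: field_simps split: if_splits)
      qed (use that in auto)
      then show ?thesis by (simp add: algebra_simps)
    qed
    have "(\<lambda>t. K (t, 1)) ` closure {0..<1} \<subseteq> {\<tau>' - pi / 2 + 2 * pi * n .. \<tau>' + pi / 2 + 2 * pi * n}"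
      by (rule image_closure_subset) (use cK(2) leg2 in \<open>auto simp: less_imp_le\<close>)
    then have "K (1, 1) \<in> {\<tau>' - pi / 2 + 2 * pi * n .. \<tau>' + pi / 2 + 2 * pi * n}"
      by (rule subsetD) (auto intro!: image_eqI[of _ _ 1])
    moreover have "2 * pi * of_bool (\<tau>' < \<tau>) = 2 * pi * of_int n"
      by (simp add: n_def)
    ultimately show ?thesis
      unfolding atLeastAtMost_iff by linarith
  qed
  ultimately show ?thesis
    using that[OF cK(3)] tan by (simp add: cisK)
qed

section \<open>Tangent lifts in a trivialisation\<close>

lemma rspin_D:
  assumes "rspin r M"
  shows "oriented_surface M" "principal_bundle r M" "frame_map M" "boundary_parametrisation r M"
  using assms by (auto simp: rspin_def)

lemma chart_exists:
  assumes "oriented_surface M" "x \<in> topspace (topo M)"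
  obtains c where "c \<in> atlas M" "x \<in> fst c"
  using assms unfolding oriented_surface_def by blast

text \<open>The chart domain pulls back to a relatively open subset of \<open>S\<close>, so
  restricting to it does not change the derivative.\<close>

lemma push_has_derivative:
  assumes "oriented_surface M" "smooth_into M S h" "c \<in> atlas M" "z \<in> S" "h z \<in> fst c"
  shows "(snd c \<circ> h has_derivative push S h c z) (at z within S)"
proof -
  define T where "T = {z \<in> S. h z \<in> fst c}"
  have z: "z \<in> T"
    using assms by (simp add: T_def)
  have "openin (topo M) (fst c)"
    using assms(1,3) by (simp add: oriented_surface_def)
  moreover have "continuous_map (top_of_set S) (topo M) h"
    using assms(2) by (simp add: smooth_into_def)
  ultimately have "openin (top_of_set S) {z \<in> topspace (top_of_set S). h z \<in> fst c}"
    by (rule openin_continuous_map_preimage[rotated])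
  then obtain U where U: "open U" "T = S \<inter> U"
    by (auto simp: openin_open T_def)
  have "at z within T = at z within S"
    using U z by (intro at_within_nhd[of z U]) auto
  moreover have "smooth_on T (snd c \<circ> h)"
    using assms(2,3) by (simp add: smooth_into_def T_def)
  ultimately show ?thesis
    using smooth_on_has_derivative[of T "snd c \<circ> h" z] z by (simp add: push_def)
qed

lemma push_linear:
  assumes "oriented_surface M" "smooth_into M S h" "c \<in> atlas M" "z \<in> S" "h z \<in> fst c"
  shows "linear (push S h c z)"
  using push_has_derivative[OF assms] has_derivative_linear by blast

lemma push_eq_mapply:
  assumes "oriented_surface M" "smooth_into M S h" "c \<in> atlas M" "z \<in> S" "h z \<in> fst c"
  shows "push S h c z w = mapply (push S h c z 1, push S h c z \<i>) w"
proof -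
  interpret linear "push S h c z"
    by (rule push_linear[OF assms])
  have "w = Re w *\<^sub>R 1 + Im w *\<^sub>R \<i>"
    by (simp add: complex_eq_iff)
  then have "push S h c z w = push S h c z (Re w *\<^sub>R 1 + Im w *\<^sub>R \<i>)"
    by simp
  then show ?thesis
    by (simp only: add scaleR mapply_def fst_conv snd_conv)
qed

lemma velocity_comp:
  assumes M: "oriented_surface M" "smooth_into M S h" "c \<in> atlas M"
    and \<eta>: "smooth_on {0..1} \<eta>" "\<eta> ` {0..1} \<subseteq> S" and t: "t \<in> {0..1}" "h (\<eta> t) \<in> fst c"
    and \<gamma>: "\<And>t. t \<in> {0..1} \<Longrightarrow> \<gamma> t = h (\<eta> t)"
  shows "velocity \<gamma> c t = push S h c (\<eta> t) (vector_derivative \<eta> (at t within {0..1}))"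
proof -
  have S: "\<eta> t \<in> S"
    using \<eta>(2) t(1) by auto
  have f: "(snd c \<circ> h has_derivative push S h c (\<eta> t)) (at (\<eta> t) within \<eta> ` {0..1})"
    using push_has_derivative[OF M S t(2)] \<eta>(2) has_derivative_subset by blast
  have "(\<eta> has_derivative (\<lambda>x. x *\<^sub>R vector_derivative \<eta> (at t within {0..1}))) (at t within {0..1})"
    using smooth_arc_derivative(1)[OF \<eta>(1) t(1)] by (simp add: has_vector_derivative_def)
  from diff_chain_within[OF this f]
  have "(snd c \<circ> h \<circ> \<eta> has_derivative (\<lambda>x. push S h c (\<eta> t) (x *\<^sub>R vector_derivative \<eta> (at t within {0..1}))))
      (at t within {0..1})"
    by (simp add: o_def)
  then have "(snd c \<circ> h \<circ> \<eta> has_vector_derivative push S h c (\<eta> t) (vector_derivative \<eta> (at t within {0..1})))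
      (at t within {0..1})"
    by (simp add: has_vector_derivative_def linear_cmul[OF push_linear[OF M S t(2)]])
  then have "(snd c \<circ> \<gamma> has_vector_derivative push S h c (\<eta> t) (vector_derivative \<eta> (at t within {0..1})))
      (at t within {0..1})"
    unfolding has_vector_derivative_def
    by (rule has_derivative_transform[rotated 2]) (use \<gamma> t in auto)
  then show ?thesis
    unfolding velocity_def by (rule vector_derivative_within_closed_interval[rotated 2]) (use t in auto)
qed

lemma morphism_tot:
  assumes "rspin_morphism M S \<kappa> h \<Psi>" "g \<in> GLt" "z \<in> S"
  shows "\<Psi> (g, z) \<in> topspace (tot M)"
  using assms continuous_map_image_subset_topspace[of "top_of_set (GLt \<times> S)" "tot M" \<Psi>]
  by (auto simp: rspin_morphism_def image_subset_iff)

lemma morphism_equivariant: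
  assumes "rspin_morphism M S \<kappa> h \<Psi>" "g \<in> GLt" "g' \<in> GLt" "z \<in> S"
  shows "\<Psi> (gmul g g', z) = act M (\<Psi> (g, z)) g'"
  using assms by (auto simp: rspin_morphism_def)

lemma morphism_proj:
  assumes "rspin_morphism M S \<kappa> h \<Psi>" "g \<in> GLt" "z \<in> S"
  shows "proj M (\<Psi> (g, z)) = h z"
  using assms by (auto simp: rspin_morphism_def)

lemma morphism_frm:
  assumes "rspin_morphism M S \<kappa> h \<Psi>" "g \<in> GLt" "z \<in> S" "c \<in> atlas M" "h z \<in> fst c"
  shows "fst (frm M (\<Psi> (g, z)) c) = push S h c z (z powi \<kappa> * fst (fst g))"
  using assms by (auto simp: rspin_morphism_def)

lemma frm_act:
  assumes "frame_map M" "c \<in> atlas M" "q \<in> topspace (tot M)" "proj M q \<in> fst c" "g \<in> GLt"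
  shows "frm M (act M q g) c = mmul (frm M q c) (fst g)"
  using assms unfolding frame_map_def by blast

lemma frm_det:
  assumes "frame_map M" "c \<in> atlas M" "q \<in> topspace (tot M)" "proj M q \<in> fst c"
  shows "0 < det2 (fst (frm M q c)) (snd (frm M q c))"
  using assms unfolding frame_map_def by blast

text \<open>A rotation on the left adds its angle without any correction.\<close>

lemma gmul_rot_inverse: "gmul (rot a) (gmul (rot (- a)) p) = p"
  by (rule prod_eqI) (simp_all add: mmul_def cis_mult prod_eq_iff flip: mult.assoc)

lemma tangent_frame_GLt:
  assumes "c > 0" "v = of_real c * cis a"
  shows "((v, \<i> * v), a) \<in> GLt"
proof (rule GLt_I)
  have "det2 v (\<i> * v) = c\<^sup>2 * ((cos a)\<^sup>2 + (sin a)\<^sup>2)"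
    unfolding assms(2) by (simp add: det2_def power2_eq_square algebra_simps del: sin_cos_squared_add sin_cos_squared_add2 sin_cos_squared_add3)
  then show "0 < det2 (fst (fst ((v, \<i> * v), a))) (snd (fst ((v, \<i> * v), a)))"
    using assms(1) by simp
  show "sgn (fst (fst ((v, \<i> * v), a))) = cis (snd ((v, \<i> * v), a))"
    using assms by (simp add: sgn_mult sgn_of_real)
qed

text \<open>The velocity completed to a frame, with angle \<open>\<theta>\<close>, is one tangent
  lift in the trivialisation. Any other differs from it by group elements fixing the first vector;
  their angles are full turns, whose number is constant modulo \<open>r\<close>. Hence every tangent
  lift turns as \<open>\<theta>\<close> does.\<close>

lemma tangent_lift_angle:
  fixes M :: "('p, 'q) rspin_surface"
  assumes M: "rspin r M" and S: "smooth_into M S h" and \<Psi>: "rspin_morphism M S 0 h \<Psi>"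
    and \<eta>: "smooth_on {0..1} \<eta>" "\<eta> ` {0..1} \<subseteq> S"
    and \<theta>: "continuous_on {0..1} \<theta>"
      "\<And>t. t \<in> {0..1} \<Longrightarrow> \<exists>c>0. vector_derivative \<eta> (at t within {0..1}) = of_real c * cis (\<theta> t)"
    and \<Gamma>: "tangent_lift M \<gamma> \<Gamma>" and \<gamma>: "\<And>t. t \<in> {0..1} \<Longrightarrow> \<gamma> t = h (\<eta> t)"
  obtains p0 p1 and k0 k1 :: int where "p0 \<in> GLt" "p1 \<in> GLt"
    "\<Gamma> 0 = \<Psi> (p0, \<eta> 0)" "\<Gamma> 1 = \<Psi> (p1, \<eta> 1)" "snd p0 = \<theta> 0 + 2 * pi * of_int k0"
    "snd p1 = \<theta> 1 + 2 * pi * of_int k1" "[k1 = k0] (mod int r)"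
proof -
  note os = rspin_D(1)[OF M] and pb = rspin_D(2)[OF M] and fm = rspin_D(3)[OF M]
  define D where "D = (\<lambda>t. vector_derivative \<eta> (at t within {0..1}))"
  define g where "g = (\<lambda>t. ((D t, \<i> * D t), \<theta> t))"
  have g: "g t \<in> GLt" if t: "t \<in> {0..1}" for t
    using \<theta>(2)[OF t] tangent_frame_GLt unfolding g_def D_def by blast
  have \<eta>S: "\<eta> t \<in> S" if "t \<in> {0..1}" for t
    using \<eta>(2) that by blast
  define \<Gamma>0 where "\<Gamma>0 = (\<lambda>t. \<Psi> (g t, \<eta> t))"
  have D: "continuous_on {0..1} D"
    unfolding D_def by (rule smooth_arc_derivative(2)[OF \<eta>(1)])
  have c\<eta>: "continuous_on {0..1} \<eta>"
    unfolding continuous_on_eq_continuous_within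
    by (intro ballI has_vector_derivative_continuous[OF smooth_arc_derivative(1)[OF \<eta>(1)]])
  have "continuous_on {0..1} (\<lambda>t. (g t, \<eta> t))"
    unfolding g_def by (intro continuous_intros D c\<eta> \<theta>(1))
  then have "continuous_map (top_of_set {0..1}) (top_of_set (GLt \<times> S)) (\<lambda>t. (g t, \<eta> t))"
    using g \<eta>S by (auto simp: continuous_map_iff_continuous image_subset_iff continuous_map_in_subtopology)
  moreover have "continuous_map (top_of_set (GLt \<times> S)) (tot M) \<Psi>"
    using \<Psi> by (simp add: rspin_morphism_def)
  ultimately have c0: "continuous_map (top_of_set {0..1}) (tot M) \<Gamma>0"
    unfolding \<Gamma>0_def by (rule continuous_map_compose[unfolded o_def])
  have c1: "continuous_map (top_of_set {0..1}) (tot M) \<Gamma>"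
    using \<Gamma> by (simp add: tangent_lift_def)
  have "\<exists>x k. x \<in> GLt \<and> \<Gamma> t = act M (\<Gamma>0 t) x \<and> snd x = 2 * pi * of_int (k::int)" if t: "t \<in> {0..1}" for t
  proof -
    have tot: "\<Gamma>0 t \<in> topspace (tot M)" "\<Gamma> t \<in> topspace (tot M)"
      using morphism_tot[OF \<Psi> g[OF t] \<eta>S[OF t]] continuous_map_image_subset_topspace[OF c1] t
      by (auto simp: \<Gamma>0_def)
    have pr: "proj M (\<Gamma>0 t) = h (\<eta> t)" "proj M (\<Gamma> t) = h (\<eta> t)"
      using morphism_proj[OF \<Psi> g[OF t] \<eta>S[OF t]] \<Gamma> \<gamma>[OF t] t by (auto simp: \<Gamma>0_def tangent_lift_def)
    then obtain x where x: "x \<in> GLt" "\<Gamma> t = act M (\<Gamma>0 t) x"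
      using act_transitive[OF pb tot] by metis
    obtain c where c: "c \<in> atlas M" "h (\<eta> t) \<in> fst c"
      using chart_exists[OF os proj_in_topspace[OF pb tot(1)]] pr by metis
    have "fst (frm M (\<Gamma> t) c) = velocity \<gamma> c t"
      using \<Gamma> c \<gamma>[OF t] t by (simp add: tangent_lift_def)
    also have "\<dots> = push S h c (\<eta> t) (D t)"
      unfolding D_def by (rule velocity_comp[OF os S c(1) \<eta> t c(2) \<gamma>])
    also have "\<dots> = fst (frm M (\<Gamma>0 t) c)"
      using morphism_frm[OF \<Psi> g[OF t] \<eta>S[OF t] c] by (simp add: \<Gamma>0_def g_def)
    \<comment> \<open>Both lifts have the velocity as first vector, so the matrix relating them
      fixes 1.\<close>
    finally have "mapply (frm M (\<Gamma>0 t) c) (fst (fst x)) = mapply (frm M (\<Gamma>0 t) c) 1"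
      using frm_act[OF fm c(1) tot(1) _ x(1)] pr c(2) x(2) by (simp add: mmul_def)
    then have "fst (fst x) = 1"
      using mapply_inj[OF frm_det[OF fm c(1) tot(1)]] pr c(2) by simp
    then have "cis (snd x) = cis 0"
      using GLt_D(2)[OF x(1)] by simp
    then obtain k :: int where "snd x = 2 * pi * of_int k"
      unfolding cis_eq_iff by auto
    with x show ?thesis by blast
  qed
  then obtain x k where x: "\<And>t. t \<in> {0..1} \<Longrightarrow>
      x t \<in> GLt \<and> \<Gamma> t = act M (\<Gamma>0 t) (x t) \<and> snd (x t) = 2 * pi * of_int (k t::int)"
    by metis
  have k: "[k 1 = k 0] (mod int r)"
    by (rule lift_rotation_constant[OF pb c1 c0 x])
  have 1: "\<Gamma> t = \<Psi> (gmul (g t) (x t), \<eta> t)" "gmul (g t) (x t) \<in> GLt"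
    "snd (gmul (g t) (x t)) = \<theta> t + 2 * pi * of_int (k t)" if t: "t \<in> {0..1}" for t
    using x[OF t] morphism_equivariant[OF \<Psi> g[OF t] _ \<eta>S[OF t]] g[OF t] gmul_snd_int[OF g[OF t], of "x t" "k t"]
    by (auto simp: \<Gamma>0_def) (simp add: g_def)
  show ?thesis
    by (rule that[OF 1(2) 1(2) 1(1) 1(1) 1(3) 1(3) k]) auto
qed

section \<open>Holonomies of curves crossing one edge\<close>

lemma punctured_face_ball: "ball 0 1 \<subseteq> punctured_face D f"
  by (auto simp: punctured_face_def)

lemma side_arc_bounds:
  assumes "x \<in> sides D" "\<tau> \<in> side_arc D x"
  shows "0 < \<tau>" "\<tau> < 2 * pi"
proof -
  obtain f k where x: "x = (f, k)" "1 \<le> k" "k \<le> nsides D f"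
    using assms(1) by (auto simp: sides_def)
  have n: "0 < nsides D f"
    using x by simp
  have b: "2 * pi * (real k - 1) / real (nsides D f) < \<tau>" "\<tau> < 2 * pi * real k / real (nsides D f)"
    using assms(2) x(1) by (auto simp: side_arc_def)
  have "0 \<le> 2 * pi * (real k - 1) / real (nsides D f)"
    using x n by simp
  then show "0 < \<tau>" using b by linarith
  have "2 * pi * real k / real (nsides D f) \<le> 2 * pi * real (nsides D f) / real (nsides D f)"
    using x n by (intro divide_right_mono mult_left_mono) auto
  then show "\<tau> < 2 * pi" using b n by simp
qed

lemma side_arc_punctured_face:
  assumes "x \<in> sides D" "\<tau> \<in> side_arc D x"
  shows "cis \<tau> \<in> punctured_face D (fst x)"
proof -
  obtain f k where x: "x = (f, k)" "1 \<le> k" "k \<le> nsides D f"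
    using assms(1) by (auto simp: sides_def)
  define n where "n = nsides D f"
  have n: "0 < n"
    using x by (simp add: n_def)
  have b: "2 * pi * (real k - 1) / n < \<tau>" "\<tau> < 2 * pi * real k / n"
    using assms(2) x(1) by (auto simp: side_arc_def n_def)
  have "cis \<tau> \<noteq> cis (2 * pi * real j / n)" for j :: nat
  proof
    assume "cis \<tau> = cis (2 * pi * real j / n)"
    then obtain m :: int where "\<tau> = 2 * pi * real j / n + 2 * pi * of_int m"
      unfolding cis_eq_iff by blast
    then have \<tau>: "\<tau> = 2 * pi * of_int (int j + m * int n) / n"
      using n by (simp add: field_simps)
    have "2 * pi * (real k - 1) < 2 * pi * of_int (int j + m * int n)"
      "2 * pi * of_int (int j + m * int n) < 2 * pi * real k"
      using b n unfolding \<tau> by (simp_all add: divide_less_cancel)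
    then have "real k - 1 < of_int (int j + m * int n)" "of_int (int j + m * int n) < real k"
      using pi_gt_zero by (simp_all only: mult_less_cancel_left_pos mult_pos_pos zero_less_numeral)
    then have "int k - 1 < int j + m * int n" "int j + m * int n < int k"
      by linarith+
    then show False by linarith
  qed
  then show ?thesis
    using x(1) by (auto simp: punctured_face_def n_def)
qed

lemma side_arc_less:
  assumes "(f, a) \<in> sides D" "\<tau> \<in> side_arc D (f, a)" "\<tau>' \<in> side_arc D (f, b)" "a < b"
  shows "\<tau> < \<tau>'"
proof -
  have "2 * pi * real a / real (nsides D f) \<le> 2 * pi * (real b - 1) / real (nsides D f)"
    using assms(1,4) by (intro divide_right_mono mult_left_mono) (auto simp: sides_def)
  then show ?thesis
    using assms(2,3) by (auto simp: side_arc_def)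
qed

lemma side_arc_less_iff:
  assumes "(f, a) \<in> sides D" "(f, b) \<in> sides D" "\<tau> \<in> side_arc D (f, a)" "\<tau>' \<in> side_arc D (f, b)" "a \<noteq> b"
  shows "\<tau> < \<tau>' \<longleftrightarrow> a < b"
  using side_arc_less[OF assms(1,3,4)] side_arc_less[OF assms(2,4,3)] assms(5)
  by (metis linorder_neqE_nat order.asym)

lemma presents_D:
  assumes "presents r M D"
  shows "plcw_cells M D" "plcw_gluing M D" "plcw M D" "admissible r M D"
proof -
  note * = assms[unfolded presents_def]
  show 1: "plcw M D"
    by (rule conjunct1[OF *])
  show "admissible r M D"
    by (rule conjunct1[OF conjunct2[OF *]])
  show "plcw_cells M D" "plcw_gluing M D"
    using 1 by (simp_all add: plcw_def)
qed

lemma side_face: "x \<in> sides D \<Longrightarrow> fst x \<in> faces D"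
  by (auto simp: sides_def)

lemma strict_antimono_on_imp_inj:
  fixes h :: "'a::linorder \<Rightarrow> 'b::preorder"
  assumes "strict_antimono_on A h"
  shows "inj_on h A"
  using assms unfolding monotone_on_def inj_on_def by (metis linorder_neqE less_irrefl)

lemma side_glue:
  assumes "plcw_gluing M D" "x \<in> sides D"
  obtains h where "inj_on h (side_arc D x)" "h ` side_arc D x = {0<..<1}"
    "\<And>\<tau>. \<tau> \<in> side_arc D x \<Longrightarrow> fmap D (fst x) (cis \<tau>) = emap D (side_edge D x) (h \<tau>)"
proof -
  note g = conjunct2[OF bspec[OF conjunct1[OF assms(1)[unfolded plcw_gluing_def]] assms(2)]]
  obtain h where "if side_dir D x then strict_mono_on (side_arc D x) h
              else strict_antimono_on (side_arc D x) h" "h ` side_arc D x = {0<..<1}"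
    "\<forall>\<tau>\<in>side_arc D x. fmap D (fst x) (cis \<tau>) = emap D (side_edge D x) (h \<tau>)"
    using g by (elim exE conjE) (rule that)
  then show ?thesis
    using that by (metis strict_mono_on_imp_inj_on strict_antimono_on_imp_inj)
qed

lemma side_edge_in_edges:
  assumes "plcw_gluing M D" "x \<in> sides D"
  shows "side_edge D x \<in> edges D"
  using assms unfolding plcw_gluing_def by blast

lemma side_label_inj:
  assumes "plcw_gluing M D" "x \<in> sides D" "y \<in> sides D" "side_edge D x = side_edge D y" "side_dir D x = side_dir D y"
  shows "x = y"
  using assms unfolding plcw_gluing_def inj_on_def side_label_def by blast

lemma fmap_side_inj:
  assumes "presents r M D" "x \<in> sides D" "\<tau> \<in> side_arc D x" "\<tau>' \<in> side_arc D x"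
    "fmap D (fst x) (cis \<tau>) = fmap D (fst x) (cis \<tau>')"
  shows "\<tau> = \<tau>'"
proof -
  obtain h where h: "inj_on h (side_arc D x)" "h ` side_arc D x = {0<..<1}"
    "\<And>\<tau>. \<tau> \<in> side_arc D x \<Longrightarrow> fmap D (fst x) (cis \<tau>) = emap D (side_edge D x) (h \<tau>)"
    using side_glue[OF presents_D(2)[OF assms(1)] assms(2)] by blast
  have "inj_on (emap D (side_edge D x)) {0<..<1}"
    using presents_D(1)[OF assms(1)] side_edge_in_edges[OF presents_D(2)[OF assms(1)] assms(2)]
    by (simp add: plcw_cells_def)
  moreover have "emap D (side_edge D x) (h \<tau>) = emap D (side_edge D x) (h \<tau>')"
    using h(3) assms(3-5) by metis
  moreover have "h \<tau> \<in> {0<..<1}" "h \<tau>' \<in> {0<..<1}"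
    using h(2) assms(3,4) by blast+
  ultimately have "h \<tau> = h \<tau>'"
    by (auto dest: inj_onD)
  then show ?thesis
    using h(1) assms(3,4) by (auto dest: inj_onD)
qed

text \<open>Two angles known only up to strips of length \<pi> still determine the number of full
  turns between them, provided that both strips start at even multiples of \<pi>.\<close>

lemma interval_index_eq:
  fixes i j l :: int
  assumes "of_int (2 * i) * pi < a" "a < (of_int (2 * i) + 1) * pi"
    and "of_int (2 * j) * pi < b" "b < (of_int (2 * j) + 1) * pi" and "a = b + 2 * pi * of_int l"
  shows "i = j + l"
proof -
  have "of_int (2 * i) * pi < (of_int (2 * j) + 1) * pi + 2 * pi * of_int l"
    "of_int (2 * j) * pi + 2 * pi * of_int l < (of_int (2 * i) + 1) * pi"
    using assms by linarith+
  then have "of_int (2 * i) * pi < (of_int (2 * j) + 1 + 2 * of_int l) * pi"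
    "(of_int (2 * j) + 2 * of_int l) * pi < (of_int (2 * i) + 1) * pi"
    by (simp_all add: algebra_simps)
  then have "of_int (2 * i) < (of_int (2 * j) + 1 + 2 * of_int l :: real)"
    "(of_int (2 * j) + 2 * of_int l :: real) < of_int (2 * i) + 1"
    by (simp_all only: mult_less_cancel_right_pos[OF pi_gt_zero])
  then show ?thesis by linarith
qed

lemma side_lift_rotate:
  assumes "rspin_morphism M S \<kappa> h (\<Psi> f)" "p \<in> GLt" "cis \<tau> \<in> S"
  shows "\<Psi> f (p, cis \<tau>) = act M (side_lift \<Psi> f \<tau>) (gmul (rot (- (\<tau> + pi / 2))) p)"
proof -
  have "\<Psi> f (p, cis \<tau>) = \<Psi> f (gmul (rot (\<tau> + pi / 2)) (gmul (rot (- (\<tau> + pi / 2))) p), cis \<tau>)"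
    unfolding gmul_rot_inverse ..
  also have "\<dots> = act M (side_lift \<Psi> f \<tau>) (gmul (rot (- (\<tau> + pi / 2))) p)"
    unfolding side_lift_def by (rule morphism_equivariant[OF assms(1)]) (use assms in auto)
  finally show ?thesis .
qed

lemma act_free_angle:
  assumes "principal_bundle r M" "q \<in> topspace (tot M)" "g \<in> GLt" "h \<in> GLt" "act M q g = act M q h"
  shows "\<exists>k::int. snd g = snd h + 2 * pi * of_int (k * int r)"
  by (rule act_free[OF assms]) blast

text \<open>Angles are measured from the counter-clockwise tangent of the polygon. Up to full turns,
  the curve enters at an angle between 0 and \<pi> and leaves at one between -\<pi> and 0; the
  turning contributes \<open>n\<close> full turns, the gluing across \<open>e\<close> a rotation by
  \<open>pi + 2 * pi * s\<close>, and alignment respects the strips. Crossing in the other direction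
  replaces \<open>s\<close> by \<open>-1 - s\<close> and the order of the two sides by the opposite
  one, so both directions give the same parity.\<close>

lemma crossing_holonomy:
  fixes M :: "('p, 'q) rspin_surface"
  assumes r: "even r" and M: "rspin r M" and pres: "presents r M D"
    and cr: "crossing_curve D f e \<gamma>" and hol: "closed_holonomy M \<gamma> k"
    and x: "x \<in> sides D" "side_edge D x = e" "side_dir D x"
    and y: "y \<in> sides D" "side_edge D y = e" "\<not> side_dir D y"
  shows "even (k - (eidx D e + of_bool (snd y < snd x)))"
proof -
  note pb = rspin_D(2)[OF M]
  note gl = presents_D(2)[OF pres]
  obtain \<eta> where pc: "polygon_curve D f e e \<eta> \<gamma>"
    and tr: "\<And>t. t \<in> {0, 1} \<Longrightarrow> Re (cnj (\<eta> t) * vector_derivative \<eta> (at t within {0..1})) \<noteq> 0"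
    and cl: "\<gamma> 0 = \<gamma> 1"
    using cr unfolding crossing_curve_def by blast
  have sm: "smooth_on {0..1} \<eta>" and inj: "inj_on \<eta> {0..1}" and ball: "\<eta> ` {0<..<1} \<subseteq> ball 0 1"
    and nz: "\<And>t. t \<in> {0..1} \<Longrightarrow> vector_derivative \<eta> (at t within {0..1}) \<noteq> 0"
    and \<gamma>: "\<And>t. t \<in> {0..1} \<Longrightarrow> \<gamma> t = fmap D f (\<eta> t)"
    using pc unfolding polygon_curve_def by blast+
  obtain a \<tau> where a: "a \<in> sides D" "fst a = f" "side_edge D a = e" "\<tau> \<in> side_arc D a" "\<eta> 0 = cis \<tau>"
    using pc unfolding polygon_curve_def by blast
  obtain b \<tau>' where b: "b \<in> sides D" "fst b = f" "side_edge D b = e" "\<tau>' \<in> side_arc D b" "\<eta> 1 = cis \<tau>'"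
    using pc unfolding polygon_curve_def by blast
  have pts: "fmap D f (cis \<tau>) = fmap D f (cis \<tau>')"
    using \<gamma>[of 0] \<gamma>[of 1] cl a(5) b(5) by simp
  have "a \<noteq> b"
  proof
    assume "a = b"
    then have "\<tau> = \<tau>'"
      using fmap_side_inj[OF pres a(1,4)] b(4) pts a(2) by metis
    then have "\<eta> 0 = \<eta> 1"
      using a(5) b(5) by simp
    then show False
      using inj_onD[OF inj, of 0 1] by simp
  qed
  then have dir: "side_dir D a \<noteq> side_dir D b"
    using side_label_inj[OF gl a(1) b(1)] a(3) b(3) by auto
  have ord: "\<tau>' < \<tau> \<longleftrightarrow> snd b < snd a"
    using side_arc_less_iff[of f "snd b" D "snd a" \<tau>' \<tau>] a b \<open>a \<noteq> b\<close> by (metis prod.collapse)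
  have f: "f \<in> faces D"
    using side_face[OF a(1)] a(2) by simp
  obtain \<Psi> where \<Psi>: "\<forall>f\<in>faces D. rspin_morphism M (punctured_face D f) 0 (fmap D f) (\<Psi> f)"
    and al0: "\<forall>x\<in>sides D. \<forall>y\<in>sides D. \<forall>\<tau>\<in>side_arc D x. \<forall>\<tau>'\<in>side_arc D y.
           side_edge D x = side_edge D y \<and> side_dir D x \<and> \<not> side_dir D y \<and>
           fmap D (fst x) (cis \<tau>) = fmap D (fst y) (cis \<tau>') \<longrightarrow>
           aligned M
             (act M (side_lift \<Psi> (fst x) \<tau>) (rot (pi + 2 * pi * of_int (eidx D (side_edge D x)))))
             (side_lift \<Psi> (fst y) \<tau>')"
    using pres unfolding presents_def by (elim conjE exE) (rule that)
  note al = al0[rule_format]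
  define S where "S = punctured_face D f"
  have \<Psi>f: "rspin_morphism M S 0 (fmap D f) (\<Psi> f)"
    using bspec[OF \<Psi> f] by (simp add: S_def)
  have si: "smooth_into M S (fmap D f)"
    using presents_D(1)[OF pres] f by (simp add: plcw_cells_def S_def)
  have S01: "cis \<tau> \<in> S" "cis \<tau>' \<in> S"
    using side_arc_punctured_face[OF a(1,4)] side_arc_punctured_face[OF b(1,4)] a(2) b(2) by (auto simp: S_def)
  have \<eta>S: "\<eta> ` {0..1} \<subseteq> S"
  proof
    fix z assume "z \<in> \<eta> ` {0..1}"
    then obtain t where "t \<in> {0..1}" "z = \<eta> t" by blast
    then have "z \<in> \<eta> ` {0<..<1} \<or> z = \<eta> 0 \<or> z = \<eta> 1"
      by (cases "t = 0 \<or> t = 1") auto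
    then show "z \<in> S"
      using ball punctured_face_ball[of D f] S01 a(5) b(5) by (auto simp: S_def)
  qed
  define n :: int where "n = of_bool (\<tau>' < \<tau>)"
  obtain \<theta> where \<theta>: "continuous_on {0..1} \<theta>"
    "\<And>t. t \<in> {0..1} \<Longrightarrow> \<exists>c>0. vector_derivative \<eta> (at t within {0..1}) = of_real c * cis (\<theta> t)"
    "\<theta> 0 \<in> {\<tau> + pi / 2 .. \<tau> + 3 * pi / 2}"
    "\<theta> 1 - 2 * pi * of_bool (\<tau>' < \<tau>) \<in> {\<tau>' - pi / 2 .. \<tau>' + pi / 2}"
    using turning_of_chordal_arc[OF sm inj nz ball a(5) b(5) side_arc_bounds[OF a(1,4)] side_arc_bounds[OF b(1,4)]]
    by blast
  \<comment> \<open>Transversality excludes the end points of the intervals for the initial and the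
    final direction.\<close>
  have cosne: "cos (\<theta> t - \<sigma>) \<noteq> 0" if t: "t \<in> {0, 1}" "\<eta> t = cis \<sigma>" for t \<sigma>
  proof -
    obtain c where c: "vector_derivative \<eta> (at t within {0..1}) = of_real c * cis (\<theta> t)"
      using \<theta>(2)[of t] t by auto
    have "Re (cnj (\<eta> t) * vector_derivative \<eta> (at t within {0..1})) = c * cos (\<theta> t - \<sigma>)"
      unfolding c t(2) by (simp add: cos_diff algebra_simps)
    then show ?thesis
      using tr[OF t(1)] by auto
  qed
  have "\<theta> 0 - \<tau> \<noteq> pi / 2" "\<theta> 0 - \<tau> \<noteq> 3 * pi / 2"
  proof -
    have "cos (\<theta> 0 - \<tau>) \<noteq> 0"
      by (rule cosne) (use a(5) in auto)
    moreover have "cos (pi / 2) = 0" "cos (3 * pi / 2) = 0"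
      using cos_3over2_pi by simp_all
    ultimately show "\<theta> 0 - \<tau> \<noteq> pi / 2" "\<theta> 0 - \<tau> \<noteq> 3 * pi / 2"
      by metis+
  qed
  then have \<theta>0: "\<tau> + pi / 2 < \<theta> 0" "\<theta> 0 < \<tau> + 3 * pi / 2"
    using \<theta>(3) by (auto simp: less_le)
  have n2: "2 * pi * of_bool (\<tau>' < \<tau>) = 2 * pi * of_int n"
    by (simp add: n_def)
  have shift: "cos (\<theta> 1 - \<tau>') = cos (\<theta> 1 - \<tau>' - 2 * pi * of_int n)"
    by (simp only: cos_diff[of "\<theta> 1 - \<tau>'"] cos_int_2pin sin_int_2pin)
  have "\<theta> 1 - \<tau>' - 2 * pi * of_int n \<noteq> pi / 2" "\<theta> 1 - \<tau>' - 2 * pi * of_int n \<noteq> - (pi / 2)"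
  proof -
    have "cos (\<theta> 1 - \<tau>' - 2 * pi * of_int n) \<noteq> 0"
      unfolding shift[symmetric] by (rule cosne) (use b(5) in auto)
    moreover have "cos (pi / 2) = 0" "cos (- (pi / 2)) = 0"
      by simp_all
    ultimately show "\<theta> 1 - \<tau>' - 2 * pi * of_int n \<noteq> pi / 2" "\<theta> 1 - \<tau>' - 2 * pi * of_int n \<noteq> - (pi / 2)"
      by metis+
  qed
  then have \<theta>1: "\<tau>' - pi / 2 + 2 * pi * of_int n < \<theta> 1" "\<theta> 1 < \<tau>' + pi / 2 + 2 * pi * of_int n"
    using \<theta>(4) unfolding n2 atLeastAtMost_iff by linarith+
  obtain \<Gamma> where \<Gamma>: "tangent_lift M \<gamma> \<Gamma>" "\<Gamma> 1 = act M (\<Gamma> 0) (deck k)"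
    using hol unfolding closed_holonomy_def by blast
  obtain p0 p1 and k0 k1 :: int where p: "p0 \<in> GLt" "p1 \<in> GLt"
    "\<Gamma> 0 = \<Psi> f (p0, \<eta> 0)" "\<Gamma> 1 = \<Psi> f (p1, \<eta> 1)" "snd p0 = \<theta> 0 + 2 * pi * of_int k0"
    "snd p1 = \<theta> 1 + 2 * pi * of_int k1" "[k1 = k0] (mod int r)"
    using tangent_lift_angle[OF M si \<Psi>f sm \<eta>S \<theta>(1,2) \<Gamma>(1) \<gamma>] by blast
  define u0 where "u0 = gmul (rot (- (\<tau> + pi / 2))) p0"
  define u1 where "u1 = gmul (rot (- (\<tau>' + pi / 2))) p1"
  have u: "u0 \<in> GLt" "u1 \<in> GLt"
    using p by (auto simp: u0_def u1_def)
  define qa where "qa = side_lift \<Psi> f \<tau>"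
  define qb where "qb = side_lift \<Psi> f \<tau>'"
  have q: "qa \<in> topspace (tot M)" "qb \<in> topspace (tot M)"
    unfolding qa_def qb_def side_lift_def using morphism_tot[OF \<Psi>f] S01 by auto
  have G0: "\<Gamma> 0 = act M qa u0" and G1: "\<Gamma> 1 = act M qb u1"
    using side_lift_rotate[of M S 0 "fmap D f" \<Psi> f] \<Psi>f p S01 a(5) b(5)
    by (auto simp: u0_def u1_def qa_def qb_def)
  have su0: "of_int (2 * k0) * pi < snd u0" "snd u0 < (of_int (2 * k0) + 1) * pi"
    using p(5) \<theta>0 by (simp_all add: u0_def algebra_simps)
  have su1: "of_int (2 * (k1 + n) - 1) * pi < snd u1" "snd u1 < (of_int (2 * (k1 + n) - 1) + 1) * pi"
    using p(6) \<theta>1 by (simp_all add: u1_def algebra_simps)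
  have dk: "deck k \<in> GLt" "snd (deck k) = 2 * pi * of_int k"
    by (auto simp: deck_def)
  define s where "s = eidx D e"
  define \<rho> where "\<rho> = rot (pi + 2 * pi * of_int s)"
  have \<rho>: "\<rho> \<in> GLt" "snd (gmul \<rho> g) = pi + 2 * pi * of_int s + snd g" for g
    by (auto simp: \<rho>_def)
  show ?thesis
  proof (cases "side_dir D a")
    case True
    then have xy: "x = a" "y = b"
      using side_label_inj[OF gl x(1) a(1)] side_label_inj[OF gl y(1) b(1)] x y a b dir by auto
    have "aligned M (act M qa \<rho>) qb"
      using al[OF a(1) b(1) a(4) b(4)] a(2,3) b(2,3) dir True pts
      unfolding qa_def qb_def \<rho>_def s_def by simp
    then obtain g where g: "(g, 0) \<in> GLt" "qb = act M (act M qa \<rho>) (g, 0)"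
      unfolding aligned_def by blast
    have "act M qb u1 = act M qa (gmul \<rho> (gmul (g, 0) u1))"
      using act_act[OF pb act_in_tot[OF pb q(1) \<rho>(1)] g(1) u(2)] act_act[OF pb q(1) \<rho>(1) gmul_GLt[OF g(1) u(2)]] g(2)
      by simp
    moreover have "act M qb u1 = act M qa (gmul u0 (deck k))"
      using act_act[OF pb q(1) u(1) dk(1)] G0 G1 \<Gamma>(2) by simp
    ultimately have "act M qa (gmul u0 (deck k)) = act M qa (gmul \<rho> (gmul (g, 0) u1))"
      by simp
    then obtain m :: int where
      "snd (gmul u0 (deck k)) = snd (gmul \<rho> (gmul (g, 0) u1)) + 2 * pi * of_int (m * int r)"
      using act_free_angle[OF pb q(1) gmul_GLt[OF u(1) dk(1)] gmul_GLt[OF \<rho>(1) gmul_GLt[OF g(1) u(2)]]] by blast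
    then have eq: "snd u0 = (snd (gmul (g, 0) u1) + pi) + 2 * pi * of_int (s + m * int r - k)"
      unfolding gmul_snd_int[OF u(1) dk(2)] dk(2) \<rho>(2) by (simp add: algebra_simps)
    have "of_int (2 * (k1 + n)) * pi < snd (gmul (g, 0) u1) + pi"
      "snd (gmul (g, 0) u1) + pi < (of_int (2 * (k1 + n)) + 1) * pi"
      using gmul_positive_interval[OF g(1) su1 refl] by (simp_all add: algebra_simps)
    then have "k0 = (k1 + n) + (s + m * int r - k)"
      using interval_index_eq[OF su0 _ _ eq] by blast
    then have "k - (s + n) = (k1 - k0) + m * int r"
      by simp
    moreover have "even (k1 - k0)"
      using p(7) r by (meson cong_iff_dvd_diff dvd_trans even_of_nat)
    ultimately have "even (k - (s + n))"
      using r by simp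
    then show ?thesis
      by (simp add: s_def n_def ord xy)
  next
    case False
    then have xy: "x = b" "y = a"
      using side_label_inj[OF gl x(1) b(1)] side_label_inj[OF gl y(1) a(1)] x y a b dir by auto
    have "aligned M (act M qb \<rho>) qa"
      using al[OF b(1) a(1) b(4) a(4)] a(2,3) b(2,3) dir False pts
      unfolding qa_def qb_def \<rho>_def s_def by simp
    then obtain g where g: "(g, 0) \<in> GLt" "qa = act M (act M qb \<rho>) (g, 0)"
      unfolding aligned_def by blast
    have "act M qa u0 = act M qb (gmul \<rho> (gmul (g, 0) u0))"
      using act_act[OF pb act_in_tot[OF pb q(2) \<rho>(1)] g(1) u(1)] act_act[OF pb q(2) \<rho>(1) gmul_GLt[OF g(1) u(1)]] g(2)
      by simp
    then have "act M qb u1 = act M qb (gmul (gmul \<rho> (gmul (g, 0) u0)) (deck k))"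
      using act_act[OF pb q(2) gmul_GLt[OF \<rho>(1) gmul_GLt[OF g(1) u(1)]] dk(1)] G0 G1 \<Gamma>(2) by simp
    then obtain m :: int where
      "snd u1 = snd (gmul (gmul \<rho> (gmul (g, 0) u0)) (deck k)) + 2 * pi * of_int (m * int r)"
      using act_free_angle[OF pb q(2) u(2) gmul_GLt[OF gmul_GLt[OF \<rho>(1) gmul_GLt[OF g(1) u(1)]] dk(1)]] by blast
    then have eq: "snd u1 + pi = snd (gmul (g, 0) u0) + 2 * pi * of_int (1 + s + k + m * int r)"
      unfolding gmul_snd_int[OF gmul_GLt[OF \<rho>(1) gmul_GLt[OF g(1) u(1)]] dk(2)] dk(2) \<rho>(2)
      by (simp add: algebra_simps)
    have "of_int (2 * (k1 + n)) * pi < snd u1 + pi" "snd u1 + pi < (of_int (2 * (k1 + n)) + 1) * pi"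
      using su1 by (simp_all add: algebra_simps)
    then have "k1 + n = k0 + (1 + s + k + m * int r)"
      using interval_index_eq[OF _ _ gmul_positive_interval[OF g(1) su0 refl] eq] by blast
    then have E: "k - (s + (1 - n)) = (k1 - k0) - m * int r + 2 * (n - 1 - s)"
      by simp
    have "even (k1 - k0)"
      using p(7) r by (meson cong_iff_dvd_diff dvd_trans even_of_nat)
    then have "even (k - (s + (1 - n)))"
      unfolding E using r by simp
    moreover have "1 - n = of_bool (snd a < snd b)"
      using \<open>a \<noteq> b\<close> a(2) b(2) ord by (auto simp: n_def prod_eq_iff)
    ultimately show ?thesis
      by (simp add: s_def xy)
  qed
qed

section \<open>Tangents at the boundary\<close>

lemma oriented_surface_chart:
  assumes "oriented_surface M" "c \<in> atlas M"
  shows "openin (topo M) (fst c)" "openin (top_of_set half_plane) (snd c ` fst c)"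
    "homeomorphic_map (subtopology (topo M) (fst c)) (top_of_set (snd c ` fst c)) (snd c)"
  using assms by (simp_all add: oriented_surface_def)

lemma chart_inj:
  assumes "oriented_surface M" "c \<in> atlas M"
  shows "inj_on (snd c) (fst c)"
proof -
  have "fst c \<subseteq> topspace (topo M)"
    using oriented_surface_chart(1)[OF assms] openin_subset by blast
  then show ?thesis
    using oriented_surface_chart(3)[OF assms] by (auto simp: homeomorphic_map_def quotient_map_def Int_absorb1)
qed

lemma chart_half_plane:
  assumes "oriented_surface M" "c \<in> atlas M" "x \<in> fst c"
  shows "0 \<le> Im (snd c x)"
  using openin_subset[OF oriented_surface_chart(2)[OF assms(1,2)]] assms(3) by auto

text \<open>If a chart placed the point in the open half-plane, the imaginary part of the transition
  map to a chart showing it on the real axis would have an interior minimum. Its derivative would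
  vanish there, against the positive determinant.\<close>

lemma boundary_chart:
  assumes M: "oriented_surface M" and x: "x \<in> boundary M" "x \<in> fst c" and c: "c \<in> atlas M"
  shows "Im (snd c x) = 0"
proof (rule ccontr)
  assume "Im (snd c x) \<noteq> 0"
  then have pos: "Im (snd c x) > 0"
    using chart_half_plane[OF M c x(2)] by simp
  obtain c0 where c0: "c0 \<in> atlas M" "x \<in> fst c0" "Im (snd c0 x) = 0"
    using x(1) by (auto simp: boundary_def)
  define z where "z = snd c x"
  define f where "f = transition c c0"
  define T where "T = snd c ` (fst c \<inter> fst c0)"
  have zT: "z \<in> T"
    using x c0 by (auto simp: T_def z_def)
  have inj: "inj_on (snd c) (fst c)"
    by (rule chart_inj[OF M c])
  have f: "f (snd c y) = snd c0 y" if "y \<in> fst c" for y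
    using that inj by (simp add: f_def transition_def)
  have sub: "fst c \<subseteq> topspace (topo M)"
    using oriented_surface_chart(1)[OF M c] openin_subset by blast
  have "openin (subtopology (topo M) (fst c)) (fst c \<inter> fst c0)"
    using oriented_surface_chart(1)[OF M c0(1)] by (simp add: openin_subtopology_Int2)
  then have "openin (top_of_set (snd c ` fst c)) T"
    using homeomorphic_map_openness_eq[OF oriented_surface_chart(3)[OF M c], of "fst c \<inter> fst c0"] sub
    by (auto simp: T_def)
  then have "openin (top_of_set half_plane) T"
    using oriented_surface_chart(2)[OF M c] openin_trans by blast
  then obtain U where U: "open U" "T = half_plane \<inter> U"
    by (auto simp: openin_open)
  define V where "V = U \<inter> {z. Im z > 0}"
  have V: "open V" "z \<in> V" "V \<subseteq> T"
    using U zT pos by (auto simp: V_def z_def open_halfspace_Im_gt intro!: open_Int)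
  have "smooth_on T f \<and> (\<forall>z\<in>T. 0 < det2 (dtransition c c0 z 1) (dtransition c c0 z \<i>))"
    using M c c0(1) unfolding oriented_surface_def T_def f_def by blast
  then have sm: "smooth_on T f" and det: "0 < det2 (dtransition c c0 z 1) (dtransition c c0 z \<i>)"
    using zT by auto
  define d where "d = dtransition c c0 z"
  have "at z within T = at z"
    using V by (metis at_within_interior interiorI)
  then have d: "(f has_derivative d) (at z)"
    using smooth_on_has_derivative[OF sm zT] by (simp add: d_def dtransition_def f_def T_def)
  have "((\<lambda>w. Im (f w)) has_derivative (\<lambda>v. Im (d v))) (at z)"
    by (intro derivative_intros d)
  moreover have "Im (f z) \<le> Im (f w)" if "w \<in> V" for w
  proof -
    obtain y where y: "y \<in> fst c" "y \<in> fst c0" "w = snd c y"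
      using \<open>w \<in> V\<close> V(3) by (auto simp: T_def)
    have "Im (f z) = 0"
      using f[OF x(2)] c0(3) by (simp add: z_def)
    then show ?thesis
      using f[OF y(1)] y chart_half_plane[OF M c0(1) y(2)] by simp
  qed
  ultimately have "(\<lambda>v. Im (d v)) = (\<lambda>v. 0)"
    using V by (intro differential_zero_maxmin[of z V]) auto
  then have "Im (d 1) = 0" "Im (d \<i>) = 0"
    by metis+
  then have "det2 (d 1) (d \<i>) = 0"
    by (simp add: det2_def)
  then show False
    using det by (simp add: d_def)
qed

text \<open>Along the arc the imaginary part of the chart is constantly 0.\<close>

lemma boundary_push_real:
  assumes M: "oriented_surface M" "smooth_into M S h" "c \<in> atlas M"
    and I: "open I" "\<tau> \<in> I" "\<And>s. s \<in> I \<Longrightarrow> cis s \<in> S \<and> h (cis s) \<in> boundary M" and c: "h (cis \<tau>) \<in> fst c"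
  shows "Im (push S h c (cis \<tau>) (\<i> * cis \<tau>)) = 0"
proof -
  have S: "cis \<tau> \<in> S"
    using I by auto
  note p = push_has_derivative[OF M S c]
  have dc: "(cis has_derivative (\<lambda>x. x *\<^sub>R (\<i> * cis \<tau>))) (at \<tau> within I)"
    by (rule has_derivative_cis[OF has_derivative_ident])
  have "(snd c \<circ> h has_derivative push S h c (cis \<tau>)) (at (cis \<tau>) within cis ` I)"
    by (rule has_derivative_subset[OF p]) (use I in auto)
  from diff_chain_within[OF dc this]
  have "((\<lambda>s. snd c (h (cis s))) has_derivative (\<lambda>x. push S h c (cis \<tau>) (x *\<^sub>R (\<i> * cis \<tau>)))) (at \<tau> within I)"
    by (simp add: o_def)
  then have 1: "((\<lambda>s. Im (snd c (h (cis s)))) has_derivative (\<lambda>x. Im (push S h c (cis \<tau>) (x *\<^sub>R (\<i> * cis \<tau>))))) (at \<tau>)"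
    using at_within_open[OF I(2,1)] by (auto intro: derivative_intros)
  have "continuous_map (top_of_set S) (topo M) h"
    using M(2) by (simp add: smooth_into_def)
  moreover have "continuous_map (top_of_set I) (top_of_set S) cis"
    using I(3) by (auto intro!: continuous_intros)
  ultimately have "continuous_map (top_of_set I) (topo M) (h \<circ> cis)"
    using continuous_map_compose by blast
  then have "openin (top_of_set I) {s \<in> topspace (top_of_set I). (h \<circ> cis) s \<in> fst c}"
    by (rule openin_continuous_map_preimage) (rule oriented_surface_chart(1)[OF M(1,3)])
  then have J: "open {s \<in> I. h (cis s) \<in> fst c}"
    using I(1) by (simp add: openin_open_eq)
  have "((\<lambda>s. Im (snd c (h (cis s)))) has_derivative (\<lambda>x. 0)) (at \<tau>)"
  proof (rule has_derivative_transform_within_open[OF has_derivative_const J])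
    show "0 = Im (snd c (h (cis s)))" if "s \<in> {s \<in> I. h (cis s) \<in> fst c}" for s
      using boundary_chart[OF M(1) _ _ M(3), of "h (cis s)"] I(3) that by auto
  qed (use I c in auto)
  from has_derivative_unique[OF 1 this] show ?thesis
    by (metis scaleR_one)
qed

text \<open>The imaginary part of the chart vanishes at \<open>z\<close> and is nonnegative along
  the segment, so its one-sided derivative cannot be negative.\<close>

lemma boundary_push_inward:
  assumes M: "oriented_surface M" "smooth_into M S h" "c \<in> atlas M"
    and z: "z \<in> S" "h z \<in> boundary M" "h z \<in> fst c" and \<epsilon>: "\<epsilon> > 0"
    and seg: "\<And>s. 0 \<le> s \<Longrightarrow> s \<le> \<epsilon> \<Longrightarrow> z + s *\<^sub>R w \<in> S"
  shows "0 \<le> Im (push S h c z w)"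
proof (rule ccontr)
  assume neg: "\<not> 0 \<le> Im (push S h c z w)"
  define l where "l = (\<lambda>s::real. z + s *\<^sub>R w)"
  have "(l has_derivative (\<lambda>x. x *\<^sub>R w)) (at 0 within {0..\<epsilon>})"
    unfolding l_def by (auto intro!: derivative_eq_intros)
  moreover have "(snd c \<circ> h has_derivative push S h c z) (at (l 0) within l ` {0..\<epsilon>})"
    by (rule has_derivative_subset[of _ _ _ S]) (use push_has_derivative[OF M z(1,3)] seg in \<open>auto simp: l_def\<close>)
  ultimately have "(snd c \<circ> h \<circ> l has_derivative push S h c z \<circ> (\<lambda>x. x *\<^sub>R w)) (at 0 within {0..\<epsilon>})"
    by (rule diff_chain_within)
  then have "((\<lambda>s. Im (snd c (h (l s)))) has_derivative (\<lambda>x. Im (push S h c z (x *\<^sub>R w)))) (at 0 within {0..\<epsilon>})"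
    by (auto simp: o_def intro: derivative_intros)
  moreover have "(\<lambda>x. Im (push S h c z (x *\<^sub>R w))) = (\<lambda>x. Im (push S h c z w) * x)"
    by (simp add: linear_cmul[OF push_linear[OF M z(1,3)]] mult.commute)
  ultimately have "((\<lambda>s. Im (snd c (h (l s)))) has_real_derivative Im (push S h c z w)) (at 0 within {0..\<epsilon>})"
    by (simp add: has_field_derivative_def)
  then obtain d where d: "d > 0" "\<And>s. s > 0 \<Longrightarrow> 0 + s \<in> {0..\<epsilon>} \<Longrightarrow> s < d \<Longrightarrow>
      Im (snd c (h (l (0 + s)))) < Im (snd c (h (l 0)))"
    using has_real_derivative_neg_dec_right neg by (metis not_le)
  have "Im (snd c (h (l 0))) = 0"
    using boundary_chart[OF M(1) z(2,3) M(3)] by (simp add: l_def)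
  have "continuous_map (top_of_set S) (topo M) h"
    using M(2) by (simp add: smooth_into_def)
  moreover have "continuous_map (top_of_set {0..\<epsilon>}) (top_of_set S) l"
    using seg by (auto simp: l_def intro!: continuous_intros)
  ultimately have "continuous_map (top_of_set {0..\<epsilon>}) (topo M) (h \<circ> l)"
    using continuous_map_compose by blast
  then have "openin (top_of_set {0..\<epsilon>}) {s \<in> topspace (top_of_set {0..\<epsilon>}). (h \<circ> l) s \<in> fst c}"
    by (rule openin_continuous_map_preimage) (rule oriented_surface_chart(1)[OF M(1,3)])
  then obtain U where U: "open U" "{s \<in> topspace (top_of_set {0..\<epsilon>}). (h \<circ> l) s \<in> fst c} = {0..\<epsilon>} \<inter> U"
    unfolding openin_open by blast
  have mem: "s \<in> {0..\<epsilon>} \<and> h (l s) \<in> fst c \<longleftrightarrow> s \<in> {0..\<epsilon>} \<inter> U" for s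
    using arg_cong[OF U(2), of "\<lambda>X. s \<in> X"] by simp
  have "0 \<in> U"
    using mem[of 0] z(3) \<epsilon> by (simp add: l_def)
  then obtain e where "e > 0" "ball 0 e \<subseteq> U"
    using U(1) openE by blast
  then have e: "e > 0" "\<And>s. s \<in> {0..\<epsilon>} \<Longrightarrow> dist s 0 < e \<Longrightarrow> h (l s) \<in> fst c"
  proof -
    show "h (l s) \<in> fst c" if "s \<in> {0..\<epsilon>}" "dist s 0 < e" for s
    proof -
      have "s \<in> U"
        using \<open>ball 0 e \<subseteq> U\<close> that(2) by (auto simp: dist_commute)
      then show ?thesis
        using mem[of s] that(1) by simp
    qed
  qed
  define s where "s = min (min (d / 2) (e / 2)) \<epsilon>"
  have s: "s > 0" "s \<le> \<epsilon>" "s < d" "s < e"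
    using d(1) e(1) \<epsilon> by (auto simp: s_def)
  have "Im (snd c (h (l s))) < 0"
    using d(2)[of s] s \<open>Im (snd c (h (l 0))) = 0\<close> by simp
  moreover have "0 \<le> Im (snd c (h (l s)))"
    by (rule chart_half_plane[OF M(1,3)]) (use e(2)[of s] s in auto)
  ultimately show False by simp
qed

lemma push_det2_rotate:
  assumes M: "oriented_surface M" "smooth_into M S h" "c \<in> atlas M" "z \<in> S" "h z \<in> fst c"
    and o: "orientation_preserving M S h" and w: "norm w = 1"
  shows "0 < det2 (push S h c z w) (push S h c z (\<i> * w))"
proof -
  have "0 < det2 (push S h c z 1) (push S h c z \<i>)"
    using o M by (auto simp: orientation_preserving_def)
  moreover have "det2 w (\<i> * w) = (norm w)\<^sup>2"
    unfolding cmod_power2 by (simp add: det2_def power2_eq_square)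
  ultimately show ?thesis
    using det2_mmul[of "(push S h c z 1, push S h c z \<i>)" "(w, \<i> * w)"] w
    by (simp add: mmul_def flip: push_eq_mapply[OF M])
qed

lemma push_inj:
  assumes M: "oriented_surface M" "smooth_into M S h" "c \<in> atlas M" "z \<in> S" "h z \<in> fst c"
    and o: "orientation_preserving M S h" and eq: "push S h c z v = push S h c z w"
  shows "v = w"
proof (rule mapply_inj)
  show "0 < det2 (fst (push S h c z 1, push S h c z \<i>)) (snd (push S h c z 1, push S h c z \<i>))"
    using o M by (auto simp: orientation_preserving_def)
  show "mapply (push S h c z 1, push S h c z \<i>) v = mapply (push S h c z 1, push S h c z \<i>) w"
    using eq unfolding push_eq_mapply[OF M, of v] push_eq_mapply[OF M, of w] .
qed


section \<open>Boundary tangents of collars and polygons\<close>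

lemma boundary_parametrisation_D:
  assumes "boundary_parametrisation r M"
  shows "bij_betw (\<lambda>j. bpar M j ` sphere 0 1) {1..nin M} (connected_components_of (subtopology (topo M) (boundary M)))"
    and "j \<in> {1..nin M} \<Longrightarrow> \<exists>W. open W \<and> 0 \<notin> W \<and> sphere 0 1 \<subseteq> W \<and> collar M j = W \<inter> {z. 1 \<le> norm z}"
    and "j \<in> {1..nin M} \<Longrightarrow> smooth_into M (collar M j) (bpar M j)"
    and "j \<in> {1..nin M} \<Longrightarrow> orientation_preserving M (collar M j) (bpar M j)"
    and "j \<in> {1..nin M} \<Longrightarrow> rspin_morphism M (collar M j) (lam M j) (bpar M j) (blift M j)"
  using assms by (simp_all add: boundary_parametrisation_def)

lemma boundary_circle_subset:
  assumes "boundary_parametrisation r M" "j \<in> {1..nin M}"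
  shows "bpar M j ` sphere 0 1 \<subseteq> boundary M"
proof -
  have "bpar M j ` sphere 0 1 \<in> connected_components_of (subtopology (topo M) (boundary M))"
    using boundary_parametrisation_D(1)[OF assms(1)] assms(2) by (auto simp: bij_betw_def)
  then have "bpar M j ` sphere 0 1 \<subseteq> topspace (subtopology (topo M) (boundary M))"
    by (rule connected_components_of_subset)
  then show ?thesis by auto
qed

text \<open>The vector 1 points into the collar and is sent to the closed upper half-plane; since
  the parametrisation preserves orientation, \<open>\<i>\<close> is sent to the negative real
  direction.\<close>

lemma collar_tangent_positive:
  assumes M: "rspin r M" and j: "j \<in> {1..nin M}" and c: "c \<in> atlas M" "bpar M j 1 \<in> fst c"
  shows "1 \<in> collar M j" "Im (push (collar M j) (bpar M j) c 1 (- \<i>)) = 0" "0 < Re (push (collar M j) (bpar M j) c 1 (- \<i>))"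
proof -
  note os = rspin_D(1)[OF M] and bp = rspin_D(4)[OF M]
  define S h where "S = collar M j" and "h = bpar M j"
  obtain W where W: "open W" "sphere 0 1 \<subseteq> W" "S = W \<inter> {z. 1 \<le> norm z}"
    using boundary_parametrisation_D(2)[OF bp j] by (auto simp: S_def)
  note si = boundary_parametrisation_D(3)[OF bp j, folded S_def h_def]
  note op = boundary_parametrisation_D(4)[OF bp j, folded S_def h_def]
  have bd: "h z \<in> boundary M" if "norm z = 1" for z
    using boundary_circle_subset[OF bp j] that by (auto simp: h_def)
  have inS: "z \<in> S" if "norm z = 1" for z
    using W that by auto
  show "1 \<in> collar M j"
    using inS[of 1] by (simp add: S_def)
  have c1: "h (cis 0) \<in> fst c"
    using c by (simp add: h_def)
  have "Im (push S h c (cis 0) (\<i> * cis 0)) = 0"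
    by (rule boundary_push_real[OF os si c(1) open_UNIV _ _ c1]) (use bd inS in auto)
  then have i0: "Im (push S h c 1 \<i>) = 0"
    by simp
  have "1 \<in> W"
    using W(2) by auto
  then obtain e where e: "e > 0" "ball 1 e \<subseteq> W"
    using W(1) openE by blast
  have "0 \<le> Im (push S h c 1 1)"
  proof (rule boundary_push_inward[OF os si c(1), where \<epsilon> = "e / 2"])
    show "1 + s *\<^sub>R 1 \<in> S" if "0 \<le> s" "s \<le> e / 2" for s
    proof -
      have n: "1 + s *\<^sub>R 1 = complex_of_real (1 + s)"
        by (simp add: scaleR_conv_of_real)
      have "dist (1::complex) (complex_of_real (1 + s)) = s"
        using that(1) by (simp add: dist_norm norm_minus_commute)
      then have "complex_of_real (1 + s) \<in> W"
        using e that by (intro subsetD[OF e(2)]) auto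
      moreover have "norm (complex_of_real (1 + s)) = 1 + s"
        using that(1) by (subst norm_of_real) simp
      ultimately show ?thesis
        unfolding n W(3) using that by simp
    qed
  qed (use bd inS c1 e in auto)
  moreover have d: "0 < det2 (push S h c 1 1) (push S h c 1 (\<i> * 1))"
    by (rule push_det2_rotate[OF os si c(1) _ _ op]) (use inS c1 in auto)
  ultimately have "Re (push S h c 1 \<i>) < 0"
    using i0 by (simp add: det2_def mult_less_0_iff zero_less_mult_iff)
  moreover have "push S h c 1 (- \<i>) = - push S h c 1 \<i>"
    by (rule linear_neg[OF push_linear[OF os si c(1)]]) (use inS c1 in auto)
  ultimately show "Im (push (collar M j) (bpar M j) c 1 (- \<i>)) = 0" "0 < Re (push (collar M j) (bpar M j) c 1 (- \<i>))"
    using i0 by (simp_all add: S_def h_def)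
qed

lemma open_side_arc: "open (side_arc D x)"
  by (cases x) (simp add: side_arc_def)

text \<open>The same argument with the inward normal \<open>- cis \<tau>\<close>. Hence the
  counter-clockwise tangent of a boundary side and the clockwise tangent of the collar are positive
  multiples of each other.\<close>

lemma face_tangent_positive:
  assumes M: "rspin r M" and pl: "plcw M D" and x: "x \<in> sides D" "\<tau> \<in> side_arc D x"
    and e: "emap D (side_edge D x) ` {0..1} \<subseteq> boundary M"
    and c: "c \<in> atlas M" "fmap D (fst x) (cis \<tau>) \<in> fst c"
  defines "p \<equiv> push (punctured_face D (fst x)) (fmap D (fst x)) c (cis \<tau>) (\<i> * cis \<tau>)"
  shows "Im p = 0" "0 < Re p"
proof -
  note os = rspin_D(1)[OF M]
  define S h where "S = punctured_face D (fst x)" and "h = fmap D (fst x)"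
  have f: "fst x \<in> faces D"
    by (rule side_face[OF x(1)])
  have cells: "plcw_cells M D" "plcw_gluing M D"
    using pl by (simp_all add: plcw_def)
  have si: "smooth_into M S h" and op: "orientation_preserving M S h"
    using cells(1) f by (simp_all add: plcw_cells_def S_def h_def)
  have bd: "h (cis s) \<in> boundary M" if s: "s \<in> side_arc D x" for s
  proof -
    obtain k where k: "k ` side_arc D x = {0<..<1}"
      "\<And>\<tau>. \<tau> \<in> side_arc D x \<Longrightarrow> fmap D (fst x) (cis \<tau>) = emap D (side_edge D x) (k \<tau>)"
      by (rule side_glue[OF cells(2) x(1)]) (rule that)
    have "k s \<in> {0..1}"
      using k(1) s by (metis greaterThanLessThan_subseteq_atLeastAtMost_iff image_eqI order_refl subsetD)
    then show ?thesis
      using e k(2)[OF s] by (auto simp: h_def)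
  qed
  have inS: "cis s \<in> S" if "s \<in> side_arc D x" for s
    using side_arc_punctured_face[OF x(1) that] by (simp add: S_def)
  have c1: "h (cis \<tau>) \<in> fst c"
    using c by (simp add: h_def)
  have i0: "Im (push S h c (cis \<tau>) (\<i> * cis \<tau>)) = 0"
    by (rule boundary_push_real[OF os si c(1) open_side_arc x(2) _ c1]) (use bd inS in auto)
  have "0 \<le> Im (push S h c (cis \<tau>) (- cis \<tau>))"
  proof (rule boundary_push_inward[OF os si c(1), where \<epsilon> = "1"])
    show "cis \<tau> + s *\<^sub>R (- cis \<tau>) \<in> S" if "0 \<le> s" "s \<le> 1" for s
    proof (cases "s = 0")
      case False
      have "cis \<tau> + s *\<^sub>R (- cis \<tau>) = (1 - s) *\<^sub>R cis \<tau>"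
        by (simp add: algebra_simps)
      then have "norm (cis \<tau> + s *\<^sub>R (- cis \<tau>)) < 1"
        using False that by simp
      then show ?thesis
        using punctured_face_ball[of D "fst x"] by (auto simp: S_def)
    qed (use inS x in simp)
  qed (use bd inS c1 x in auto)
  moreover have "push S h c (cis \<tau>) (- cis \<tau>) = - push S h c (cis \<tau>) (cis \<tau>)"
    by (rule linear_neg[OF push_linear[OF os si c(1)]]) (use inS c1 x in auto)
  moreover have "0 < det2 (push S h c (cis \<tau>) (cis \<tau>)) (push S h c (cis \<tau>) (\<i> * cis \<tau>))"
    by (rule push_det2_rotate[OF os si c(1) _ _ op]) (use inS c1 x in auto)
  ultimately have "0 < Re (push S h c (cis \<tau>) (\<i> * cis \<tau>))"
    using i0 by (simp add: det2_def mult_less_0_iff zero_less_mult_iff)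
  then show "Im p = 0" "0 < Re p"
    using i0 by (simp_all add: p_def S_def h_def)
qed

section \<open>Holonomies of arcs between boundary components\<close>

lemma plcw_D:
  assumes "plcw M D"
  shows "plcw_cells M D" "plcw_gluing M D"
    "j \<in> {1..nin M} \<Longrightarrow> \<exists>e\<in>edges D. emap D e ` {0..1} = bpar M j ` sphere 0 1 \<and>
        emap D e 0 = emap D e 1 \<and> emap D e 0 \<noteq> bpar M j 1"
  using assms by (simp_all add: plcw_def)

lemma plcw_cells_D:
  assumes "plcw_cells M D"
  shows "finite (faces D)" "finite (edges D)"
    "f \<in> faces D \<Longrightarrow> 1 \<le> nsides D f"
    "f \<in> faces D \<Longrightarrow> continuous_map (top_of_set (cball 0 1)) (topo M) (fmap D f)"
    "e \<in> edges D \<Longrightarrow> continuous_map (top_of_set {0..1}) (topo M) (emap D e)"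
    "e \<in> edges D \<Longrightarrow> inj_on (emap D e) {0<..<1}"
    "disjoint_family_on (\<lambda>f. fmap D f ` ball 0 1) (faces D)"
    "disjoint_family_on (\<lambda>e. emap D e ` {0<..<1}) (edges D)"
    "(\<Union>f\<in>faces D. fmap D f ` ball 0 1) \<union> (\<Union>e\<in>edges D. emap D e ` {0<..<1}) \<union> verts D = topspace (topo M)"
    "(\<Union>f\<in>faces D. fmap D f ` ball 0 1) \<inter> (\<Union>e\<in>edges D. emap D e ` {0<..<1}) = {}"
    "(\<Union>f\<in>faces D. fmap D f ` ball 0 1) \<inter> verts D = {}"
    "(\<Union>e\<in>edges D. emap D e ` {0<..<1}) \<inter> verts D = {}"
  using assms unfolding plcw_cells_def Let_def by simp_all

lemma edge_ends_in_verts: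
  assumes "e \<in> edges D"
  shows "emap D e 0 \<in> verts D" "emap D e 1 \<in> verts D"
  using assms by (auto simp: verts_def)

lemma edge_interior_not_vert:
  assumes "plcw_cells M D" "e \<in> edges D" "s \<in> {0<..<1}"
  shows "emap D e s \<notin> verts D"
proof -
  have "emap D e s \<in> (\<Union>e\<in>edges D. emap D e ` {0<..<1})"
    using assms(2,3) by blast
  then show ?thesis
    using plcw_cells_D(12)[OF assms(1)] by blast
qed

lemma edge_interior_unique:
  assumes "plcw_cells M D" "e \<in> edges D" "s \<in> {0<..<1}" "e' \<in> edges D" "emap D e s \<in> emap D e' ` {0..1}"
  shows "e = e'"
proof (rule ccontr)
  assume "e \<noteq> e'"
  obtain t where t: "t \<in> {0..1}" "emap D e s = emap D e' t"
    using assms(5) by blast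
  show False
  proof (cases "t = 0 \<or> t = 1")
    case True
    then have "emap D e s \<in> verts D"
      using t(2) edge_ends_in_verts[OF assms(4)] by auto
    then show False
      using edge_interior_not_vert[OF assms(1-3)] by simp
  next
    case False
    then have "t \<in> {0<..<1}"
      using t(1) by auto
    then have "emap D e s \<in> emap D e' ` {0<..<1}"
      unfolding t(2) by (rule imageI)
    then have "emap D e s \<in> emap D e ` {0<..<1} \<inter> emap D e' ` {0<..<1}"
      using assms(3) by blast
    then show False
      using disjoint_family_onD[OF plcw_cells_D(8)[OF assms(1)] assms(2,4) \<open>e \<noteq> e'\<close>] by blast
  qed
qed

lemma edge_eqI:
  assumes "plcw_cells M D" "e \<in> edges D" "e' \<in> edges D" "emap D e ` {0..1} = emap D e' ` {0..1}"
  shows "e = e'"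
proof (rule edge_interior_unique[OF assms(1,2) _ assms(3), of "1 / 2"])
  have "emap D e (1 / 2) \<in> emap D e ` {0..1}"
    by (rule imageI) simp
  then show "emap D e (1 / 2) \<in> emap D e' ` {0..1}"
    unfolding assms(4) .
qed simp

lemma bedge_D:
  assumes "plcw M D" "j \<in> {1..nin M}"
  shows "bedge M D j \<in> edges D" "emap D (bedge M D j) ` {0..1} = bpar M j ` sphere 0 1"
    "emap D (bedge M D j) 0 = emap D (bedge M D j) 1"
proof -
  obtain e where e: "e \<in> edges D" "emap D e ` {0..1} = bpar M j ` sphere 0 1" "emap D e 0 = emap D e 1"
    using plcw_D(3)[OF assms] by blast
  have "bedge M D j = e"
    unfolding bedge_def
    by (rule the_equality) (use e edge_eqI[OF plcw_D(1)[OF assms(1)]] in auto)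
  with e show "bedge M D j \<in> edges D" "emap D (bedge M D j) ` {0..1} = bpar M j ` sphere 0 1"
    "emap D (bedge M D j) 0 = emap D (bedge M D j) 1"
    by simp_all
qed

lemma edge_attached_cases:
  assumes "plcw_gluing M D" "e \<in> edges D"
  shows "inner_edge D e \<and> emap D e ` {0<..<1} \<inter> boundary M = {} \<or>
        (e, True) \<in> attached D \<and> (e, False) \<notin> attached D \<and> emap D e ` {0..1} \<subseteq> boundary M"
  using bspec[OF conjunct2[OF conjunct2[OF assms(1)[unfolded plcw_gluing_def]]] assms(2)] .

lemma bedge_attached:
  assumes "rspin r M" "plcw M D" "j \<in> {1..nin M}"
  shows "emap D (bedge M D j) ` {0..1} \<subseteq> boundary M"
    "(bedge M D j, True) \<in> attached D" "(bedge M D j, False) \<notin> attached D" "\<not> inner_edge D (bedge M D j)"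
proof -
  let ?e = "bedge M D j"
  show b: "emap D ?e ` {0..1} \<subseteq> boundary M"
    using bedge_D(2)[OF assms(2,3)] boundary_circle_subset[OF rspin_D(4)[OF assms(1)] assms(3)] by simp
  have "emap D ?e (1 / 2) \<in> emap D ?e ` {0<..<1}"
    by (rule imageI) simp
  moreover have "emap D ?e (1 / 2) \<in> boundary M"
    using b by auto
  ultimately have "emap D ?e ` {0<..<1} \<inter> boundary M \<noteq> {}"
    by blast
  then show "(?e, True) \<in> attached D" "(?e, False) \<notin> attached D"
    using edge_attached_cases[OF plcw_D(2)[OF assms(2)] bedge_D(1)[OF assms(2,3)]] by auto
  then show "\<not> inner_edge D ?e"
    by (simp add: inner_edge_def)
qed

lemma bedge_side_dir:
  assumes "rspin r M" "plcw M D" "j \<in> {1..nin M}" "x \<in> sides D" "side_edge D x = bedge M D j"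
  shows "side_dir D x"
proof (rule ccontr)
  assume "\<not> side_dir D x"
  then have "side_label D x = (bedge M D j, False)"
    using assms(5) by (simp add: side_label_def)
  then have "(bedge M D j, False) \<in> attached D"
    using assms(4) by (metis attached_def imageI)
  then show False
    using bedge_attached(3)[OF assms(1-3)] by simp
qed

lemma two_pi_int_less_iff: "2 * pi * of_int a < 2 * pi * of_int b \<longleftrightarrow> a < b"
  by simp

lemma positive_real_eq_scale:
  assumes "Im a = 0" "0 < Re a" "Im b = 0" "0 < Re b"
  shows "a = of_real (Re a / Re b) * b"
  using assms by (simp add: complex_eq_iff)

text \<open>The end directions are tangent to the boundary, so the angles are known exactly and not
  only up to strips. At each end the comparison of face and collar relates edge index, collar angle
  and face angle modulo \<open>r\<close>; the difference of the two relations eliminates the initial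
  collar angle \<open>m\<close> and leaves \<open>k\<close>.\<close>

lemma arc_holonomy_parity:
  fixes M :: "('p, 'q) rspin_surface"
  assumes r: "even r" and M: "rspin r M" and pres: "presents r M D"
    and i: "i \<in> {1..nin M}" and j: "j \<in> {1..nin M}"
    and pc: "polygon_curve D f (bedge M D i) (bedge M D j) \<eta> \<gamma>" and hol: "arc_holonomy M i j \<gamma> k"
    and x: "x \<in> sides D" "side_edge D x = bedge M D i"
    and y: "y \<in> sides D" "side_edge D y = bedge M D j"
    and xy: "x \<noteq> y"
  shows "even (k - (eidx D (bedge M D i) - eidx D (bedge M D j) + of_bool (snd y < snd x)))"
proof -
  note pb = rspin_D(2)[OF M] and os = rspin_D(1)[OF M] and bp = rspin_D(4)[OF M]
  note pl = presents_D(3)[OF pres]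
  note gl = presents_D(2)[OF pres]
  have sm: "smooth_on {0..1} \<eta>" and inj: "inj_on \<eta> {0..1}" and ball: "\<eta> ` {0<..<1} \<subseteq> ball 0 1"
    and nz: "\<And>t. t \<in> {0..1} \<Longrightarrow> vector_derivative \<eta> (at t within {0..1}) \<noteq> 0"
    and \<gamma>: "\<And>t. t \<in> {0..1} \<Longrightarrow> \<gamma> t = fmap D f (\<eta> t)"
    using pc unfolding polygon_curve_def by blast+
  obtain a \<tau> where a: "a \<in> sides D" "fst a = f" "side_edge D a = bedge M D i" "\<tau> \<in> side_arc D a" "\<eta> 0 = cis \<tau>"
    using pc unfolding polygon_curve_def by blast
  obtain b \<tau>' where b: "b \<in> sides D" "fst b = f" "side_edge D b = bedge M D j" "\<tau>' \<in> side_arc D b" "\<eta> 1 = cis \<tau>'"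
    using pc unfolding polygon_curve_def by blast
  have ab: "x = a" "y = b"
    using side_label_inj[OF gl x(1) a(1)] side_label_inj[OF gl y(1) b(1)] x y a b
      bedge_side_dir[OF M pl i] bedge_side_dir[OF M pl j] by simp_all
  have ord: "\<tau>' < \<tau> \<longleftrightarrow> snd b < snd a"
    using side_arc_less_iff[of f "snd b" D "snd a" \<tau>' \<tau>] a b xy ab by (metis prod.collapse)
  have f: "f \<in> faces D"
    using side_face[OF a(1)] a(2) by simp
  obtain \<Psi> where \<Psi>: "\<forall>f\<in>faces D. rspin_morphism M (punctured_face D f) 0 (fmap D f) (\<Psi> f)"
    and al0: "\<forall>j\<in>{1..nin M}. \<forall>x\<in>sides D. \<forall>\<tau>\<in>side_arc D x.
           side_edge D x = bedge M D j \<and> fmap D (fst x) (cis \<tau>) = bpar M j 1 \<longrightarrow>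
           aligned M
             (act M (side_lift \<Psi> (fst x) \<tau>) (rot (pi + 2 * pi * of_int (eidx D (bedge M D j)))))
             (blift M j (rot (pi / 2), 1))"
    using pres unfolding presents_def by (elim conjE exE) (rule that)
  note al = al0[rule_format]
  define S where "S = punctured_face D f"
  have \<Psi>f: "rspin_morphism M S 0 (fmap D f) (\<Psi> f)"
    using bspec[OF \<Psi> f] by (simp add: S_def)
  have si: "smooth_into M S (fmap D f)" and op: "orientation_preserving M S (fmap D f)"
    using presents_D(1)[OF pres] f by (simp_all add: plcw_cells_def S_def)
  have S01: "cis \<tau> \<in> S" "cis \<tau>' \<in> S"
    using side_arc_punctured_face[OF a(1,4)] side_arc_punctured_face[OF b(1,4)] a(2) b(2) by (auto simp: S_def)
  have \<eta>S: "\<eta> ` {0..1} \<subseteq> S"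
  proof
    fix z assume "z \<in> \<eta> ` {0..1}"
    then obtain t where "t \<in> {0..1}" "z = \<eta> t" by blast
    then have "z \<in> \<eta> ` {0<..<1} \<or> z = \<eta> 0 \<or> z = \<eta> 1"
      by (cases "t = 0 \<or> t = 1") auto
    then show "z \<in> S"
      using ball punctured_face_ball[of D f] S01 a(5) b(5) by (auto simp: S_def)
  qed
  define n :: int where "n = of_bool (\<tau>' < \<tau>)"
  obtain \<theta> where \<theta>: "continuous_on {0..1} \<theta>"
    "\<And>t. t \<in> {0..1} \<Longrightarrow> \<exists>c>0. vector_derivative \<eta> (at t within {0..1}) = of_real c * cis (\<theta> t)"
    "\<theta> 0 \<in> {\<tau> + pi / 2 .. \<tau> + 3 * pi / 2}"
    "\<theta> 1 - 2 * pi * of_bool (\<tau>' < \<tau>) \<in> {\<tau>' - pi / 2 .. \<tau>' + pi / 2}"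
    using turning_of_chordal_arc[OF sm inj nz ball a(5) b(5) side_arc_bounds[OF a(1,4)] side_arc_bounds[OF b(1,4)]]
    by blast
  have H: "immersed_curve M \<gamma> \<and> \<gamma> 0 = bpar M i 1 \<and> \<gamma> 1 = bpar M j 1 \<and>
     (\<forall>c\<in>atlas M. \<gamma> 0 \<in> fst c \<longrightarrow> velocity \<gamma> c 0 = push (collar M i) (bpar M i) c 1 (- \<i>)) \<and>
     (\<forall>c\<in>atlas M. \<gamma> 1 \<in> fst c \<longrightarrow> velocity \<gamma> c 1 = push (collar M j) (bpar M j) c 1 (- \<i>)) \<and>
     (\<exists>\<Gamma>. tangent_lift M \<gamma> \<Gamma> \<and>
        (\<exists>g\<in>GLt. \<Gamma> 0 = blift M i (g, 1) \<and> \<Gamma> 1 = blift M j (gmul g (deck k), 1)))"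
    using hol unfolding arc_holonomy_def .
  then obtain \<Gamma> g where \<Gamma>: "tangent_lift M \<gamma> \<Gamma>" "g \<in> GLt" "\<Gamma> 0 = blift M i (g, 1)" "\<Gamma> 1 = blift M j (gmul g (deck k), 1)"
    by blast
  \<comment> \<open>In a chart both boundary tangents are positive real. Injectivity of the
    derivative of the face map then makes the velocity in the polygon a positive multiple of
    \<open>\<i> * cis \<sigma>\<close>.\<close>
  have tang: "cis (\<theta> t) = \<i> * cis \<sigma>"
    if t: "t \<in> {0, 1}" and w: "w \<in> sides D" "fst w = f" "side_edge D w = bedge M D l" "\<sigma> \<in> side_arc D w" "\<eta> t = cis \<sigma>"
      and l: "l \<in> {1..nin M}" "\<gamma> t = bpar M l 1"
      and vel: "\<forall>c\<in>atlas M. \<gamma> t \<in> fst c \<longrightarrow> velocity \<gamma> c t = push (collar M l) (bpar M l) c 1 (- \<i>)" for t w l \<sigma>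
  proof -
    have t1: "t \<in> {0..1}" using t by auto
    have eq: "fmap D f (cis \<sigma>) = bpar M l 1"
      using \<gamma>[OF t1] l(2) w(5) by simp
    have "fmap D f (cis \<sigma>) \<in> boundary M"
      unfolding eq using boundary_circle_subset[OF bp l(1)] by auto
    then obtain c where c: "c \<in> atlas M" "fmap D f (cis \<sigma>) \<in> fst c"
      by (auto simp: boundary_def)
    have S: "cis \<sigma> \<in> S"
      using side_arc_punctured_face[OF w(1,4)] w(2) by (simp add: S_def)
    define P where "P = push S (fmap D f) c (cis \<sigma>)"
    define V where "V = push (collar M l) (bpar M l) c 1 (- \<i>)"
    have V: "Im V = 0" "0 < Re V"
      unfolding V_def using collar_tangent_positive[OF M l(1) c(1)] c(2) eq by simp_all
    have T: "Im (P (\<i> * cis \<sigma>)) = 0" "0 < Re (P (\<i> * cis \<sigma>))"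
      using face_tangent_positive[OF M pl w(1,4) _ c(1)] bedge_attached(1)[OF M pl l(1)] w(2,3) c(2)
      by (simp_all add: P_def S_def)
    define \<rho> where "\<rho> = Re V / Re (P (\<i> * cis \<sigma>))"
    have \<rho>: "\<rho> > 0" "V = of_real \<rho> * P (\<i> * cis \<sigma>)"
      using positive_real_eq_scale[OF V T] V T by (auto simp: \<rho>_def)
    have "V = velocity \<gamma> c t"
      using vel c eq l(2) by (simp add: V_def)
    also have "\<dots> = P (vector_derivative \<eta> (at t within {0..1}))"
      using velocity_comp[OF os si c(1) sm \<eta>S t1 _ \<gamma>] c(2) w(5) by (simp add: P_def)
    finally have "P (vector_derivative \<eta> (at t within {0..1})) = \<rho> *\<^sub>R P (\<i> * cis \<sigma>)"
      using \<rho>(2) by (simp add: scaleR_conv_of_real)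
    also have "\<dots> = P (\<rho> *\<^sub>R (\<i> * cis \<sigma>))"
      unfolding P_def by (rule linear_cmul[OF push_linear[OF os si c(1) S c(2)], symmetric])
    finally have "vector_derivative \<eta> (at t within {0..1}) = \<rho> *\<^sub>R (\<i> * cis \<sigma>)"
      unfolding P_def by (rule push_inj[OF os si c(1) S c(2) op])
    moreover obtain d where "d > 0" "vector_derivative \<eta> (at t within {0..1}) = of_real d * cis (\<theta> t)"
      using \<theta>(2)[OF t1] by blast
    ultimately have d: "d > 0" "of_real d * cis (\<theta> t) = of_real \<rho> * (\<i> * cis \<sigma>)"
      by (auto simp: scaleR_conv_of_real)
    have "norm (of_real d * cis (\<theta> t)) = norm (of_real \<rho> * (\<i> * cis \<sigma>))"
      unfolding d(2) ..
    then have "d = \<rho>"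
      using d(1) \<rho>(1) by (simp add: norm_mult)
    then show ?thesis
      using d \<rho>(1) by simp
  qed
  have icis: "\<i> * cis s = cis (s + pi / 2)" for s
    by (simp add: mult.commute flip: cis_mult)
  \<comment> \<open>The tangential direction is the left end point of the closed interval; its
    translates by multiples of 2\<pi> lie outside.\<close>
  have \<theta>0: "\<theta> 0 = \<tau> + pi / 2"
  proof -
    have "cis (\<theta> 0) = cis (\<tau> + pi / 2)"
      unfolding icis[symmetric] by (rule tang[OF _ a i]) (use H in auto)
    then obtain m :: int where m: "\<theta> 0 = \<tau> + pi / 2 + 2 * pi * of_int m"
      unfolding cis_eq_iff by blast
    then have "0 \<le> 2 * pi * of_int m" "2 * pi * of_int m \<le> pi"
      using \<theta>(3) by auto
    then have "m < 1" "-1 < m"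
      using two_pi_int_less_iff[of m 1] two_pi_int_less_iff[of "-1" m] pi_gt_zero by auto
    then have "m = 0" by simp
    then show ?thesis using m by simp
  qed
  have n2: "2 * pi * of_bool (\<tau>' < \<tau>) = 2 * pi * of_int n"
    by (simp add: n_def)
  have \<theta>1: "\<theta> 1 = \<tau>' + pi / 2 + 2 * pi * of_int n"
  proof -
    have "cis (\<theta> 1) = cis (\<tau>' + pi / 2)"
      unfolding icis[symmetric] by (rule tang[OF _ b j]) (use H in auto)
    then obtain m :: int where m: "\<theta> 1 = \<tau>' + pi / 2 + 2 * pi * of_int m"
      unfolding cis_eq_iff by blast
    have "- pi \<le> 2 * pi * of_int m - 2 * pi * of_int n" "2 * pi * of_int m - 2 * pi * of_int n \<le> 0"
      using \<theta>(4) unfolding m n2 atLeastAtMost_iff by linarith+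
    then have "- pi \<le> 2 * pi * of_int (m - n)" "2 * pi * of_int (m - n) \<le> 0"
      by (simp_all add: algebra_simps)
    then have "m - n < 1" "-1 < m - n"
      using two_pi_int_less_iff[of "m - n" 1] two_pi_int_less_iff[of "-1" "m - n"] pi_gt_zero by linarith+
    then have "m = n" by simp
    then show ?thesis using m by simp
  qed
  obtain p0 p1 and k0 k1 :: int where p: "p0 \<in> GLt" "p1 \<in> GLt"
    "\<Gamma> 0 = \<Psi> f (p0, \<eta> 0)" "\<Gamma> 1 = \<Psi> f (p1, \<eta> 1)" "snd p0 = \<theta> 0 + 2 * pi * of_int k0"
    "snd p1 = \<theta> 1 + 2 * pi * of_int k1" "[k1 = k0] (mod int r)"
    using tangent_lift_angle[OF M si \<Psi>f sm \<eta>S \<theta>(1,2) \<Gamma>(1) \<gamma>] by blast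
  \<comment> \<open>Over the base point the first vector is read in the collar, where the tangent of
    the curve is \<open>- \<i>\<close>.\<close>
  have g: "fst (fst g) = - \<i>"
  proof -
    obtain c where c: "c \<in> atlas M" "bpar M i 1 \<in> fst c"
    proof -
      have "bpar M i 1 \<in> boundary M"
        using boundary_circle_subset[OF bp i] by auto
      then show ?thesis
        using that by (auto simp: boundary_def)
    qed
    note c1 = collar_tangent_positive(1)[OF M i c]
    have "push (collar M i) (bpar M i) c 1 (fst (fst g)) = fst (frm M (\<Gamma> 0) c)"
      using morphism_frm[OF boundary_parametrisation_D(5)[OF bp i] \<Gamma>(2) c1 c] \<Gamma>(3) by simp
    also have "\<dots> = velocity \<gamma> c 0"
      using \<Gamma>(1) c H by (simp add: tangent_lift_def)
    also have "\<dots> = push (collar M i) (bpar M i) c 1 (- \<i>)"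
      using H c by simp
    finally show ?thesis
      by (rule push_inj[OF os boundary_parametrisation_D(3)[OF bp i] c(1) c1 c(2) boundary_parametrisation_D(4)[OF bp i]])
  qed
  have dk: "deck k \<in> GLt" "snd (deck k) = 2 * pi * of_int k"
    by (auto simp: deck_def)
  have "cis (snd g) = cis (- (pi / 2))"
    using GLt_D(2)[OF \<Gamma>(2)] g by (simp add: sgn_eq cis_minus_pi_half)
  then obtain m :: int where m: "snd g = - (pi / 2) + 2 * pi * of_int m"
    unfolding cis_eq_iff by blast
  have m': "snd (gmul g (deck k)) = - (pi / 2) + 2 * pi * of_int (m + k)"
    using gmul_snd_int[OF \<Gamma>(2) dk(2)] dk(2) m by (simp add: algebra_simps)
  \<comment> \<open>The collar lift \<open>rot (pi / 2)\<close> used in \<open>presents\<close> and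
    the lift \<open>u\<close> of the clockwise tangent differ by an odd multiple of \<pi>, which
    \<open>gmul_positive_odd\<close> carries through the alignment unchanged.\<close>
  have key: "\<exists>l'::int. eidx D (bedge M D l) + n' = N + l' * int r"
    if w: "w \<in> sides D" "fst w = f" "side_edge D w = bedge M D l" "\<sigma> \<in> side_arc D w"
      and l: "l \<in> {1..nin M}" "fmap D f (cis \<sigma>) = bpar M l 1"
      and u: "u \<in> GLt" "snd u = - (pi / 2) + 2 * pi * of_int n'" and p: "p \<in> GLt" "snd p = \<sigma> + pi / 2 + 2 * pi * of_int N"
      and eq: "\<Psi> f (p, cis \<sigma>) = blift M l (u, 1)" for w l \<sigma> u n' p N
  proof -
    have S: "cis \<sigma> \<in> S"
      using side_arc_punctured_face[OF w(1,4)] w(2) by (simp add: S_def)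
    define q where "q = side_lift \<Psi> f \<sigma>"
    have q: "q \<in> topspace (tot M)"
      unfolding q_def side_lift_def using morphism_tot[OF \<Psi>f _ S] by auto
    define \<rho> where "\<rho> = rot (pi + 2 * pi * of_int (eidx D (bedge M D l)))"
    have \<rho>: "\<rho> \<in> GLt"
      by (simp add: \<rho>_def)
    have "aligned M (act M q \<rho>) (blift M l (rot (pi / 2), 1))"
      using al[OF l(1) w(1,4)] w(2,3) l(2) by (simp add: q_def \<rho>_def)
    then obtain g' where g': "(g', 0) \<in> GLt" "blift M l (rot (pi / 2), 1) = act M (act M q \<rho>) (g', 0)"
      unfolding aligned_def by blast
    have c1: "1 \<in> collar M l"
    proof -
      obtain W where W: "sphere 0 1 \<subseteq> W" "collar M l = W \<inter> {z. 1 \<le> norm z}"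
        using boundary_parametrisation_D(2)[OF bp l(1)] by blast
      then show ?thesis by auto
    qed
    define v where "v = gmul (rot (- (pi / 2))) u"
    have v: "v \<in> GLt" "snd v = pi + 2 * pi * of_int (n' - 1)"
      using u by (auto simp: v_def algebra_simps)
    have "blift M l (u, 1) = blift M l (gmul (rot (pi / 2)) v, 1)"
      unfolding v_def gmul_rot_inverse ..
    also have "\<dots> = act M (blift M l (rot (pi / 2), 1)) v"
      by (rule morphism_equivariant[OF boundary_parametrisation_D(5)[OF bp l(1)] rot_GLt v(1) c1])
    also have "\<dots> = act M q (gmul \<rho> (gmul (g', 0) v))"
      using act_act[OF pb act_in_tot[OF pb q \<rho>] g'(1) v(1)] act_act[OF pb q \<rho> gmul_GLt[OF g'(1) v(1)]] g'(2)
      by simp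
    finally have "blift M l (u, 1) = act M q (gmul \<rho> (gmul (g', 0) v))" .
    moreover have "\<Psi> f (p, cis \<sigma>) = act M q (gmul (rot (- (\<sigma> + pi / 2))) p)"
      unfolding q_def by (rule side_lift_rotate[of M S 0 "fmap D f" \<Psi> f p \<sigma>, OF \<Psi>f p(1) S])
    ultimately have "act M q (gmul \<rho> (gmul (g', 0) v)) = act M q (gmul (rot (- (\<sigma> + pi / 2))) p)"
      using eq by simp
    then obtain l' :: int where l': "snd (gmul \<rho> (gmul (g', 0) v)) = snd (gmul (rot (- (\<sigma> + pi / 2))) p) + 2 * pi * of_int (l' * int r)"
      using act_free_angle[OF pb q gmul_GLt[OF \<rho> gmul_GLt[OF g'(1) v(1)]] gmul_GLt[OF rot_GLt p(1)]] by blast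
    have "snd (gmul \<rho> (gmul (g', 0) v)) = pi + 2 * pi * of_int (eidx D (bedge M D l)) + (pi + 2 * pi * of_int (n' - 1))"
      using gmul_positive_odd[OF g'(1) v(2)] v(2) by (simp add: \<rho>_def)
    then have "2 * pi * of_int (eidx D (bedge M D l) + n') = 2 * pi * of_int (N + l' * int r)"
      using l' p(2) by (simp add: algebra_simps)
    then have "of_int (eidx D (bedge M D l) + n') = (of_int (N + l' * int r) :: real)"
      by (simp only: mult_cancel_left) simp
    then show ?thesis
      by (metis of_int_eq_iff)
  qed
  have ga: "fmap D f (cis \<tau>) = bpar M i 1" "fmap D f (cis \<tau>') = bpar M j 1"
    using \<gamma>[of 0] \<gamma>[of 1] H a(5) b(5) by simp_all
  obtain l0 :: int where l0: "eidx D (bedge M D i) + m = k0 + l0 * int r"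
    using key[OF a(1-4) i ga(1) \<Gamma>(2) m p(1), of k0] p(3,5) \<theta>0 a(5) \<Gamma>(3) by auto
  obtain l1 :: int where l1: "eidx D (bedge M D j) + (m + k) = (n + k1) + l1 * int r"
    using key[OF b(1-4) j ga(2) gmul_GLt[OF \<Gamma>(2) dk(1)] m' p(2), of "n + k1"] p(4,6) \<theta>1 b(5) \<Gamma>(4)
    by (auto simp: algebra_simps)
  have E: "k - (eidx D (bedge M D i) - eidx D (bedge M D j) + n) = (k1 - k0) + (l1 - l0) * int r + 2 * (m + eidx D (bedge M D i) - eidx D (bedge M D i) - m)"
    using l0 l1 by (simp add: algebra_simps)
  have "even (k1 - k0)"
    using p(7) r by (meson cong_iff_dvd_diff dvd_trans even_of_nat)
  then have "even (k - (eidx D (bedge M D i) - eidx D (bedge M D j) + n))"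
    unfolding E using r by simp
  then show ?thesis
    by (simp add: n_def ord ab)
qed

section \<open>End points of sides\<close>

text \<open>The gluing condition does not contain continuity of the reparametrisation; monotonicity
  and surjectivity supply the limits at its ends.\<close>

lemma strict_mono_tendsto_sup:
  fixes h :: "real \<Rightarrow> real"
  assumes "a < b" "strict_mono_on {a<..<b} h" "h ` {a<..<b} = {c<..<d}"
  shows "(h \<longlongrightarrow> d) (at_left b)"
proof (rule order_tendstoI)
  have ev: "\<forall>\<^sub>F t in at_left b. t \<in> {u<..<b}" if "u < b" for u
    using that eventually_at_left_field by (auto simp: eventually_at_left)
  fix y assume "y < d"
  have "h ((a + b) / 2) \<in> {c<..<d}"
    unfolding assms(3)[symmetric] using assms(1) by (intro imageI) auto
  then have "(max y c + d) / 2 \<in> {c<..<d}"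
    using \<open>y < d\<close> by auto
  then obtain u where u: "u \<in> {a<..<b}" "h u = (max y c + d) / 2"
    using assms(3) by (metis imageE)
  then have "y < h u"
    using \<open>y < d\<close> by (auto simp: max_def split: if_splits)
  have "\<forall>\<^sub>F t in at_left b. t \<in> {u<..<b}"
    using ev u by simp
  then show "\<forall>\<^sub>F t in at_left b. y < h t"
  proof eventually_elim
    case (elim t)
    then have "h u < h t"
      using u(1) by (intro strict_mono_onD[OF assms(2)]) auto
    then show ?case using \<open>y < h u\<close> by simp
  qed
next
  fix y assume "d < y"
  have "\<forall>\<^sub>F t in at_left b. t \<in> {a<..<b}"
    using assms(1) by (auto simp: eventually_at_left)
  then show "\<forall>\<^sub>F t in at_left b. h t < y"
  proof eventually_elim
    case (elim t)
    then have "h t \<in> {c<..<d}"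
      using assms(3) by blast
    then show ?case using \<open>d < y\<close> by simp
  qed
qed

lemma strict_mono_tendsto_inf:
  fixes h :: "real \<Rightarrow> real"
  assumes "a < b" "strict_mono_on {a<..<b} h" "h ` {a<..<b} = {c<..<d}"
  shows "(h \<longlongrightarrow> c) (at_right a)"
proof -
  have "((\<lambda>t. - h (- t)) \<longlongrightarrow> - c) (at_left (- a))"
  proof (rule strict_mono_tendsto_sup)
    show "- b < - a" using assms(1) by simp
    show "strict_mono_on {- b<..<- a} (\<lambda>t. - h (- t))"
      using assms(2) by (auto simp: monotone_on_def)
    have "(\<lambda>t. - h (- t)) ` {- b<..<- a} = uminus ` h ` uminus ` {- b<..<- a}"
      by (simp only: image_comp o_def)
    also have "uminus ` {- b<..<- a} = {a<..<b}"
      by simp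
    finally show "(\<lambda>t. - h (- t)) ` {- b<..<- a} = {- d<..<- c}"
      using assms(3) by simp
  qed
  then have "((\<lambda>t. - h (- t)) \<longlongrightarrow> - c) (filtermap uminus (at_right a))"
    by (simp add: at_left_minus)
  then have "((\<lambda>t. - h t) \<longlongrightarrow> - c) (at_right a)"
    by (simp add: filterlim_filtermap)
  then show ?thesis
    by (simp add: tendsto_minus_cancel_left)
qed

definition start_point :: "'p mplcw \<Rightarrow> nat \<times> nat \<Rightarrow> 'p" where
  "start_point D x = fmap D (fst x) (cis (2 * pi * (real (snd x) - 1) / real (nsides D (fst x))))"

definition end_point :: "'p mplcw \<Rightarrow> nat \<times> nat \<Rightarrow> 'p" where
  "end_point D x = fmap D (fst x) (cis (2 * pi * real (snd x) / real (nsides D (fst x))))"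

text \<open>The gluing condition speaks of open sides only. Towards an end of the side the same
  points converge along the face map and along the edge, and limits in a Hausdorff space are
  unique.\<close>

lemma end_points_of_side:
  assumes os: "oriented_surface M" and pl: "plcw M D" and x: "x \<in> sides D"
  shows "start_point D x = emap D (side_edge D x) (of_bool (\<not> side_dir D x))"
    "end_point D x = emap D (side_edge D x) (of_bool (side_dir D x))"
proof -
  obtain f k where fk: "x = (f, k)" "f \<in> faces D" "1 \<le> k" "k \<le> nsides D f"
    using x by (auto simp: sides_def)
  define n where "n = nsides D f"
  define e where "e = side_edge D x"
  define a b where "a = 2 * pi * (real k - 1) / n" and "b = 2 * pi * real k / n"
  have n: "n > 0" using fk by (simp add: n_def)
  have ab: "a < b"
    unfolding a_def b_def using n by (intro divide_strict_right_mono mult_strict_left_mono) auto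
  have arc: "side_arc D x = {a<..<b}"
    by (simp add: fk(1) side_arc_def a_def b_def n_def)
  have cells: "plcw_cells M D" and gl: "plcw_gluing M D"
    using pl by (simp_all add: plcw_def)
  have e: "e \<in> edges D"
    unfolding e_def by (rule side_edge_in_edges[OF gl x])
  note g = conjunct2[OF bspec[OF conjunct1[OF gl[unfolded plcw_gluing_def]] x]]
  obtain h where h: "if side_dir D x then strict_mono_on (side_arc D x) h
              else strict_antimono_on (side_arc D x) h" "h ` side_arc D x = {0<..<1}"
    "\<forall>\<tau>\<in>side_arc D x. fmap D (fst x) (cis \<tau>) = emap D (side_edge D x) (h \<tau>)"
    using g by (elim exE conjE) (rule that)
  have lim: "(h \<longlongrightarrow> of_bool (side_dir D x)) (at_left b)" "(h \<longlongrightarrow> of_bool (\<not> side_dir D x)) (at_right a)"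
  proof -
    show "(h \<longlongrightarrow> of_bool (side_dir D x)) (at_left b)"
    proof (cases "side_dir D x")
      case True
      then show ?thesis
        using strict_mono_tendsto_sup[OF ab, of h 0 1] h(1,2) by (simp add: arc)
    next
      case False
      have "strict_mono_on {a<..<b} (\<lambda>t. - h t)"
        using h(1) False by (auto simp: monotone_on_def arc)
      moreover have "(\<lambda>t. - h t) ` {a<..<b} = {-1<..<0}"
        using image_comp[of uminus h "{a<..<b}"] h(2) by (simp add: arc o_def)
      ultimately have "((\<lambda>t. - h t) \<longlongrightarrow> 0) (at_left b)"
        by (rule strict_mono_tendsto_sup[OF ab])
      then show ?thesis
        using False tendsto_minus_cancel_left[of h 0] by simp
    qed
    show "(h \<longlongrightarrow> of_bool (\<not> side_dir D x)) (at_right a)"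
    proof (cases "side_dir D x")
      case True
      then show ?thesis
        using strict_mono_tendsto_inf[OF ab, of h 0 1] h(1,2) by (simp add: arc)
    next
      case False
      have "strict_mono_on {a<..<b} (\<lambda>t. - h t)"
        using h(1) False by (auto simp: monotone_on_def arc)
      moreover have "(\<lambda>t. - h t) ` {a<..<b} = {-1<..<0}"
        using image_comp[of uminus h "{a<..<b}"] h(2) by (simp add: arc o_def)
      ultimately have "((\<lambda>t. - h t) \<longlongrightarrow> -1) (at_right a)"
        by (rule strict_mono_tendsto_inf[OF ab])
      from tendsto_minus[OF this] show ?thesis
        using False by simp
    qed
  qed
  have Haus: "Hausdorff_space (topo M)"
    using os by (simp add: oriented_surface_def)
  have key: "fmap D f (cis p) = emap D e l"
    if F: "F \<noteq> bot" "F \<le> nhds p" "\<forall>\<^sub>F t in F. t \<in> {a<..<b}" "(h \<longlongrightarrow> l) F" "l \<in> {0..1}" for F p l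
  proof -
    have "(cis \<longlongrightarrow> cis p) F"
      using tendsto_mono[OF F(2)] isCont_def tendsto_cis[OF filterlim_ident] by blast
    then have "limitin (top_of_set (cball 0 1)) cis (cis p) F"
      by (simp add: limitin_subtopology)
    then have "limitin (topo M) (fmap D f \<circ> cis) (fmap D f (cis p)) F"
      by (rule continuous_map_limit[OF plcw_cells_D(4)[OF cells fk(2)]])
    moreover have "\<forall>\<^sub>F t in F. (fmap D f \<circ> cis) t = (emap D e \<circ> h) t"
      using F(3)
    proof (rule eventually_mono)
      show "(fmap D f \<circ> cis) t = (emap D e \<circ> h) t" if "t \<in> {a<..<b}" for t
        using bspec[OF h(3)[unfolded arc] that] by (simp add: fk(1) e_def)
    qed
    ultimately have 1: "limitin (topo M) (emap D e \<circ> h) (fmap D f (cis p)) F"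
      by (rule limitin_transform_eventually[rotated])
    have "\<forall>\<^sub>F t in F. h t \<in> {0..1}"
      using F(3)
    proof (rule eventually_mono)
      show "h t \<in> {0..1}" if "t \<in> {a<..<b}" for t
        using imageI[OF that, of h] h(2) by (simp add: arc)
    qed
    then have "limitin (top_of_set {0..1}) h l F"
      using F(4,5) by (simp add: limitin_subtopology)
    then have "limitin (topo M) (emap D e \<circ> h) (emap D e l) F"
      by (rule continuous_map_limit[OF plcw_cells_D(5)[OF cells e]])
    then show ?thesis
      using limitin_Hausdorff_unique[OF 1 _ _ Haus] F(1) by blast
  qed
  have "fmap D f (cis a) = emap D e (of_bool (\<not> side_dir D x))"
  proof (rule key[OF _ _ _ lim(2)])
    show "\<forall>\<^sub>F t in at_right a. t \<in> {a<..<b}"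
      using ab by (auto simp: eventually_at_right)
  qed (use at_within_le_nhds trivial_limit_at_right_real in auto)
  then show "start_point D x = emap D (side_edge D x) (of_bool (\<not> side_dir D x))"
    by (simp add: start_point_def fk(1) a_def n_def e_def)
  have "fmap D f (cis b) = emap D e (of_bool (side_dir D x))"
  proof (rule key[OF _ _ _ lim(1)])
    show "\<forall>\<^sub>F t in at_left b. t \<in> {a<..<b}"
      using ab by (auto simp: eventually_at_left)
  qed (use at_within_le_nhds trivial_limit_at_left_real in auto)
  then show "end_point D x = emap D (side_edge D x) (of_bool (side_dir D x))"
    by (simp add: end_point_def fk(1) b_def n_def e_def)
qed

definition next_side :: "'p mplcw \<Rightarrow> nat \<times> nat \<Rightarrow> nat \<times> nat" where
  "next_side D x = (fst x, if snd x = nsides D (fst x) then 1 else Suc (snd x))"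

lemma next_side_in_sides: "x \<in> sides D \<Longrightarrow> next_side D x \<in> sides D"
  by (auto simp: next_side_def sides_def)

lemma start_point_next_side:
  assumes "x \<in> sides D"
  shows "start_point D (next_side D x) = end_point D x"
proof (cases "snd x = nsides D (fst x)")
  case True
  then have "real (nsides D (fst x)) \<noteq> 0"
    using assms by (auto simp: sides_def)
  then show ?thesis
    using True by (simp add: start_point_def end_point_def next_side_def)
next
  case False
  then show ?thesis
    by (simp add: start_point_def end_point_def next_side_def)
qed

lemma start_point_marked: "start_point D (f, 1) = fmap D f 1"
  by (simp add: start_point_def)

section \<open>The Clifford algebra\<close>

declare add_bit_eq_xor [simp del] mult_bit_eq_and [simp del]

text \<open>Exponents of signs live in the field \<open>bit\<close>, where parity arguments become
  ring identities; this is the character through which they act on the coefficients.\<close>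

definition bsign :: "bit \<Rightarrow> 'k::field" where
  "bsign b = (if b = 0 then 1 else - 1)"

lemma bsign_0 [simp]: "bsign 0 = 1"
  and bsign_1 [simp]: "bsign 1 = - 1"
  by (simp_all add: bsign_def)

lemma bsign_add: "bsign (a + b) = bsign a * bsign b"
  by (cases a; cases b) simp_all

lemma bsign_sum: "bsign (\<Sum>x\<in>A. f x) = (\<Prod>x\<in>A. bsign (f x))"
  by (induction A rule: infinite_finite_induct) (simp_all add: bsign_add)

lemma minus_one_power_bsign: "(- 1) ^ n = bsign (of_nat n)"
  by (induction n) (simp_all add: bsign_add)

lemma bit_of_int_eq_0_iff: "of_int n = (0::bit) \<longleftrightarrow> even n"
  by (metis bit_not_one_iff even_of_int_iff even_zero odd_one)

lemma bit_of_int_odd: "of_int n = (of_bool (odd n) :: bit)"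
  using bit_of_int_eq_0_iff[of n] by (cases "odd n") auto

lemma bit_add_self [simp]: "(a::bit) + a = 0"
  by (cases a) simp_all

lemma bit_of_bool_neq: "of_bool (a \<noteq> b) = (of_bool a + of_bool b :: bit)"
  by (cases a; cases b) simp_all

lemma clifford_simps [simp]:
  "parity clifford = of_bool" "funit clifford = (\<lambda>i. if i then 0 else 1)"
  "fmul clifford = (\<lambda>i j k. if k = (i \<noteq> j) then 1 else 0)"
  "fcounit clifford = (\<lambda>i. if i then 0 else 2)"
  "fcomul clifford = (\<lambda>i j k. if i = (j \<noteq> k) then 1 / 2 else 0)"
  by (simp_all add: clifford_def)

lemma vmul_clifford: "vmul clifford x y = (\<lambda>k. x False * y k + x True * y (\<not> k))"
  by (rule ext) (auto simp: vmul_def UNIV_bool)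

lemma vmul_clifford_basis: "vmul clifford (basis_vec a) (basis_vec b) = (basis_vec (a \<noteq> b) :: bool \<Rightarrow> 'k::field)"
  by (rule ext) (auto simp: vmul_clifford basis_vec_def)

lemma vmul_clifford_unit: "vmul clifford (funit clifford) y = y"
  by (rule ext) (simp add: vmul_clifford)

lemma counit_clifford: "counit clifford x = 2 * x False"
  by (simp add: counit_def UNIV_bool)

lemma comul_clifford_unit: "comul clifford (funit clifford) j m = (if j = m then 1 / 2 else 0)"
  by (auto simp: comul_def UNIV_bool)

lemma window_clifford:
  assumes "(2::'k::field) \<noteq> 0"
  shows "window clifford = (funit clifford :: bool \<Rightarrow> 'k)"
  using assms by (intro ext) (auto simp: window_def comul_def UNIV_bool)

lemma window_inv_clifford:
  assumes "(2::'k::field) \<noteq> 0"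
  shows "window_inv clifford = (funit clifford :: bool \<Rightarrow> 'k)"
  unfolding window_inv_def window_clifford[OF assms]
  by (rule the_equality) (simp_all only: vmul_clifford_unit)

lemma nakayama_clifford:
  assumes "(2::'k::field) \<noteq> 0"
  shows "nakayama clifford x = (\<lambda>j. if j then - x j else (x j :: 'k))"
  using assms
  by (intro ext) (auto simp: nakayama_def comul_def UNIV_bool counit_clifford vmul_clifford basis_vec_def)

lemma nak_pow_clifford:
  assumes "(2::'k::field) \<noteq> 0"
  shows "nak_pow clifford n x = (\<lambda>j. bsign (of_bool j * of_int n) * (x j :: 'k))"
proof -
  have p: "(nakayama clifford ^^ m) x = (\<lambda>j. bsign (of_bool j * of_nat m) * (x j :: 'k))" for m
    by (induction m) (auto simp: nakayama_clifford[OF assms] bsign_add fun_eq_iff)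
  have "(nakayama clifford :: (bool \<Rightarrow> 'k) \<Rightarrow> _) \<circ> nakayama clifford = id"
    by (rule ext) (auto simp: nakayama_clifford[OF assms] fun_eq_iff)
  then have i: "inv (nakayama clifford :: (bool \<Rightarrow> 'k) \<Rightarrow> _) = nakayama clifford"
    by (metis inv_unique_comp)
  have "of_nat (nat n) = (of_int n :: bit)" if "0 \<le> n"
    using that by (metis int_nat_eq of_int_of_nat_eq)
  moreover have "of_nat (nat (- n)) = (of_int n :: bit)" if "\<not> 0 \<le> n"
  proof -
    have "of_nat (nat (- n)) = (of_int (- n) :: bit)"
      using that by (metis int_nat_eq of_int_of_nat_eq linorder_linear neg_0_le_iff_le)
    then show ?thesis by (simp add: bit_of_int_odd)
  qed
  ultimately show ?thesis
    by (simp add: nak_pow_def p i)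
qed

text \<open>The two terms of the coproduct of a basis element return equal multiples of it up to the
  sign of \<open>N\<close> and the Koszul sign; they add up if its parity is that of
  \<open>l\<close> and cancel otherwise.\<close>

lemma proj_lambda_clifford:
  assumes "(2::'k::field) \<noteq> 0"
  shows "proj_lambda clifford l (basis_vec x) m = (if m = x \<and> x = odd l then 1 else (0::'k))"
  unfolding proj_lambda_def window_inv_clifford[OF assms] vmul_clifford_unit nak_pow_clifford[OF assms]
  using assms by (cases m; cases x) (auto simp: UNIV_bool comul_def basis_vec_def bit_of_int_odd)

lemma vertex_factor_clifford:
  assumes "(2::'k::field) \<noteq> 0"
  shows "vertex_factor clifford D V y z x = (if y x = z x then 1 else (0::'k))"
proof -
  have "(vmul clifford (funit clifford) ^^ n) v = v" for n and v :: "bool \<Rightarrow> 'k"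
    by (induction n) (simp_all only: funpow.simps id_apply o_apply vmul_clifford_unit)
  then show ?thesis
    unfolding vertex_factor_def window_inv_clifford[OF assms] by (auto simp: basis_vec_def)
qed

lemma foldl_vmul_clifford:
  "foldl (vmul clifford) (basis_vec b) (map (\<lambda>x. basis_vec (z x)) xs) = (basis_vec (foldl (\<noteq>) b (map z xs)) :: bool \<Rightarrow> 'k::field)"
  by (induction xs arbitrary: b) (simp_all add: vmul_clifford_basis)

lemma foldl_neq_bit: "of_bool (foldl (\<noteq>) b (map z xs)) = (of_bool b + (\<Sum>x\<leftarrow>xs. of_bool (z x)) :: bit)"
  by (induction xs arbitrary: b) (simp_all only: foldl.simps list.map bit_of_bool_neq sum_list.Cons sum_list.Nil add.assoc add_0_right)

text \<open>Products of basis vectors add parities, and the counit is 2 on 1 and 0 on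
  \<open>\<theta>\<close>.\<close>

lemma face_factor_clifford:
  assumes "1 \<le> nsides D f"
  shows "face_factor clifford D z f =
    (if (\<Sum>x\<leftarrow>face_labels D f. of_bool (z x)) = (0::bit) then 2 else (0::'k::field))"
proof -
  obtain a xs where ax: "face_labels D f = a # xs"
    using assms by (cases "face_labels D f") (auto simp: face_labels_def)
  have "face_factor clifford D z f = counit clifford (basis_vec (foldl (\<noteq>) (z a) (map z xs)) :: bool \<Rightarrow> 'k)"
    by (simp add: face_factor_def ax foldl_vmul_clifford)
  also have "\<dots> = (if of_bool (foldl (\<noteq>) (z a) (map z xs)) = (0::bit) then 2 else 0)"
    by (simp add: counit_clifford basis_vec_def)
  finally show ?thesis
    by (simp only: foldl_neq_bit ax list.map sum_list.Cons)
qed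

text \<open>\<open>N\<close> is an involution, so the exponent \<open>s + 1\<close> of inner edges
  and the exponent \<open>- s - 1\<close> of ingoing ones give the same sign.\<close>

lemma edge_factor_clifford:
  assumes "(2::'k::field) \<noteq> 0"
  shows "edge_factor clifford M D i y e =
    (if inner_edge D e
     then if y (e, True) = y (e, False) then 1 / 2 * bsign (of_bool (y (e, True)) * (of_int (eidx D e) + 1)) else 0
     else if i (boundary_of_edge M D e) = y (e, True)
       then bsign (of_bool (y (e, True)) * (of_int (eidx D e) + 1)) else (0::'k))"
  unfolding edge_factor_def nak_pow_clifford[OF assms] comul_clifford_unit
  by (cases "y (e, True)"; cases "y (e, False)") (auto simp: basis_vec_def UNIV_bool bit_of_int_odd)

section \<open>Koszul signs\<close>

text \<open>Lists enter the Koszul sign only through the order of their entries, which for a list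
  sorted by an asymmetric relation is that relation.\<close>

lemma before_sorted_iff:
  assumes "sorted_wrt R xs" "\<And>a b. R a b \<Longrightarrow> \<not> R b a"
  shows "before xs a b \<longleftrightarrow> a \<in> set xs \<and> b \<in> set xs \<and> R a b"
proof
  assume "before xs a b"
  then show "a \<in> set xs \<and> b \<in> set xs \<and> R a b"
    using sorted_wrt_nth_less[OF assms(1)] by (auto simp: before_def)
next
  assume ab: "a \<in> set xs \<and> b \<in> set xs \<and> R a b"
  then obtain i j where ij: "i < length xs" "j < length xs" "xs ! i = a" "xs ! j = b"
    by (metis in_set_conv_nth)
  have "\<not> j < i" "i \<noteq> j"
    using sorted_wrt_nth_less[OF assms(1), of j i] ij ab assms(2) by auto
  then show "before xs a b"
    unfolding before_def using ij by (intro exI[of _ i] exI[of _ j]) simp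
qed

lemma sorted_wrt_concat_map:
  assumes "sorted_wrt Q ks" "\<And>k. k \<in> set ks \<Longrightarrow> sorted_wrt R (g k)"
    "\<And>k k' a b. k \<in> set ks \<Longrightarrow> k' \<in> set ks \<Longrightarrow> Q k k' \<Longrightarrow> a \<in> set (g k) \<Longrightarrow> b \<in> set (g k') \<Longrightarrow> R a b"
  shows "sorted_wrt R (concat (map g ks))"
  using assms
proof (induction ks)
  case (Cons k ks)
  have "sorted_wrt R (concat (map g ks))"
  proof (rule Cons.IH)
    show "R a b" if "k' \<in> set ks" "k'' \<in> set ks" "Q k' k''" "a \<in> set (g k')" "b \<in> set (g k'')" for k' k'' a b
      by (rule Cons.prems(3)[OF _ _ that(3-5)]) (use that in simp_all)
  qed (use Cons.prems in simp_all)
  moreover have "R a b" if ab: "a \<in> set (g k)" "b \<in> set (concat (map g ks))" for a b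
  proof -
    obtain k' where k': "k' \<in> set ks" "b \<in> set (g k')"
      using ab(2) by auto
    show ?thesis
      by (rule Cons.prems(3)[OF _ _ _ ab(1) k'(2)]) (use Cons.prems(1) k' in simp_all)
  qed
  ultimately show ?case
    using Cons.prems(2) by (simp add: sorted_wrt_append)
qed simp

text \<open>The number of inverted pairs of odd entries becomes, modulo 2, a quadratic form in the
  parities.\<close>

lemma koszul_bsign:
  assumes "finite A" "\<And>a b. before xs a b \<and> before ys b a \<longleftrightarrow> a \<in> A \<and> b \<in> A \<and> R a b \<and> Q b a"
  shows "koszul p xs ys = bsign (\<Sum>a\<in>A. \<Sum>b\<in>A. of_bool (R a b) * of_bool (Q b a) * of_nat (p a) * of_nat (p b))"
proof -
  have "{(a, b). before xs a b \<and> before ys b a \<and> odd (p a) \<and> odd (p b)} =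
      {q \<in> A \<times> A. R (fst q) (snd q) \<and> Q (snd q) (fst q) \<and> odd (p (fst q)) \<and> odd (p (snd q))}"
  proof -
    have "{(a, b). before xs a b \<and> before ys b a \<and> odd (p a) \<and> odd (p b)} =
        {(a, b). (before xs a b \<and> before ys b a) \<and> odd (p a) \<and> odd (p b)}"
      by simp
    also have "\<dots> = {(a, b). (a \<in> A \<and> b \<in> A \<and> R a b \<and> Q b a) \<and> odd (p a) \<and> odd (p b)}"
      unfolding assms(2) ..
    finally show ?thesis
      by auto
  qed
  then have "of_nat (card {(a, b). before xs a b \<and> before ys b a \<and> odd (p a) \<and> odd (p b)}) =
      (\<Sum>q\<in>A \<times> A. of_bool (R (fst q) (snd q) \<and> Q (snd q) (fst q) \<and> odd (p (fst q)) \<and> odd (p (snd q))) :: bit)"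
    using assms(1) by (simp add: sum.If_cases of_bool_def Int_def conj_ac)
  also have "\<dots> = (\<Sum>q\<in>A \<times> A. of_bool (R (fst q) (snd q)) * of_bool (Q (snd q) (fst q)) * of_nat (p (fst q)) * of_nat (p (snd q)))"
  proof -
    have "of_nat n = (of_bool (odd n) :: bit)" for n
      using bit_of_int_odd[of "int n"] by simp
    then show ?thesis
      by (intro sum.cong) (auto simp: of_bool_conj)
  qed
  also have "\<dots> = (\<Sum>a\<in>A. \<Sum>b\<in>A. of_bool (R a b) * of_bool (Q b a) * of_nat (p a) * of_nat (p b))"
    by (simp add: sum.cartesian_product split_beta)
  finally show ?thesis
    by (simp add: koszul_def minus_one_power_bsign)
qed

section \<open>The orders of sides and of edge labels\<close>

definition side_less :: "nat \<times> nat \<Rightarrow> nat \<times> nat \<Rightarrow> bool" where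
  "side_less x y \<longleftrightarrow> fst x < fst y \<or> fst x = fst y \<and> snd x < snd y"

text \<open>\<open>True\<close> precedes \<open>False\<close>, since \<open>E_list\<close> puts the
  left copy of an inner edge first.\<close>

definition label_less :: "nat \<times> bool \<Rightarrow> nat \<times> bool \<Rightarrow> bool" where
  "label_less a b \<longleftrightarrow> fst a < fst b \<or> fst a = fst b \<and> snd a \<and> \<not> snd b"

lemma side_less_asym: "side_less x y \<Longrightarrow> \<not> side_less y x"
  by (auto simp: side_less_def)

lemma label_less_asym: "label_less x y \<Longrightarrow> \<not> label_less y x"
  by (auto simp: label_less_def)

text \<open>The bijection \<open>\<Phi>\<close> of the state sum, from attached labels to
  sides.\<close>

definition side_of :: "'p mplcw \<Rightarrow> nat \<times> bool \<Rightarrow> nat \<times> nat" where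
  "side_of D = inv_into (sides D) (side_label D)"

lemma finite_sides:
  assumes "plcw_cells M D"
  shows "finite (sides D)"
  unfolding sides_def using plcw_cells_D(1)[OF assms] by auto

lemma finite_attached:
  assumes "plcw_cells M D"
  shows "finite (attached D)"
  unfolding attached_def using finite_sides[OF assms] by simp

lemma side_of_label:
  assumes "plcw_gluing M D" "x \<in> sides D"
  shows "side_of D (side_label D x) = x"
  unfolding side_of_def
  by (rule inv_into_f_f) (use assms(2) conjunct1[OF conjunct2[OF assms(1)[unfolded plcw_gluing_def]]] in auto)

lemma attached_edge:
  assumes "plcw_gluing M D" "a \<in> attached D"
  shows "fst a \<in> edges D"
  using assms side_edge_in_edges[OF assms(1)] by (auto simp: attached_def side_label_def)

lemma attached_True:
  assumes "plcw_gluing M D" "e \<in> edges D"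
  shows "(e, True) \<in> attached D"
  using edge_attached_cases[OF assms] by (auto simp: inner_edge_def)

lemma attached_False_iff:
  assumes "plcw_gluing M D" "e \<in> edges D"
  shows "(e, False) \<in> attached D \<longleftrightarrow> inner_edge D e"
  using attached_True[OF assms] by (auto simp: inner_edge_def)

lemma set_edge_list:
  assumes "plcw_cells M D"
  shows "set (edge_list D) = edges D"
  using plcw_cells_D(2)[OF assms] by (simp add: edge_list_def)

lemma sorted_edge_list: "sorted_wrt (<) (edge_list D)"
  by (simp add: edge_list_def)

lemma set_E_list:
  assumes "plcw M D"
  shows "set (E_list D) = attached D"
proof -
  note c = plcw_D(1)[OF assms] and g = plcw_D(2)[OF assms]
  have "a \<in> set (E_list D) \<longleftrightarrow> a \<in> attached D" for a
  proof (cases a)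
    case (Pair e d)
    have 1: "a \<in> set (E_list D) \<longleftrightarrow> e \<in> edges D \<and> (d \<or> inner_edge D e)"
      by (auto simp: E_list_def set_edge_list[OF c] Pair split: if_splits)
    show ?thesis
    proof (cases d)
      case True
      then show ?thesis
        using 1 attached_True[OF g] attached_edge[OF g, of a] Pair by auto
    next
      case False
      then show ?thesis
        using 1 attached_False_iff[OF g] attached_edge[OF g, of a] Pair by auto
    qed
  qed
  then show ?thesis by blast
qed

lemma before_E_list:
  assumes "plcw M D"
  shows "before (E_list D) a b \<longleftrightarrow> a \<in> attached D \<and> b \<in> attached D \<and> label_less a b"
proof -
  have "sorted_wrt label_less (E_list D)"
    unfolding E_list_def
    by (rule sorted_wrt_concat_map[OF sorted_edge_list]) (auto simp: label_less_def split: if_splits)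
  from before_sorted_iff[OF this label_less_asym, of a b] show ?thesis
    unfolding set_E_list[OF assms] .
qed

lemma before_face_list:
  assumes "plcw M D"
  shows "before (concat (map (face_labels D) (face_list D))) a b \<longleftrightarrow>
    a \<in> attached D \<and> b \<in> attached D \<and> side_less (side_of D a) (side_of D b)"
proof -
  note c = plcw_D(1)[OF assms] and g = plcw_D(2)[OF assms]
  have f: "set (face_list D) = faces D" "sorted_wrt (<) (face_list D)"
    using plcw_cells_D(1)[OF c] by (simp_all add: face_list_def)
  have sf: "set (face_labels D f) = side_label D ` ({f} \<times> {1..nsides D f})" for f
    by (auto simp: face_labels_def)
  have mem: "(f, k) \<in> sides D \<longleftrightarrow> f \<in> faces D \<and> k \<in> {1..nsides D f}" for f k
    by (auto simp: sides_def)
  have set: "set (concat (map (face_labels D) (face_list D))) = attached D"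
    by (auto simp: sf f attached_def sides_def)
  have "sorted_wrt (\<lambda>a b. side_less (side_of D a) (side_of D b)) (concat (map (face_labels D) (face_list D)))"
  proof (rule sorted_wrt_concat_map[OF f(2)])
    fix k assume k: "k \<in> set (face_list D)"
    have "sorted_wrt (\<lambda>i j. side_less (side_of D (side_label D (k, i))) (side_of D (side_label D (k, j)))) [1..<Suc (nsides D k)]"
    proof (rule sorted_wrt_mono_rel[of _ "(<)"])
      show "sorted_wrt (<) [1..<Suc (nsides D k)]"
        by (simp del: upt_Suc)
      fix i j assume "i \<in> set [1..<Suc (nsides D k)]" "j \<in> set [1..<Suc (nsides D k)]" "i < j"
      then show "side_less (side_of D (side_label D (k, i))) (side_of D (side_label D (k, j)))"
        using k f by (subst (1 2) side_of_label[OF g]) (auto simp: mem side_less_def)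
    qed
    then show "sorted_wrt (\<lambda>a b. side_less (side_of D a) (side_of D b)) (face_labels D k)"
      unfolding face_labels_def sorted_wrt_map .
  next
    fix k k' a b
    assume k: "k \<in> set (face_list D)" "k' \<in> set (face_list D)" "k < k'" "a \<in> set (face_labels D k)" "b \<in> set (face_labels D k')"
    then obtain i j where "a = side_label D (k, i)" "(k, i) \<in> sides D" "b = side_label D (k', j)" "(k', j) \<in> sides D"
      unfolding sf f by (auto simp: mem)
    then show "side_less (side_of D a) (side_of D b)"
      using k(3) by (simp add: side_of_label[OF g] side_less_def)
  qed
  from before_sorted_iff[OF this side_less_asym, of a b] show ?thesis
    unfolding set .
qed

lemma sum_attached:
  assumes "plcw_gluing M D"
  shows "(\<Sum>a\<in>attached D. F a) = (\<Sum>x\<in>sides D. F (side_label D x))"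
  unfolding attached_def
  by (rule sum.reindex_cong[OF _ refl]) (use conjunct1[OF conjunct2[OF assms[unfolded plcw_gluing_def]]] in auto)

lemma koszul_faces:
  assumes pl: "plcw M D"
  shows "koszul p (E_list D) (concat (map (face_labels D) (face_list D))) =
    bsign (\<Sum>x\<in>sides D. \<Sum>y\<in>sides D. of_bool (label_less (side_label D x) (side_label D y)) *
      of_bool (side_less y x) * of_nat (p (side_label D x)) * of_nat (p (side_label D y)))"
proof -
  note c = plcw_D(1)[OF pl] and g = plcw_D(2)[OF pl]
  have "koszul p (E_list D) (concat (map (face_labels D) (face_list D))) =
    bsign (\<Sum>a\<in>attached D. \<Sum>b\<in>attached D. of_bool (label_less a b) * of_bool (side_less (side_of D b) (side_of D a)) *
      of_nat (p a) * of_nat (p b))"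
    by (rule koszul_bsign[OF finite_attached[OF c]]) (auto simp: before_E_list[OF pl] before_face_list[OF pl])
  then show ?thesis
    by (simp add: sum_attached[OF g] side_of_label[OF g] cong: sum.cong)
qed

lemma bedge_inj:
  assumes "rspin r M" "plcw M D"
  shows "inj_on (bedge M D) {1..nin M}"
proof (rule inj_onI)
  fix i j assume ij: "i \<in> {1..nin M}" "j \<in> {1..nin M}" "bedge M D i = bedge M D j"
  then have "bpar M i ` sphere 0 1 = bpar M j ` sphere 0 1"
    using bedge_D(2)[OF assms(2)] by metis
  then show "i = j"
    using inj_onD[OF bij_betw_imp_inj_on[OF boundary_parametrisation_D(1)[OF rspin_D(4)[OF assms(1)]]], of i j] ij
    by blast
qed

lemma boundary_subset_topspace:
  assumes "oriented_surface M"
  shows "boundary M \<subseteq> topspace (topo M)"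
  using openin_subset[OF oriented_surface_chart(1)[OF assms]] by (auto simp: boundary_def)

lemma boundary_circle_cover:
  assumes "rspin r M" "p \<in> boundary M"
  obtains j where "j \<in> {1..nin M}" "p \<in> bpar M j ` sphere 0 1"
proof -
  have "p \<in> topspace (subtopology (topo M) (boundary M))"
    using assms boundary_subset_topspace[OF rspin_D(1)[OF assms(1)]] by auto
  then obtain C where "C \<in> connected_components_of (subtopology (topo M) (boundary M))" "p \<in> C"
    by (metis Union_connected_components_of UnionE)
  then show ?thesis
    using that boundary_parametrisation_D(1)[OF rspin_D(4)[OF assms(1)]] unfolding bij_betw_def by blast
qed

text \<open>The boundary components cover the boundary, and each is a single edge; the midpoint of a
  non-inner edge lies on one of them.\<close>

lemma non_inner_edge:
  assumes "rspin r M" "plcw M D" "e \<in> edges D" "\<not> inner_edge D e"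
  obtains j where "j \<in> {1..nin M}" "e = bedge M D j"
proof -
  have "emap D e ` {0..1} \<subseteq> boundary M"
    using edge_attached_cases[OF plcw_D(2)[OF assms(2)] assms(3)] assms(4) by blast
  then have "emap D e (1 / 2) \<in> boundary M"
    by auto
  then obtain j where j: "j \<in> {1..nin M}" "emap D e (1 / 2) \<in> bpar M j ` sphere 0 1"
    by (rule boundary_circle_cover[OF assms(1)])
  then have "emap D e (1 / 2) \<in> emap D (bedge M D j) ` {0..1}"
    using bedge_D(2)[OF assms(2) j(1)] by simp
  then have "e = bedge M D j"
    by (intro edge_interior_unique[OF plcw_D(1)[OF assms(2)] assms(3) _ bedge_D(1)[OF assms(2) j(1)], of "1 / 2"]) auto
  with j that show ?thesis by blast
qed

lemma boundary_of_bedge: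
  assumes "rspin r M" "plcw M D" "j \<in> {1..nin M}"
  shows "boundary_of_edge M D (bedge M D j) = j"
  unfolding boundary_of_edge_def
  by (rule the_equality) (use assms(3) inj_onD[OF bedge_inj[OF assms(1,2)]] in auto)

lemma before_in_list:
  assumes M: "rspin r M" and pl: "plcw M D"
  shows "before (in_list M D) i j \<longleftrightarrow> i \<in> {1..nin M} \<and> j \<in> {1..nin M} \<and> bedge M D i < bedge M D j"
proof -
  have set: "set (filter (\<lambda>e. \<not> inner_edge D e) (edge_list D)) = bedge M D ` {1..nin M}"
  proof
    show "set (filter (\<lambda>e. \<not> inner_edge D e) (edge_list D)) \<subseteq> bedge M D ` {1..nin M}"
      using set_edge_list[OF plcw_D(1)[OF pl]] by (auto elim: non_inner_edge[OF M pl])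
    show "bedge M D ` {1..nin M} \<subseteq> set (filter (\<lambda>e. \<not> inner_edge D e) (edge_list D))"
      using set_edge_list[OF plcw_D(1)[OF pl]] bedge_D(1)[OF pl] bedge_attached(4)[OF M pl] by auto
  qed
  have "sorted_wrt (\<lambda>e e'. bedge M D (boundary_of_edge M D e) < bedge M D (boundary_of_edge M D e'))
      (filter (\<lambda>e. \<not> inner_edge D e) (edge_list D))"
  proof (rule sorted_wrt_mono_rel[OF _ sorted_wrt_filter[OF sorted_edge_list]])
    fix e e' assume "e \<in> set (filter (\<lambda>e. \<not> inner_edge D e) (edge_list D))"
      "e' \<in> set (filter (\<lambda>e. \<not> inner_edge D e) (edge_list D))" "e < e'"
    then show "bedge M D (boundary_of_edge M D e) < bedge M D (boundary_of_edge M D e')"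
      unfolding set by (auto simp: boundary_of_bedge[OF M pl])
  qed
  then have sorted: "sorted_wrt (\<lambda>i j. bedge M D i < bedge M D j) (in_list M D)"
    by (simp add: in_list_def sorted_wrt_map)
  have "set (in_list M D) = {1..nin M}"
    unfolding in_list_def set_map set image_image using boundary_of_bedge[OF M pl] by force
  then show ?thesis
    using before_sorted_iff[OF sorted less_not_sym, of i j] by simp
qed

lemma koszul_in_list:
  assumes M: "rspin r M" and pl: "plcw M D"
  shows "koszul p [1..<Suc (nin M)] (in_list M D) =
    bsign (\<Sum>i\<in>{1..nin M}. \<Sum>j\<in>{1..nin M}. of_bool (i < j) * of_bool (bedge M D j < bedge M D i) * of_nat (p i) * of_nat (p j))"
proof (rule koszul_bsign)
  show "before [1..<Suc (nin M)] a b \<and> before (in_list M D) b a \<longleftrightarrow>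
      a \<in> {1..nin M} \<and> b \<in> {1..nin M} \<and> a < b \<and> bedge M D b < bedge M D a" for a b
  proof -
    have "sorted_wrt (<) [1..<Suc (nin M)]"
      by (simp del: upt_Suc)
    from before_sorted_iff[OF this less_not_sym, of a b] show ?thesis
      unfolding before_in_list[OF M pl] set_upt by auto
  qed
qed simp

section \<open>The state sum as a sum of signs\<close>

definition inner_edges :: "'p mplcw \<Rightarrow> nat set" where
  "inner_edges D = {e \<in> edges D. inner_edge D e}"

text \<open>The assignments that survive in the state sum, as cochains on all edges.\<close>

definition conf :: "('p, 'q) rspin_surface \<Rightarrow> 'p mplcw \<Rightarrow> (nat \<Rightarrow> bool) \<Rightarrow> nat \<Rightarrow> bit" where
  "conf M D w e = (if inner_edge D e then of_bool (w e) else of_int (lam M (boundary_of_edge M D e)))"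

text \<open>The coboundary of the cochain \<open>c\<close>, evaluated on the face
  \<open>f\<close>.\<close>

definition face_parity :: "'p mplcw \<Rightarrow> (nat \<Rightarrow> bit) \<Rightarrow> nat \<Rightarrow> bit" where
  "face_parity D c f = (\<Sum>k\<in>{1..nsides D f}. c (side_edge D (f, k)))"

text \<open>The three sums are the contributions of the Nakayama automorphisms, of the reordering of the inputs, and of the
  reordering of the factors attached to the edges into those attached to the sides of the faces.\<close>

definition sign_exponent :: "('p, 'q) rspin_surface \<Rightarrow> 'p mplcw \<Rightarrow> (nat \<Rightarrow> bit) \<Rightarrow> bit" where
  "sign_exponent M D c =
     (\<Sum>e\<in>edges D. c e * (of_int (eidx D e) + 1)) +
     (\<Sum>i\<in>{1..nin M}. \<Sum>j\<in>{1..nin M}. of_bool (i < j) * of_bool (bedge M D j < bedge M D i) *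
        of_int (lam M i) * of_int (lam M j)) +
     (\<Sum>x\<in>sides D. \<Sum>y\<in>sides D. of_bool (label_less (side_label D x) (side_label D y)) *
        of_bool (side_less y x) * c (side_edge D x) * c (side_edge D y))"

lemma theta_pow_apply: "theta_pow n b = (if b = odd n then 1 else 0)"
  by (auto simp: theta_pow_def basis_vec_def)

lemma prod_indicator:
  assumes "finite A"
  shows "(\<Prod>x\<in>A. if P x then 1 else (0::'k::field)) = (if \<forall>x\<in>A. P x then 1 else 0)"
  using assms by (auto intro: prod_zero)

lemma side_label_eq: "side_label D x = (side_edge D x, side_dir D x)"
  by (simp add: side_label_def)

lemma of_nat_of_bool_bit: "of_nat (of_bool b) = (of_bool b :: bit)"
  by (cases b) simp_all

text \<open>All factors are monomial in the basis. The input fixes \<open>i\<close>; the window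
  element is 1 and forces \<open>y = z\<close>; an edge forces equal values on its two sides or the
  value of its input; a face gives 2 or 0. There remains one free value for each inner edge, with a
  factor 1/2 from the coproduct.\<close>

lemma state_sum_clifford:
  fixes M :: "('p, 'q) rspin_surface"
  assumes k: "(2::'k::field) \<noteq> 0" and M: "rspin r M" and pl: "plcw M D"
  shows "state_sum clifford M D V (\<lambda>i. \<Prod>j=1..nin M. theta_pow (lam M j) (i j)) =
    (\<Sum>w\<in>inner_edges D \<rightarrow>\<^sub>E UNIV.
      if \<forall>f\<in>faces D. face_parity D (conf M D w) f = 0
      then 2 ^ card (faces D) * (1 / 2) ^ card (inner_edges D) * bsign (sign_exponent M D (conf M D w)) else (0::'k))"
proof -
  let ?C = "clifford :: (bool, 'k) frobenius"
  note c = plcw_D(1)[OF pl] and g = plcw_D(2)[OF pl]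
  define A where "A = attached D"
  define Y where "Y = (A \<rightarrow>\<^sub>E (UNIV :: bool set))"
  define I where "I = ({1..nin M} \<rightarrow>\<^sub>E (UNIV :: bool set))"
  have A: "finite A"
    unfolding A_def by (rule finite_attached[OF c])
  have Y: "finite Y"
    unfolding Y_def using A by (intro finite_PiE) auto
  have I: "finite I"
    unfolding I_def by (intro finite_PiE) auto
  define i0 where "i0 = restrict (\<lambda>j. odd (lam M j)) {1..nin M}"
  have i0: "i0 \<in> I"
    by (simp add: i0_def I_def)
  have T: "(\<Prod>j=1..nin M. theta_pow (lam M j) (i j)) = (if i = i0 then 1 else (0::'k))" if "i \<in> I" for i
  proof -
    have "(\<Prod>j=1..nin M. theta_pow (lam M j) (i j)) = (if \<forall>j\<in>{1..nin M}. i j = odd (lam M j) then 1 else (0::'k))"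
      unfolding theta_pow_apply by (rule prod_indicator) simp
    moreover have "(\<forall>j\<in>{1..nin M}. i j = odd (lam M j)) \<longleftrightarrow> i = i0"
    proof
      assume "\<forall>j\<in>{1..nin M}. i j = odd (lam M j)"
      then show "i = i0"
        by (intro PiE_ext[OF that[unfolded I_def] i0[unfolded I_def]]) (simp add: i0_def)
    qed (simp add: i0_def)
    ultimately show ?thesis by simp
  qed
  have vf: "(\<Prod>x\<in>A. vertex_factor ?C D V y z x) = (if y = z then 1 else (0::'k))"
    if "y \<in> Y" "z \<in> Y" for y z
  proof -
    have "(\<Prod>x\<in>A. vertex_factor ?C D V y z x) = (if \<forall>x\<in>A. y x = z x then 1 else (0::'k))"
      unfolding vertex_factor_clifford[OF k] by (rule prod_indicator[OF A])
    moreover have "(\<forall>x\<in>A. y x = z x) \<longleftrightarrow> y = z"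
      using PiE_ext[OF that[unfolded Y_def]] by blast
    ultimately show ?thesis by simp
  qed
  define K1 :: 'k where "K1 = koszul (parity ?C \<circ> i0) [1..<Suc (nin M)] (in_list M D)"
  define K2 :: "(nat \<times> bool \<Rightarrow> bool) \<Rightarrow> 'k" where
    "K2 = (\<lambda>y. koszul (parity ?C \<circ> y) (E_list D) (concat (map (face_labels D) (face_list D))))"
  define EF :: "(nat \<times> bool \<Rightarrow> bool) \<Rightarrow> 'k" where "EF = (\<lambda>y. \<Prod>e\<in>edges D. edge_factor ?C M D i0 y e)"
  define FF :: "(nat \<times> bool \<Rightarrow> bool) \<Rightarrow> 'k" where "FF = (\<lambda>y. \<Prod>f\<in>faces D. face_factor ?C D y f)"
  have "state_sum clifford M D V (\<lambda>i. \<Prod>j=1..nin M. theta_pow (lam M j) (i j)) =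
    (\<Sum>i\<in>I. \<Sum>y\<in>Y. \<Sum>z\<in>Y.
        (if i = i0 then 1 else 0) * koszul (parity ?C \<circ> i) [1..<Suc (nin M)] (in_list M D) *
        (\<Prod>e\<in>edges D. edge_factor ?C M D i y e) * (if y = z then 1 else 0) * K2 z * FF z)"
    unfolding state_sum_def A_def[symmetric] I_def[symmetric] Y_def[symmetric] K2_def FF_def
    by (intro sum.cong refl arg_cong2[of _ _ _ _ "(*)"] T vf)
  also have "\<dots> = (\<Sum>i\<in>I. if i = i0 then \<Sum>y\<in>Y. K1 * EF y * K2 y * FF y else 0)"
  proof (rule sum.cong[OF refl])
    fix i assume "i \<in> I"
    show "(\<Sum>y\<in>Y. \<Sum>z\<in>Y.
        (if i = i0 then 1 else 0) * koszul (parity ?C \<circ> i) [1..<Suc (nin M)] (in_list M D) *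
        (\<Prod>e\<in>edges D. edge_factor ?C M D i y e) * (if y = z then 1 else 0) * K2 z * FF z) =
      (if i = i0 then \<Sum>y\<in>Y. K1 * EF y * K2 y * FF y else 0)"
    proof (cases "i = i0")
      case True
      have "(\<Sum>z\<in>Y. K1 * EF y * (if y = z then 1 else 0) * K2 z * FF z) = K1 * EF y * K2 y * FF y" if "y \<in> Y" for y
      proof -
        have "(\<Sum>z\<in>Y. K1 * EF y * (if y = z then 1 else 0) * K2 z * FF z) =
            (\<Sum>z\<in>Y. if y = z then K1 * EF y * K2 z * FF z else 0)"
          by (intro sum.cong) auto
        then show ?thesis
          using Y that by simp
      qed
      moreover have "EF y = (\<Prod>e\<in>edges D. edge_factor ?C M D i0 y e)" for y
        by (simp add: EF_def)
      ultimately show ?thesis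
        unfolding True by (simp only: simp_thms if_True mult_1 K1_def cong: sum.cong)
    qed (simp del: upt_Suc)
  qed
  also have "\<dots> = (\<Sum>y\<in>Y. K1 * EF y * K2 y * FF y)"
    using I i0 by simp
  \<comment> \<open>An assignment that violates the condition at some edge has a vanishing edge
    factor.\<close>
  also have "\<dots> = (\<Sum>y\<in>Y. if \<forall>e\<in>edges D. (if inner_edge D e then y (e, True) = y (e, False)
        else i0 (boundary_of_edge M D e) = y (e, True)) then K1 * EF y * K2 y * FF y else 0)"
  proof (rule sum.cong[OF refl])
    fix y
    show "K1 * EF y * K2 y * FF y = (if \<forall>e\<in>edges D. (if inner_edge D e then y (e, True) = y (e, False)
        else i0 (boundary_of_edge M D e) = y (e, True)) then K1 * EF y * K2 y * FF y else 0)"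
    proof (cases "\<forall>e\<in>edges D. (if inner_edge D e then y (e, True) = y (e, False)
        else i0 (boundary_of_edge M D e) = y (e, True))")
      case False
      then obtain e where e: "e \<in> edges D" "\<not> (if inner_edge D e then y (e, True) = y (e, False)
        else i0 (boundary_of_edge M D e) = y (e, True))"
        by blast
      have "edge_factor ?C M D i0 y e = 0"
        unfolding edge_factor_clifford[OF k] using e(2) by (simp split: if_splits)
      then have "EF y = 0"
        unfolding EF_def using plcw_cells_D(2)[OF c] e(1) by (intro prod_zero) auto
      then show ?thesis by simp
    qed simp
  qed
  also have "\<dots> = (\<Sum>y\<in>{y \<in> Y. \<forall>e\<in>edges D. (if inner_edge D e then y (e, True) = y (e, False)
        else i0 (boundary_of_edge M D e) = y (e, True))}. K1 * EF y * K2 y * FF y)"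
    using Y by (simp only: sum.inter_filter)
  also have "\<dots> = (\<Sum>w\<in>inner_edges D \<rightarrow>\<^sub>E UNIV.
      if \<forall>f\<in>faces D. face_parity D (conf M D w) f = 0
      then 2 ^ card (faces D) * (1 / 2) ^ card (inner_edges D) * bsign (sign_exponent M D (conf M D w)) else (0::'k))"
  \<comment> \<open>Surviving assignments correspond to their values on the left copies of the inner
    edges.\<close>
  proof (rule sum.reindex_bij_witness[where
        j = "\<lambda>y. restrict (\<lambda>e. y (e, True)) (inner_edges D)" and
        i = "\<lambda>w. restrict (\<lambda>a. if inner_edge D (fst a) then w (fst a) else i0 (boundary_of_edge M D (fst a))) A"])
    fix y assume y: "y \<in> {y \<in> Y. \<forall>e\<in>edges D. (if inner_edge D e then y (e, True) = y (e, False)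
        else i0 (boundary_of_edge M D e) = y (e, True))}"
    let ?w = "restrict (\<lambda>e. y (e, True)) (inner_edges D)"
    have val: "y (e, d) = (if inner_edge D e then ?w e else i0 (boundary_of_edge M D e))" if "(e, d) \<in> A" for e d
    proof -
      have e: "e \<in> edges D"
        using attached_edge[OF g] that by (force simp: A_def)
      then have "if inner_edge D e then y (e, True) = y (e, False) else i0 (boundary_of_edge M D e) = y (e, True)"
        using y by blast
      moreover have "inner_edge D e \<or> d"
        using that attached_False_iff[OF g e] by (cases d) (auto simp: A_def)
      ultimately show ?thesis
        using e by (cases d) (auto simp: inner_edges_def split: if_splits)
    qed
    show "restrict (\<lambda>a. if inner_edge D (fst a) then ?w (fst a) else i0 (boundary_of_edge M D (fst a))) A = y"
    proof (rule PiE_ext)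
      show "y \<in> A \<rightarrow>\<^sub>E UNIV"
        using y by (simp add: Y_def)
    qed (use val in auto)
    show "?w \<in> inner_edges D \<rightarrow>\<^sub>E UNIV"
      by simp
    have lamj: "i0 (boundary_of_edge M D e) = odd (lam M (boundary_of_edge M D e))"
      if e: "e \<in> edges D" "\<not> inner_edge D e" for e
    proof -
      obtain j where "j \<in> {1..nin M}" "e = bedge M D j"
        by (rule non_inner_edge[OF M pl e])
      then show ?thesis
        by (simp add: boundary_of_bedge[OF M pl] i0_def)
    qed
    have cval: "of_bool (y (e, d)) = conf M D ?w e" if "(e, d) \<in> A" for e d
      using val[OF that] lamj[of e] attached_edge[OF g, of "(e, d)"] that
      by (auto simp: conf_def bit_of_int_odd A_def)
    have sval: "of_bool (y (side_label D x)) = conf M D ?w (side_edge D x)" if "x \<in> sides D" for x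
      using cval[of "side_edge D x" "side_dir D x"] that unfolding A_def attached_def side_label_eq by auto
    have FF: "FF y = (if \<forall>f\<in>faces D. face_parity D (conf M D ?w) f = 0 then 2 ^ card (faces D) else 0)"
    proof -
      have 1: "(\<Sum>x\<leftarrow>face_labels D f. of_bool (y x)) = face_parity D (conf M D ?w) f" if f: "f \<in> faces D" for f
      proof -
        have "(\<Sum>x\<leftarrow>face_labels D f. of_bool (y x) :: bit) = (\<Sum>k\<leftarrow>[1..<Suc (nsides D f)]. of_bool (y (side_label D (f, k))))"
          by (simp add: face_labels_def o_def del: upt_Suc)
        also have "\<dots> = (\<Sum>k\<in>{1..nsides D f}. of_bool (y (side_label D (f, k))))"
          by (simp only: interv_sum_list_conv_sum_set_nat set_upt atLeastLessThanSuc_atLeastAtMost)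
        also have "\<dots> = face_parity D (conf M D ?w) f"
          unfolding face_parity_def by (intro sum.cong refl sval) (use f in \<open>auto simp: sides_def\<close>)
        finally show ?thesis .
      qed
      have "FF y = (\<Prod>f\<in>faces D. 2 * (if face_parity D (conf M D ?w) f = 0 then 1 else 0))"
        unfolding FF_def by (intro prod.cong refl)
          (simp add: face_factor_clifford[OF plcw_cells_D(3)[OF c]] 1)
      also have "\<dots> = 2 ^ card (faces D) * (\<Prod>f\<in>faces D. if face_parity D (conf M D ?w) f = 0 then 1 else 0)"
        by (simp only: prod.distrib prod_constant)
      finally show ?thesis
        unfolding prod_indicator[OF plcw_cells_D(1)[OF c]] by simp
    qed
    have EF: "EF y = (1 / 2) ^ card (inner_edges D) * bsign (\<Sum>e\<in>edges D. conf M D ?w e * (of_int (eidx D e) + 1))"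
    proof -
      have "edge_factor ?C M D i0 y e =
          (if inner_edge D e then 1 / 2 else 1) * (bsign (conf M D ?w e * (of_int (eidx D e) + 1)) :: 'k)" if e: "e \<in> edges D" for e
      proof -
        have "if inner_edge D e then y (e, True) = y (e, False) else i0 (boundary_of_edge M D e) = y (e, True)"
          using y e by blast
        moreover have "of_bool (y (e, True)) = conf M D ?w e"
          by (rule cval) (simp add: A_def attached_True[OF g e])
        ultimately show ?thesis
          unfolding edge_factor_clifford[OF k] by (cases "inner_edge D e") simp_all
      qed
      then have "EF y = (\<Prod>e\<in>edges D. (if inner_edge D e then 1 / 2 else 1) * bsign (conf M D ?w e * (of_int (eidx D e) + 1)))"
        unfolding EF_def by (intro prod.cong refl)
      moreover have "(\<Prod>e\<in>edges D. if inner_edge D e then 1 / 2 else (1::'k)) = (1 / 2) ^ card (inner_edges D)"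
        using plcw_cells_D(2)[OF c] by (simp only: inner_edges_def prod.inter_filter[symmetric] prod_constant)
      ultimately show ?thesis
        by (simp only: prod.distrib bsign_sum)
    qed
    have K1: "K1 = bsign (\<Sum>i\<in>{1..nin M}. \<Sum>j\<in>{1..nin M}. of_bool (i < j) * of_bool (bedge M D j < bedge M D i) *
        of_int (lam M i) * of_int (lam M j))"
      unfolding K1_def koszul_in_list[OF M pl]
      by (intro arg_cong[of _ _ bsign] sum.cong refl) (simp add: i0_def of_nat_of_bool_bit bit_of_int_odd)
    have K2: "K2 y = bsign (\<Sum>x\<in>sides D. \<Sum>y\<in>sides D. of_bool (label_less (side_label D x) (side_label D y)) *
        of_bool (side_less y x) * conf M D ?w (side_edge D x) * conf M D ?w (side_edge D y))"
      unfolding K2_def koszul_faces[OF pl]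
      by (intro arg_cong[of _ _ bsign] sum.cong refl) (simp add: of_nat_of_bool_bit sval)
    show "(if \<forall>f\<in>faces D. face_parity D (conf M D ?w) f = 0
      then 2 ^ card (faces D) * (1 / 2) ^ card (inner_edges D) * bsign (sign_exponent M D (conf M D ?w)) else (0::'k)) =
      K1 * EF y * K2 y * FF y"
      unfolding FF EF K1 K2 sign_exponent_def bsign_add by simp
  next
    fix w :: "nat \<Rightarrow> bool" assume w: "w \<in> inner_edges D \<rightarrow>\<^sub>E UNIV"
    let ?y = "restrict (\<lambda>a. if inner_edge D (fst a) then w (fst a) else i0 (boundary_of_edge M D (fst a))) A"
    show "restrict (\<lambda>e. ?y (e, True)) (inner_edges D) = w"
    proof (rule PiE_ext[OF _ w])
      show "restrict (\<lambda>e. ?y (e, True)) (inner_edges D) e = w e" if "e \<in> inner_edges D" for e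
        using that attached_True[OF g] by (simp add: inner_edges_def A_def)
    qed simp
    show "?y \<in> {y \<in> Y. \<forall>e\<in>edges D. (if inner_edge D e then y (e, True) = y (e, False)
        else i0 (boundary_of_edge M D e) = y (e, True))}"
      using attached_True[OF g] by (auto simp: Y_def A_def inner_edge_def)
  qed
  finally show ?thesis .
qed

text \<open>Each factor is fixed by its idempotent; this puts the argument into the subspace on
  which \<open>state_sum_value\<close> determines \<open>Z\<close>.\<close>

lemma theta_state_in_state_space:
  assumes k: "(2::'k::field) \<noteq> 0"
  shows "(\<lambda>i. \<Prod>j=1..nin M. theta_pow (lam M j) (i j)) \<in> state_space (clifford :: (bool, 'k) frobenius) M"
proof -
  define J where "J = {1..nin M}"
  have ind: "(\<Prod>j\<in>J. theta_pow (lam M j) (i j)) = (if \<forall>j\<in>J. i j = odd (lam M j) then 1 else (0::'k))" for i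
    unfolding theta_pow_apply by (rule prod_indicator) (simp add: J_def)
  have "(\<Prod>j\<in>J. theta_pow (lam M j) (i j)) = (\<Sum>i'\<in>J \<rightarrow>\<^sub>E UNIV. (\<Prod>j\<in>J. theta_pow (lam M j) (i' j)) *
      (\<Prod>j\<in>J. proj_lambda (clifford :: (bool, 'k) frobenius) (lam M j) (basis_vec (i' j)) (i j)))"
    if i: "i \<in> J \<rightarrow>\<^sub>E UNIV" for i
  proof -
    have pr: "(\<Prod>j\<in>J. proj_lambda (clifford :: (bool, 'k) frobenius) (lam M j) (basis_vec (i' j)) (i j)) =
        (if \<forall>j\<in>J. i j = i' j \<and> i' j = odd (lam M j) then 1 else 0)" for i'
      unfolding proj_lambda_clifford[OF k] by (rule prod_indicator) (simp add: J_def)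
    have "(\<Sum>i'\<in>J \<rightarrow>\<^sub>E UNIV. (\<Prod>j\<in>J. theta_pow (lam M j) (i' j)) *
      (\<Prod>j\<in>J. proj_lambda (clifford :: (bool, 'k) frobenius) (lam M j) (basis_vec (i' j)) (i j))) =
      (\<Sum>i'\<in>J \<rightarrow>\<^sub>E UNIV. if i' = i then (\<Prod>j\<in>J. theta_pow (lam M j) (i j)) else 0)"
    proof (rule sum.cong[OF refl])
      fix i' assume i': "i' \<in> J \<rightarrow>\<^sub>E (UNIV :: bool set)"
      have "i' = i" if "\<forall>j\<in>J. i j = i' j"
        by (rule PiE_ext[OF i' i]) (use that in auto)
      then show "(\<Prod>j\<in>J. theta_pow (lam M j) (i' j)) *
          (\<Prod>j\<in>J. proj_lambda (clifford :: (bool, 'k) frobenius) (lam M j) (basis_vec (i' j)) (i j)) =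
          (if i' = i then (\<Prod>j\<in>J. theta_pow (lam M j) (i j)) else 0)"
        unfolding pr ind by auto
    qed
    also have "\<dots> = (\<Prod>j\<in>J. theta_pow (lam M j) (i j))"
      using i by (subst sum.delta) (auto simp: J_def intro!: finite_PiE)
    finally show ?thesis ..
  qed
  then show ?thesis
    unfolding state_space_def J_def by blast
qed

text \<open>Every edge is attached on its left, so a vertex can use the left copy of any edge ending
  there. A choice is required to instantiate \<open>state_sum_value\<close>.\<close>

lemma vertex_choice_exists:
  assumes "plcw M D"
  shows "\<exists>V. vertex_choice D V"
proof -
  have "\<forall>v\<in>verts D. \<exists>a. a \<in> attached D \<and> v \<in> {emap D (fst a) 0, emap D (fst a) 1}"
  proof
    fix v assume "v \<in> verts D"
    then obtain e where "e \<in> edges D" "v \<in> {emap D e 0, emap D e 1}"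
      by (auto simp: verts_def)
    then show "\<exists>a. a \<in> attached D \<and> v \<in> {emap D (fst a) 0, emap D (fst a) 1}"
      using attached_True[OF plcw_D(2)[OF assms]] by (intro exI[of _ "(e, True)"]) simp
  qed
  then obtain V where "\<forall>v\<in>verts D. V v \<in> attached D \<and> v \<in> {emap D (fst (V v)) 0, emap D (fst (V v)) 1}"
    by metis
  then show ?thesis
    unfolding vertex_choice_def by blast
qed

lemma state_sum_value_clifford:
  fixes M :: "('p, 'q) rspin_surface" and Z :: "((nat \<Rightarrow> bool) \<Rightarrow> 'k::field) \<Rightarrow> 'k"
  assumes k: "(2::'k) \<noteq> 0" and M: "rspin r M"
    and Z: "state_sum_value r (clifford :: (bool, 'k) frobenius) M Z" and D: "presents r M D"
  shows "Z (\<lambda>i. \<Prod>j=1..nin M. theta_pow (lam M j) (i j)) =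
    (\<Sum>w\<in>inner_edges D \<rightarrow>\<^sub>E UNIV.
      if \<forall>f\<in>faces D. face_parity D (conf M D w) f = 0
      then 2 ^ card (faces D) * (1 / 2) ^ card (inner_edges D) * bsign (sign_exponent M D (conf M D w)) else 0)"
proof -
  note pl = presents_D(3)[OF D]
  obtain V where V: "vertex_choice D V"
    using vertex_choice_exists[OF pl] by blast
  have "Z (\<lambda>i. \<Prod>j=1..nin M. theta_pow (lam M j) (i j)) =
      state_sum clifford M D V (\<lambda>i. \<Prod>j=1..nin M. theta_pow (lam M j) (i j))"
    using Z D V theta_state_in_state_space[OF k, of M] unfolding state_sum_value_def by blast
  then show ?thesis
    unfolding state_sum_clifford[OF k M pl] .
qed

section \<open>The sign exponent sorted by edges\<close>

definition lt :: "nat \<times> nat \<Rightarrow> nat \<times> nat \<Rightarrow> bit" where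
  "lt x y = of_bool (side_less x y)"

lemma lt_self [simp]: "lt x x = 0"
  by (simp add: lt_def side_less_def)

lemma lt_flip: "x \<noteq> y \<Longrightarrow> lt y x = lt x y + 1"
  by (auto simp: lt_def side_less_def prod_eq_iff)

definition edge_dirs :: "'p mplcw \<Rightarrow> nat \<Rightarrow> bool set" where
  "edge_dirs D e = (if inner_edge D e then {True, False} else {True})"

text \<open>The number modulo 2 of pairs of sides for which the side of \<open>e'\<close> comes
  first. For two inner edges on a single face this is the linking of their pairs of sides.\<close>

definition edge_order :: "'p mplcw \<Rightarrow> nat \<Rightarrow> nat \<Rightarrow> bit" where
  "edge_order D e e' = (\<Sum>d\<in>edge_dirs D e. \<Sum>d'\<in>edge_dirs D e'. lt (side_of D (e', d')) (side_of D (e, d)))"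

lemma attached_eq_Sigma:
  assumes "plcw_gluing M D"
  shows "attached D = (SIGMA e:edges D. edge_dirs D e)"
proof (rule set_eqI)
  fix a :: "nat \<times> bool"
  obtain e d where a: "a = (e, d)" by fastforce
  show "a \<in> attached D \<longleftrightarrow> a \<in> (SIGMA e:edges D. edge_dirs D e)"
  proof (cases "e \<in> edges D")
    case True
    then show ?thesis
      using attached_True[OF assms True] attached_False_iff[OF assms True] by (cases d) (simp_all add: a edge_dirs_def)
  next
    case False
    then have "a \<notin> attached D"
      using attached_edge[OF assms, of a] by (auto simp: a)
    with False show ?thesis
      by (simp add: a)
  qed
qed

lemma side_of_inverse:
  assumes "a \<in> attached D"
  shows "side_of D a \<in> sides D" "side_label D (side_of D a) = a"
  using assms unfolding side_of_def attached_def by (auto intro: inv_into_into f_inv_into_f)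

lemma side_of_D:
  assumes "plcw_gluing M D" "e \<in> edges D" "d \<in> edge_dirs D e"
  shows "side_of D (e, d) \<in> sides D" "side_edge D (side_of D (e, d)) = e" "side_dir D (side_of D (e, d)) = d"
proof -
  have "(e, d) \<in> attached D"
    using assms attached_eq_Sigma[OF assms(1)] by auto
  from side_of_inverse[OF this] show "side_of D (e, d) \<in> sides D" "side_edge D (side_of D (e, d)) = e"
    "side_dir D (side_of D (e, d)) = d"
    by (simp_all add: side_label_def)
qed

lemma finite_edge_dirs [simp]: "finite (edge_dirs D e)"
  by (simp add: edge_dirs_def)

lemma sum_sides:
  assumes "plcw M D"
  shows "(\<Sum>x\<in>sides D. F x) = (\<Sum>e\<in>edges D. \<Sum>d\<in>edge_dirs D e. F (side_of D (e, d)))"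
proof -
  note g = plcw_D(2)[OF assms]
  have "(\<Sum>x\<in>sides D. F x) = (\<Sum>x\<in>sides D. F (side_of D (side_label D x)))"
    by (intro sum.cong refl) (simp add: side_of_label[OF g])
  also have "\<dots> = (\<Sum>a\<in>attached D. F (side_of D a))"
    by (rule sum_attached[OF g, symmetric])
  also have "\<dots> = (\<Sum>e\<in>edges D. \<Sum>d\<in>edge_dirs D e. F (side_of D (e, d)))"
    unfolding attached_eq_Sigma[OF g]
    by (subst sum.Sigma) (auto simp: plcw_cells_D(2)[OF plcw_D(1)[OF assms]] split_def)
  finally show ?thesis .
qed

text \<open>Every pair of sides is counted in exactly one of the two orders, and the number of pairs
  is odd only if each edge has a single side.\<close>

lemma edge_order_flip:
  assumes "plcw_gluing M D" "e \<in> edges D" "e' \<in> edges D" "e \<noteq> e'"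
  shows "edge_order D e' e = edge_order D e e' + of_bool (\<not> inner_edge D e \<and> \<not> inner_edge D e')"
proof -
  have ne: "side_of D (e, d) \<noteq> side_of D (e', d')" if "d \<in> edge_dirs D e" "d' \<in> edge_dirs D e'" for d d'
    using side_of_D(2)[OF assms(1,2) that(1)] side_of_D(2)[OF assms(1,3) that(2)] assms(4) by metis
  have "edge_order D e' e = (\<Sum>d'\<in>edge_dirs D e'. \<Sum>d\<in>edge_dirs D e. lt (side_of D (e', d')) (side_of D (e, d)) + 1)"
    unfolding edge_order_def by (intro sum.cong refl lt_flip ne[symmetric, THEN not_sym] ) (metis ne)+
  also have "\<dots> = edge_order D e e' + (\<Sum>d'\<in>edge_dirs D e'. \<Sum>d\<in>edge_dirs D e. 1)"
    unfolding edge_order_def by (subst (2) sum.swap) (simp add: sum.distrib)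
  also have "(\<Sum>d'\<in>edge_dirs D e'. \<Sum>d\<in>edge_dirs D e. 1) = (of_bool (\<not> inner_edge D e \<and> \<not> inner_edge D e') :: bit)"
    by (simp add: edge_dirs_def)
  finally show ?thesis .
qed

text \<open>Labels are ordered by edge number first, so different edges contribute if
  \<open>e < e'\<close>; the pair of sides of one inner edge yields the second sum, as squares in
  \<open>bit\<close> are linear.\<close>

lemma sign_exponent_edges:
  assumes M: "rspin r M" and pl: "plcw M D"
  shows "sign_exponent M D c =
     (\<Sum>e\<in>edges D. c e * (of_int (eidx D e) + 1)) +
     (\<Sum>e\<in>inner_edges D. c e * lt (side_of D (e, False)) (side_of D (e, True))) +
     (\<Sum>e\<in>edges D. \<Sum>e'\<in>edges D. of_bool (e < e') * c e * c e' * edge_order D e e') +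
     (\<Sum>i\<in>{1..nin M}. \<Sum>j\<in>{1..nin M}. of_bool (i < j) * of_bool (bedge M D j < bedge M D i) *
        of_int (lam M i) * of_int (lam M j))"
proof -
  note g = plcw_D(2)[OF pl]
  have fin: "finite (edges D)"
    by (rule plcw_cells_D(2)[OF plcw_D(1)[OF pl]])
  have cc: "c e * c e = c e" for e
    by (cases "c e") simp_all
  have "(\<Sum>x\<in>sides D. \<Sum>y\<in>sides D. of_bool (label_less (side_label D x) (side_label D y)) *
        of_bool (side_less y x) * c (side_edge D x) * c (side_edge D y)) =
    (\<Sum>e\<in>edges D. \<Sum>d\<in>edge_dirs D e. \<Sum>e'\<in>edges D. \<Sum>d'\<in>edge_dirs D e'.
        of_bool (label_less (e, d) (e', d')) * lt (side_of D (e', d')) (side_of D (e, d)) * c e * c e')"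
    unfolding sum_sides[OF pl]
    by (intro sum.cong refl) (simp add: side_label_def side_of_D[OF g] lt_def)
  also have "\<dots> = (\<Sum>e\<in>edges D. \<Sum>e'\<in>edges D. \<Sum>d\<in>edge_dirs D e. \<Sum>d'\<in>edge_dirs D e'.
        of_bool (label_less (e, d) (e', d')) * lt (side_of D (e', d')) (side_of D (e, d)) * c e * c e')"
    by (intro sum.cong refl sum.swap)
  also have "\<dots> = (\<Sum>e\<in>edges D. \<Sum>e'\<in>edges D. of_bool (e < e') * c e * c e' * edge_order D e e' +
      (if e' = e then of_bool (inner_edge D e) * c e * lt (side_of D (e, False)) (side_of D (e, True)) else 0))"
  proof (intro sum.cong refl)
    fix e e' assume e: "e \<in> edges D" "e' \<in> edges D"
    consider "e < e'" | "e' < e" | "e' = e" by linarith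
    then show "(\<Sum>d\<in>edge_dirs D e. \<Sum>d'\<in>edge_dirs D e'.
        of_bool (label_less (e, d) (e', d')) * lt (side_of D (e', d')) (side_of D (e, d)) * c e * c e') =
      of_bool (e < e') * c e * c e' * edge_order D e e' +
      (if e' = e then of_bool (inner_edge D e) * c e * lt (side_of D (e, False)) (side_of D (e, True)) else 0)"
    proof cases
      case 1
      then show ?thesis
        by (simp add: edge_order_def label_less_def sum_distrib_left sum_distrib_right mult_ac)
    next
      case 2
      then show ?thesis
        by (simp add: label_less_def)
    next
      case 3
      then show ?thesis
        using cc[of e] by (simp add: edge_dirs_def label_less_def mult.assoc)
    qed
  qed
  also have "\<dots> = (\<Sum>e\<in>edges D. \<Sum>e'\<in>edges D. of_bool (e < e') * c e * c e' * edge_order D e e') +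
      (\<Sum>e\<in>edges D. of_bool (inner_edge D e) * c e * lt (side_of D (e, False)) (side_of D (e, True)))"
    using fin by (simp add: sum.distrib)
  also have "(\<Sum>e\<in>edges D. of_bool (inner_edge D e) * c e * lt (side_of D (e, False)) (side_of D (e, True))) =
      (\<Sum>e\<in>inner_edges D. c e * lt (side_of D (e, False)) (side_of D (e, True)))"
    unfolding inner_edges_def using fin by (subst sum.inter_filter) (auto intro!: sum.cong)
  finally show ?thesis
    unfolding sign_exponent_def by (simp add: add_ac)
qed

section \<open>The standard polygon\<close>

locale standard_surface =
  fixes r g m f :: nat and M :: "('p, 'q) rspin_surface" and D :: "'p mplcw" and se te re :: "nat \<Rightarrow> nat"
  assumes r_even: "even r" and M: "rspin r M" and D: "presents r M D"
    and std: "standard_polygon M D f m g se te re" and gpos: "0 < g + nin M" and gen: "genus M g"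
begin

definition len :: nat where
  "len = 4 * g + 3 * nin M"

definition side :: "nat \<Rightarrow> nat \<times> nat" where
  "side p = (f, (m + p) mod len + 1)"

definition ed :: "nat \<Rightarrow> nat" where
  "ed p = side_edge D (side p)"

text \<open>Sides are located by their position counted from the side \<open>m + 1\<close>, where the word of the polygon starts. An inner
  edge is represented by the first of its two positions \<open>p\<close>, \<open>p + 2\<close>.\<close>

definition P_in :: "nat set" where
  "P_in = {p. p < 4 * g \<and> p mod 4 < 2 \<or> 4 * g \<le> p \<and> p < len \<and> (p - 4 * g) mod 3 = 0}"

definition P_bd :: "nat set" where
  "P_bd = {p. 4 * g \<le> p \<and> p < len \<and> (p - 4 * g) mod 3 = 1}"

lemma len_pos: "0 < len"
  using gpos by (auto simp: len_def)

lemmas pl = presents_D(3)[OF D]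
lemmas gl = presents_D(2)[OF D]
lemmas cells = presents_D(1)[OF D]

lemma std_expanded:
  "faces D = {f}" "nsides D f = len"
  "i \<in> {1..g} \<Longrightarrow> ed (4 * (i - 1)) = se i \<and> ed (4 * (i - 1) + 1) = te i \<and>
     ed (4 * (i - 1) + 2) = se i \<and> ed (4 * (i - 1) + 3) = te i"
  "j \<in> {1..nin M} \<Longrightarrow> ed (4 * g + 3 * (j - 1)) = re j \<and> side_dir D (side (4 * g + 3 * (j - 1))) \<and>
     ed (4 * g + 3 * (j - 1) + 1) = bedge M D j \<and>
     ed (4 * g + 3 * (j - 1) + 2) = re j \<and> \<not> side_dir D (side (4 * g + 3 * (j - 1) + 2))"
  using std unfolding standard_polygon_def Let_def ed_def side_def len_def by simp_all

lemma side_in_sides: "side p \<in> sides D"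
proof -
  have "(m + p) mod len < len"
    using len_pos by simp
  then show ?thesis
    by (simp add: sides_def side_def std_expanded(1,2))
qed

lemma side_inj: "p < len \<Longrightarrow> p' < len \<Longrightarrow> side p = side p' \<Longrightarrow> p = p'"
proof -
  assume p: "p < len" "p' < len" "side p = side p'"
  then have "[m + p = m + p'] (mod len)"
    by (simp add: side_def cong_def)
  then have "[p = p'] (mod len)"
    by (simp add: cong_add_lcancel_nat)
  then show "p = p'"
    using p by (simp add: cong_def)
qed

lemma sides_eq: "sides D = side ` {..<len}"
proof -
  have "card (side ` {..<len}) = len"
    using side_inj by (subst card_image) (auto simp: inj_on_def)
  moreover have "card (sides D) = len"
    by (simp add: sides_def std_expanded(1,2))
  moreover have "finite (sides D)"
    by (rule finite_sides[OF cells])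
  ultimately show ?thesis
    using side_in_sides by (metis card_subset_eq image_subsetI)
qed

lemma sides_three:
  assumes "x \<in> sides D" "y \<in> sides D" "z \<in> sides D" "side_edge D x = side_edge D y" "side_edge D x = side_edge D z"
  shows "x = y \<or> x = z \<or> y = z"
  using side_label_inj[OF gl assms(1,2)] side_label_inj[OF gl assms(1,3)] side_label_inj[OF gl assms(2,3)] assms(4,5)
  by metis

lemma two_sides_inner:
  assumes "x \<in> sides D" "y \<in> sides D" "x \<noteq> y" "side_edge D x = side_edge D y"
  shows "inner_edge D (side_edge D x)" "side_dir D x \<noteq> side_dir D y"
proof -
  show d: "side_dir D x \<noteq> side_dir D y"
    using side_label_inj[OF gl assms(1,2)] assms(3,4) by auto
  have "side_label D x \<in> attached D" "side_label D y \<in> attached D"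
    using assms by (auto simp: attached_def)
  then show "inner_edge D (side_edge D x)"
    using d assms(4) unfolding inner_edge_def side_label_def by (cases "side_dir D x"; cases "side_dir D y") auto
qed

lemma P_less: "p \<in> P_in \<union> P_bd \<Longrightarrow> p < len" "p \<in> P_in \<Longrightarrow> p + 2 < len"
proof -
  show "p \<in> P_in \<union> P_bd \<Longrightarrow> p < len"
    by (auto simp: P_in_def P_bd_def len_def)
  have "p + 2 < 4 * g + 3 * nin M" if "p < 4 * g" "p mod 4 < 2"
    using that by presburger
  moreover have "p + 2 < 4 * g + 3 * nin M" if "4 * g \<le> p" "p < 4 * g + 3 * nin M" "(p - 4 * g) mod 3 = 0"
    using that by presburger
  ultimately show "p \<in> P_in \<Longrightarrow> p + 2 < len"
    unfolding P_in_def len_def mem_Collect_eq by (elim disjE conjE) simp_all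
qed

lemma P_handle:
  assumes "p < 4 * g"
  obtains i where "i \<in> {1..g}" "p = 4 * (i - 1) + p mod 4"
proof (rule that[of "p div 4 + 1"])
  have "p div 4 < g"
    using assms by (simp add: div_less_iff_less_mult)
  then show "p div 4 + 1 \<in> {1..g}" by simp
qed simp

lemma P_hole:
  assumes "4 * g \<le> p" "p < len"
  obtains j where "j \<in> {1..nin M}" "p = 4 * g + 3 * (j - 1) + (p - 4 * g) mod 3"
proof (rule that[of "(p - 4 * g) div 3 + 1"])
  have "(p - 4 * g) div 3 < nin M"
    using assms by (simp add: len_def div_less_iff_less_mult)
  then show "(p - 4 * g) div 3 + 1 \<in> {1..nin M}" by simp
  show "p = 4 * g + 3 * ((p - 4 * g) div 3 + 1 - 1) + (p - 4 * g) mod 3"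
    using assms by simp
qed

lemma ed_second:
  assumes "p \<in> P_in"
  shows "ed (p + 2) = ed p"
proof (cases "p < 4 * g")
  case True
  then have "p mod 4 < 2"
    using assms by (simp add: P_in_def)
  obtain i where i: "i \<in> {1..g}" "p = 4 * (i - 1) + p mod 4"
    using P_handle[OF True] .
  consider "p mod 4 = 0" | "p mod 4 = 1"
    using \<open>p mod 4 < 2\<close> by linarith
  then show ?thesis
  proof cases
    case 1
    then have "p = 4 * (i - 1)" "p + 2 = 4 * (i - 1) + 2"
      using i(2) by linarith+
    then show ?thesis
      using std_expanded(3)[OF i(1)] by metis
  next
    case 2
    then have "p = 4 * (i - 1) + 1" "p + 2 = 4 * (i - 1) + 3"
      using i(2) by linarith+
    then show ?thesis
      using std_expanded(3)[OF i(1)] by metis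
  qed
next
  case False
  then have p: "4 * g \<le> p" "p < len" "(p - 4 * g) mod 3 = 0"
    using assms by (auto simp: P_in_def)
  obtain j where j: "j \<in> {1..nin M}" "p = 4 * g + 3 * (j - 1) + (p - 4 * g) mod 3"
    using P_hole[OF p(1,2)] .
  then have "p = 4 * g + 3 * (j - 1)"
    using p(3) by linarith
  then show ?thesis
    using std_expanded(4)[OF j(1)] by metis
qed

lemma bd_index:
  "P_bd = (\<lambda>j. 4 * g + 3 * (j - 1) + 1) ` {1..nin M}"
proof
  show "P_bd \<subseteq> (\<lambda>j. 4 * g + 3 * (j - 1) + 1) ` {1..nin M}"
  proof
    fix p assume "p \<in> P_bd"
    then have p: "4 * g \<le> p" "p < len" "(p - 4 * g) mod 3 = 1"
      by (auto simp: P_bd_def)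
    obtain j where "j \<in> {1..nin M}" "p = 4 * g + 3 * (j - 1) + (p - 4 * g) mod 3"
      using P_hole[OF p(1,2)] .
    then show "p \<in> (\<lambda>j. 4 * g + 3 * (j - 1) + 1) ` {1..nin M}"
      using p(3) by auto
  qed
  show "(\<lambda>j. 4 * g + 3 * (j - 1) + 1) ` {1..nin M} \<subseteq> P_bd"
    by (auto simp: P_bd_def len_def)
qed

lemma ed_bd: "j \<in> {1..nin M} \<Longrightarrow> ed (4 * g + 3 * (j - 1) + 1) = bedge M D j"
  using std_expanded(4) by blast

lemma ed_inner:
  assumes "p \<in> P_in"
  shows "inner_edge D (ed p)" "side_dir D (side p) \<noteq> side_dir D (side (p + 2))"
proof -
  have "side p \<noteq> side (p + 2)"
    using side_inj[of p "p + 2"] P_less[of p] assms by auto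
  moreover have "side_edge D (side p) = side_edge D (side (p + 2))"
    using ed_second[OF assms] by (simp add: ed_def)
  ultimately show "inner_edge D (ed p)" "side_dir D (side p) \<noteq> side_dir D (side (p + 2))"
    unfolding ed_def using two_sides_inner[OF side_in_sides side_in_sides] by blast+
qed

lemma ed_not_inner: "p \<in> P_bd \<Longrightarrow> \<not> inner_edge D (ed p)"
  unfolding bd_index using ed_bd bedge_attached(4)[OF M pl] by auto

lemma P_disjoint: "P_in \<inter> P_bd = {}"
  by (auto simp: P_in_def P_bd_def)

lemma second_not_P: "p \<in> P_in \<Longrightarrow> p + 2 \<notin> P_in \<union> P_bd"
proof -
  have "\<not> (p + 2) mod 4 < 2" "p + 2 < 4 * g" if "p < 4 * g" "p mod 4 < 2"
    using that by presburger+
  moreover have "(p + 2 - 4 * g) mod 3 = 2" "\<not> p + 2 < 4 * g" if p: "4 * g \<le> p" "(p - 4 * g) mod 3 = 0"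
  proof -
    define q where "q = p - 4 * g"
    have "q mod 3 = 0" "p + 2 - 4 * g = q + 2"
      using p by (simp_all add: q_def)
    then show "(p + 2 - 4 * g) mod 3 = 2" "\<not> p + 2 < 4 * g"
      using p(1) by (auto simp: mod_Suc)
  qed
  ultimately show "p \<in> P_in \<Longrightarrow> p + 2 \<notin> P_in \<union> P_bd"
    unfolding P_in_def P_bd_def by auto
qed

text \<open>An edge has at most two sides. Those of an inner edge are at \<open>p\<close> and
  \<open>p + 2\<close>, and \<open>p + 2\<close> is in neither index set; boundary edges are told
  apart by their boundary components.\<close>

lemma ed_inj: "inj_on ed (P_in \<union> P_bd)"
proof (rule inj_onI)
  fix p p' assume p: "p \<in> P_in \<union> P_bd" "p' \<in> P_in \<union> P_bd" "ed p = ed p'"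
  have in_in: "a = a'" if a: "a \<in> P_in" "a' \<in> P_in \<union> P_bd" "ed a = ed a'" for a a'
  proof (rule ccontr)
    assume "a \<noteq> a'"
    have "side a = side (a + 2) \<or> side a = side a' \<or> side (a + 2) = side a'"
      by (rule sides_three[OF side_in_sides side_in_sides side_in_sides])
        (use ed_second[OF a(1)] a(3) in \<open>simp_all add: ed_def\<close>)
    then have "a = a + 2 \<or> a = a' \<or> a + 2 = a'"
      using side_inj P_less a by (metis UnI1)
    then show False
      using \<open>a \<noteq> a'\<close> second_not_P[OF a(1)] a(2) by auto
  qed
  show "p = p'"
  proof (cases "p \<in> P_in \<or> p' \<in> P_in")
    case True
    then show ?thesis
      using in_in[of p p'] in_in[of p' p] p by auto
  next
    case False
    then have "p \<in> P_bd" "p' \<in> P_bd"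
      using p by auto
    then obtain j j' where "j \<in> {1..nin M}" "j' \<in> {1..nin M}" "p = 4 * g + 3 * (j - 1) + 1" "p' = 4 * g + 3 * (j' - 1) + 1"
      unfolding bd_index by blast
    then show ?thesis
      using p(3) ed_bd inj_onD[OF bedge_inj[OF M pl]] by metis
  qed
qed

lemma edges_eq: "edges D = ed ` (P_in \<union> P_bd)"
proof
  show "ed ` (P_in \<union> P_bd) \<subseteq> edges D"
    using side_edge_in_edges[OF gl side_in_sides] by (auto simp: ed_def)
  show "edges D \<subseteq> ed ` (P_in \<union> P_bd)"
  proof
    fix e assume "e \<in> edges D"
    then have "(e, True) \<in> attached D"
      by (rule attached_True[OF gl])
    then obtain p where p: "p < len" "e = ed p"
      unfolding attached_def sides_eq by (auto simp: ed_def side_label_def)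
    have "p \<in> P_in \<union> P_bd \<or> p - 2 \<in> P_in \<and> p = (p - 2) + 2"
    proof (cases "p < 4 * g")
      case True
      have "(p - 2) mod 4 < 2 \<and> p = (p - 2) + 2" if "\<not> p mod 4 < 2"
      proof -
        define c where "c = p mod 4 - 2"
        have "p mod 4 < 4" by simp
        then have p4: "p = 4 * (p div 4) + c + 2" and "c < 2"
          using that mult_div_mod_eq[of 4 p] by (simp_all add: c_def)
        obtain k where "p = 4 * k + c + 2"
          using p4 ..
        with \<open>c < 2\<close> show ?thesis by simp
      qed
      then have "p mod 4 < 2 \<or> (p - 2) mod 4 < 2 \<and> p = (p - 2) + 2"
        by blast
      then show ?thesis
        using True unfolding P_in_def by auto
    next
      case False
      define q where "q = p - 4 * g"
      have "(q - 2) mod 3 = 0 \<and> 2 \<le> q" if "q mod 3 = 2"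
      proof -
        have "q = 3 * (q div 3) + 2"
          using that mult_div_mod_eq[of 3 q] by simp
        then obtain k where "q = 3 * k + 2" ..
        then show ?thesis by simp
      qed
      moreover have "q mod 3 = 0 \<or> q mod 3 = 1 \<or> q mod 3 = 2"
        by linarith
      ultimately have "q mod 3 = 0 \<or> q mod 3 = 1 \<or> (q - 2) mod 3 = 0 \<and> 2 \<le> q"
        by blast
      moreover have "p - 2 - 4 * g = q - 2"
        by (simp add: q_def)
      ultimately show ?thesis
        using False p(1) unfolding P_in_def P_bd_def by (auto simp: q_def)
    qed
    then show "e \<in> ed ` (P_in \<union> P_bd)"
      using p(2) ed_second[of "p - 2"] by (metis UnI1 imageI)
  qed
qed

lemma inner_edges_eq: "inner_edges D = ed ` P_in"
  unfolding inner_edges_def edges_eq using ed_inner(1) ed_not_inner by auto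

lemma finite_P [simp]: "finite P_in" "finite P_bd"
  by (rule finite_subset[of _ "{..<len}"]; use P_less in auto)+

lemma sum_edges_P: "(\<Sum>e\<in>edges D. F e) = (\<Sum>p\<in>P_in. F (ed p)) + (\<Sum>p\<in>P_bd. F (ed p))"
  unfolding edges_eq using ed_inj P_disjoint by (simp add: sum.reindex sum.union_disjoint)

lemma sum_inner_edges_P: "(\<Sum>e\<in>inner_edges D. F e) = (\<Sum>p\<in>P_in. F (ed p))"
  unfolding inner_edges_eq using inj_on_subset[OF ed_inj, of P_in] by (simp add: sum.reindex)

lemma in_index: "P_in = (\<lambda>i. 4 * (i - 1)) ` {1..g} \<union> (\<lambda>i. 4 * (i - 1) + 1) ` {1..g} \<union> (\<lambda>j. 4 * g + 3 * (j - 1)) ` {1..nin M}"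
proof (rule set_eqI)
  fix p
  show "p \<in> P_in \<longleftrightarrow> p \<in> (\<lambda>i. 4 * (i - 1)) ` {1..g} \<union> (\<lambda>i. 4 * (i - 1) + 1) ` {1..g} \<union> (\<lambda>j. 4 * g + 3 * (j - 1)) ` {1..nin M}"
  proof
    assume p: "p \<in> P_in"
    show "p \<in> (\<lambda>i. 4 * (i - 1)) ` {1..g} \<union> (\<lambda>i. 4 * (i - 1) + 1) ` {1..g} \<union> (\<lambda>j. 4 * g + 3 * (j - 1)) ` {1..nin M}"
    proof (cases "p < 4 * g")
      case True
      obtain i where i: "i \<in> {1..g}" "p = 4 * (i - 1) + p mod 4"
        using P_handle[OF True] .
      have "p mod 4 = 0 \<or> p mod 4 = 1"
        using p True by (auto simp: P_in_def)
      then have "p = 4 * (i - 1) \<or> p = 4 * (i - 1) + 1"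
        using i(2) by linarith
      then show ?thesis
        using i(1) by blast
    next
      case False
      then have q: "4 * g \<le> p" "p < len" "(p - 4 * g) mod 3 = 0"
        using p by (auto simp: P_in_def)
      obtain j where "j \<in> {1..nin M}" "p = 4 * g + 3 * (j - 1) + (p - 4 * g) mod 3"
        using P_hole[OF q(1,2)] .
      then show ?thesis
        using q(3) by auto
    qed
  next
    assume "p \<in> (\<lambda>i. 4 * (i - 1)) ` {1..g} \<union> (\<lambda>i. 4 * (i - 1) + 1) ` {1..g} \<union> (\<lambda>j. 4 * g + 3 * (j - 1)) ` {1..nin M}"
    then consider i where "i \<in> {1..g}" "p = 4 * (i - 1)" | i where "i \<in> {1..g}" "p = 4 * (i - 1) + 1"
      | j where "j \<in> {1..nin M}" "p = 4 * g + 3 * (j - 1)"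
      by blast
    then show "p \<in> P_in"
    proof cases
      case 1
      then have "p < 4 * g" "p mod 4 = 0" by auto
      then show ?thesis by (simp add: P_in_def)
    next
      case 2
      then have "p < 4 * g" "p mod 4 = 1" by (auto simp: mod_Suc)
      then show ?thesis by (simp add: P_in_def)
    next
      case 3
      then have "4 * g \<le> p" "p < len" "(p - 4 * g) mod 3 = 0" by (auto simp: len_def)
      then show ?thesis by (simp add: P_in_def)
    qed
  qed
qed

lemma sum_P_in: "(\<Sum>p\<in>P_in. F p) =
    (\<Sum>i\<in>{1..g}. F (4 * (i - 1)) + F (4 * (i - 1) + 1)) + (\<Sum>j\<in>{1..nin M}. F (4 * g + 3 * (j - 1)))"
proof -
  have inj: "inj_on (\<lambda>i. 4 * (i - 1)) {1..g}" "inj_on (\<lambda>i. 4 * (i - 1) + 1) {1..g}" "inj_on (\<lambda>j. 4 * g + 3 * (j - 1)) {1..nin M}"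
    by (auto simp: inj_on_def)
  have d1: "(\<lambda>i. 4 * (i - 1)) ` {1..g} \<inter> (\<lambda>i. 4 * (i - 1) + 1) ` {1..g} = {}"
  proof -
    have "4 * a \<noteq> 4 * b + 1" for a b :: nat
      by presburger
    then show ?thesis by auto
  qed
  have "4 * (i - 1) + 1 < 4 * g" if "i \<in> {1..g}" for i
    using that by auto
  then have d2: "((\<lambda>i. 4 * (i - 1)) ` {1..g} \<union> (\<lambda>i. 4 * (i - 1) + 1) ` {1..g}) \<inter> (\<lambda>j. 4 * g + 3 * (j - 1)) ` {1..nin M} = {}"
    by fastforce
  show ?thesis
    unfolding in_index using d1 d2 inj by (simp add: sum.union_disjoint sum.reindex sum.distrib)
qed

lemma sum_P_bd: "(\<Sum>p\<in>P_bd. F p) = (\<Sum>j\<in>{1..nin M}. F (4 * g + 3 * (j - 1) + 1))"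
  unfolding bd_index by (subst sum.reindex) (auto simp: inj_on_def)

end

text \<open>The order of edges by number is exchanged for that by position. A pair on which the two
  orders disagree is counted with the arguments of \<open>G\<close> exchanged, which costs
  \<open>K\<close>.\<close>

lemma sum_pairs_reorder:
  fixes G K :: "nat \<Rightarrow> nat \<Rightarrow> bit" and u :: "nat \<Rightarrow> nat"
  assumes inj: "inj_on u P"
    and G: "\<And>p p'. p \<in> P \<Longrightarrow> p' \<in> P \<Longrightarrow> p < p' \<Longrightarrow> G p' p = G p p' + K p p'"
  shows "(\<Sum>p\<in>P. \<Sum>p'\<in>P. of_bool (u p < u p') * G p p') =
    (\<Sum>p\<in>P. \<Sum>p'\<in>P. of_bool (p < p') * G p p') + (\<Sum>p\<in>P. \<Sum>p'\<in>P. of_bool (p < p') * of_bool (u p' < u p) * K p p')"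
proof -
  have "(\<Sum>p\<in>P. \<Sum>p'\<in>P. of_bool (u p < u p') * G p p') =
      (\<Sum>p\<in>P. \<Sum>p'\<in>P. of_bool (p < p') * of_bool (u p < u p') * G p p') +
      (\<Sum>p\<in>P. \<Sum>p'\<in>P. of_bool (p' < p) * of_bool (u p < u p') * G p p')"
    unfolding sum.distrib[symmetric] by (intro sum.cong refl) auto
  also have "(\<Sum>p\<in>P. \<Sum>p'\<in>P. of_bool (p' < p) * of_bool (u p < u p') * G p p') =
      (\<Sum>p\<in>P. \<Sum>p'\<in>P. of_bool (p < p') * of_bool (u p' < u p) * G p' p)"
    by (rule sum.swap)
  also have "(\<Sum>p\<in>P. \<Sum>p'\<in>P. of_bool (p < p') * of_bool (u p < u p') * G p p') +
      (\<Sum>p\<in>P. \<Sum>p'\<in>P. of_bool (p < p') * of_bool (u p' < u p) * G p' p) =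
      (\<Sum>p\<in>P. \<Sum>p'\<in>P. of_bool (p < p') * G p p' + of_bool (p < p') * of_bool (u p' < u p) * K p p')"
    unfolding sum.distrib[symmetric]
  proof (intro sum.cong refl)
    fix p p' assume p: "p \<in> P" "p' \<in> P"
    show "of_bool (p < p') * of_bool (u p < u p') * G p p' + of_bool (p < p') * of_bool (u p' < u p) * G p' p =
      of_bool (p < p') * G p p' + of_bool (p < p') * of_bool (u p' < u p) * K p p'"
    proof (cases "p < p'")
      case True
      then have "u p \<noteq> u p'"
        using inj_onD[OF inj _ p] by auto
      then show ?thesis
        using True G[OF p True] by (cases "u p < u p'") auto
    qed simp
  qed
  finally show ?thesis
    by (simp only: sum.distrib)
qed

section \<open>Orders of sides and edges by position\<close>

context standard_surface
begin

text \<open>Counted from the side \<open>m + 1\<close>, the side at position \<open>p\<close> comes after the marked vertex.\<close>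

definition wr :: "nat \<Rightarrow> bit" where
  "wr p = of_bool (len \<le> m mod len + p)"

text \<open>For an inner edge this says whether the marked vertex lies between its two
  sides.\<close>

definition om :: "nat \<Rightarrow> bit" where
  "om p = (if p \<in> P_in then wr p + wr (p + 2) else wr p)"

abbreviation lamb :: "nat \<Rightarrow> bit" where
  "lamb j \<equiv> of_int (lam M j)"

text \<open>Sides are numbered from the marked one, positions from the side \<open>m + 1\<close>.
  The two orders are cyclic shifts of each other and disagree if just one of the two sides has
  wrapped around.\<close>

lemma lt_side:
  assumes "p < len" "p' < len"
  shows "lt (side p) (side p') = of_bool (p < p') + wr p + wr p'"
proof -
  define k where "k = m mod len"
  have k: "k < len"
    using len_pos by (simp add: k_def)
  have s: "side q = (f, (if k + q < len then k + q else k + q - len) + 1)" if "q < len" for q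
  proof -
    have "(m + q) mod len = (k + q) mod len"
      by (simp add: k_def mod_add_left_eq)
    also have "\<dots> = (if k + q < len then k + q else k + q - len)"
      using that k by (simp add: mod_if[of "k + q"])
    finally show ?thesis
      by (simp add: side_def)
  qed
  show ?thesis
    unfolding s[OF assms(1)] s[OF assms(2)] lt_def side_less_def wr_def k_def[symmetric] using assms k
    by (cases "k + p < len"; cases "k + p' < len") auto
qed

lemma sum_dirs_in:
  assumes "p \<in> P_in"
  shows "(\<Sum>d\<in>edge_dirs D (ed p). F (side_of D (ed p, d))) = F (side p) + (F (side (p + 2)) :: bit)"
proof -
  have "side_of D (ed p, side_dir D (side p)) = side p"
    using side_of_label[OF gl side_in_sides[of p]] by (simp add: side_label_def ed_def)
  moreover have "side_of D (ed p, side_dir D (side (p + 2))) = side (p + 2)"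
    using side_of_label[OF gl side_in_sides[of "p + 2"]] ed_second[OF assms] by (simp add: side_label_def ed_def)
  ultimately show ?thesis
    using ed_inner[OF assms] by (cases "side_dir D (side p)") (simp_all add: edge_dirs_def add.commute)
qed

lemma sum_dirs_bd:
  assumes "p \<in> P_bd"
  shows "(\<Sum>d\<in>edge_dirs D (ed p). F (side_of D (ed p, d))) = (F (side p) :: bit)"
proof -
  obtain j where j: "j \<in> {1..nin M}" "ed p = bedge M D j"
    using assms ed_bd unfolding bd_index by auto
  then have "side_dir D (side p)"
    using bedge_side_dir[OF M pl j(1) side_in_sides] by (simp add: ed_def)
  then have "side_of D (ed p, True) = side p"
    using side_of_label[OF gl side_in_sides[of p]] by (simp add: side_label_def ed_def)
  then show ?thesis
    using ed_not_inner[OF assms] by (simp add: edge_dirs_def)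
qed

text \<open>For two inner edges the wrap-around terms occur twice and cancel. The sides of an inner
  edge are two positions apart, so the first side of another edge can lie between them only at
  position \<open>p + 1\<close>.\<close>

lemma edge_order_ed:
  assumes "p \<in> P_in \<union> P_bd" "p' \<in> P_in \<union> P_bd" "p < p'"
  shows "edge_order D (ed p) (ed p') = of_bool (p' = p + 1) + of_bool (p' \<in> P_bd) * om p + of_bool (p \<in> P_bd) * om p'"
proof -
  have dist: "q \<notin> P_bd" if "q \<in> P_in" for q
    using P_disjoint that by blast
  have dist': "q \<notin> P_in" if "q \<in> P_bd" for q
    using P_disjoint that by blast
  consider "p \<in> P_in" "p' \<in> P_in" | "p \<in> P_in" "p' \<in> P_bd" | "p \<in> P_bd" "p' \<in> P_in" | "p \<in> P_bd" "p' \<in> P_bd"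
    using assms by blast
  then show ?thesis
  proof cases
    case 1
    note b = P_less(2)[OF 1(1)] P_less(2)[OF 1(2)]
    have "edge_order D (ed p) (ed p') = of_bool (p' < p + 2)"
      unfolding edge_order_def sum_dirs_in[OF 1(2), of "\<lambda>y. lt y x" for x]
        sum_dirs_in[OF 1(1), of "\<lambda>x. lt (side p') x + lt (side (p' + 2)) x"]
      using b assms(3) by (simp add: lt_side add_ac)
    moreover have "p' < p + 2 \<longleftrightarrow> p' = p + 1"
      using assms(3) by auto
    ultimately show ?thesis
      using dist[OF 1(1)] dist[OF 1(2)] by simp
  next
    case 2
    note b = P_less(2)[OF 2(1)] P_less(1)[of p', OF UnI2[OF 2(2)]]
    have "edge_order D (ed p) (ed p') = of_bool (p' < p + 2) + (wr p + wr (p + 2))"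
      unfolding edge_order_def sum_dirs_bd[OF 2(2), of "\<lambda>y. lt y x" for x]
        sum_dirs_in[OF 2(1), of "\<lambda>x. lt (side p') x"]
      using b assms(3) by (simp add: lt_side add_ac)
    moreover have "p' < p + 2 \<longleftrightarrow> p' = p + 1"
      using assms(3) by auto
    ultimately show ?thesis
      using dist[OF 2(1)] 2 by (simp add: om_def)
  next
    case 3
    note b = P_less(1)[of p, OF UnI2[OF 3(1)]] P_less(2)[OF 3(2)]
    have "edge_order D (ed p) (ed p') = wr p' + wr (p' + 2)"
      unfolding edge_order_def sum_dirs_in[OF 3(2), of "\<lambda>y. lt y x" for x]
        sum_dirs_bd[OF 3(1), of "\<lambda>x. lt (side p') x + lt (side (p' + 2)) x"]
      using b assms(3) by (simp add: lt_side add_ac)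
    moreover have "p' \<noteq> p + 1"
    proof
      assume a: "p' = p + 1"
      obtain j where j: "j \<in> {1..nin M}" "p = 4 * g + 3 * (j - 1) + 1"
        using 3(1) unfolding bd_index by blast
      then have "4 * g + 3 * (j - 1) \<in> P_in"
        unfolding in_index by blast
      moreover have "p' = 4 * g + 3 * (j - 1) + 2"
        using a j by simp
      ultimately show False
        using second_not_P 3(2) by blast
    qed
    ultimately show ?thesis
      using dist[OF 3(2)] 3 by (simp add: om_def)
  next
    case 4
    note b = P_less(1)[of p, OF UnI2[OF 4(1)]] P_less(1)[of p', OF UnI2[OF 4(2)]]
    have "edge_order D (ed p) (ed p') = wr p + wr p'"
      unfolding edge_order_def sum_dirs_bd[OF 4(2), of "\<lambda>y. lt y x" for x]
        sum_dirs_bd[OF 4(1), of "\<lambda>x. lt (side p') x"]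
      using b assms(3) by (simp add: lt_side add_ac)
    moreover have "p' \<noteq> p + 1"
      using 4 unfolding P_bd_def by (auto simp: mod_Suc Suc_diff_le)
    ultimately show ?thesis
      using dist'[OF 4(1)] dist'[OF 4(2)] 4 by (simp add: om_def)
  qed
qed

lemma sum_P_bd_indicator: "(\<Sum>p\<in>P_in \<union> P_bd. of_bool (p \<in> P_bd) * F p) = (\<Sum>p\<in>P_bd. (F p :: bit))"
proof -
  have "(\<Sum>p\<in>P_in \<union> P_bd. of_bool (p \<in> P_bd) * F p) = (\<Sum>p\<in>P_in \<union> P_bd. if p \<in> P_bd then F p else 0)"
    by (intro sum.cong) auto
  also have "\<dots> = (\<Sum>p\<in>P_bd. F p)"
    by (simp add: sum.If_cases Int_absorb1)
  finally show ?thesis .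
qed

text \<open>The correction for boundary edges reproduces the Koszul sign of the permutation of the
  inputs; the two cancel, and the numbering of the edges disappears from the pair terms.\<close>

lemma boundary_order_correction:
  fixes C :: "nat \<Rightarrow> bit"
  assumes "\<And>j. j \<in> {1..nin M} \<Longrightarrow> C (4 * g + 3 * (j - 1) + 1) = lamb j"
  shows "(\<Sum>p\<in>P_in \<union> P_bd. \<Sum>p'\<in>P_in \<union> P_bd. of_bool (p < p') * of_bool (ed p' < ed p) *
      (C p * C p' * (of_bool (p \<in> P_bd) * of_bool (p' \<in> P_bd)))) =
    (\<Sum>i\<in>{1..nin M}. \<Sum>j\<in>{1..nin M}. of_bool (i < j) * of_bool (bedge M D j < bedge M D i) * lamb i * lamb j)"
proof -
  have "(\<Sum>p\<in>P_in \<union> P_bd. \<Sum>p'\<in>P_in \<union> P_bd. of_bool (p < p') * of_bool (ed p' < ed p) *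
      (C p * C p' * (of_bool (p \<in> P_bd) * of_bool (p' \<in> P_bd)))) =
    (\<Sum>p\<in>P_in \<union> P_bd. of_bool (p \<in> P_bd) * (\<Sum>p'\<in>P_in \<union> P_bd. of_bool (p' \<in> P_bd) *
      (of_bool (p < p') * of_bool (ed p' < ed p) * C p * C p')))"
    unfolding sum_distrib_left by (intro sum.cong refl) (simp add: mult_ac)
  also have "\<dots> = (\<Sum>p\<in>P_bd. \<Sum>p'\<in>P_bd. of_bool (p < p') * of_bool (ed p' < ed p) * C p * C p')"
    unfolding sum_P_bd_indicator ..
  also have "\<dots> = (\<Sum>i\<in>{1..nin M}. \<Sum>j\<in>{1..nin M}. of_bool (i < j) * of_bool (bedge M D j < bedge M D i) * lamb i * lamb j)"
    unfolding sum_P_bd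
  proof (intro sum.cong refl)
    fix i j assume ij: "i \<in> {1..nin M}" "j \<in> {1..nin M}"
    then have "4 * g + 3 * (i - 1) + 1 < 4 * g + 3 * (j - 1) + 1 \<longleftrightarrow> i < j"
      by auto
    then show "of_bool (4 * g + 3 * (i - 1) + 1 < 4 * g + 3 * (j - 1) + 1) *
       of_bool (ed (4 * g + 3 * (j - 1) + 1) < ed (4 * g + 3 * (i - 1) + 1)) *
       C (4 * g + 3 * (i - 1) + 1) * C (4 * g + 3 * (j - 1) + 1) =
      of_bool (i < j) * of_bool (bedge M D j < bedge M D i) * lamb i * lamb j"
      unfolding ed_bd[OF ij(1)] ed_bd[OF ij(2)] assms[OF ij(1)] assms[OF ij(2)] by simp
  qed
  finally show ?thesis .
qed

text \<open>Boundary edges interact with all other edges through \<open>om\<close>, but these terms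
  have the common factor \<open>\<Sum>\<lambda>\<^sub>j = 0\<close>; only the missing diagonal
  remains, and gives \<open>wr\<close>.\<close>

lemma sign_exponent_positions:
  assumes c: "\<And>j. j \<in> {1..nin M} \<Longrightarrow> c (bedge M D j) = lamb j" and Lam: "(\<Sum>j\<in>{1..nin M}. lamb j) = 0"
  shows "sign_exponent M D c =
    (\<Sum>p\<in>P_in \<union> P_bd. c (ed p) * (of_int (eidx D (ed p)) + 1)) +
    (\<Sum>p\<in>P_in. c (ed p) * lt (side_of D (ed p, False)) (side_of D (ed p, True))) +
    (\<Sum>p\<in>P_in \<union> P_bd. c (ed p) * (if p + 1 \<in> P_in \<union> P_bd then c (ed (p + 1)) else 0)) +
    (\<Sum>p\<in>P_bd. c (ed p) * wr p)"
proof -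
  define P where "P = P_in \<union> P_bd"
  define C where "C = (\<lambda>p. c (ed p))"
  have fin: "finite P"
    by (simp add: P_def)
  have CC: "C p * C p = C p" for p
    by (cases "C p") simp_all
  have re: "(\<Sum>e\<in>edges D. F e) = (\<Sum>p\<in>P. F (ed p))" for F :: "nat \<Rightarrow> bit"
    unfolding edges_eq P_def by (rule sum.reindex_cong[OF ed_inj refl refl])
  have "(\<Sum>e\<in>edges D. \<Sum>e'\<in>edges D. of_bool (e < e') * c e * c e' * edge_order D e e') =
      (\<Sum>p\<in>P. \<Sum>p'\<in>P. of_bool (ed p < ed p') * (C p * C p' * edge_order D (ed p) (ed p')))"
    unfolding re C_def by (simp add: mult.assoc)
  also have "\<dots> = (\<Sum>p\<in>P. \<Sum>p'\<in>P. of_bool (p < p') * (C p * C p' * edge_order D (ed p) (ed p'))) +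
      (\<Sum>p\<in>P. \<Sum>p'\<in>P. of_bool (p < p') * of_bool (ed p' < ed p) * (C p * C p' * (of_bool (p \<in> P_bd) * of_bool (p' \<in> P_bd))))"
  proof (rule sum_pairs_reorder)
    show "inj_on ed P"
      unfolding P_def by (rule ed_inj)
    fix p p' assume p: "p \<in> P" "p' \<in> P" "p < p'"
    have "ed p \<noteq> ed p'"
      using inj_onD[OF ed_inj] p by (auto simp: P_def)
    moreover have "\<not> inner_edge D (ed q) \<longleftrightarrow> q \<in> P_bd" if "q \<in> P" for q
      using that ed_inner(1) ed_not_inner by (auto simp: P_def)
    moreover have "ed p \<in> edges D" "ed p' \<in> edges D"
      using p unfolding edges_eq P_def by blast+
    ultimately have "edge_order D (ed p') (ed p) = edge_order D (ed p) (ed p') + of_bool (p \<in> P_bd) * of_bool (p' \<in> P_bd)"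
      using edge_order_flip[OF gl, of "ed p" "ed p'"] p by (simp add: of_bool_conj)
    then show "C p' * C p * edge_order D (ed p') (ed p) =
        C p * C p' * edge_order D (ed p) (ed p') + C p * C p' * (of_bool (p \<in> P_bd) * of_bool (p' \<in> P_bd))"
      by (simp add: algebra_simps)
  qed
  also have "(\<Sum>p\<in>P. \<Sum>p'\<in>P. of_bool (p < p') * of_bool (ed p' < ed p) * (C p * C p' * (of_bool (p \<in> P_bd) * of_bool (p' \<in> P_bd)))) =
      (\<Sum>i\<in>{1..nin M}. \<Sum>j\<in>{1..nin M}. of_bool (i < j) * of_bool (bedge M D j < bedge M D i) * lamb i * lamb j)"
    unfolding P_def by (rule boundary_order_correction) (use c ed_bd in \<open>simp add: C_def\<close>)
  also have "(\<Sum>p\<in>P. \<Sum>p'\<in>P. of_bool (p < p') * (C p * C p' * edge_order D (ed p) (ed p'))) =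
      (\<Sum>p\<in>P. \<Sum>p'\<in>P. of_bool (p' = p + 1) * C p * C p') +
      ((\<Sum>p\<in>P. \<Sum>p'\<in>P. of_bool (p < p') * (of_bool (p' \<in> P_bd) * C p' * (om p * C p))) +
       (\<Sum>p\<in>P. \<Sum>p'\<in>P. of_bool (p < p') * (of_bool (p \<in> P_bd) * C p * (om p' * C p'))))"
    unfolding sum.distrib[symmetric]
  proof (intro sum.cong refl)
    fix p p' assume "p \<in> P" "p' \<in> P"
    then show "of_bool (p < p') * (C p * C p' * edge_order D (ed p) (ed p')) =
        of_bool (p' = p + 1) * C p * C p' + (of_bool (p < p') * (of_bool (p' \<in> P_bd) * C p' * (om p * C p)) +
          of_bool (p < p') * (of_bool (p \<in> P_bd) * C p * (om p' * C p')))"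
      by (cases "p < p'") (auto simp: edge_order_ed P_def algebra_simps)
  qed
  also have "(\<Sum>p\<in>P. \<Sum>p'\<in>P. of_bool (p < p') * (of_bool (p \<in> P_bd) * C p * (om p' * C p'))) =
      (\<Sum>p\<in>P. \<Sum>p'\<in>P. of_bool (p' < p) * (of_bool (p' \<in> P_bd) * C p' * (om p * C p)))"
    by (rule sum.swap)
  \<comment> \<open>The two sums cover all pairs but the diagonal, which is inserted in the first
    term and compensated by the second.\<close>
  also have "(\<Sum>p\<in>P. \<Sum>p'\<in>P. of_bool (p < p') * (of_bool (p' \<in> P_bd) * C p' * (om p * C p))) +
      (\<Sum>p\<in>P. \<Sum>p'\<in>P. of_bool (p' < p) * (of_bool (p' \<in> P_bd) * C p' * (om p * C p))) =
      (\<Sum>p\<in>P. \<Sum>p'\<in>P. of_bool (p' \<in> P_bd) * C p' * (om p * C p) + (if p' = p then of_bool (p \<in> P_bd) * (om p * C p) else 0))"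
    unfolding sum.distrib[symmetric]
  proof (intro sum.cong refl)
    fix p p'
    show "of_bool (p < p') * (of_bool (p' \<in> P_bd) * C p' * (om p * C p)) + of_bool (p' < p) * (of_bool (p' \<in> P_bd) * C p' * (om p * C p)) =
        of_bool (p' \<in> P_bd) * C p' * (om p * C p) + (if p' = p then of_bool (p \<in> P_bd) * (om p * C p) else 0)"
      using CC[of p] by (cases p p' rule: linorder_cases) (auto simp: mult.left_commute[of "C p"])
  qed
  also have "\<dots> = (\<Sum>p\<in>P. (\<Sum>p'\<in>P. of_bool (p' \<in> P_bd) * C p') * (om p * C p) + of_bool (p \<in> P_bd) * (om p * C p))"
  proof (intro sum.cong refl)
    fix p assume p: "p \<in> P"
    show "(\<Sum>p'\<in>P. of_bool (p' \<in> P_bd) * C p' * (om p * C p) + (if p' = p then of_bool (p \<in> P_bd) * (om p * C p) else 0)) =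
        (\<Sum>p'\<in>P. of_bool (p' \<in> P_bd) * C p') * (om p * C p) + of_bool (p \<in> P_bd) * (om p * C p)"
      by (simp only: sum.distrib sum_distrib_right[symmetric] sum.delta[OF fin] p if_True)
  qed
  also have "(\<Sum>p'\<in>P. of_bool (p' \<in> P_bd) * C p') = 0"
  proof -
    have "(\<Sum>p'\<in>P. of_bool (p' \<in> P_bd) * C p') = (\<Sum>j\<in>{1..nin M}. lamb j)"
      unfolding P_def sum_P_bd_indicator sum_P_bd using c ed_bd by (intro sum.cong refl) (simp add: C_def)
    then show ?thesis using Lam by simp
  qed
  also have "(\<Sum>p\<in>P. 0 * (om p * C p) + of_bool (p \<in> P_bd) * (om p * C p)) = (\<Sum>p\<in>P_bd. C p * wr p)"
    unfolding mult_zero_left add_0 P_def sum_P_bd_indicator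
    using P_disjoint by (intro sum.cong refl) (auto simp: om_def mult.commute)
  also have "(\<Sum>p\<in>P. \<Sum>p'\<in>P. of_bool (p' = p + 1) * C p * C p') = (\<Sum>p\<in>P. C p * (if p + 1 \<in> P then C (p + 1) else 0))"
  proof (intro sum.cong refl)
    fix p
    have "(\<Sum>p'\<in>P. of_bool (p' = p + 1) * C p * C p') = (\<Sum>p'\<in>P. if p' = p + 1 then C p * C p' else 0)"
      by (intro sum.cong) auto
    then show "(\<Sum>p'\<in>P. of_bool (p' = p + 1) * C p * C p') = C p * (if p + 1 \<in> P then C (p + 1) else 0)"
      using fin by simp
  qed
  finally have X: "(\<Sum>e\<in>edges D. \<Sum>e'\<in>edges D. of_bool (e < e') * c e * c e' * edge_order D e e') =
    (\<Sum>p\<in>P. C p * (if p + 1 \<in> P then C (p + 1) else 0)) + (\<Sum>p\<in>P_bd. C p * wr p) +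
    (\<Sum>i\<in>{1..nin M}. \<Sum>j\<in>{1..nin M}. of_bool (i < j) * of_bool (bedge M D j < bedge M D i) * lamb i * lamb j)" .
  have dbl: "a + b + (x + y + z) + z = a + b + x + (y :: bit)" for a b x y z
    by (cases z) (simp_all add: add.assoc)
  show ?thesis
    unfolding sign_exponent_edges[OF M pl] X unfolding re sum_inner_edges_P dbl by (simp only: P_def C_def)
qed

end

section \<open>Vertices of the standard polygon and admissibility\<close>

lemma cong_imp_bit_eq:
  assumes "[a = b] (mod int r)" "even r"
  shows "of_int a = (of_int b :: bit)"
proof -
  have "even (a - b)"
    using assms by (meson cong_iff_dvd_diff dvd_trans even_of_nat)
  then show ?thesis
    by (simp add: bit_of_int_odd)
qed

lemma edges_at_ends: "edges_at D v = {e \<in> edges D. emap D e 0 = v} \<union> {e \<in> edges D. emap D e 1 = v}"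
  by (auto simp: edges_at_def)

lemma bit_of_nat_odd: "(of_nat n :: bit) = of_bool (odd n)"
  by (induction n) auto

lemma bit_parity_count: "of_int (of_bool P - int (2 * g + n + 2 * g) + 1) = (of_bool P + of_nat n + 1 :: bit)"
  unfolding bit_of_int_odd bit_of_nat_odd
  by (cases P; cases "even n") simp_all

context standard_surface
begin

definition sp :: "nat \<Rightarrow> 'p" where
  "sp p = start_point D (side p)"

definition v0 :: 'p where
  "v0 = sp 0"

definition vb :: "nat \<Rightarrow> 'p" where
  "vb j = sp (4 * g + 3 * (j - 1) + 1)"

lemma next_side_side: "next_side D (side p) = side (p + 1)"
  by (simp add: next_side_def side_def std_expanded(2) mod_Suc)

lemma end_point_side: "end_point D (side p) = sp (p + 1)"
  using start_point_next_side[OF side_in_sides] by (simp add: next_side_side sp_def)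

lemma emap_ed:
  "emap D (ed p) (of_bool (\<not> side_dir D (side p))) = sp p"
  "emap D (ed p) (of_bool (side_dir D (side p))) = sp (p + 1)"
proof -
  note e = end_points_of_side[OF rspin_D(1)[OF M] pl side_in_sides[of p]]
  show "emap D (ed p) (of_bool (\<not> side_dir D (side p))) = sp p"
    unfolding ed_def sp_def by (rule e(1)[symmetric])
  show "emap D (ed p) (of_bool (side_dir D (side p))) = sp (p + 1)"
    unfolding ed_def end_point_side[symmetric] by (rule e(2)[symmetric])
qed

text \<open>The two sides of an inner edge are traversed in opposite directions, so the start of one
  is the end of the other.\<close>

lemma sp_in:
  assumes "p \<in> P_in"
  shows "sp (p + 3) = sp p" "sp (p + 2) = sp (p + 1)"
proof -
  have "side_dir D (side (p + 2)) = (\<not> side_dir D (side p))"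
    using ed_inner(2)[OF assms] by auto
  then show "sp (p + 3) = sp p" "sp (p + 2) = sp (p + 1)"
    using emap_ed[of p] emap_ed[of "p + 2"] ed_second[OF assms] by (simp_all add: numeral_3_eq_3)
qed

lemma P_in_intros:
  "i < g \<Longrightarrow> 4 * i \<in> P_in" "i < g \<Longrightarrow> 4 * i + 1 \<in> P_in" "j < nin M \<Longrightarrow> 4 * g + 3 * j \<in> P_in"
  by (auto simp: P_in_def len_def mod_Suc)

text \<open>Counted from \<open>4 * i\<close>, the first edge of the handle identifies the corners 0
  with 3 and 1 with 2, the second one 1 with 4 and 2 with 3; so all five agree.\<close>

lemma sp_handle: "i \<le> g \<Longrightarrow> sp (4 * i) = v0"
proof (induction i)
  case 0
  then show ?case by (simp add: v0_def)
next
  case (Suc i)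
  then have "i < g" by simp
  have "sp (4 * i) = v0"
    using Suc by simp
  moreover have "sp (4 * i + 4) = sp (4 * i)"
    using sp_in[OF P_in_intros(1)[OF \<open>i < g\<close>]] sp_in[OF P_in_intros(2)[OF \<open>i < g\<close>]]
    by (simp add: eval_nat_numeral)
  ultimately show ?case by (simp add: add.commute)
qed

lemma sp_handle_all:
  assumes "i < g" "c < 4"
  shows "sp (4 * i + c) = v0"
proof -
  have "sp (4 * i) = v0"
    using sp_handle[of i] assms(1) by simp
  moreover have "c = 0 \<or> c = 1 \<or> c = 2 \<or> c = 3"
    using assms(2) by linarith
  ultimately show ?thesis
    using sp_in[OF P_in_intros(1)[OF assms(1)]] sp_in[OF P_in_intros(2)[OF assms(1)]]
    by (auto simp: eval_nat_numeral)
qed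

lemma sp_hole: "j \<le> nin M \<Longrightarrow> sp (4 * g + 3 * j) = v0"
proof (induction j)
  case 0
  then show ?case using sp_handle[of g] by simp
next
  case (Suc j)
  then show ?case
    using sp_in(1)[OF P_in_intros(3)[of j]] by (simp add: add.commute add.left_commute)
qed

lemma sp_u:
  assumes "j \<in> {1..nin M}"
  shows "sp (4 * g + 3 * (j - 1)) = v0" "sp (4 * g + 3 * (j - 1) + 1) = vb j" "sp (4 * g + 3 * (j - 1) + 2) = vb j"
    "4 * g + 3 * (j - 1) \<in> P_in"
proof -
  show p: "4 * g + 3 * (j - 1) \<in> P_in"
    by (rule P_in_intros(3)) (use assms in auto)
  show "sp (4 * g + 3 * (j - 1)) = v0"
    by (rule sp_hole) (use assms in auto)
  show "sp (4 * g + 3 * (j - 1) + 1) = vb j" "sp (4 * g + 3 * (j - 1) + 2) = vb j"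
    using sp_in(2)[OF p] by (simp_all add: vb_def)
qed

lemma ends_handle:
  assumes "p \<in> P_in" "p < 4 * g"
  shows "emap D (ed p) 0 = v0" "emap D (ed p) 1 = v0"
proof -
  obtain i where i: "i \<in> {1..g}" "p = 4 * (i - 1) + p mod 4"
    using P_handle[OF assms(2)] .
  have "p mod 4 < 2"
    using assms by (simp add: P_in_def)
  moreover have "i - 1 < g"
    using i(1) by auto
  ultimately have "sp (4 * (i - 1) + p mod 4) = v0" "sp (4 * (i - 1) + p mod 4 + 1) = v0"
    using sp_handle_all[of "i - 1" "p mod 4"] sp_handle_all[of "i - 1" "p mod 4 + 1"] by simp_all
  then have "sp p = v0" "sp (p + 1) = v0"
    unfolding i(2)[symmetric] .
  then show "emap D (ed p) 0 = v0" "emap D (ed p) 1 = v0"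
    using emap_ed[of p] by (cases "side_dir D (side p)"; simp)+
qed

lemma ends_r:
  assumes "j \<in> {1..nin M}"
  shows "emap D (re j) 0 = v0" "emap D (re j) 1 = vb j"
  using emap_ed[of "4 * g + 3 * (j - 1)"] std_expanded(4)[OF assms] sp_u[OF assms] by auto

lemma ends_u:
  assumes "j \<in> {1..nin M}"
  shows "emap D (bedge M D j) 0 = vb j" "emap D (bedge M D j) 1 = vb j"
proof -
  have "side_dir D (side (4 * g + 3 * (j - 1) + 1))"
    by (rule bedge_side_dir[OF M pl assms side_in_sides]) (use ed_bd[OF assms] in \<open>simp add: ed_def\<close>)
  then show "emap D (bedge M D j) 0 = vb j"
    using emap_ed(1)[of "4 * g + 3 * (j - 1) + 1"] ed_bd[OF assms] sp_u(2)[OF assms] by simp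
  then show "emap D (bedge M D j) 1 = vb j"
    using bedge_D(3)[OF pl assms] by simp
qed

lemma edge_cases:
  assumes "e \<in> edges D"
  obtains p where "p \<in> P_in" "p < 4 * g" "e = ed p" | j where "j \<in> {1..nin M}" "e = re j" | j where "j \<in> {1..nin M}" "e = bedge M D j"
proof -
  obtain p where p: "p \<in> P_in \<union> P_bd" "e = ed p"
    using assms unfolding edges_eq by blast
  consider "p \<in> P_in" "p < 4 * g" | "p \<in> P_in" "4 * g \<le> p" | "p \<in> P_bd"
    using p by force
  then show ?thesis
  proof cases
    case 1
    then show ?thesis using that(1) p by blast
  next
    case 2
    then have q: "p < len" "(p - 4 * g) mod 3 = 0"
      by (auto simp: P_in_def)
    obtain j where "j \<in> {1..nin M}" "p = 4 * g + 3 * (j - 1) + (p - 4 * g) mod 3"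
      using P_hole[OF 2(2) q(1)] .
    then show ?thesis
      using that(2)[of j] q(2) p(2) std_expanded(4)[of j] by simp
  next
    case 3
    then obtain j where "j \<in> {1..nin M}" "p = 4 * g + 3 * (j - 1) + 1"
      unfolding bd_index by blast
    then show ?thesis
      using that(3)[of j] p(2) ed_bd by simp
  qed
qed

lemma verts_subset: "verts D \<subseteq> insert v0 (vb ` {1..nin M})"
proof
  fix v assume "v \<in> verts D"
  then obtain e where e: "e \<in> edges D" "v \<in> {emap D e 0, emap D e 1}"
    by (auto simp: verts_def)
  show "v \<in> insert v0 (vb ` {1..nin M})"
    using e(1)
  proof (cases rule: edge_cases)
    case (1 p)
    then show ?thesis using e(2) ends_handle by simp
  next
    case (2 j)
    then show ?thesis using e(2) ends_r by auto
  next
    case (3 j)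
    then show ?thesis using e(2) ends_u by auto
  qed
qed

lemma card_edges: "card (edges D) = 2 * g + 2 * nin M" "card (inner_edges D) = 2 * g + nin M"
proof -
  have "card (edges D) = (\<Sum>e\<in>edges D. 1)" by simp
  also have "\<dots> = 2 * g + 2 * nin M"
    unfolding sum_edges_P sum_P_in sum_P_bd by simp
  finally show "card (edges D) = 2 * g + 2 * nin M" .
  have "card (inner_edges D) = (\<Sum>e\<in>inner_edges D. 1)" by simp
  also have "\<dots> = 2 * g + nin M"
    unfolding sum_inner_edges_P sum_P_in by simp
  finally show "card (inner_edges D) = 2 * g + nin M" .
qed

lemma card_verts: "card (verts D) = 1 + nin M"
proof -
  have "int (card (verts D)) - int (card (edges D)) + int (card (faces D)) = 2 - 2 * int g - int (nin M)"
    using gen pl unfolding genus_def by blast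
  then show ?thesis
    unfolding card_edges std_expanded(1) by simp
qed

text \<open>The Euler characteristic gives \<open>1 + nin M\<close> vertices, and the gluing leaves
  no more candidates than that.\<close>

lemma vertices_distinct: "v0 \<notin> vb ` {1..nin M}" "inj_on vb {1..nin M}"
proof -
  have 1: "1 + nin M \<le> card (insert v0 (vb ` {1..nin M}))"
    using card_mono[OF _ verts_subset] card_verts by simp
  have 2: "card (vb ` {1..nin M}) \<le> nin M"
    using card_image_le[of "{1..nin M}" vb] by simp
  show "v0 \<notin> vb ` {1..nin M}"
    using 1 2 by (auto simp: insert_absorb)
  then have "card (vb ` {1..nin M}) = card {1..nin M}"
    using 1 2 by simp
  then show "inj_on vb {1..nin M}"
    by (simp add: eq_card_imp_inj_on)
qed

lemma vb_neq_v0: "j \<in> {1..nin M} \<Longrightarrow> vb j \<noteq> v0"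
  using vertices_distinct(1) by force

lemma vb_eq_iff: "i \<in> {1..nin M} \<Longrightarrow> j \<in> {1..nin M} \<Longrightarrow> vb i = vb j \<longleftrightarrow> i = j"
  using vertices_distinct(2) by (auto dest: inj_onD)

lemma re_edge: "j \<in> {1..nin M} \<Longrightarrow> re j \<in> edges D" "j \<in> {1..nin M} \<Longrightarrow> inner_edge D (re j)"
proof -
  assume j: "j \<in> {1..nin M}"
  note p = sp_u(4)[OF j]
  show "re j \<in> edges D" "inner_edge D (re j)"
    using std_expanded(4)[OF j] p ed_inner(1)[OF p] unfolding edges_eq by (metis UnI1 imageI, metis)
qed

lemma re_neq_bedge: "i \<in> {1..nin M} \<Longrightarrow> j \<in> {1..nin M} \<Longrightarrow> re i \<noteq> bedge M D j"
  using re_edge(2) bedge_attached(4)[OF M pl] by metis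

lemma edges_ends_vb:
  assumes j: "j \<in> {1..nin M}"
  shows "{e \<in> edges D. emap D e 0 = vb j} = {bedge M D j}"
    "{e \<in> edges D. emap D e 1 = vb j} = {re j, bedge M D j}"
proof -
  note be = bedge_D(1)[OF pl j]
  have "e = bedge M D j" if e: "e \<in> edges D" "emap D e 0 = vb j" for e
    using e(1)
  proof (cases rule: edge_cases)
    case (1 p)
    then show ?thesis using e(2) ends_handle vb_neq_v0[OF j] by simp
  next
    case (2 i)
    then show ?thesis using e(2) ends_r(1) vb_neq_v0[OF j] by simp
  next
    case (3 i)
    then show ?thesis using e(2) ends_u(1) vb_eq_iff[OF _ j] by simp
  qed
  then show "{e \<in> edges D. emap D e 0 = vb j} = {bedge M D j}"
    using be ends_u(1)[OF j] by blast
  have "e = bedge M D j \<or> e = re j" if e: "e \<in> edges D" "emap D e 1 = vb j" for e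
    using e(1)
  proof (cases rule: edge_cases)
    case (1 p)
    then show ?thesis using e(2) ends_handle vb_neq_v0[OF j] by simp
  next
    case (2 i)
    then show ?thesis using e(2) ends_r(2) vb_eq_iff[OF _ j] by simp
  next
    case (3 i)
    then show ?thesis using e(2) ends_u(2) vb_eq_iff[OF _ j] by simp
  qed
  then show "{e \<in> edges D. emap D e 1 = vb j} = {re j, bedge M D j}"
    using be ends_u(2)[OF j] re_edge(1)[OF j] ends_r(2)[OF j] by blast
qed

text \<open>Admissibility at \<open>vb j\<close>, a vertex of degree 3: the boundary loop counts
  twice in the degree but contributes \<open>-1\<close> once to the sum, and \<open>re j\<close>
  points into the vertex.\<close>

lemma r_index:
  assumes j: "j \<in> {1..nin M}"
  shows "of_int (eidx D (re j)) = lamb j + 1 + of_bool (fmap D f 1 = vb j)"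
proof -
  have ne: "re j \<noteq> bedge M D j"
    by (rule re_neq_bedge[OF j j])
  have at: "edges_at D (vb j) = {re j, bedge M D j}"
    unfolding edges_at_ends edges_ends_vb[OF j] by auto
  have hat: "hat_s D (vb j) (re j) = - 1 - eidx D (re j)" "hat_s D (vb j) (bedge M D j) = - 1"
    using ends_r[OF j] ends_u[OF j] vb_neq_v0[OF j] by (simp_all add: hat_s_def)
  have N: "vertex_N D (vb j) = 3"
    unfolding vertex_N_def edges_ends_vb[OF j] using ne by simp
  have Dv: "vertex_D D (vb j) = of_bool (fmap D f 1 = vb j)"
    unfolding vertex_D_def std_expanded(1) by (cases "fmap D f 1 = vb j") (simp_all add: Collect_conv_if)
  have "vb j \<in> verts D"
    using edge_ends_in_verts(1)[OF bedge_D(1)[OF pl j]] ends_u(1)[OF j] by simp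
  moreover have "vb j \<in> bpar M j ` sphere 0 1"
    unfolding bedge_D(2)[OF pl j, symmetric] ends_u(1)[OF j, symmetric] by (rule imageI) simp
  ultimately have "[(\<Sum>e\<in>edges_at D (vb j). hat_s D (vb j) e) = vertex_D D (vb j) - vertex_N D (vb j) + 1 - (lam M j - 1)] (mod int r)"
    by (intro bspec[OF bspec[OF conjunct2[OF presents_D(4)[OF D, unfolded admissible_def]] j]] IntI)
  from cong_imp_bit_eq[OF this r_even]
  have "of_int (- 1 - eidx D (re j) + - 1) = (of_int (of_bool (fmap D f 1 = vb j) - 3 + 1 - (lam M j - 1)) :: bit)"
    unfolding at N Dv using ne by (simp add: hat)
  then show ?thesis
    unfolding bit_of_int_odd by (cases "fmap D f 1 = vb j") (auto split: if_splits)
qed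

lemma marked_vertex:
  obtains p where "p < len" "(m + p) mod len = 0" "fmap D f 1 = sp p"
proof -
  have "(f, 1) \<in> sides D"
    using len_pos by (simp add: sides_def std_expanded(1,2) Suc_le_eq)
  then obtain p where p: "p < len" "side p = (f, 1)"
    unfolding sides_eq by auto
  then show ?thesis
    using that[of p] start_point_marked[of D f] by (auto simp: sp_def side_def)
qed

lemma sp_cases:
  assumes "p < len"
  shows "sp p = v0 \<and> (\<forall>j\<in>{1..nin M}. p \<noteq> 4 * g + 3 * (j - 1) + 1 \<and> p \<noteq> 4 * g + 3 * (j - 1) + 2) \<or>
    (\<exists>j\<in>{1..nin M}. sp p = vb j \<and> (p = 4 * g + 3 * (j - 1) + 1 \<or> p = 4 * g + 3 * (j - 1) + 2))"
proof (cases "p < 4 * g")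
  case True
  obtain i where i: "i \<in> {1..g}" "p = 4 * (i - 1) + p mod 4"
    using P_handle[OF True] .
  have "i - 1 < g"
    using i(1) by auto
  then have "sp (4 * (i - 1) + p mod 4) = v0"
    by (rule sp_handle_all) simp
  then have "sp p = v0"
    unfolding i(2)[symmetric] .
  then show ?thesis
    using True by auto
next
  case False
  then have *: "4 * g \<le> p"
    by simp
  obtain j where j: "j \<in> {1..nin M}" "p = 4 * g + 3 * (j - 1) + (p - 4 * g) mod 3"
    using P_hole[OF * assms] .
  consider "(p - 4 * g) mod 3 = 0" | "(p - 4 * g) mod 3 = 1" | "(p - 4 * g) mod 3 = 2"
    by linarith
  then show ?thesis
  proof cases
    case 1
    then have p: "p = 4 * g + 3 * (j - 1)" using j(2) by linarith
    have ne: "4 * g + 3 * a \<noteq> 4 * g + 3 * b + 1" "4 * g + 3 * a \<noteq> 4 * g + 3 * b + 2" for a b :: nat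
      by presburger+
    show ?thesis
      unfolding p by (intro disjI1 conjI ballI sp_u(1)[OF j(1)] ne)
  next
    case 2
    then have "p = 4 * g + 3 * (j - 1) + 1" using j(2) by linarith
    then show ?thesis using sp_u(2)[OF j(1)] by (intro disjI2 bexI[OF _ j(1)]) simp
  next
    case 3
    then have "p = 4 * g + 3 * (j - 1) + 2" using j(2) by linarith
    then show ?thesis using sp_u(3)[OF j(1)] by (intro disjI2 bexI[OF _ j(1)]) simp
  qed
qed

text \<open>Between the two sides of \<open>re j\<close> lie the two corners at \<open>vb j\<close>,
  at the positions \<open>q + 1\<close> and \<open>q + 2\<close>; the wrap-around terms of these
  sides differ if marking starts at one of them.\<close>

lemma marked_om:
  assumes j: "j \<in> {1..nin M}"
  shows "om (4 * g + 3 * (j - 1)) = of_bool (fmap D f 1 = vb j)"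
proof -
  define q where "q = 4 * g + 3 * (j - 1)"
  have q: "q \<in> P_in"
    unfolding q_def by (rule sp_u(4)[OF j])
  obtain p where p: "p < len" "(m + p) mod len = 0" "fmap D f 1 = sp p"
    by (rule marked_vertex)
  have iff: "fmap D f 1 = vb j \<longleftrightarrow> p = q + 1 \<or> p = q + 2"
  proof
    assume "fmap D f 1 = vb j"
    then obtain i where i: "i \<in> {1..nin M}" "sp p = vb i" "p = 4 * g + 3 * (i - 1) + 1 \<or> p = 4 * g + 3 * (i - 1) + 2"
      using sp_cases[OF p(1)] p(3) vb_neq_v0[OF j] by auto
    then have "i = j"
      using \<open>fmap D f 1 = vb j\<close> p(3) vb_eq_iff[OF i(1) j] by simp
    then show "p = q + 1 \<or> p = q + 2"
      using i(3) by (simp add: q_def)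
  next
    assume "p = q + 1 \<or> p = q + 2"
    then show "fmap D f 1 = vb j"
      using sp_u(2,3)[OF j] p(3) by (auto simp: q_def)
  qed
  define k where "k = m mod len"
  have k: "k < len"
    using len_pos by (simp add: k_def)
  have "(k + p) mod len = 0"
    using p(2) by (simp add: k_def mod_add_left_eq)
  then have kp: "k + p = 0 \<or> k + p = len"
    using k p(1) by (simp add: mod_if split: if_splits)
  have "om q = wr q + wr (q + 2)"
    using q by (simp add: om_def)
  also have "\<dots> = of_bool (p = q + 1 \<or> p = q + 2)"
    unfolding wr_def k_def[symmetric] using kp P_less(2)[OF q] k
    by (cases "len \<le> k + q"; cases "len \<le> k + (q + 2)") auto
  finally show ?thesis
    unfolding iff q_def .
qed

text \<open>A vertex on a boundary component is the end point of its boundary edge, hence some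
  \<open>vb j\<close>.\<close>

lemma v0_not_boundary:
  assumes "v0 \<in> verts D"
  shows "v0 \<notin> boundary M"
proof
  assume "v0 \<in> boundary M"
  then obtain j where j: "j \<in> {1..nin M}" "v0 \<in> bpar M j ` sphere 0 1"
    by (rule boundary_circle_cover[OF M])
  then obtain t where t: "t \<in> {0..1}" "v0 = emap D (bedge M D j) t"
    using bedge_D(2)[OF pl j(1)] by (metis imageE)
  have "t \<notin> {0<..<1}"
    using edge_interior_not_vert[OF cells bedge_D(1)[OF pl j(1)]] assms t(2) by auto
  then have "t = 0 \<or> t = 1"
    using t(1) by auto
  then have "v0 = vb j"
    using t(2) ends_u[OF j(1)] by auto
  then show False
    using vb_neq_v0[OF j(1)] by simp
qed

text \<open>This is admissibility at the inner vertex.\<close>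

lemma lam_sum: "(\<Sum>j\<in>{1..nin M}. lamb j) = 0"
proof (cases "nin M = 0")
  case False
  then have one: "1 \<in> {1..nin M}" by simp
  have v0: "v0 \<in> verts D"
    using edge_ends_in_verts(1)[OF re_edge(1)[OF one]] ends_r(1)[OF one] by simp
  have E0: "{e \<in> edges D. emap D e 0 = v0} = inner_edges D"
  proof -
    have "emap D e 0 = v0 \<longleftrightarrow> inner_edge D e" if e: "e \<in> edges D" for e
      using e
    proof (cases rule: edge_cases)
      case (1 p)
      then show ?thesis using ends_handle ed_inner(1) by simp
    next
      case (2 i)
      then show ?thesis using ends_r(1) re_edge(2) by simp
    next
      case (3 i)
      then show ?thesis using ends_u(1) vb_neq_v0 bedge_attached(4)[OF M pl] by simp
    qed
    then show ?thesis
      by (auto simp: inner_edges_def)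
  qed
  have E1: "e \<in> inner_edges D" if "e \<in> edges D" "emap D e 1 = v0" for e
    using that(1)
  proof (cases rule: edge_cases)
    case (1 p)
    then show ?thesis using ed_inner(1) that by (simp add: inner_edges_def)
  next
    case (2 i)
    then show ?thesis using ends_r(2) vb_neq_v0 that by simp
  next
    case (3 i)
    then show ?thesis using ends_u(2) vb_neq_v0 that by simp
  qed
  have fin: "finite (inner_edges D)"
    unfolding inner_edges_eq by simp
  have at: "edges_at D v0 = inner_edges D"
    unfolding edges_at_ends E0 using E1 by blast
  have inE: "inner_edges D \<subseteq> edges D"
    by (auto simp: inner_edges_def)
  have c1: "card {e \<in> edges D. emap D e 1 = v0} = (\<Sum>e\<in>inner_edges D. of_bool (emap D e 1 = v0))"
  proof -
    have "{e \<in> edges D. emap D e 1 = v0} = {e \<in> inner_edges D. emap D e 1 = v0}"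
      using E1 inE by auto
    then show ?thesis
      using fin by (simp add: of_bool_def sum.If_cases Int_def)
  qed
  have handle: "emap D (ed (4 * (i - 1))) 1 = v0" "emap D (ed (4 * (i - 1) + 1)) 1 = v0" if i: "i \<in> {1..g}" for i
  proof -
    have "i - 1 < g" using i by auto
    then show "emap D (ed (4 * (i - 1))) 1 = v0" "emap D (ed (4 * (i - 1) + 1)) 1 = v0"
      using ends_handle(2)[OF P_in_intros(1)] ends_handle(2)[OF P_in_intros(2)] by simp_all
  qed
  have hole: "ed (4 * g + 3 * (j - 1)) = re j" "emap D (re j) 1 \<noteq> v0" if j: "j \<in> {1..nin M}" for j
    using std_expanded(4)[OF j] ends_r(2)[OF j] vb_neq_v0[OF j] by simp_all
  have E1c: "card {e \<in> edges D. emap D e 1 = v0} = 2 * g"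
  proof -
    have "card {e \<in> edges D. emap D e 1 = v0} = (\<Sum>i\<in>{1..g}. 2) + (\<Sum>j\<in>{1..nin M}. 0)"
      unfolding c1 sum_inner_edges_P sum_P_in
      by (intro arg_cong2[where f = "(+)"] sum.cong refl) (simp_all only: handle hole, simp_all)
    then show ?thesis by simp
  qed
  \<comment> \<open>The degree of \<open>v0\<close>: all inner edges start here, and the
    \<open>2 * g\<close> handle edges also end here.\<close>
  have N: "vertex_N D v0 = int (2 * g + nin M + 2 * g)"
    unfolding vertex_N_def E0 E1c card_edges by simp
  have Dv: "vertex_D D v0 = of_bool (fmap D f 1 = v0)"
    unfolding vertex_D_def std_expanded(1) by (cases "fmap D f 1 = v0") (simp_all add: Collect_conv_if)
  have "[(\<Sum>e\<in>edges_at D v0. hat_s D v0 e) = vertex_D D v0 - vertex_N D v0 + 1] (mod int r)"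
    by (rule bspec[OF conjunct1[OF presents_D(4)[OF D, unfolded admissible_def]]])
      (use v0 v0_not_boundary[OF v0] in simp)
  from cong_imp_bit_eq[OF this r_even]
  have "of_int (\<Sum>e\<in>inner_edges D. hat_s D v0 e) = of_bool (fmap D f 1 = v0) + of_nat (nin M) + (1 :: bit)"
    unfolding at N Dv unfolding bit_parity_count .
  moreover have "of_int (\<Sum>e\<in>inner_edges D. hat_s D v0 e) = (\<Sum>j\<in>{1..nin M}. of_int (eidx D (re j)) :: bit)"
  proof -
    have h: "hat_s D v0 (ed (4 * (i - 1))) = - 1" "hat_s D v0 (ed (4 * (i - 1) + 1)) = - 1" if i: "i \<in> {1..g}" for i
    proof -
      have "i - 1 < g" using i by auto
      then show "hat_s D v0 (ed (4 * (i - 1))) = - 1" "hat_s D v0 (ed (4 * (i - 1) + 1)) = - 1"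
        using ends_handle[OF P_in_intros(1)] ends_handle[OF P_in_intros(2)] by (simp_all add: hat_s_def)
    qed
    have "hat_s D v0 (ed (4 * g + 3 * (j - 1))) = eidx D (re j)" if j: "j \<in> {1..nin M}" for j
      using hole[OF j] ends_r(1)[OF j] by (simp add: hat_s_def)
    note h = h this
    have "(\<Sum>e\<in>inner_edges D. of_int (hat_s D v0 e)) = (\<Sum>i\<in>{1..g}. 0) + (\<Sum>j\<in>{1..nin M}. of_int (eidx D (re j)) :: bit)"
      unfolding sum_inner_edges_P sum_P_in
      by (intro arg_cong2[where f = "(+)"] sum.cong refl) (simp_all only: h, simp)
    then show ?thesis by simp
  qed
  moreover have "(\<Sum>j\<in>{1..nin M}. of_int (eidx D (re j))) =
      (\<Sum>j\<in>{1..nin M}. lamb j) + of_nat (nin M) + (\<Sum>j\<in>{1..nin M}. of_bool (fmap D f 1 = vb j))"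
    using r_index by (simp add: sum.distrib)
  \<comment> \<open>The marked vertex of the only face is exactly one of \<open>v0\<close> and the
    \<open>vb j\<close>.\<close>
  moreover have "(\<Sum>j\<in>{1..nin M}. of_bool (fmap D f 1 = vb j)) = of_bool (fmap D f 1 = v0) + (1 :: bit)"
  proof -
    obtain p where p: "p < len" "fmap D f 1 = sp p"
      using marked_vertex by metis
    consider "sp p = v0" | i where "i \<in> {1..nin M}" "sp p = vb i"
      using sp_cases[OF p(1)] by blast
    then show ?thesis
    proof cases
      case 1
      then have "fmap D f 1 \<noteq> vb j" if "j \<in> {1..nin M}" for j
        using vb_neq_v0[OF that] p(2) by simp
      then show ?thesis using 1 p(2) by simp
    next
      case (2 i)
      then have "(\<Sum>j\<in>{1..nin M}. of_bool (fmap D f 1 = vb j)) = (\<Sum>j\<in>{1..nin M}. if j = i then 1 else (0 :: bit))"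
        using p(2) vb_eq_iff by (intro sum.cong refl) auto
      then show ?thesis
        using 2 p(2) vb_neq_v0[OF 2(1)] by simp
    qed
  qed
  ultimately have "of_bool (fmap D f 1 = v0) + of_nat (nin M) + 1 =
      (\<Sum>j\<in>{1..nin M}. lamb j) + of_nat (nin M) + (of_bool (fmap D f 1 = v0) + (1 :: bit))"
    by (simp only:)
  then show ?thesis
    by (simp add: add_ac)
qed simp

end

section \<open>Evaluation on the standard polygon\<close>

lemma sum_PiE_insert:
  assumes "a \<notin> I"
  shows "(\<Sum>w\<in>insert a I \<rightarrow>\<^sub>E UNIV. F w) = (\<Sum>x\<in>UNIV. \<Sum>w\<in>I \<rightarrow>\<^sub>E UNIV. (F (w(a := x)) :: 'b::comm_monoid_add))"
proof -
  have inj: "inj_on (\<lambda>(x, w). w(a := x)) (UNIV \<times> (I \<rightarrow>\<^sub>E UNIV))"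
  proof (rule inj_onI, clarify)
    fix x x' w w' assume w: "w \<in> I \<rightarrow>\<^sub>E UNIV" "w' \<in> I \<rightarrow>\<^sub>E UNIV" "w(a := x) = w'(a := x')"
    then have "x = x'"
      by (metis fun_upd_same)
    moreover have "w b = w' b" for b
      using fun_cong[OF w(3), of b] assms PiE_arb[OF w(1), of a] PiE_arb[OF w(2), of a] by (cases "b = a") auto
    ultimately show "x = x' \<and> w = w'" by blast
  qed
  show ?thesis
    unfolding PiE_insert_eq sum.reindex[OF inj] by (simp add: sum.cartesian_product o_def split_def)
qed

lemma sum_UNIV_bool: "(\<Sum>x\<in>UNIV. F x) = F False + (F True :: 'b::comm_monoid_add)"
  by (simp add: UNIV_bool)


text \<open>The two variables of one handle are summed at a time. Values on \<open>R\<close> do not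
  occur in the exponent and contribute a factor 2 each.\<close>

lemma gauss_sum:
  fixes A B :: "nat \<Rightarrow> bit"
  assumes "finite J" "inj_on s J" "inj_on t J" "s ` J \<inter> t ` J = {}" "finite R" "(s ` J \<union> t ` J) \<inter> R = {}"
  shows "(\<Sum>w\<in>s ` J \<union> t ` J \<union> R \<rightarrow>\<^sub>E UNIV. bsign (\<Sum>i\<in>J. of_bool (w (s i)) * A i + of_bool (w (t i)) * B i +
      of_bool (w (s i)) * of_bool (w (t i)))) = 2 ^ card J * 2 ^ card R * (bsign (\<Sum>i\<in>J. A i * B i) :: 'k::field)"
  using assms
proof (induction J rule: finite_induct)
  case empty
  then show ?case by (simp add: card_PiE)
next
  case (insert j J)
  define Q where "Q = (\<lambda>J (w :: _ \<Rightarrow> bool). \<Sum>i\<in>J. of_bool (w (s i)) * A i + of_bool (w (t i)) * B i +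
      of_bool (w (s i)) * of_bool (w (t i)))"
  define I where "I = s ` J \<union> t ` J \<union> R"
  have notin: "t j \<notin> I" "s j \<notin> insert (t j) I"
    using insert.prems insert.hyps by (auto simp: I_def)
  have IH: "(\<Sum>w\<in>I \<rightarrow>\<^sub>E UNIV. bsign (Q J w)) = 2 ^ card J * 2 ^ card R * (bsign (\<Sum>i\<in>J. A i * B i) :: 'k)"
    unfolding I_def Q_def using insert.prems by (intro insert.IH) auto
  have Q: "Q (insert j J) (w(t j := y, s j := x)) = of_bool x * A j + of_bool y * B j + of_bool x * of_bool y + Q J w" for w x y
  proof -
    have "Q J (w(t j := y, s j := x)) = Q J w"
      unfolding Q_def
    proof (intro sum.cong refl)
      fix i assume "i \<in> J"
      then have "s i \<in> I" "t i \<in> I"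
        by (auto simp: I_def)
      then have "s i \<noteq> s j" "s i \<noteq> t j" "t i \<noteq> s j" "t i \<noteq> t j"
        using notin by auto
      then show "of_bool ((w(t j := y, s j := x)) (s i)) * A i + of_bool ((w(t j := y, s j := x)) (t i)) * B i +
          of_bool ((w(t j := y, s j := x)) (s i)) * of_bool ((w(t j := y, s j := x)) (t i)) =
        of_bool (w (s i)) * A i + of_bool (w (t i)) * B i + of_bool (w (s i)) * of_bool (w (t i))"
        by simp
    qed
    moreover have "s j \<noteq> t j" "t j \<noteq> s j"
      using notin by auto
    ultimately show ?thesis
      using insert.hyps by (simp add: Q_def)
  qed
  have Q': "bsign (Q (insert j J) (w(t j := y, s j := x))) =
      bsign (of_bool x * A j + of_bool y * B j + of_bool x * of_bool y) * (bsign (Q J w) :: 'k)" for w x y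
    unfolding Q by (rule bsign_add)
  have "s ` insert j J \<union> t ` insert j J \<union> R = insert (s j) (insert (t j) I)"
    by (auto simp: I_def)
  then have "(\<Sum>w\<in>s ` insert j J \<union> t ` insert j J \<union> R \<rightarrow>\<^sub>E UNIV. bsign (Q (insert j J) w)) =
      (\<Sum>x\<in>UNIV. \<Sum>y\<in>UNIV. bsign (of_bool x * A j + of_bool y * B j + of_bool x * of_bool y) *
        (\<Sum>w\<in>I \<rightarrow>\<^sub>E UNIV. (bsign (Q J w) :: 'k)))"
    by (simp only: sum_PiE_insert[OF notin(1)] sum_PiE_insert[OF notin(2)] Q' sum_distrib_left)
  \<comment> \<open>Since \<open>xA + yB + xy = (x + B)(y + A) + AB\<close>, the constant is
    \<open>\<Sum>(-1)^(xy) = 3 - 1 = 2\<close>.\<close>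
  also have "\<dots> = 2 * bsign (A j * B j) * (\<Sum>w\<in>I \<rightarrow>\<^sub>E UNIV. bsign (Q J w))"
    by (cases "A j"; cases "B j") (simp_all add: sum_UNIV_bool)
  also have "\<dots> = 2 ^ card (insert j J) * 2 ^ card R * bsign (\<Sum>i\<in>insert j J. A i * B i)"
    unfolding IH using insert.hyps by (simp add: bsign_add)
  finally show ?case
    unfolding Q_def .
qed

section \<open>Coefficients of the exponent as holonomies\<close>

context standard_surface
begin

definition qp :: "nat \<Rightarrow> nat" where
  "qp j = 4 * g + 3 * (j - 1)"

text \<open>The coefficient of an inner edge in the sign exponent; it equals \<open>\<zeta>(\<gamma>) + 1\<close> for a closed curve \<open>\<gamma>\<close> crossing only
  that edge (\<open>crossing_curve_index\<close>). Likewise \<open>hU i + hU j\<close> is \<open>\<zeta>(\<gamma>) + 1\<close> for an arc from the \<open>i\<close>-th boundary edge to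
  the \<open>j\<close>-th (\<open>arc_index\<close>).\<close>

definition hA :: "nat \<Rightarrow> bit" where
  "hA e = of_int (eidx D e) + 1 + lt (side_of D (e, False)) (side_of D (e, True))"

definition hU :: "nat \<Rightarrow> bit" where
  "hU j = of_int (eidx D (bedge M D j)) + 1 + wr (qp j + 1)"

lemma qp_less: "j \<in> {1..nin M} \<Longrightarrow> qp j < len" "j \<in> {1..nin M} \<Longrightarrow> qp j + 1 < len" "j \<in> {1..nin M} \<Longrightarrow> qp j + 2 < len"
  by (auto simp: qp_def len_def)

lemma re_sides:
  assumes j: "j \<in> {1..nin M}"
  shows "side_of D (re j, True) = side (qp j)" "side_of D (re j, False) = side (qp j + 2)"
  using side_of_label[OF gl side_in_sides[of "qp j"]] side_of_label[OF gl side_in_sides[of "qp j + 2"]]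
    std_expanded(4)[OF j] by (simp_all add: side_label_def ed_def qp_def)

text \<open>\<open>marked_om\<close> and \<open>r_index\<close> contain the same condition on the
  marked vertex. In consequence \<open>hA (re j)\<close> is the parity of
  \<open>\<lambda>\<^sub>j\<close>.\<close>

lemma re_lt:
  assumes j: "j \<in> {1..nin M}"
  shows "lt (side_of D (re j, False)) (side_of D (re j, True)) = of_int (eidx D (re j)) + 1 + lamb j"
proof -
  have "lt (side_of D (re j, False)) (side_of D (re j, True)) = om (qp j)"
    unfolding re_sides[OF j] lt_side[OF qp_less(3)[OF j] qp_less(1)[OF j]]
    using sp_u(4)[OF j] by (simp add: om_def qp_def add.commute)
  also have "\<dots> = of_bool (fmap D f 1 = vb j)"
    unfolding qp_def by (rule marked_om[OF j])
  finally show ?thesis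
    unfolding r_index[OF j] by (simp add: add_ac)
qed

lemma next_position:
  assumes "j \<in> {1..nin M}"
  shows "4 * g + 3 * (j - 1) + 1 \<in> P_in \<union> P_bd" "4 * g + 3 * (j - 1) + 1 + 1 \<notin> P_in \<union> P_bd"
proof -
  show "4 * g + 3 * (j - 1) + 1 \<in> P_in \<union> P_bd"
    unfolding bd_index using assms by blast
  have "4 * g + 3 * (j - 1) + 2 \<notin> P_in \<union> P_bd"
    by (rule second_not_P[OF sp_u(4)[OF assms]])
  then show "4 * g + 3 * (j - 1) + 1 + 1 \<notin> P_in \<union> P_bd"
    by simp
qed

lemma next_position_handle:
  assumes "i \<in> {1..g}"
  shows "4 * (i - 1) + 1 \<in> P_in \<union> P_bd" "4 * (i - 1) + 1 + 1 \<notin> P_in \<union> P_bd"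
proof -
  have i: "i - 1 < g"
    using assms by auto
  show "4 * (i - 1) + 1 \<in> P_in \<union> P_bd"
    using P_in_intros(2)[OF i] by blast
  have "4 * (i - 1) + 2 \<notin> P_in \<union> P_bd"
    by (rule second_not_P[OF P_in_intros(1)[OF i]])
  then show "4 * (i - 1) + 1 + 1 \<notin> P_in \<union> P_bd"
    by simp
qed

lemma sum_P: "(\<Sum>p\<in>P_in \<union> P_bd. F p) = (\<Sum>p\<in>P_in. F p) + (\<Sum>p\<in>P_bd. F p)"
  by (rule sum.union_disjoint) (simp_all add: P_disjoint)

text \<open>Edges at neighbouring positions \<open>p\<close>, \<open>p + 1\<close> of the index sets
  are \<open>s_i\<close>, \<open>t_i\<close> or \<open>r_j\<close>, \<open>u_j\<close>. The former
  give the products of the handles; with the latter the total coefficient of \<open>r_j\<close> is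
  \<open>2\<lambda>\<^sub>j\<close>, which vanishes modulo 2.\<close>

lemma sign_exponent_standard:
  assumes c: "\<And>j. j \<in> {1..nin M} \<Longrightarrow> c (bedge M D j) = lamb j"
  shows "sign_exponent M D c =
    (\<Sum>i\<in>{1..g}. c (se i) * hA (se i) + c (te i) * hA (te i) + c (se i) * c (te i)) + (\<Sum>j\<in>{1..nin M}. lamb j * hU j)"
proof -
  define G where "G = (\<lambda>p. c (ed p) * (of_int (eidx D (ed p)) + 1) +
      c (ed p) * (if p + 1 \<in> P_in \<union> P_bd then c (ed (p + 1)) else 0))"
  have "sign_exponent M D c =
    (\<Sum>p\<in>P_in. G p + c (ed p) * lt (side_of D (ed p, False)) (side_of D (ed p, True))) + (\<Sum>p\<in>P_bd. G p + c (ed p) * wr p)"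
    unfolding G_def sum.distrib
    by (rule trans[OF sign_exponent_positions], erule c, rule lam_sum, simp only: sum_P add_ac)
  also have "(\<Sum>p\<in>P_bd. G p + c (ed p) * wr p) = (\<Sum>j\<in>{1..nin M}. lamb j * hU j)"
    unfolding sum_P_bd
  proof (intro sum.cong refl)
    fix j assume j: "j \<in> {1..nin M}"
    show "G (4 * g + 3 * (j - 1) + 1) + c (ed (4 * g + 3 * (j - 1) + 1)) * wr (4 * g + 3 * (j - 1) + 1) = lamb j * hU j"
      unfolding G_def if_not_P[OF next_position(2)[OF j]] ed_bd[OF j] c[OF j] hU_def qp_def by (simp add: algebra_simps)
  qed
  also have "(\<Sum>p\<in>P_in. G p + c (ed p) * lt (side_of D (ed p, False)) (side_of D (ed p, True))) =
      (\<Sum>i\<in>{1..g}. c (se i) * hA (se i) + c (te i) * hA (te i) + c (se i) * c (te i)) + (\<Sum>j\<in>{1..nin M}. 0)"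
    unfolding sum_P_in
  proof (rule arg_cong2[where f = "(+)"]; rule sum.cong[OF refl])
    fix i assume i: "i \<in> {1..g}"
    have e: "ed (4 * (i - 1)) = se i" "ed (4 * (i - 1) + 1) = te i"
      using std_expanded(3)[OF i] by simp_all
    show "G (4 * (i - 1)) + c (ed (4 * (i - 1))) * lt (side_of D (ed (4 * (i - 1)), False)) (side_of D (ed (4 * (i - 1)), True)) +
       (G (4 * (i - 1) + 1) + c (ed (4 * (i - 1) + 1)) * lt (side_of D (ed (4 * (i - 1) + 1), False)) (side_of D (ed (4 * (i - 1) + 1), True))) =
       c (se i) * hA (se i) + c (te i) * hA (te i) + c (se i) * c (te i)"
      unfolding G_def if_not_P[OF next_position_handle(2)[OF i]] if_P[OF next_position_handle(1)[OF i]] e hA_def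
      by (simp add: algebra_simps)
  next
    fix j assume j: "j \<in> {1..nin M}"
    have e: "ed (4 * g + 3 * (j - 1)) = re j"
      using std_expanded(4)[OF j] by simp
    show "G (4 * g + 3 * (j - 1)) + c (ed (4 * g + 3 * (j - 1))) *
        lt (side_of D (ed (4 * g + 3 * (j - 1)), False)) (side_of D (ed (4 * g + 3 * (j - 1)), True)) = 0"
      unfolding G_def if_P[OF next_position(1)[OF j]] e ed_bd[OF j] c[OF j] re_lt[OF j]
      by (simp add: algebra_simps)
  qed
  finally show ?thesis by simp
qed

lemma inner_edges_standard: "inner_edges D = se ` {1..g} \<union> te ` {1..g} \<union> re ` {1..nin M}"
proof -
  have "(\<lambda>i. ed (4 * (i - 1))) ` {1..g} = se ` {1..g}" "(\<lambda>i. ed (4 * (i - 1) + 1)) ` {1..g} = te ` {1..g}"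
    "(\<lambda>j. ed (4 * g + 3 * (j - 1))) ` {1..nin M} = re ` {1..nin M}"
    by (intro image_cong refl; use std_expanded(3,4) in blast)+
  then show ?thesis
    unfolding inner_edges_eq in_index image_Un image_image by (simp only:)
qed

lemma conf_bedge: "j \<in> {1..nin M} \<Longrightarrow> conf M D w (bedge M D j) = lamb j"
  using boundary_of_bedge[OF M pl] bedge_attached(4)[OF M pl] by (simp add: conf_def)

lemma conf_inner: "e \<in> inner_edges D \<Longrightarrow> conf M D w e = of_bool (w e)"
  by (simp add: conf_def inner_edges_def)

text \<open>Each inner edge occurs twice on the polygon, and the boundary values add up to 0 by
  \<open>lam_sum\<close>.\<close>

lemma face_parity_standard:
  assumes "\<And>j. j \<in> {1..nin M} \<Longrightarrow> c (bedge M D j) = lamb j"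
  shows "face_parity D c f = 0"
proof -
  have "face_parity D c f = (\<Sum>x\<in>sides D. c (side_edge D x))"
  proof -
    have "sides D = Pair f ` {1..nsides D f}"
      by (auto simp: sides_def std_expanded(1))
    then show ?thesis
      unfolding face_parity_def by (simp add: sum.reindex inj_on_def)
  qed
  also have "\<dots> = (\<Sum>e\<in>edges D. \<Sum>d\<in>edge_dirs D e. c e)"
    unfolding sum_sides[OF pl] by (intro sum.cong refl) (simp add: side_of_D(2)[OF gl])
  also have "\<dots> = (\<Sum>p\<in>P_in. 0) + (\<Sum>p\<in>P_bd. c (ed p))"
    unfolding sum_edges_P
    by (intro arg_cong2[where f = "(+)"] sum.cong refl) (simp_all add: edge_dirs_def ed_inner(1) ed_not_inner)
  also have "(\<Sum>p\<in>P_bd. c (ed p)) = (\<Sum>j\<in>{1..nin M}. lamb j)"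
    unfolding sum_P_bd using assms ed_bd by (intro sum.cong refl) simp
  finally show ?thesis
    using lam_sum by simp
qed

lemma value_standard:
  fixes Z :: "((nat \<Rightarrow> bool) \<Rightarrow> 'k::field) \<Rightarrow> 'k"
  assumes k: "(2::'k) \<noteq> 0" and Z: "state_sum_value r (clifford :: (bool, 'k) frobenius) M Z"
  shows "Z (\<lambda>i. \<Prod>j=1..nin M. theta_pow (lam M j) (i j)) =
    2 powi (1 - int g) * bsign ((\<Sum>i\<in>{1..g}. hA (se i) * hA (te i)) + (\<Sum>j\<in>{1..nin M}. lamb j * hU j))"
proof -
  define Q where "Q = (\<lambda>w. \<Sum>i\<in>{1..g}. of_bool (w (se i)) * hA (se i) + of_bool (w (te i)) * hA (te i) +
      of_bool (w (se i)) * of_bool (w (te i)))"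
  define E where "E = (\<Sum>j\<in>{1..nin M}. lamb j * hU j)"
  \<comment> \<open>That \<open>se\<close>, \<open>te\<close> and \<open>re\<close> enumerate
    different edges is deduced from the number \<open>2g + b\<close> of inner edges, which turns all
    bounds for the images into equalities.\<close>
  have card_U: "card (se ` {1..g} \<union> te ` {1..g} \<union> re ` {1..nin M}) = g + g + nin M"
    using card_edges(2) unfolding inner_edges_standard by simp
  have "card (se ` {1..g} \<union> te ` {1..g} \<union> re ` {1..nin M}) \<le> card (se ` {1..g} \<union> te ` {1..g}) + card (re ` {1..nin M})"
    "card (se ` {1..g} \<union> te ` {1..g}) \<le> card (se ` {1..g}) + card (te ` {1..g})"
    "card (se ` {1..g}) \<le> g" "card (te ` {1..g}) \<le> g" "card (re ` {1..nin M}) \<le> nin M"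
    using card_image_le[of "{1..g}" se] card_image_le[of "{1..g}" te] card_image_le[of "{1..nin M}" re]
    by (simp_all add: card_Un_le)
  then have cards: "card (se ` {1..g}) = g" "card (te ` {1..g}) = g" "card (re ` {1..nin M}) = nin M"
    "card (se ` {1..g} \<union> te ` {1..g}) = card (se ` {1..g}) + card (te ` {1..g})"
    "card (se ` {1..g} \<union> te ` {1..g} \<union> re ` {1..nin M}) = card (se ` {1..g} \<union> te ` {1..g}) + card (re ` {1..nin M})"
    using card_U by linarith+
  have inj: "inj_on se {1..g}" "inj_on te {1..g}"
    by (rule eq_card_imp_inj_on; use cards in simp)+
  have disj: "se ` {1..g} \<inter> te ` {1..g} = {}" "(se ` {1..g} \<union> te ` {1..g}) \<inter> re ` {1..nin M} = {}"
    using cards(4,5) card_Un_Int[of "se ` {1..g}" "te ` {1..g}"]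
      card_Un_Int[of "se ` {1..g} \<union> te ` {1..g}" "re ` {1..nin M}"] by simp_all
  have "sign_exponent M D (conf M D w) = Q w + E" for w
  proof -
    have "se i \<in> inner_edges D" "te i \<in> inner_edges D" if "i \<in> {1..g}" for i
      using that unfolding inner_edges_standard by blast+
    then show ?thesis
      unfolding E_def Q_def
      by (intro trans[OF sign_exponent_standard] conf_bedge) (simp_all add: conf_inner)
  qed
  moreover have "\<forall>f'\<in>faces D. face_parity D (conf M D w) f' = 0" for w
    unfolding std_expanded(1) using face_parity_standard[of "conf M D w", OF conf_bedge] by simp
  ultimately have "Z (\<lambda>i. \<Prod>j=1..nin M. theta_pow (lam M j) (i j)) =
      (\<Sum>w\<in>inner_edges D \<rightarrow>\<^sub>E UNIV. (2 * (1 / 2) ^ (g + g + nin M) * bsign E) * bsign (Q w))"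
    unfolding state_sum_value_clifford[OF k M Z D]
    using card_edges(2) std_expanded(1) by (simp add: bsign_add mult_ac flip: mult_2)
  also have "\<dots> = 2 * (1 / 2) ^ (g + g + nin M) * bsign E * (2 ^ g * 2 ^ nin M * bsign (\<Sum>i\<in>{1..g}. hA (se i) * hA (te i)))"
  proof -
    have "(\<Sum>w\<in>inner_edges D \<rightarrow>\<^sub>E UNIV. bsign (Q w)) =
        2 ^ g * 2 ^ nin M * (bsign (\<Sum>i\<in>{1..g}. hA (se i) * hA (te i)) :: 'k)"
      unfolding inner_edges_standard Q_def
      using gauss_sum[of "{1..g}" se te "re ` {1..nin M}" "\<lambda>i. hA (se i)" "\<lambda>i. hA (te i)", OF _ inj disj(1) _ disj(2)]
        cards(3) by simp
    then show ?thesis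
      unfolding sum_distrib_left[symmetric] by (simp only:)
  qed
  \<comment> \<open>One face, \<open>2g + b\<close> inner edges, and a factor 2 from each handle and
    from each edge to a hole.\<close>
  also have "2 * (1 / 2) ^ (g + g + nin M) * (2 ^ g * 2 ^ nin M) = (2 powi (1 - int g) :: 'k)"
    using k by (simp add: power_int_diff power_add field_simps)
  then have "2 * (1 / 2) ^ (g + g + nin M) * bsign E * (2 ^ g * 2 ^ nin M * bsign (\<Sum>i\<in>{1..g}. hA (se i) * hA (te i))) =
      (2 powi (1 - int g) :: 'k) * bsign ((\<Sum>i\<in>{1..g}. hA (se i) * hA (te i)) + E)"
    by (simp add: bsign_add mult_ac)
  finally show ?thesis
    unfolding E_def .
qed

lemma crossing_curve_index:
  assumes cr: "crossing_curve D f e \<gamma>" and hol: "closed_holonomy M \<gamma> k" and e: "e \<in> inner_edges D"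
  shows "of_int k + 1 = hA e"
proof -
  define x where "x = side_of D (e, True)"
  define y where "y = side_of D (e, False)"
  have e': "e \<in> edges D" "True \<in> edge_dirs D e" "False \<in> edge_dirs D e"
    using e by (auto simp: inner_edges_def edge_dirs_def)
  note x = side_of_D[OF gl e'(1,2), folded x_def] and y = side_of_D[OF gl e'(1,3), folded y_def]
  have "even (k - (eidx D e + of_bool (snd y < snd x)))"
    by (rule crossing_holonomy[OF r_even M D cr hol x(1,2) _ y(1,2)]) (use x(3) y(3) in simp_all)
  then have "of_int k = (of_int (eidx D e + of_bool (snd y < snd x)) :: bit)"
    by (simp add: bit_of_int_odd)
  moreover have "fst x = fst y"
    using x(1) y(1) by (auto simp: sides_def std_expanded(1))
  ultimately show ?thesis
    unfolding hA_def x_def[symmetric] y_def[symmetric] lt_def side_less_def by (simp add: add_ac)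
qed

text \<open>By position the side of \<open>j\<close> precedes that of the last component. The
  wrap-around terms then belong to one component each, and the holonomy splits into two
  summands.\<close>

lemma arc_index:
  assumes j: "j \<in> {1..<nin M}" and pc: "polygon_curve D f (bedge M D (nin M)) (bedge M D j) \<eta> \<gamma>"
    and hol: "arc_holonomy M (nin M) j \<gamma> k"
  shows "of_int k + 1 = hU j + hU (nin M)"
proof -
  define b where "b = nin M"
  have jb: "j \<in> {1..b}" "b \<in> {1..b}" "j < b"
    using j by (auto simp: b_def)
  note less = qp_less(2)[OF jb(1)[unfolded b_def]] qp_less(2)[OF jb(2)[unfolded b_def]]
  have qlt: "qp j + 1 < qp b + 1"
    using j by (auto simp: qp_def b_def)
  have "even (k - (eidx D (bedge M D b) - eidx D (bedge M D j) + of_bool (snd (side (qp j + 1)) < snd (side (qp b + 1)))))"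
    unfolding b_def
  proof (rule arc_holonomy_parity[OF r_even M D _ _ pc hol side_in_sides _ side_in_sides])
    show "side_edge D (side (qp (nin M) + 1)) = bedge M D (nin M)" "side_edge D (side (qp j + 1)) = bedge M D j"
      using ed_bd jb by (simp_all add: ed_def qp_def b_def)
    show "side (qp (nin M) + 1) \<noteq> side (qp j + 1)"
      using side_inj less qlt by (metis b_def less_irrefl)
  qed (use j in auto)
  then have "of_int k = (of_int (eidx D (bedge M D b)) + of_int (eidx D (bedge M D j)) +
      of_bool (snd (side (qp j + 1)) < snd (side (qp b + 1))) :: bit)"
    by (cases "snd (side (qp j + 1)) < snd (side (qp b + 1))") (auto simp: bit_of_int_odd)
  also have "of_bool (snd (side (qp j + 1)) < snd (side (qp b + 1))) = lt (side (qp j + 1)) (side (qp b + 1))"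
    by (simp add: lt_def side_less_def side_def)
  also have "\<dots> = 1 + wr (qp j + 1) + wr (qp b + 1)"
    using lt_side[OF less[folded b_def]] qlt by simp
  finally show ?thesis
    unfolding hU_def b_def by (simp add: add_ac)
qed

text \<open>The summand \<open>hU (nin M)\<close> common to all arcs is multiplied by the sum of the
  other \<open>\<lambda>\<^sub>j\<close>, which modulo 2 is the last one.\<close>

lemma arf_exponent:
  assumes "\<And>i. i \<in> {1..g} \<Longrightarrow> crossing_curve D f (se i) (ca i) \<and> closed_holonomy M (ca i) (\<zeta>a i) \<and>
      crossing_curve D f (te i) (cb i) \<and> closed_holonomy M (cb i) (\<zeta>b i)"
    and "\<And>j. j \<in> {1..<nin M} \<Longrightarrow> crossing_curve D f (re j) (cd j) \<and> closed_holonomy M (cd j) (\<zeta>d j) \<and>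
      (\<exists>\<eta>. polygon_curve D f (bedge M D (nin M)) (bedge M D j) \<eta> (cc j)) \<and> arc_holonomy M (nin M) j (cc j) (\<zeta>c j)"
  shows "of_int ((\<Sum>i\<in>{1..g}. (\<zeta>a i + 1) * (\<zeta>b i + 1)) + (\<Sum>j\<in>{1..<nin M}. (\<zeta>c j + 1) * (\<zeta>d j + 1))) =
    (\<Sum>i\<in>{1..g}. hA (se i) * hA (te i)) + (\<Sum>j\<in>{1..nin M}. lamb j * hU j)"
proof -
  have a: "of_int (\<zeta>a i) + 1 = hA (se i)" "of_int (\<zeta>b i) + 1 = hA (te i)" if i: "i \<in> {1..g}" for i
    by (rule crossing_curve_index; use assms(1)[OF i] i in \<open>auto simp: inner_edges_standard\<close>)+
  have d: "of_int (\<zeta>d j) + 1 = lamb j" if j: "j \<in> {1..<nin M}" for j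
  proof -
    have j': "j \<in> {1..nin M}" using j by auto
    have "of_int (\<zeta>d j) + 1 = hA (re j)"
      by (rule crossing_curve_index) (use assms(2)[OF j] j' in \<open>auto simp: inner_edges_standard\<close>)
    then show ?thesis
      unfolding hA_def re_lt[OF j'] by (simp add: add_ac)
  qed
  have c: "of_int (\<zeta>c j) + 1 = hU j + hU (nin M)" if j: "j \<in> {1..<nin M}" for j
    using assms(2)[OF j] arc_index[OF j] by blast
  have "(\<Sum>j\<in>{1..<nin M}. (hU j + hU (nin M)) * lamb j) = (\<Sum>j\<in>{1..nin M}. lamb j * hU j)"
  proof (cases "nin M = 0")
    case False
    have e: "(\<Sum>j\<in>{1..nin M}. F j) = (\<Sum>j\<in>{1..<nin M}. F j) + (F (nin M) :: bit)" for F
    proof -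
      have "{1..nin M} = insert (nin M) {1..<nin M}"
        using False by auto
      then show ?thesis by (simp add: add.commute)
    qed
    have "(\<Sum>j\<in>{1..<nin M}. lamb j) = lamb (nin M)"
      using lam_sum unfolding e by (cases "lamb (nin M)") (auto simp: add_eq_0_iff)
    then show ?thesis
      unfolding e by (simp add: algebra_simps sum.distrib flip: sum_distrib_right)
  qed simp
  then show ?thesis
    using a c d by simp
qed

end

section \<open>Faces of a connected surface\<close>

lemma start_point_in_verts:
  assumes "oriented_surface M" "plcw M D" "x \<in> sides D"
  shows "start_point D x \<in> verts D" "end_point D x \<in> verts D"
  using end_points_of_side[OF assms] edge_ends_in_verts[OF side_edge_in_edges[OF plcw_D(2)[OF assms(2)] assms(3)]]
  by (cases "side_dir D x"; simp)+

lemma closed_face_cases: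
  assumes os: "oriented_surface M" and pl: "plcw M D" and f: "f \<in> faces D" and z: "z \<in> cball 0 1"
  obtains "z \<in> ball 0 1" | x \<tau> where "x \<in> sides D" "fst x = f" "\<tau> \<in> side_arc D x" "z = cis \<tau>" | "fmap D f z \<in> verts D"
proof (cases "norm z = 1")
  case True
  define n where "n = nsides D f"
  have n: "0 < n"
    using plcw_cells_D(3)[OF plcw_D(1)[OF pl] f] by (simp add: n_def)
  obtain \<tau> where \<tau>: "0 \<le> \<tau>" "\<tau> < 2 * pi" "z = cis \<tau>"
  proof (rule that[of "Arg2pi z"])
    show "z = cis (Arg2pi z)"
      using Arg2pi[of z] True by (simp add: is_Arg_def cis_conv_exp mult.commute)
  qed (simp_all add: Arg2pi_ge_0 Arg2pi_lt_2pi)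
  define q where "q = \<tau> * real n / (2 * pi)"
  have q: "0 \<le> q" "q < real n"
    unfolding q_def using \<tau> n by (simp_all add: field_simps)
  have t: "\<tau> = 2 * pi * q / real n"
    unfolding q_def using n by simp
  define k where "k = nat \<lfloor>q\<rfloor>"
  have k: "real k \<le> q" "q < real k + 1"
    unfolding k_def using q(1) by linarith+
  have "real k < real n"
    using k q by linarith
  then have side: "(f, k + 1) \<in> sides D"
    using f by (simp add: sides_def n_def)
  show ?thesis
  proof (cases "q = real k")
    case True
    have "fmap D f z = start_point D (f, k + 1)"
      unfolding start_point_def \<tau>(3) t True by (simp add: n_def)
    then show ?thesis
      using that(3) start_point_in_verts(1)[OF os pl side] by simp
  next
    case False
    then have "real k < q"
      using k by simp
    then have "\<tau> \<in> side_arc D (f, k + 1)"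
      unfolding side_arc_def t using k(2) n by (auto simp: n_def intro!: divide_strict_right_mono)
    then show ?thesis
      using that(2)[of "(f, k + 1)" \<tau>] side \<tau>(3) by simp
  qed
next
  case False
  then show ?thesis
    using that(1) z by auto
qed

lemma side_glue_ex:
  assumes "plcw_gluing M D" "x \<in> sides D"
  shows "\<exists>h. h ` side_arc D x = {0<..<1} \<and>
    (\<forall>\<tau>\<in>side_arc D x. fmap D (fst x) (cis \<tau>) = emap D (side_edge D x) (h \<tau>))"
  by (rule side_glue[OF assms]) auto

lemma edge_in_closed_face:
  assumes pl: "plcw M D" and e: "e \<in> edges D" "s \<in> {0<..<1}"
  obtains x \<tau> where "x \<in> sides D" "\<tau> \<in> side_arc D x" "side_edge D x = e" "emap D e s = fmap D (fst x) (cis \<tau>)"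
proof -
  note gl = plcw_D(2)[OF pl]
  obtain x where x: "x \<in> sides D" "side_edge D x = e"
    using attached_True[OF gl e(1)] by (auto simp: attached_def side_label_def)
  obtain h where h: "h ` side_arc D x = {0<..<1}"
    "\<forall>\<tau>\<in>side_arc D x. fmap D (fst x) (cis \<tau>) = emap D (side_edge D x) (h \<tau>)"
    using side_glue_ex[OF gl x(1)] by (elim exE conjE)
  obtain \<tau> where "\<tau> \<in> side_arc D x" "s = h \<tau>"
    using h(1) e(2) by (metis imageE)
  then show ?thesis
    using that[of x \<tau>] h(2) x by simp
qed

definition closed_face :: "'p mplcw \<Rightarrow> nat \<Rightarrow> 'p set" where
  "closed_face D f = fmap D f ` cball 0 1"

lemma closedin_closed_face:
  assumes "Hausdorff_space (topo M)" "plcw M D" "f \<in> faces D"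
  shows "closedin (topo M) (closed_face D f)"
proof -
  have "compactin (top_of_set (cball 0 1)) (cball (0::complex) 1)"
    by (simp add: compactin_subtopology)
  then have "compactin (topo M) (closed_face D f)"
    unfolding closed_face_def using plcw_cells_D(4)[OF plcw_D(1)[OF assms(2)] assms(3)] by (rule image_compactin)
  then show ?thesis
    by (rule compactin_imp_closedin[OF assms(1)])
qed

lemma closed_faces_cover:
  assumes os: "oriented_surface M" and pl: "plcw M D" and p: "p \<in> topspace (topo M)"
  obtains f where "f \<in> faces D" "p \<in> closed_face D f"
proof -
  note cells = plcw_D(1)[OF pl] and gl = plcw_D(2)[OF pl]
  have edge: "\<exists>f\<in>faces D. emap D e s \<in> closed_face D f" if es: "e \<in> edges D" "s \<in> {0..1}" for e s
  proof (cases "s \<in> {0<..<1}")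
    case True
    obtain x \<tau> where x: "x \<in> sides D" "emap D e s = fmap D (fst x) (cis \<tau>)"
      using edge_in_closed_face[OF pl es(1) True] by metis
    then show ?thesis
      using side_face[OF x(1)] unfolding closed_face_def by force
  next
    case False
    obtain x where x: "x \<in> sides D" "side_edge D x = e" "side_dir D x"
      using attached_True[OF gl es(1)] by (auto simp: attached_def side_label_def)
    have "s = 0 \<or> s = 1"
      using False es(2) by auto
    then have "emap D e s \<in> {start_point D x, end_point D x}"
      using end_points_of_side[OF os pl x(1)] x by auto
    moreover have "start_point D x \<in> closed_face D (fst x)" "end_point D x \<in> closed_face D (fst x)"
      unfolding start_point_def end_point_def closed_face_def by (intro imageI; simp)+
    ultimately show ?thesis
      using side_face[OF x(1)] by auto
  qed
  have "(\<exists>f\<in>faces D. p \<in> fmap D f ` ball 0 1) \<or> (\<exists>e\<in>edges D. \<exists>s\<in>{0..1}. p = emap D e s)"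
  proof -
    have "p \<in> (\<Union>f\<in>faces D. fmap D f ` ball 0 1) \<union> (\<Union>e\<in>edges D. emap D e ` {0<..<1}) \<union> verts D"
      using p unfolding plcw_cells_D(9)[OF cells] .
    then show ?thesis
    proof (elim UnE)
      assume "p \<in> (\<Union>e\<in>edges D. emap D e ` {0<..<1})"
      then obtain e s where "e \<in> edges D" "s \<in> {0<..<1}" "p = emap D e s"
        by (elim UN_E imageE)
      then show ?thesis
        by (intro disjI2 bexI[of _ e] bexI[of _ s]) auto
    next
      assume "p \<in> verts D"
      then obtain e where "e \<in> edges D" "p = emap D e 0 \<or> p = emap D e 1"
        unfolding verts_def by (elim UN_E) simp
      then show ?thesis
        by (intro disjI2 bexI[of _ e]) auto
    qed (elim UN_E, blast)
  qed
  then consider f where "f \<in> faces D" "p \<in> fmap D f ` ball 0 1" | e s where "e \<in> edges D" "s \<in> {0..1}" "p = emap D e s"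
    by (elim disjE bexE)
  then show ?thesis
  proof cases
    case 1
    then show ?thesis
      using that[of f] unfolding closed_face_def by auto
  next
    case 2
    then show ?thesis
      using edge[of e s] that by auto
  qed
qed

text \<open>Off the vertices, a point of two closed faces is interior to neither, so it lies on an
  open edge glued to a side of each.\<close>

lemma closed_faces_meet:
  assumes os: "oriented_surface M" and pl: "plcw M D"
    and f: "f \<in> faces D" "f' \<in> faces D" "f \<noteq> f'" and p: "p \<in> closed_face D f" "p \<in> closed_face D f'" "p \<notin> verts D"
  obtains x y where "x \<in> sides D" "y \<in> sides D" "fst x = f" "fst y = f'" "side_edge D x = side_edge D y"
proof -
  note cells = plcw_D(1)[OF pl] and gl = plcw_D(2)[OF pl]
  define F where "F = (\<Union>f\<in>faces D. fmap D f ` ball 0 1)"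
  define E where "E = (\<Union>e\<in>edges D. emap D e ` {0<..<1})"
  have dis: "F \<inter> E = {}"
    using cells unfolding plcw_cells_def Let_def F_def E_def by (elim conjE)
  have cases: "p \<in> fmap D f ` ball 0 1 \<or> (\<exists>x s. x \<in> sides D \<and> fst x = f \<and> s \<in> {0<..<1} \<and> p = emap D (side_edge D x) s)"
    if f: "f \<in> faces D" "p \<in> closed_face D f" for f
  proof -
    obtain z where z: "z \<in> cball 0 1" "p = fmap D f z"
      using f(2) by (auto simp: closed_face_def)
    show ?thesis
    proof (cases rule: closed_face_cases[OF os pl f(1) z(1)])
      case 1
      then show ?thesis using z by blast
    next
      case (2 x \<tau>)
      obtain h where h: "h ` side_arc D x = {0<..<1}"
        "\<forall>\<tau>\<in>side_arc D x. fmap D (fst x) (cis \<tau>) = emap D (side_edge D x) (h \<tau>)"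
        using side_glue_ex[OF gl 2(1)] by (elim exE conjE)
      have "p = emap D (side_edge D x) (h \<tau>)" "h \<tau> \<in> {0<..<1}"
        using h 2 z(2) by auto
      then show ?thesis using 2 by blast
    next
      case 3
      then show ?thesis using p(3) z(2) by simp
    qed
  qed
  have inF: "p \<in> F" if "f \<in> faces D" "p \<in> fmap D f ` ball 0 1" for f
    using that by (auto simp: F_def)
  have inE: "p \<in> E" if "x \<in> sides D" "s \<in> {0<..<1}" "p = emap D (side_edge D x) s" for x s
    unfolding E_def that(3) by (rule UN_I[OF side_edge_in_edges[OF gl that(1)] imageI[OF that(2)]])
  have "\<not> (p \<in> fmap D f ` ball 0 1 \<and> p \<in> fmap D f' ` ball 0 1)"
    using plcw_cells_D(7)[OF cells] f unfolding disjoint_family_on_def by blast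
  moreover have nE: "p \<notin> fmap D h ` ball 0 1" if "h \<in> faces D" "x \<in> sides D" "s \<in> {0<..<1}" "p = emap D (side_edge D x) s" for h x s
    using inF[OF that(1)] inE[OF that(2-4)] dis by blast
  ultimately have "p \<notin> fmap D f ` ball 0 1" "p \<notin> fmap D f' ` ball 0 1"
    using cases[OF f(1) p(1)] cases[OF f(2) p(2)] nE[OF f(1)] nE[OF f(2)] by metis+
  note side_points = cases[OF f(1) p(1)] cases[OF f(2) p(2)] this
  obtain x s where x: "x \<in> sides D" "fst x = f" "s \<in> {0<..<1}" "p = emap D (side_edge D x) s"
    using side_points(1,3) by (elim disjE exE conjE) simp_all
  obtain y t where y: "y \<in> sides D" "fst y = f'" "t \<in> {0<..<1}" "p = emap D (side_edge D y) t"
    using side_points(2,4) by (elim disjE exE conjE) simp_all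
  have "emap D (side_edge D y) t \<in> emap D (side_edge D y) ` {0..1}"
    using y(3) by (intro imageI) auto
  then have "side_edge D x = side_edge D y"
    using edge_interior_unique[OF cells side_edge_in_edges[OF gl x(1)] x(3) side_edge_in_edges[OF gl y(1)]] x(4) y(4) by simp
  then show ?thesis
    using that x y by blast
qed

lemma finite_verts: "plcw_cells M D \<Longrightarrow> finite (verts D)"
  using plcw_cells_D(2) by (auto simp: verts_def)

text \<open>A small disc in a chart that avoids the other points of \<open>V\<close>; a punctured
  disc is connected.\<close>

lemma interior_punctured_neighbourhood:
  assumes os: "oriented_surface M" and p: "p \<in> topspace (topo M)" "p \<notin> boundary M" and V: "finite V"
  obtains N where "openin (topo M) N" "p \<in> N" "N - {p} \<noteq> {}" "connectedin (topo M) (N - {p})" "(N - {p}) \<inter> V = {}"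
proof -
  obtain c where c: "c \<in> atlas M" "p \<in> fst c"
    by (rule chart_exists[OF os p(1)])
  define U where "U = fst c"
  define \<phi> where "\<phi> = snd c"
  have U: "openin (topo M) U" "openin (top_of_set half_plane) (\<phi> ` U)"
    and hom: "homeomorphic_map (subtopology (topo M) U) (top_of_set (\<phi> ` U)) \<phi>"
    unfolding U_def \<phi>_def by (rule oriented_surface_chart[OF os c(1)])+
  have Utop: "topspace (subtopology (topo M) U) = U"
    using openin_subset[OF U(1)] by auto
  obtain \<psi> where hom': "homeomorphic_maps (subtopology (topo M) U) (top_of_set (\<phi> ` U)) \<phi> \<psi>"
    using hom homeomorphic_map_maps by blast
  have \<psi>: "continuous_map (top_of_set (\<phi> ` U)) (subtopology (topo M) U) \<psi>"
    "\<And>x. x \<in> U \<Longrightarrow> \<psi> (\<phi> x) = x" "\<And>z. z \<in> \<phi> ` U \<Longrightarrow> \<phi> (\<psi> z) = z"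
    using hom' Utop by (auto simp: homeomorphic_maps_def)
  have inj: "inj_on \<phi> U"
    using \<psi>(2) by (rule inj_on_inverseI)
  define z where "z = \<phi> p"
  have "Im z \<noteq> 0"
    using p(2) c by (auto simp: boundary_def z_def \<phi>_def)
  moreover have zU: "z \<in> \<phi> ` U"
    using c(2) by (simp add: z_def U_def)
  moreover have "\<phi> ` U \<subseteq> half_plane"
    using U(2) openin_imp_subset by blast
  ultimately have Imz: "0 < Im z"
    by force
  obtain T where T: "open T" "\<phi> ` U = half_plane \<inter> T"
    using U(2) by (auto simp: openin_open)
  define O' where "O' = T \<inter> {w. 0 < Im w} - (\<phi> ` (V \<inter> U) - {z})"
  have "open O'"
    unfolding O'_def using T(1) V by (intro open_Diff open_Int open_halfspace_Im_gt finite_imp_closed) auto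
  moreover have "z \<in> O'"
    using zU T(2) Imz by (auto simp: O'_def)
  ultimately obtain e where e: "0 < e" "ball z e \<subseteq> O'"
    by (auto simp: open_contains_ball)
  have bU: "ball z e \<subseteq> \<phi> ` U"
    using e(2) T(2) by (auto simp: O'_def)
  define N where "N = \<psi> ` ball z e"
  have NU: "N \<subseteq> U"
    using bU \<psi>(2) by (auto simp: N_def)
  have N_eq: "N = {x \<in> U. \<phi> x \<in> ball z e}"
    using bU \<psi>(2,3) by (force simp: N_def)
  have "continuous_map (subtopology (topo M) U) (top_of_set (\<phi> ` U)) \<phi>"
    using hom' by (simp add: homeomorphic_maps_def)
  then have "openin (subtopology (topo M) U) {x \<in> topspace (subtopology (topo M) U). \<phi> x \<in> ball z e}"
    by (rule openin_continuous_map_preimage) (use bU in \<open>simp add: openin_open_eq open_subset\<close>)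
  then have "openin (topo M) N"
    unfolding Utop N_eq[symmetric] using openin_open_subtopology[OF U(1)] by blast
  moreover have pN: "p \<in> N"
    using e(1) c(2) by (simp add: N_eq z_def U_def)
  moreover have Np: "N - {p} = \<psi> ` (ball z e - {z})"
  proof -
    have "p = \<psi> z"
      using \<psi>(2) c(2) by (simp add: z_def U_def)
    moreover have "inj_on \<psi> (ball z e)"
      using \<psi>(3) bU by (intro inj_on_inverseI[of _ \<phi>]) blast
    ultimately show ?thesis
      using e(1) by (simp add: N_def inj_on_image_set_diff[of \<psi> "ball z e"])
  qed
  moreover have "N - {p} \<noteq> {}"
  proof -
    have "z + of_real (e / 2) \<in> ball z e - {z}"
      using e(1) by (simp add: dist_norm)
    then show ?thesis
      unfolding Np by blast
  qed
  moreover have "connectedin (topo M) (N - {p})"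
  proof -
    have "connected (ball z e - {z})"
      using connected_punctured_ball[of z e] by simp
    then have "connectedin (top_of_set (\<phi> ` U)) (ball z e - {z})"
      using bU by (auto simp: connectedin_subtopology)
    then show ?thesis
      unfolding Np using connectedin_continuous_map_image[OF \<psi>(1)] by (simp add: connectedin_subtopology)
  qed
  moreover have "(N - {p}) \<inter> V = {}"
  proof -
    have "x = p" if x: "x \<in> N" "x \<in> V" for x
    proof -
      have "\<phi> x \<in> O'" "x \<in> U"
        using x(1) e(2) by (auto simp: N_eq)
      then have "\<phi> x = z"
        using x(2) by (auto simp: O'_def)
      then show ?thesis
        using inj_onD[OF inj] \<open>x \<in> U\<close> c(2) by (simp add: z_def U_def)
    qed
    then show ?thesis by blast
  qed
  ultimately show ?thesis
    using that by blast
qed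

text \<open>The closed faces of the two classes would meet in finitely many points only, but removing finitely many points
  does not disconnect a surface.\<close>

lemma faces_edge_connected:
  assumes os: "oriented_surface M" and pl: "plcw M D" and bd: "boundary M = {}" and conn: "connected_space (topo M)"
    and P: "\<And>x y. x \<in> sides D \<Longrightarrow> y \<in> sides D \<Longrightarrow> side_edge D x = side_edge D y \<Longrightarrow> P (fst x) \<Longrightarrow> P (fst y)"
    and f: "f \<in> faces D" "P f" and f': "f' \<in> faces D"
  shows "P f'"
proof (rule ccontr)
  assume nP: "\<not> P f'"
  note cells = plcw_D(1)[OF pl]
  have Haus: "Hausdorff_space (topo M)"
    using os by (simp add: oriented_surface_def)
  define A where "A = (\<Union>f\<in>{f\<in>faces D. P f}. closed_face D f)"
  define B where "B = (\<Union>f\<in>{f\<in>faces D. \<not> P f}. closed_face D f)"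
  define S where "S = topspace (topo M)"
  have AB: "closedin (topo M) A" "closedin (topo M) B"
    unfolding A_def B_def using plcw_cells_D(1)[OF cells] closedin_closed_face[OF Haus pl]
    by (intro closedin_Union; auto)+
  have cover: "S \<subseteq> A \<union> B"
  proof
    fix p assume "p \<in> S"
    then obtain f where "f \<in> faces D" "p \<in> closed_face D f"
      unfolding S_def by (rule closed_faces_cover[OF os pl])
    then show "p \<in> A \<union> B"
      unfolding A_def B_def by blast
  qed
  have meet: "A \<inter> B \<subseteq> verts D"
  proof
    fix p assume "p \<in> A \<inter> B"
    then obtain f1 f2 where 1: "f1 \<in> faces D" "P f1" "p \<in> closed_face D f1"
      and 2: "f2 \<in> faces D" "\<not> P f2" "p \<in> closed_face D f2"
      unfolding A_def B_def by blast
    show "p \<in> verts D"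
    proof (rule ccontr)
      assume nv: "p \<notin> verts D"
      have ne: "f1 \<noteq> f2"
        using 1(2) 2(2) by auto
      obtain x y where "x \<in> sides D" "y \<in> sides D" "fst x = f1" "fst y = f2" "side_edge D x = side_edge D y"
        by (rule closed_faces_meet[OF os pl 1(1) 2(1) ne 1(3) 2(3) nv])
      then show False
        using P 1(2) 2(2) by blast
    qed
  qed
  \<comment> \<open>The largest open set contained in \<open>C\<close> up to vertices.
    \<open>A\<close> and \<open>B\<close> may share vertices, while \<open>G A\<close> and
    \<open>G B\<close> will be disjoint open sets.\<close>
  define G where "G = (\<lambda>C. \<Union>{N. openin (topo M) N \<and> N - verts D \<subseteq> C})"
  have open_G: "openin (topo M) (G C)" for C
    unfolding G_def by blast
  have "S \<subseteq> G A \<union> G B"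
  proof
    fix p assume p: "p \<in> S"
    have pb: "p \<notin> boundary M"
      using bd by simp
    obtain N where N: "openin (topo M) N" "p \<in> N" "N - {p} \<noteq> {}" "connectedin (topo M) (N - {p})" "(N - {p}) \<inter> verts D = {}"
      by (rule interior_punctured_neighbourhood[OF os p[unfolded S_def] pb finite_verts[OF cells]])
    have NS: "N \<subseteq> S"
      unfolding S_def using openin_subset[OF N(1)] .
    show "p \<in> G A \<union> G B"
    proof (cases "p \<in> verts D")
      case True
      have "\<not> ((N - {p}) \<inter> (S - A) \<noteq> {} \<and> (N - {p}) \<inter> (S - B) \<noteq> {})"
      proof
        assume ne: "(N - {p}) \<inter> (S - A) \<noteq> {} \<and> (N - {p}) \<inter> (S - B) \<noteq> {}"
        have op: "openin (topo M) (S - A)" "openin (topo M) (S - B)"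
          using AB by (auto simp: S_def closedin_def)
        have "N - {p} \<subseteq> (S - A) \<union> (S - B)"
          using NS meet N(5) by blast
        moreover have "(S - A) \<inter> (S - B) \<inter> (N - {p}) = {}"
          using cover by blast
        ultimately have "\<exists>E1 E2. openin (topo M) E1 \<and> openin (topo M) E2 \<and> N - {p} \<subseteq> E1 \<union> E2 \<and>
            E1 \<inter> E2 \<inter> (N - {p}) = {} \<and> E1 \<inter> (N - {p}) \<noteq> {} \<and> E2 \<inter> (N - {p}) \<noteq> {}"
          using op ne by (intro exI[of _ "S - A"] exI[of _ "S - B"] conjI) (simp_all add: Int_commute)
        then show False
          using N(4) unfolding connectedin by simp
      qed
      then have "N - {p} \<subseteq> A \<or> N - {p} \<subseteq> B"
        using NS by blast
      then have "N - verts D \<subseteq> A \<or> N - verts D \<subseteq> B"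
        using True by blast
      then show ?thesis
        unfolding G_def using N(1,2) by blast
    next
      case False
      then have "p \<in> S - A \<or> p \<in> S - B"
        using meet p by blast
      moreover have "openin (topo M) (S - A)" "openin (topo M) (S - B)"
        using AB by (auto simp: S_def closedin_def)
      moreover have "S - A \<subseteq> B" "S - B \<subseteq> A"
        using cover by blast+
      ultimately show ?thesis
        unfolding G_def by blast
    qed
  qed
  \<comment> \<open>A common point would have a neighbourhood consisting of vertices and be
    isolated, hence open and closed; it would be the whole surface.\<close>
  moreover have "G A \<inter> G B = {}"
  proof (rule ccontr)
    assume "G A \<inter> G B \<noteq> {}"
    then obtain p N1 N2 where N: "openin (topo M) N1" "openin (topo M) N2" "p \<in> N1" "p \<in> N2"
      "N1 - verts D \<subseteq> A" "N2 - verts D \<subseteq> B"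
      unfolding G_def by blast
    define N where "N = N1 \<inter> N2"
    have NO: "openin (topo M) N" "p \<in> N" "N \<subseteq> verts D"
      using N meet by (auto simp: N_def)
    then have p: "p \<in> topspace (topo M)"
      using openin_subset by blast
    have pb: "p \<notin> boundary M"
      using bd by simp
    obtain N' where N': "openin (topo M) N'" "p \<in> N'" "N' - {p} \<noteq> {}" "connectedin (topo M) (N' - {p})" "(N' - {p}) \<inter> verts D = {}"
      by (rule interior_punctured_neighbourhood[OF os p pb finite_verts[OF cells]])
    have "N \<inter> N' = {p}"
      using NO N' by blast
    then have op: "openin (topo M) {p}"
      using openin_Int[OF NO(1) N'(1)] by simp
    have "closedin (topo M) {p}"
      using Haus p by (simp add: closedin_Hausdorff_singleton)
    then have "topspace (topo M) - {p} = {}"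
      using conn op unfolding connected_space_clopen_in by blast
    then show False
      using N'(3) openin_subset[OF N'(1)] by blast
  qed
  ultimately have "G A = {} \<or> G B = {}"
    using conn open_G unfolding connected_space_def S_def by metis
  \<comment> \<open>The centres of the faces will show that neither set is empty.\<close>
  moreover have "fmap D h 0 \<in> closed_face D h \<inter> S - verts D" if h: "h \<in> faces D" for h
  proof -
    have c: "fmap D h 0 \<in> closed_face D h" "fmap D h 0 \<in> (\<Union>f\<in>faces D. fmap D f ` ball 0 1)"
      unfolding closed_face_def by (rule imageI, simp) (rule UN_I[OF h], rule imageI, simp)
    moreover have "closed_face D h \<subseteq> S"
      unfolding S_def by (rule closedin_subset[OF closedin_closed_face[OF Haus pl h]])
    ultimately show ?thesis
      using plcw_cells_D(11)[OF cells] by blast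
  qed
  note centre = this
  have "closed_face D f \<subseteq> A" "closed_face D f' \<subseteq> B"
    using f f' nP unfolding A_def B_def by (auto simp: Union_upper)
  then have "fmap D f 0 \<in> S - B" "fmap D f' 0 \<in> S - A"
    using centre[OF f(1)] centre[OF f'] meet by auto
  moreover have "S - B \<subseteq> A" "S - A \<subseteq> B"
    using cover by auto
  moreover have "openin (topo M) (S - A)" "openin (topo M) (S - B)"
    using AB by (auto simp: S_def closedin_def)
  ultimately show False
    unfolding G_def by blast
qed

section \<open>Closed surfaces\<close>

text \<open>The side glued to \<open>x\<close>; on a surface without boundary this is an
  involution.\<close>

definition opp :: "'p mplcw \<Rightarrow> nat \<times> nat \<Rightarrow> nat \<times> nat" where
  "opp D x = side_of D (side_edge D x, \<not> side_dir D x)"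

definition lab :: "'p mplcw \<Rightarrow> nat \<times> nat \<Rightarrow> nat \<times> nat \<Rightarrow> bit" where
  "lab D x y = of_bool (label_less (side_label D x) (side_label D y))"

text \<open>The coboundary of the indicator function of \<open>T\<close>.\<close>

definition vertex_cochain :: "'p mplcw \<Rightarrow> 'p set \<Rightarrow> nat \<Rightarrow> bit" where
  "vertex_cochain D T e = of_bool (emap D e 0 \<in> T) + of_bool (emap D e 1 \<in> T)"

text \<open>The initial segment before \<open>x\<close> grows by \<open>x\<close>; if the next side
  is the marked one, all sides of the face drop out again.\<close>

lemma lt_next_side:
  assumes "x \<in> sides D" "y \<in> sides D"
  shows "lt y (next_side D x) = lt y x + of_bool (y = x) + of_bool (snd (next_side D x) = 1 \<and> fst y = fst x)"
proof -
  obtain f k f' k' where x: "x = (f, k)" "1 \<le> k" "k \<le> nsides D f" and y: "y = (f', k')" "1 \<le> k'" "k' \<le> nsides D f'"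
    using assms by (auto simp: sides_def)
  show ?thesis
    using x y by (cases "k = nsides D f") (auto simp: next_side_def lt_def side_less_def)
qed

lemma fst_next_side [simp]: "fst (next_side D x) = fst x"
  by (simp add: next_side_def)

lemma next_side_inj: "inj_on (next_side D) (sides D)"
proof (rule inj_onI)
  fix x y assume xy: "x \<in> sides D" "y \<in> sides D" "next_side D x = next_side D y"
  obtain f k f' k' where "x = (f, k)" "y = (f', k')" "1 \<le> k" "1 \<le> k'"
    using xy(1,2) by (auto simp: sides_def)
  then show "x = y"
    using xy(3) by (cases "k = nsides D f"; cases "k' = nsides D f'") (simp_all add: next_side_def)
qed

lemma next_side_bij:
  assumes "plcw_cells M D"
  shows "bij_betw (next_side D) (sides D) (sides D)"
proof -
  have "next_side D ` sides D = sides D"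
    by (rule card_subset_eq[OF finite_sides[OF assms]])
      (use next_side_in_sides card_image[OF next_side_inj[of D]] in auto)
  then show ?thesis
    using next_side_inj by (simp add: bij_betw_def)
qed

lemma sum_next_side: "plcw_cells M D \<Longrightarrow> (\<Sum>x\<in>sides D. F (next_side D x)) = (\<Sum>x\<in>sides D. F x)"
  by (rule sum.reindex_bij_betw[OF next_side_bij])

lemma face_parity_sides:
  assumes "plcw_cells M D" "f \<in> faces D"
  shows "face_parity D c f = (\<Sum>x\<in>sides D. of_bool (fst x = f) * c (side_edge D x))"
proof -
  have "(\<Sum>x\<in>sides D. of_bool (fst x = f) * c (side_edge D x)) = (\<Sum>x\<in>Pair f ` {1..nsides D f}. c (side_edge D x))"
    by (rule sum.mono_neutral_cong_right[OF finite_sides[OF assms(1)]]) (use assms(2) in \<open>auto simp: sides_def\<close>)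
  then show ?thesis
    by (simp add: face_parity_def sum.reindex inj_on_def)
qed

section \<open>Cochains on a surface without boundary\<close>

locale closed_surface =
  fixes r :: nat and M :: "('p, 'q) rspin_surface" and D :: "'p mplcw"
  assumes r_even: "even r" and M: "rspin r M" and D: "presents r M D" and nin: "nin M = 0"
begin

lemmas pl = presents_D(3)[OF D]
lemmas gl = presents_D(2)[OF D]
lemmas cells = presents_D(1)[OF D]
lemmas os = rspin_D(1)[OF M]

lemma inner: "e \<in> edges D \<Longrightarrow> inner_edge D e"
  using non_inner_edge[OF M pl] nin by (metis atLeastAtMost_iff le_trans not_one_le_zero)

lemma edge_dirs_eq: "e \<in> edges D \<Longrightarrow> edge_dirs D e = {True, False}"
  using inner by (simp add: edge_dirs_def)

lemma inner_edges_all: "inner_edges D = edges D"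
  using inner by (auto simp: inner_edges_def)

lemma boundary_empty: "boundary M = {}"
proof -
  have "p \<notin> boundary M" for p
    using boundary_circle_cover[OF M, of p False] nin by auto
  then show ?thesis by blast
qed

lemma sum_sides_edges: "(\<Sum>x\<in>sides D. F x) = (\<Sum>e\<in>edges D. F (side_of D (e, True)) + (F (side_of D (e, False)) :: 'b::comm_monoid_add))"
  unfolding sum_sides[OF pl] by (intro sum.cong refl) (simp add: edge_dirs_eq)

lemma side_of_edge:
  assumes "e \<in> edges D"
  shows "side_of D (e, d) \<in> sides D" "side_edge D (side_of D (e, d)) = e" "side_dir D (side_of D (e, d)) = d"
  by (rule side_of_D[OF gl assms]; cases d; simp add: edge_dirs_eq[OF assms])+

lemma opp:
  assumes "x \<in> sides D"
  shows "opp D x \<in> sides D" "side_edge D (opp D x) = side_edge D x" "side_dir D (opp D x) = (\<not> side_dir D x)"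
  unfolding opp_def by (rule side_of_edge[OF side_edge_in_edges[OF gl assms]])+

lemma sides_eqI: "x \<in> sides D \<Longrightarrow> y \<in> sides D \<Longrightarrow> side_edge D x = side_edge D y \<Longrightarrow> side_dir D x = side_dir D y \<Longrightarrow> x = y"
  by (rule side_label_inj[OF gl])

lemma opp_opp: "x \<in> sides D \<Longrightarrow> opp D (opp D x) = x"
  using opp by (intro sides_eqI) simp_all

lemma sides_edge_cases:
  assumes "x \<in> sides D" "y \<in> sides D" "side_edge D x = side_edge D y"
  shows "y = x \<or> y = opp D x"
proof (cases "side_dir D x = side_dir D y")
  case True
  then show ?thesis
    using sides_eqI[OF assms] by simp
next
  case False
  then have "y = opp D x"
    by (intro sides_eqI[OF assms(2) opp(1)[OF assms(1)]]) (simp_all add: opp[OF assms(1)] assms(3))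
  then show ?thesis ..
qed

lemma end_points:
  assumes "x \<in> sides D"
  shows "start_point D x = emap D (side_edge D x) (of_bool (\<not> side_dir D x))"
    "end_point D x = emap D (side_edge D x) (of_bool (side_dir D x))"
  by (rule end_points_of_side[OF os pl assms])+

lemma end_point_opp: "x \<in> sides D \<Longrightarrow> end_point D (opp D x) = start_point D x"
  using opp by (simp add: end_points)

lemma end_point_rotate: "x \<in> sides D \<Longrightarrow> end_point D (opp D (next_side D x)) = end_point D x"
  using end_point_opp[OF next_side_in_sides] start_point_next_side by metis

lemma vertex_cochain_side:
  assumes "x \<in> sides D"
  shows "vertex_cochain D T (side_edge D x) = of_bool (start_point D x \<in> T) + of_bool (end_point D x \<in> T)"
  by (cases "side_dir D x") (simp_all add: vertex_cochain_def end_points[OF assms] add.commute)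

lemma vertex_cochain_closed:
  assumes "f \<in> faces D"
  shows "face_parity D (vertex_cochain D T) f = 0"
proof -
  have "face_parity D (vertex_cochain D T) f =
      (\<Sum>x\<in>sides D. of_bool (fst x = f) * of_bool (start_point D x \<in> T)) +
      (\<Sum>x\<in>sides D. of_bool (fst (next_side D x) = f) * of_bool (start_point D (next_side D x) \<in> T))"
    unfolding face_parity_sides[OF cells assms] sum.distrib[symmetric]
    by (intro sum.cong refl) (simp add: vertex_cochain_side start_point_next_side algebra_simps)
  also have "\<dots> = 0"
    unfolding sum_next_side[OF cells, of "\<lambda>x. of_bool (fst x = f) * of_bool (start_point D x \<in> T)"] by simp
  finally show ?thesis .
qed

text \<open>The inversions counted by the Koszul sign.\<close>

definition wgt :: "nat \<times> nat \<Rightarrow> nat \<times> nat \<Rightarrow> bit" where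
  "wgt x y = lab D x y * lt y x"

lemma lab_self [simp]: "lab D x x = 0"
  by (simp add: lab_def label_less_def)

lemma lab_flip:
  assumes "x \<in> sides D" "y \<in> sides D" "x \<noteq> y"
  shows "lab D y x = lab D x y + 1"
proof -
  have "side_label D x \<noteq> side_label D y"
    using sides_eqI[OF assms(1,2)] assms(3) by (auto simp: side_label_def)
  then show ?thesis
    by (auto simp: lab_def label_less_def prod_eq_iff)
qed

text \<open>A pair is inverted, in one or the other order, exactly if labels and sides order it
  differently.\<close>

lemma wgt_sym:
  assumes "x \<in> sides D" "y \<in> sides D"
  shows "wgt x y + wgt y x = lab D x y + lt x y"
proof (cases "x = y")
  case False
  then show ?thesis
    using lab_flip[OF assms False] lt_flip[OF False]
    by (cases "lab D x y"; cases "lt x y") (simp_all add: wgt_def)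
qed (simp add: wgt_def)

definition quad :: "(nat \<Rightarrow> bit) \<Rightarrow> bit" where
  "quad c = (\<Sum>x\<in>sides D. \<Sum>y\<in>sides D. wgt x y * c (side_edge D x) * c (side_edge D y))"

lemma sign_exponent_quad: "sign_exponent M D c = (\<Sum>e\<in>edges D. c e * (of_int (eidx D e) + 1)) + quad c"
  by (simp add: sign_exponent_def nin quad_def wgt_def lab_def lt_def)

text \<open>A side and its opposite compare in the same way with the labels of other edges, so these
  terms cancel; within an edge one ordered pair counts.\<close>

lemma lab_sum: "(\<Sum>x\<in>sides D. \<Sum>y\<in>sides D. lab D x y * c (side_edge D x) * c' (side_edge D y)) = (\<Sum>e\<in>edges D. c e * c' e)"
proof -
  have fin: "finite (edges D)"
    by (rule plcw_cells_D(2)[OF cells])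
  have "(\<Sum>y\<in>sides D. lab D x y * c (side_edge D x) * c' (side_edge D y)) +
      (\<Sum>y\<in>sides D. lab D (opp D x) y * c (side_edge D (opp D x)) * c' (side_edge D y)) =
      c (side_edge D x) * c' (side_edge D x)" if x: "x \<in> sides D" for x
  proof -
    have "(\<Sum>y\<in>sides D. lab D x y * c (side_edge D x) * c' (side_edge D y)) +
      (\<Sum>y\<in>sides D. lab D (opp D x) y * c (side_edge D (opp D x)) * c' (side_edge D y)) =
      (\<Sum>e\<in>edges D. if e = side_edge D x then c (side_edge D x) * c' (side_edge D x) else 0)"
      unfolding sum.distrib[symmetric] sum_sides_edges
    proof (intro sum.cong refl)
      fix e assume e: "e \<in> edges D"
      show "lab D x (side_of D (e, True)) * c (side_edge D x) * c' (side_edge D (side_of D (e, True))) +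
         lab D x (side_of D (e, False)) * c (side_edge D x) * c' (side_edge D (side_of D (e, False))) +
         (lab D (opp D x) (side_of D (e, True)) * c (side_edge D (opp D x)) * c' (side_edge D (side_of D (e, True))) +
          lab D (opp D x) (side_of D (e, False)) * c (side_edge D (opp D x)) * c' (side_edge D (side_of D (e, False)))) =
         (if e = side_edge D x then c (side_edge D x) * c' (side_edge D x) else 0)"
        using opp[OF x] side_of_edge[OF e]
        by (cases "side_dir D x") (auto simp: lab_def label_less_def side_label_def)
    qed
    then show ?thesis
      using fin side_edge_in_edges[OF gl x] by simp
  qed
  note pair = this
  have opp_True: "opp D (side_of D (e, True)) = side_of D (e, False)" if "e \<in> edges D" for e
    by (simp add: opp_def side_of_edge[OF that])
  show ?thesis
    unfolding sum_sides_edges[of "\<lambda>x. \<Sum>y\<in>sides D. lab D x y * c (side_edge D x) * c' (side_edge D y)"]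
  proof (intro sum.cong refl)
    fix e assume e: "e \<in> edges D"
    show "(\<Sum>y\<in>sides D. lab D (side_of D (e, True)) y * c (side_edge D (side_of D (e, True))) * c' (side_edge D y)) +
        (\<Sum>y\<in>sides D. lab D (side_of D (e, False)) y * c (side_edge D (side_of D (e, False))) * c' (side_edge D y)) = c e * c' e"
      using pair[OF side_of_edge(1)[OF e, of True]] unfolding opp_True[OF e] side_of_edge(2)[OF e] .
  qed
qed

text \<open>The sides that drop out at the marked side are those of a whole face, over which a
  closed cochain sums to 0.\<close>

lemma prefix_next:
  assumes z: "\<And>f. f \<in> faces D \<Longrightarrow> face_parity D z f = 0" and x: "x \<in> sides D"
  shows "(\<Sum>y\<in>sides D. lt y (next_side D x) * z (side_edge D y)) = (\<Sum>y\<in>sides D. lt y x * z (side_edge D y)) + z (side_edge D x)"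
proof -
  have "(\<Sum>y\<in>sides D. lt y (next_side D x) * z (side_edge D y)) =
      (\<Sum>y\<in>sides D. lt y x * z (side_edge D y)) + (\<Sum>y\<in>sides D. of_bool (y = x) * z (side_edge D y)) +
      (\<Sum>y\<in>sides D. of_bool (snd (next_side D x) = 1) * (of_bool (fst y = fst x) * z (side_edge D y)))"
    unfolding sum.distrib[symmetric]
    by (intro sum.cong refl) (auto simp: lt_next_side[OF x] algebra_simps)
  also have "(\<Sum>y\<in>sides D. of_bool (snd (next_side D x) = 1) * (of_bool (fst y = fst x) * z (side_edge D y))) = 0"
    unfolding sum_distrib_left[symmetric] face_parity_sides[OF cells side_face[OF x], symmetric] z[OF side_face[OF x]] by simp
  also have "(\<Sum>y\<in>sides D. of_bool (y = x) * z (side_edge D y)) = (\<Sum>y\<in>sides D. if y = x then z (side_edge D y) else 0)"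
    by (intro sum.cong) auto
  finally show ?thesis
    using finite_sides[OF cells] x by simp
qed

text \<open>The polar form of \<open>quad\<close> vanishes because the sums of a closed cochain over initial segments of the sides change from
  a side to the next one by the value of the cochain only, also at the marked side.\<close>

lemma quad_add_closed:
  assumes z: "\<And>f. f \<in> faces D \<Longrightarrow> face_parity D z f = 0"
  shows "quad (\<lambda>e. z e + vertex_cochain D T e) = quad z + quad (vertex_cochain D T)"
proof -
  define c where "c = vertex_cochain D T"
  define u :: "nat \<times> nat \<Rightarrow> bit" where "u = (\<lambda>x. of_bool (end_point D x \<in> T))"
  define Pz where "Pz = (\<lambda>x. \<Sum>y\<in>sides D. lt y x * z (side_edge D y))"
  have "quad (\<lambda>e. z e + c e) = quad z + quad c +
      ((\<Sum>x\<in>sides D. \<Sum>y\<in>sides D. wgt x y * z (side_edge D x) * c (side_edge D y)) +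
       (\<Sum>x\<in>sides D. \<Sum>y\<in>sides D. wgt x y * z (side_edge D y) * c (side_edge D x)))"
    unfolding quad_def sum.distrib[symmetric] by (intro sum.cong refl) (simp add: algebra_simps)
  also have "(\<Sum>x\<in>sides D. \<Sum>y\<in>sides D. wgt x y * z (side_edge D y) * c (side_edge D x)) =
      (\<Sum>x\<in>sides D. \<Sum>y\<in>sides D. wgt y x * z (side_edge D x) * c (side_edge D y))"
    by (rule sum.swap)
  also have "(\<Sum>x\<in>sides D. \<Sum>y\<in>sides D. wgt x y * z (side_edge D x) * c (side_edge D y)) +
      (\<Sum>x\<in>sides D. \<Sum>y\<in>sides D. wgt y x * z (side_edge D x) * c (side_edge D y)) =
      (\<Sum>x\<in>sides D. \<Sum>y\<in>sides D. lab D x y * z (side_edge D x) * c (side_edge D y)) +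
      (\<Sum>x\<in>sides D. \<Sum>y\<in>sides D. lt x y * z (side_edge D x) * c (side_edge D y))"
    unfolding sum.distrib[symmetric]
  proof (intro sum.cong refl)
    fix x y assume xy: "x \<in> sides D" "y \<in> sides D"
    have "wgt x y * z (side_edge D x) * c (side_edge D y) + wgt y x * z (side_edge D x) * c (side_edge D y) =
        (wgt x y + wgt y x) * (z (side_edge D x) * c (side_edge D y))"
      by (simp add: algebra_simps)
    also have "\<dots> = lab D x y * z (side_edge D x) * c (side_edge D y) + lt x y * z (side_edge D x) * c (side_edge D y)"
      unfolding wgt_sym[OF xy] by (simp add: algebra_simps)
    finally show "wgt x y * z (side_edge D x) * c (side_edge D y) + wgt y x * z (side_edge D x) * c (side_edge D y) =
        lab D x y * z (side_edge D x) * c (side_edge D y) + lt x y * z (side_edge D x) * c (side_edge D y)" .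
  qed
  \<comment> \<open>By \<open>lab_sum\<close>; the coboundary on an edge splits into the end points
    of its two sides.\<close>
  also have "(\<Sum>x\<in>sides D. \<Sum>y\<in>sides D. lab D x y * z (side_edge D x) * c (side_edge D y)) = (\<Sum>x\<in>sides D. u x * z (side_edge D x))"
  proof -
    have "c e = u (side_of D (e, True)) + u (side_of D (e, False))" if "e \<in> edges D" for e
      by (simp add: c_def u_def vertex_cochain_def end_points side_of_edge[OF that] add.commute)
    then show ?thesis
      unfolding lab_sum sum_sides_edges[of "\<lambda>x. u x * z (side_edge D x)"]
      by (intro sum.cong refl) (simp add: side_of_edge algebra_simps)
  qed
  \<comment> \<open>Summation by parts along the cyclic order of the sides gives the same value as
    the sum over labels, so the two cancel.\<close>
  also have "(\<Sum>x\<in>sides D. \<Sum>y\<in>sides D. lt x y * z (side_edge D x) * c (side_edge D y)) = (\<Sum>x\<in>sides D. u x * z (side_edge D x))"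
  proof -
    have "(\<Sum>x\<in>sides D. \<Sum>y\<in>sides D. lt x y * z (side_edge D x) * c (side_edge D y)) =
        (\<Sum>y\<in>sides D. \<Sum>x\<in>sides D. lt x y * z (side_edge D x) * c (side_edge D y))"
      by (rule sum.swap)
    also have "\<dots> = (\<Sum>y\<in>sides D. of_bool (start_point D y \<in> T) * Pz y) + (\<Sum>y\<in>sides D. u y * Pz y)"
      unfolding sum.distrib[symmetric] sum_distrib_right[symmetric]
      by (intro sum.cong refl) (simp add: Pz_def c_def u_def vertex_cochain_side algebra_simps)
    also have "(\<Sum>y\<in>sides D. of_bool (start_point D y \<in> T) * Pz y) =
        (\<Sum>y\<in>sides D. of_bool (start_point D (next_side D y) \<in> T) * Pz (next_side D y))"
      by (rule sum_next_side[OF cells, symmetric])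
    also have "\<dots> = (\<Sum>y\<in>sides D. u y * Pz y + u y * z (side_edge D y))"
    proof (intro sum.cong refl)
      fix y assume y: "y \<in> sides D"
      have "Pz (next_side D y) = Pz y + z (side_edge D y)"
        unfolding Pz_def by (rule prefix_next[OF z y])
      then show "of_bool (start_point D (next_side D y) \<in> T) * Pz (next_side D y) = u y * Pz y + u y * z (side_edge D y)"
        by (simp add: start_point_next_side[OF y] u_def distrib_left)
    qed
    finally show ?thesis
      by (simp add: sum.distrib add_ac)
  qed
  finally show ?thesis
    by (simp add: c_def)
qed

end

section \<open>Sums over ordered pairs\<close>

lemma sum_even_odd:
  fixes F :: "nat \<Rightarrow> 'b::comm_monoid_add"
  shows "(\<Sum>a<2 * n. F a) = (\<Sum>i<n. F (2 * i) + F (2 * i + 1))"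
  by (induction n) (simp_all add: add.assoc)

lemma sum_pairs_even_odd:
  fixes K :: "nat \<Rightarrow> nat \<Rightarrow> 'b::comm_monoid_add"
  shows "(\<Sum>b<2 * n. \<Sum>a<b. K a b) = (\<Sum>i<n. K (2 * i) (2 * i + 1)) +
    (\<Sum>j<n. \<Sum>i<j. (K (2 * i) (2 * j) + K (2 * i) (2 * j + 1)) + (K (2 * i + 1) (2 * j) + K (2 * i + 1) (2 * j + 1)))"
proof -
  have "(\<Sum>b<2 * n. \<Sum>a<b. K a b) = (\<Sum>j<n. (\<Sum>a<2 * j. K a (2 * j)) + (\<Sum>a<2 * j + 1. K a (2 * j + 1)))"
    by (rule sum_even_odd)
  also have "\<dots> = (\<Sum>j<n. K (2 * j) (2 * j + 1) +
      (\<Sum>i<j. (K (2 * i) (2 * j) + K (2 * i) (2 * j + 1)) + (K (2 * i + 1) (2 * j) + K (2 * i + 1) (2 * j + 1))))"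
    by (intro sum.cong refl) (simp add: sum_even_odd sum.distrib add_ac)
  finally show ?thesis
    by (simp only: sum.distrib)
qed

lemma sum_pairs_symmetric:
  fixes K :: "nat \<Rightarrow> nat \<Rightarrow> 'b::comm_monoid_add"
  shows "(\<Sum>a<m. \<Sum>b<m. K a b) = (\<Sum>b<m. \<Sum>a<b. K a b + K b a) + (\<Sum>a<m. K a a)"
proof (induction m)
  case (Suc m)
  have "(\<Sum>a<Suc m. \<Sum>b<Suc m. K a b) = (\<Sum>a<m. \<Sum>b<m. K a b) + (\<Sum>a<m. K a m + K m a) + K m m"
    by (simp add: sum.distrib add_ac)
  then show ?case
    unfolding Suc by (simp add: add_ac)
qed simp

text \<open>Moving the element 0 to the end of the order reverses the \<open>m - 1\<close> pairs
  containing it, and each reversal adds 1.\<close>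

lemma sum_pairs_shift:
  fixes L :: "nat \<Rightarrow> nat \<Rightarrow> bit"
  assumes "\<And>a b. a < m \<Longrightarrow> b < m \<Longrightarrow> a \<noteq> b \<Longrightarrow> L a b + L b a = 1" "0 < m"
    and "\<And>a. L a m = L a 0"
  shows "(\<Sum>b<m. \<Sum>a<b. L a b) = (\<Sum>b<m. \<Sum>a<b. L (a + 1) (b + 1)) + of_nat m + 1"
proof -
  have "(\<Sum>b<m. \<Sum>a<b. L a b) + (\<Sum>a<m. L a m) = (\<Sum>b<Suc m. \<Sum>a<b. L a b)"
    by simp
  also have "\<dots> = (\<Sum>b<m. \<Sum>a<Suc b. L a (Suc b))"
    by (subst sum.lessThan_Suc_shift) simp
  also have "\<dots> = (\<Sum>b<m. L 0 (Suc b)) + (\<Sum>b<m. \<Sum>a<b. L (a + 1) (b + 1))"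
    unfolding sum.lessThan_Suc_shift sum.distrib by simp
  finally have 1: "(\<Sum>b<m. \<Sum>a<b. L a b) + (\<Sum>a<m. L a 0) = (\<Sum>b<m. L 0 (Suc b)) + (\<Sum>b<m. \<Sum>a<b. L (a + 1) (b + 1))"
    unfolding assms(3) .
  obtain l where m: "m = Suc l"
    using assms(2) by (cases m) auto
  have "(\<Sum>a<m. L a 0) = L 0 0 + (\<Sum>a<l. L (Suc a) 0)"
    unfolding m by (rule sum.lessThan_Suc_shift)
  moreover have "(\<Sum>b<m. L 0 (Suc b)) = L 0 0 + (\<Sum>a<l. L 0 (Suc a))"
    unfolding m using assms(3)[of 0] m by (simp add: add.commute)
  moreover have "(\<Sum>a<l. L (Suc a) 0) + (\<Sum>a<l. L 0 (Suc a)) = of_nat l"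
    unfolding sum.distrib[symmetric] using assms(1) m by simp
  ultimately have 2: "(\<Sum>a<m. L a 0) + (\<Sum>b<m. L 0 (Suc b)) = of_nat m + 1"
    unfolding m by (cases "L 0 0") (simp_all add: add_ac)
  have cancel: "x + p = q + s \<Longrightarrow> p + q = t \<Longrightarrow> x = s + (t :: bit)" for x p q s t
    by (cases x; cases p; cases q; cases s) auto
  show ?thesis
    unfolding add.assoc by (rule cancel[OF 1 2])
qed

lemma bit_of_int_diff: "of_int (a - b + 1) = (of_int a + of_int b + 1 :: bit)"
  unfolding bit_of_int_odd by (cases "even a"; cases "even b") simp_all

lemma sum_product_weight:
  fixes c :: "'b::comm_semiring_0"
  shows "c * (\<Sum>a\<in>I. A a) * (\<Sum>b\<in>J. B b) = (\<Sum>a\<in>I. \<Sum>b\<in>J. A a * (B b * c))"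
proof -
  have "c * (\<Sum>a\<in>I. A a) * (\<Sum>b\<in>J. B b) = (\<Sum>a\<in>I. \<Sum>b\<in>J. A a * B b) * c"
    by (simp only: sum_product[symmetric] mult_ac)
  then show ?thesis
    by (simp only: sum_distrib_right mult.assoc)
qed

section \<open>The quadratic part at a single vertex\<close>

context closed_surface
begin

text \<open>A pair of a side and a truth value stands for the start (\<open>False\<close>) or the end (\<open>True\<close>) of the side. Starts precede ends,
  so that the end of a side and the start of the next one are consecutive for \<open>half_lt\<close> unless the marked vertex lies
  between them.\<close>

definition half_lt :: "(nat \<times> nat) \<times> bool \<Rightarrow> (nat \<times> nat) \<times> bool \<Rightarrow> bit" where
  "half_lt h h' = lt (fst h) (fst h') + of_bool (fst h = fst h' \<and> \<not> snd h \<and> snd h')"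

definition half_lab :: "(nat \<times> nat) \<times> bool \<Rightarrow> (nat \<times> nat) \<times> bool \<Rightarrow> bit" where
  "half_lab h h' = lab D (fst h) (fst h') + of_bool (fst h = fst h' \<and> \<not> snd h \<and> snd h')"

lemma half_lab_flip:
  assumes "fst h \<in> sides D" "fst h' \<in> sides D" "h \<noteq> h'"
  shows "half_lab h h' + half_lab h' h = 1"
proof (cases "fst h = fst h'")
  case True
  then have "snd h \<noteq> snd h'"
    using assms(3) by (auto simp: prod_eq_iff)
  then show ?thesis
    using True by (auto simp: half_lab_def)
next
  case False
  then show ?thesis
    using lab_flip[OF assms(1,2) False] by (auto simp: half_lab_def)
qed

text \<open>The two half-sides of a corner are adjacent in the order, so others do not distinguish
  them. If the marked vertex lies between them, all half-sides of the face do, and the defect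
  depends on the face of \<open>h\<close> alone.\<close>

lemma half_lt_corner:
  assumes "fst h \<in> sides D" "x \<in> sides D" "h \<noteq> (x, True)"
  shows "half_lt h (x, True) + half_lt h (next_side D x, False) =
    of_bool (snd (next_side D x) = 1 \<and> fst (fst h) = fst x)"
  using assms by (cases "lt (fst h) x") (auto simp: half_lt_def lt_next_side prod_eq_iff)

lemma half_lt_corner_self:
  assumes "x \<in> sides D"
  shows "half_lt (x, True) (next_side D x, False) = 1 + of_bool (snd (next_side D x) = 1)"
  using assms by (auto simp: half_lt_def lt_next_side)

text \<open>\<open>(x, False)\<close> and \<open>(opp D x, True)\<close> are the half-sides at one
  end of an edge. Other edges do not distinguish them; half-sides of the same edge do, depending
  only on the direction of \<open>x\<close>.\<close>

lemma half_lab_end: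
  assumes "fst h \<in> sides D" "x \<in> sides D" "h \<noteq> (x, False)" "h \<noteq> (opp D x, True)"
  shows "half_lab h (x, False) + half_lab h (opp D x, True) = of_bool (side_edge D (fst h) = side_edge D x \<and> side_dir D x)"
proof -
  obtain y b where h: "h = (y, b)"
    by (cases h)
  note y = assms(1)[unfolded h fst_conv] and x = assms(2)
  show ?thesis
  proof (cases "side_edge D y = side_edge D x")
    case False
    then have "y \<noteq> opp D x"
      using opp(2)[OF x] by auto
    then show ?thesis
      using False opp[OF x] by (auto simp: h half_lab_def lab_def label_less_def side_label_def)
  next
    case True
    then consider "y = x" "b" "opp D x \<noteq> x" | "y = opp D x" "\<not> b"
      using sides_edge_cases[OF x y] assms(3,4) opp(3)[OF x] h by metis
    then show ?thesis
      using True opp[OF x] by cases (auto simp: h half_lab_def lab_def label_less_def side_label_def)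
  qed
qed

lemma half_lab_end_self:
  assumes "x \<in> sides D"
  shows "half_lab (x, False) (opp D x, True) = of_bool (side_dir D x)"
  using opp[OF assms] by (auto simp: half_lab_def lab_def label_less_def side_label_def)

text \<open>Refining sides to half-sides adds the same term to both orders.\<close>

lemma wgt_half:
  assumes "fst h \<in> sides D" "fst h' \<in> sides D"
  shows "wgt (fst h) (fst h') + wgt (fst h') (fst h) = half_lab h h' + half_lt h h'"
  using wgt_sym[OF assms] by (auto simp: half_lab_def half_lt_def)

text \<open>The pairs of the \<open>2n\<close> half-sides at a vertex are counted by corners for the order of the sides, and by edge ends
  for the order of the labels; the cyclic shift that turns the first grouping into the second one accounts for the
  last summand.\<close>

lemma quad_vertex_corners:
  assumes n: "0 < n" and inj: "inj_on X {..<n}" and img: "X ` {..<n} = {x \<in> sides D. end_point D x = v}"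
    and step: "\<And>i. X (Suc i) = opp D (next_side D (X i))" and per: "X n = X 0"
  shows "quad (vertex_cochain D {v}) =
    (\<Sum>x\<in>{x \<in> sides D. end_point D x = v}. 1 + of_bool (snd (next_side D x) = 1) + of_bool (side_dir D (next_side D x))) + 1"
proof -
  have X_img: "X i \<in> sides D" "end_point D (X i) = v" if "i < n" for i
    using img that by blast+
  have X: "X i \<in> sides D" for i
  proof (induction i)
    case 0
    then show ?case using X_img(1)[OF n] .
  next
    case (Suc i)
    then show ?case unfolding step by (intro opp(1) next_side_in_sides)
  qed
  \<comment> \<open>The half-sides at \<open>v\<close> in cyclic order: the end of
    \<open>X i\<close>, the start of the next side, the end of its opposite
    \<open>X (Suc i)\<close>, and so on.\<close>
  define h where "h = (\<lambda>a. if even a then (X (a div 2), True) else (next_side D (X (a div 2)), False))"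
  have h_even: "h (2 * i) = (X i, True)" and h_odd: "h (2 * i + 1) = (next_side D (X i), False)" for i
    by (simp_all add: h_def)
  have hs: "fst (h a) \<in> sides D" for a
    unfolding h_def using X next_side_in_sides[OF X] by simp
  have h_inj: "h a \<noteq> h b" if ab: "a < 2 * n" "b < 2 * n" "a \<noteq> b" for a b
  proof
    assume eq: "h a = h b"
    then have p: "even a = even b"
      by (auto simp: h_def split: if_splits)
    have "X (a div 2) = X (b div 2)"
      using eq p inj_onD[OF next_side_inj _ X X] by (auto simp: h_def split: if_splits)
    then have "a div 2 = b div 2"
      using inj_onD[OF inj, of "a div 2" "b div 2"] ab by auto
    then show False
      using p ab(3) by (metis div_mult_mod_eq parity_cases)
  qed
  \<comment> \<open>A side with both ends at \<open>v\<close> is met twice, in agreement with the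
    value 0 of the coboundary.\<close>
  have mult: "vertex_cochain D {v} (side_edge D x) = (\<Sum>a<2 * n. of_bool (fst (h a) = x))" if x: "x \<in> sides D" for x
  proof -
    have "(\<Sum>i<n. of_bool (X i = y)) = (of_bool (end_point D y = v) :: bit)" if y: "y \<in> sides D" for y
    proof -
      have "(\<Sum>i<n. of_bool (X i = y)) = (\<Sum>x\<in>X ` {..<n}. (of_bool (x = y) :: bit))"
        by (simp only: sum.reindex[OF inj] o_def)
      also have "\<dots> = (\<Sum>x\<in>X ` {..<n}. if x = y then 1 else 0)"
        by (intro sum.cong) auto
      also have "\<dots> = of_bool (y \<in> X ` {..<n})"
        by simp
      finally show ?thesis
        unfolding img using y by simp
    qed
    note cnt = this
    obtain w where w: "w \<in> sides D" "next_side D w = x"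
      using x next_side_bij[OF cells] by (metis bij_betw_def imageE)
    have "next_side D (X i) = x \<longleftrightarrow> X i = w" for i
      using w inj_onD[OF next_side_inj _ X w(1)] by auto
    then have "(\<Sum>i<n. of_bool (next_side D (X i) = x)) = (of_bool (start_point D x = v) :: bit)"
      using cnt[OF w(1)] start_point_next_side[OF w(1)] w(2) by simp
    then show ?thesis
      unfolding vertex_cochain_side[OF x] sum_even_odd h_even h_odd sum.distrib fst_conv
      using cnt[OF x] by (simp add: add.commute)
  qed
  have fin: "finite (sides D)"
    by (rule finite_sides[OF cells])
  have pick: "(\<Sum>x\<in>sides D. of_bool (fst (h a) = x) * F x) = (F (fst (h a)) :: bit)" for F a
  proof -
    have "(\<Sum>x\<in>sides D. of_bool (fst (h a) = x) * F x) = (\<Sum>x\<in>sides D. if x = fst (h a) then F x else 0)"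
      by (intro sum.cong) auto
    then show ?thesis
      using fin hs by simp
  qed
  have "quad (vertex_cochain D {v}) =
      (\<Sum>x\<in>sides D. \<Sum>y\<in>sides D. \<Sum>a<2 * n. \<Sum>b<2 * n. of_bool (fst (h a) = x) * (of_bool (fst (h b) = y) * wgt x y))"
    unfolding quad_def by (intro sum.cong refl) (simp only: mult sum_product_weight)
  also have "\<dots> = (\<Sum>a<2 * n. \<Sum>b<2 * n. \<Sum>x\<in>sides D. of_bool (fst (h a) = x) * (\<Sum>y\<in>sides D. of_bool (fst (h b) = y) * wgt x y))"
  proof -
    have "(\<Sum>x\<in>sides D. \<Sum>y\<in>sides D. \<Sum>a<2 * n. \<Sum>b<2 * n. of_bool (fst (h a) = x) * (of_bool (fst (h b) = y) * wgt x y)) =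
        (\<Sum>x\<in>sides D. \<Sum>a<2 * n. \<Sum>y\<in>sides D. \<Sum>b<2 * n. of_bool (fst (h a) = x) * (of_bool (fst (h b) = y) * wgt x y))"
      by (intro sum.cong refl sum.swap)
    also have "\<dots> = (\<Sum>a<2 * n. \<Sum>x\<in>sides D. \<Sum>y\<in>sides D. \<Sum>b<2 * n. of_bool (fst (h a) = x) * (of_bool (fst (h b) = y) * wgt x y))"
      by (rule sum.swap)
    also have "\<dots> = (\<Sum>a<2 * n. \<Sum>x\<in>sides D. \<Sum>b<2 * n. \<Sum>y\<in>sides D. of_bool (fst (h a) = x) * (of_bool (fst (h b) = y) * wgt x y))"
      by (intro sum.cong refl sum.swap)
    also have "\<dots> = (\<Sum>a<2 * n. \<Sum>b<2 * n. \<Sum>x\<in>sides D. \<Sum>y\<in>sides D. of_bool (fst (h a) = x) * (of_bool (fst (h b) = y) * wgt x y))"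
      by (intro sum.cong refl sum.swap)
    finally show ?thesis
      unfolding sum_distrib_left .
  qed
  also have "\<dots> = (\<Sum>a<2 * n. \<Sum>b<2 * n. wgt (fst (h a)) (fst (h b)))"
    unfolding pick ..
  also have "\<dots> = (\<Sum>b<2 * n. \<Sum>a<b. half_lab (h a) (h b) + half_lt (h a) (h b))"
    unfolding sum_pairs_symmetric using wgt_half[OF hs hs] by (simp add: wgt_def)
  also have "\<dots> = (\<Sum>b<2 * n. \<Sum>a<b. half_lab (h a) (h b)) + (\<Sum>b<2 * n. \<Sum>a<b. half_lt (h a) (h b))"
    by (simp only: sum.distrib)
  \<comment> \<open>Grouped by corners; terms between different corners cancel by
    \<open>half_lt_corner\<close>.\<close>
  also have "(\<Sum>b<2 * n. \<Sum>a<b. half_lt (h a) (h b)) = (\<Sum>i<n. 1 + of_bool (snd (next_side D (X i)) = 1))"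
  proof -
    have "(half_lt (h (2 * i)) (h (2 * j)) + half_lt (h (2 * i)) (h (2 * j + 1))) +
        (half_lt (h (2 * i + 1)) (h (2 * j)) + half_lt (h (2 * i + 1)) (h (2 * j + 1))) = 0" if "i < j" "j < n" for i j
    proof -
      have "(X i, True) \<noteq> (X j, True)"
        using inj_onD[OF inj, of i j] that by auto
      then have "half_lt (h (2 * i)) (h (2 * j)) + half_lt (h (2 * i)) (h (2 * j + 1)) =
          of_bool (snd (next_side D (X j)) = 1 \<and> fst (X i) = fst (X j))"
        unfolding h_even h_odd using half_lt_corner[of "(X i, True)" "X j"] X by simp
      moreover have "half_lt (h (2 * i + 1)) (h (2 * j)) + half_lt (h (2 * i + 1)) (h (2 * j + 1)) =
          of_bool (snd (next_side D (X j)) = 1 \<and> fst (X i) = fst (X j))"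
        unfolding h_even h_odd using half_lt_corner[of "(next_side D (X i), False)" "X j"] X next_side_in_sides[OF X] by simp
      ultimately show ?thesis by (simp only: bit_add_self)
    qed
    moreover have "half_lt (h (2 * i)) (h (2 * i + 1)) = 1 + of_bool (snd (next_side D (X i)) = 1)" for i
      unfolding h_even h_odd by (rule half_lt_corner_self[OF X])
    ultimately show ?thesis
      unfolding sum_pairs_even_odd by simp
  qed
  \<comment> \<open>After the shift the groups are edge ends; terms between different ones cancel by
    \<open>half_lab_end\<close>.\<close>
  also have "(\<Sum>b<2 * n. \<Sum>a<b. half_lab (h a) (h b)) = (\<Sum>i<n. of_bool (side_dir D (next_side D (X i)))) + 1"
  proof -
    have "h (2 * n) = h 0"
      using per by (simp add: h_def)
    then have "(\<Sum>b<2 * n. \<Sum>a<b. half_lab (h a) (h b)) =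
        (\<Sum>b<2 * n. \<Sum>a<b. half_lab (h (a + 1)) (h (b + 1))) + of_nat (2 * n) + 1"
      using n by (intro sum_pairs_shift half_lab_flip hs h_inj) auto
    also have "of_nat (2 * n) = (0 :: bit)"
      by (simp add: bit_of_nat_odd)
    also have "(\<Sum>b<2 * n. \<Sum>a<b. half_lab (h (a + 1)) (h (b + 1))) = (\<Sum>i<n. of_bool (side_dir D (next_side D (X i))))"
    proof -
      define w where "w = (\<lambda>i. next_side D (X i))"
      have w: "w i \<in> sides D" for i
        unfolding w_def by (intro next_side_in_sides X)
      have h1: "h (2 * i + 1) = (w i, False)" and h2: "h (2 * i + 1 + 1) = (opp D (w i), True)" for i
        using h_odd[of i] h_even[of "Suc i"] by (simp_all add: w_def step)
      have "(half_lab (h (2 * i + 1)) (h (2 * j + 1)) + half_lab (h (2 * i + 1)) (h (2 * j + 1 + 1))) +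
          (half_lab (h (2 * i + 1 + 1)) (h (2 * j + 1)) + half_lab (h (2 * i + 1 + 1)) (h (2 * j + 1 + 1))) = 0"
        if "i < j" "j < n" for i j
      proof -
        have ne: "w i \<noteq> w j"
          unfolding w_def using inj_onD[OF inj, of i j] inj_onD[OF next_side_inj _ X X] that by auto
        then have "opp D (w i) \<noteq> opp D (w j)"
          using opp_opp[OF w] by metis
        then have "half_lab (h (2 * i + 1 + 1)) (h (2 * j + 1)) + half_lab (h (2 * i + 1 + 1)) (h (2 * j + 1 + 1)) =
            of_bool (side_edge D (w i) = side_edge D (w j) \<and> side_dir D (w j))"
          unfolding h1 h2 using half_lab_end[of "(opp D (w i), True)" "w j"] opp[OF w] w by simp
        moreover have "half_lab (h (2 * i + 1)) (h (2 * j + 1)) + half_lab (h (2 * i + 1)) (h (2 * j + 1 + 1)) =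
            of_bool (side_edge D (w i) = side_edge D (w j) \<and> side_dir D (w j))"
          unfolding h1 h2 using half_lab_end[of "(w i, False)" "w j"] ne w by simp
        ultimately show ?thesis by (simp only: bit_add_self)
      qed
      moreover have "half_lab (h (2 * i + 1)) (h (2 * i + 1 + 1)) = of_bool (side_dir D (w i))" for i
        unfolding h1 h2 by (rule half_lab_end_self[OF w])
      ultimately show ?thesis
        unfolding sum_pairs_even_odd[of "\<lambda>a b. half_lab (h (a + 1)) (h (b + 1))"] by (simp add: w_def)
    qed
    finally show ?thesis by simp
  qed
  finally have "quad (vertex_cochain D {v}) =
      (\<Sum>i<n. 1 + of_bool (snd (next_side D (X i)) = 1) + of_bool (side_dir D (next_side D (X i)))) + 1"
    by (simp add: sum.distrib add_ac)
  then show ?thesis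
    unfolding img[symmetric] using inj by (simp add: sum.reindex)
qed

text \<open>The sums over the corners are the degree of \<open>v\<close>, the number of marked
  corners and the number of outgoing edges. With the linear part they make up admissibility at
  \<open>v\<close> modulo 2.\<close>

lemma sign_exponent_vertex:
  assumes v: "v \<in> verts D"
    and corners: "quad (vertex_cochain D {v}) =
      (\<Sum>x\<in>{x \<in> sides D. end_point D x = v}. 1 + of_bool (snd (next_side D x) = 1) + of_bool (side_dir D (next_side D x))) + 1"
  shows "sign_exponent M D (vertex_cochain D {v}) = 0"
proof -
  define a b :: "nat \<Rightarrow> bit" where "a = (\<lambda>e. of_bool (emap D e 0 = v))" and "b = (\<lambda>e. of_bool (emap D e 1 = v))"
  define Dv :: bit where "Dv = of_int (vertex_D D v)"
  have fin: "finite (sides D)" "finite (edges D)" "finite (faces D)"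
    using finite_sides[OF cells] plcw_cells_D(1,2)[OF cells] by auto
  have at: "(\<Sum>x\<in>{x \<in> sides D. end_point D x = v}. F x) = (\<Sum>x\<in>sides D. of_bool (end_point D x = v) * (F x :: bit))" for F
    unfolding sum.inter_filter[OF fin(1)] by (intro sum.cong refl) simp
  have shift: "(\<Sum>x\<in>sides D. of_bool (end_point D x = v) * F (next_side D x)) =
      (\<Sum>x\<in>sides D. of_bool (start_point D x = v) * (F x :: bit))" for F
    unfolding sum_next_side[OF cells, symmetric, of "\<lambda>x. of_bool (start_point D x = v) * F x"]
    by (intro sum.cong refl) (simp add: start_point_next_side)
  have ends: "end_point D (side_of D (e, True)) = emap D e 1" "end_point D (side_of D (e, False)) = emap D e 0"
    "start_point D (side_of D (e, True)) = emap D e 0" if "e \<in> edges D" for e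
    by (simp_all add: end_points side_of_edge[OF that])
  have n1: "(\<Sum>x\<in>sides D. of_bool (end_point D x = v)) = (\<Sum>e\<in>edges D. a e + b e)"
    unfolding sum_sides_edges by (intro sum.cong refl) (simp add: ends a_def b_def add.commute)
  have n2: "(\<Sum>x\<in>sides D. of_bool (start_point D x = v) * of_bool (side_dir D x)) = (\<Sum>e\<in>edges D. a e)"
    unfolding sum_sides_edges by (intro sum.cong refl) (simp add: ends a_def side_of_edge)
  have n3: "(\<Sum>x\<in>sides D. of_bool (start_point D x = v) * of_bool (snd x = 1)) = Dv"
  proof -
    have "(\<Sum>x\<in>sides D. of_bool (start_point D x = v) * of_bool (snd x = 1)) =
        (\<Sum>x\<in>(\<lambda>f. (f, 1)) ` faces D. (of_bool (start_point D x = v) :: bit))"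
      using plcw_cells_D(3)[OF cells] fin(1) by (intro sum.mono_neutral_cong_right) (auto simp: sides_def)
    also have "\<dots> = (\<Sum>f\<in>faces D. of_bool (fmap D f 1 = v))"
      by (simp add: sum.reindex inj_on_def start_point_marked[unfolded One_nat_def])
    also have "\<dots> = Dv"
      unfolding Dv_def vertex_D_def using fin(3) by (simp add: sum.If_cases of_bool_def Int_def)
    finally show ?thesis .
  qed
  have q: "quad (vertex_cochain D {v}) = (\<Sum>e\<in>edges D. a e + b e) + Dv + (\<Sum>e\<in>edges D. a e) + 1"
  proof -
    have "quad (vertex_cochain D {v}) = (\<Sum>x\<in>sides D. of_bool (end_point D x = v)) +
      (\<Sum>x\<in>sides D. of_bool (end_point D x = v) * of_bool (snd (next_side D x) = 1)) +
      (\<Sum>x\<in>sides D. of_bool (end_point D x = v) * of_bool (side_dir D (next_side D x))) + 1"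
      unfolding corners at by (simp only: distrib_left mult_1_right sum.distrib)
    then show ?thesis
      unfolding shift[of "\<lambda>x. of_bool (snd x = 1)"] shift[of "\<lambda>x. of_bool (side_dir D x)"] n1 n2 n3 .
  qed
  have "[(\<Sum>e\<in>edges_at D v. hat_s D v e) = vertex_D D v - vertex_N D v + 1] (mod int r)"
    by (rule bspec[OF conjunct1[OF presents_D(4)[OF D, unfolded admissible_def]]]) (use v boundary_empty in simp)
  from cong_imp_bit_eq[OF this r_even]
  have "(\<Sum>e\<in>edges_at D v. of_int (hat_s D v e)) = Dv + of_int (vertex_N D v) + (1 :: bit)"
    unfolding Dv_def of_int_sum bit_of_int_diff .
  also have "of_int (vertex_N D v) = (\<Sum>e\<in>edges D. a e + b e)"
    unfolding vertex_N_def sum.distrib a_def b_def using fin(2) by (simp add: sum.If_cases of_bool_def Int_def)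
  \<comment> \<open>Modulo 2 one formula covers all cases of \<open>hat_s\<close>; for a loop the
    index drops out and 1 remains.\<close>
  also have "(\<Sum>e\<in>edges_at D v. of_int (hat_s D v e)) = (\<Sum>e\<in>edges D. (a e + b e) * of_int (eidx D e) + b e)"
    using fin(2) by (intro sum.mono_neutral_cong_left) (auto simp: edges_at_def hat_s_def a_def b_def bit_of_int_odd)
  finally have s: "(\<Sum>e\<in>edges D. (a e + b e) * of_int (eidx D e)) + (\<Sum>e\<in>edges D. b e) = Dv + (\<Sum>e\<in>edges D. a e + b e) + 1"
    by (simp only: sum.distrib)
  have "sign_exponent M D (vertex_cochain D {v}) =
      (\<Sum>e\<in>edges D. (a e + b e) * of_int (eidx D e)) + (\<Sum>e\<in>edges D. a e + b e) + quad (vertex_cochain D {v})"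
    unfolding sign_exponent_quad sum.distrib[symmetric]
    by (simp add: vertex_cochain_def a_def b_def distrib_left)
  moreover have "S + B = d + (A + B) + 1 \<Longrightarrow> S + (A + B) + ((A + B) + d + A + 1) = 0" for S A B d :: bit
    by (cases S; cases A; cases B; cases d) auto
  ultimately show ?thesis
    unfolding q sum.distrib[of a b] using s[unfolded sum.distrib[of a b]] by simp
qed

end

text \<open>The sum factorises over \<open>I\<close>. It is real because it serves to count,
  whatever the characteristic of the coefficients.\<close>

lemma character_sum:
  fixes p :: "'a \<Rightarrow> bit"
  assumes "finite I"
  shows "(\<Sum>y\<in>I \<rightarrow>\<^sub>E UNIV. bsign (\<Sum>i\<in>I. of_bool (y i) * p i)) = (if \<forall>i\<in>I. p i = 0 then 2 ^ card I else (0 :: real))"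
proof -
  have "(\<Sum>y\<in>I \<rightarrow>\<^sub>E UNIV. bsign (\<Sum>i\<in>I. of_bool (y i) * p i)) = (\<Prod>i\<in>I. \<Sum>b\<in>UNIV. (bsign (of_bool b * p i) :: real))"
    unfolding bsign_sum by (rule prod_sum_PiE[OF assms, symmetric]) simp
  also have "\<dots> = (\<Prod>i\<in>I. if p i = 0 then 2 else 0)"
    by (intro prod.cong refl) (simp add: UNIV_bool)
  finally show ?thesis
    using assms by (auto intro: prod_zero)
qed

lemma sum_if_const:
  fixes c :: "'b::comm_semiring_1"
  assumes "finite A"
  shows "(\<Sum>x\<in>A. if P x then c else 0) = c * of_nat (card {x \<in> A. P x})"
  using assms by (simp add: sum.If_cases Int_def mult.commute)

lemma cong_face_parity:
  assumes "plcw_gluing M D" "f \<in> faces D" "\<And>e. e \<in> edges D \<Longrightarrow> c e = c' e"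
  shows "face_parity D c f = face_parity D c' f"
  unfolding face_parity_def
  using side_edge_in_edges[OF assms(1)] assms(2,3) by (intro sum.cong refl) (simp add: sides_def)

section \<open>Closed cochains and functions on corners\<close>

context closed_surface
begin

definition cochain :: "(nat \<Rightarrow> bool) \<Rightarrow> nat \<Rightarrow> bit" where
  "cochain y e = of_bool (y e)"

definition closed_cochains :: "(nat \<Rightarrow> bool) set" where
  "closed_cochains = {y \<in> edges D \<rightarrow>\<^sub>E UNIV. \<forall>f\<in>faces D. face_parity D (cochain y) f = 0}"

lemma sign_exponent_cong:
  assumes "\<And>e. e \<in> edges D \<Longrightarrow> c e = c' e"
  shows "sign_exponent M D c = sign_exponent M D c'"
  unfolding sign_exponent_quad quad_def
  using assms side_edge_in_edges[OF gl] by (intro arg_cong2[where f = "(+)"] sum.cong refl) simp_all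

text \<open>Adjointness of boundary and coboundary: an edge receives the values of \<open>S\<close>
  on the faces at its two sides.\<close>

lemma sum_face_parity:
  "(\<Sum>f\<in>faces D. of_bool (S f) * face_parity D c f) =
    (\<Sum>e\<in>edges D. c e * (of_bool (S (fst (side_of D (e, True)))) + of_bool (S (fst (side_of D (e, False))))))"
proof -
  have fin: "finite (faces D)"
    by (rule plcw_cells_D(1)[OF cells])
  have "(\<Sum>f\<in>faces D. of_bool (S f) * face_parity D c f) =
      (\<Sum>f\<in>faces D. \<Sum>x\<in>sides D. of_bool (S f) * (of_bool (fst x = f) * c (side_edge D x)))"
    by (intro sum.cong refl) (simp only: face_parity_sides[OF cells] sum_distrib_left)
  also have "\<dots> = (\<Sum>x\<in>sides D. \<Sum>f\<in>faces D. of_bool (S f) * (of_bool (fst x = f) * c (side_edge D x)))"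
    by (rule sum.swap)
  also have "\<dots> = (\<Sum>x\<in>sides D. of_bool (S (fst x)) * c (side_edge D x))"
  proof (intro sum.cong refl)
    fix x assume x: "x \<in> sides D"
    have "(\<Sum>f\<in>faces D. of_bool (S f) * (of_bool (fst x = f) * c (side_edge D x))) =
        (\<Sum>f\<in>faces D. if f = fst x then of_bool (S f) * c (side_edge D x) else 0)"
      by (intro sum.cong) auto
    then show "(\<Sum>f\<in>faces D. of_bool (S f) * (of_bool (fst x = f) * c (side_edge D x))) = of_bool (S (fst x)) * c (side_edge D x)"
      using fin side_face[OF x] by simp
  qed
  also have "\<dots> = (\<Sum>e\<in>edges D. c e * (of_bool (S (fst (side_of D (e, True)))) + of_bool (S (fst (side_of D (e, False))))))"
    unfolding sum_sides_edges by (intro sum.cong refl) (simp add: side_of_edge algebra_simps)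
  finally show ?thesis .
qed

lemma end_point_image: "end_point D ` sides D = verts D"
proof
  show "end_point D ` sides D \<subseteq> verts D"
    using start_point_in_verts(2)[OF os pl] by blast
  show "verts D \<subseteq> end_point D ` sides D"
  proof
    fix v assume "v \<in> verts D"
    then obtain e where e: "e \<in> edges D" "v = emap D e 0 \<or> v = emap D e 1"
      by (auto simp: verts_def)
    have "end_point D (side_of D (e, True)) = emap D e 1" "end_point D (side_of D (e, False)) = emap D e 0"
      using e(1) by (simp_all add: end_points side_of_edge)
    then show "v \<in> end_point D ` sides D"
      using e side_of_edge(1)[OF e(1)] by (metis imageI)
  qed
qed

text \<open>A side stands for the corner of its face at its end point, and \<open>opp D \<circ> next_side D\<close> rotates the corners about a vertex.\<close>

definition invariant :: "(nat \<times> nat \<Rightarrow> bool) set" where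
  "invariant = {u \<in> sides D \<rightarrow>\<^sub>E UNIV. \<forall>x\<in>sides D. u (opp D (next_side D x)) = u x}"

text \<open>The left and the right side end at the two ends of the edge, so this is the coboundary
  if \<open>u\<close> depends on end points only.\<close>

definition cobd :: "(nat \<times> nat \<Rightarrow> bool) \<Rightarrow> nat \<Rightarrow> bool" where
  "cobd u = (\<lambda>e\<in>edges D. u (side_of D (e, True)) \<noteq> u (side_of D (e, False)))"

lemma cobd_side: "x \<in> sides D \<Longrightarrow> cobd u (side_edge D x) = (u x \<noteq> u (opp D x))"
proof -
  assume x: "x \<in> sides D"
  note e = side_edge_in_edges[OF gl x]
  have "side_of D (side_edge D x, side_dir D x) = x"
    using side_of_label[OF gl x] by (simp add: side_label_def)
  then show ?thesis
    using e by (cases "side_dir D x") (auto simp: cobd_def opp_def)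
qed

text \<open>Invariance moves the value at the opposite of a side to the preceding side of the same
  face, so each corner of the face is counted twice.\<close>

lemma cobd_closed:
  assumes "u \<in> invariant"
  shows "cobd u \<in> closed_cochains"
proof -
  have u: "u (opp D (next_side D x)) = u x" if "x \<in> sides D" for x
    using assms that by (simp add: invariant_def)
  have "face_parity D (cochain (cobd u)) f = 0" if f: "f \<in> faces D" for f
  proof -
    have "face_parity D (cochain (cobd u)) f =
        (\<Sum>x\<in>sides D. of_bool (fst x = f) * of_bool (u x)) + (\<Sum>x\<in>sides D. of_bool (fst x = f) * of_bool (u (opp D x)))"
      unfolding face_parity_sides[OF cells f] sum.distrib[symmetric]
      by (intro sum.cong refl) (simp add: cochain_def cobd_side bit_of_bool_neq distrib_left)
    also have "(\<Sum>x\<in>sides D. of_bool (fst x = f) * (of_bool (u (opp D x)) :: bit)) =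
        (\<Sum>x\<in>sides D. of_bool (fst (next_side D x) = f) * of_bool (u (opp D (next_side D x))))"
      by (rule sum_next_side[OF cells, symmetric])
    also have "\<dots> = (\<Sum>x\<in>sides D. of_bool (fst x = f) * of_bool (u x))"
      by (intro sum.cong refl) (simp add: u)
    finally show ?thesis by simp
  qed
  then show ?thesis
    by (simp add: closed_cochains_def cobd_def)
qed

lemma vertex_function_invariant: "(\<lambda>x\<in>sides D. t (end_point D x)) \<in> invariant"
proof -
  have "opp D (next_side D x) \<in> sides D" if "x \<in> sides D" for x
    using opp(1)[OF next_side_in_sides[OF that]] .
  then show ?thesis
    by (simp add: invariant_def end_point_rotate)
qed

end

section \<open>The sphere\<close>

locale closed_connected_surface = closed_surface +
  assumes conn: "connected_space (topo M)" and nonempty: "topspace (topo M) \<noteq> {}" and sphere: "genus M 0"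
begin

lemma faces_nonempty: "faces D \<noteq> {}"
proof -
  obtain p where "p \<in> topspace (topo M)"
    using nonempty by blast
  then obtain f where "f \<in> faces D"
    by (rule closed_faces_cover[OF os pl])
  then show ?thesis by blast
qed

lemma euler: "card (verts D) + card (faces D) = card (edges D) + 2"
proof -
  have "int (card (verts D)) - int (card (edges D)) + int (card (faces D)) = 2"
    using sphere pl nin unfolding genus_def by simp
  then show ?thesis by linarith
qed

lemma constant_on_faces:
  assumes "\<And>x y. x \<in> sides D \<Longrightarrow> y \<in> sides D \<Longrightarrow> side_edge D x = side_edge D y \<Longrightarrow> P (fst x) \<Longrightarrow> P (fst y)"
    and "f \<in> faces D" "P f" "f' \<in> faces D"
  shows "P f'"
  by (rule faces_edge_connected[OF os pl boundary_empty conn assms])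

text \<open>Double counting: characters of the group of functions on the faces detect closed cochains, and by connectedness
  only the two constant functions are orthogonal to all cochains.\<close>

lemma card_closed_cochains: "2 ^ card (faces D) * card closed_cochains = 2 ^ card (edges D) * 2"
proof -
  define F where "F = faces D"
  define E where "E = edges D"
  define L where "L = (\<lambda>e. fst (side_of D (e, True)))"
  define R where "R = (\<lambda>e. fst (side_of D (e, False)))"
  have fin: "finite F" "finite E"
    unfolding F_def E_def using plcw_cells_D(1,2)[OF cells] by auto
  have finP: "finite (E \<rightarrow>\<^sub>E (UNIV :: bool set))" "finite (F \<rightarrow>\<^sub>E (UNIV :: bool set))"
    using fin by (auto intro: finite_PiE)
  have const: "{S \<in> F \<rightarrow>\<^sub>E (UNIV :: bool set). \<forall>e\<in>E. S (L e) = S (R e)} = {\<lambda>f\<in>F. True, \<lambda>f\<in>F. False}"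
  proof
    show "{S \<in> F \<rightarrow>\<^sub>E (UNIV :: bool set). \<forall>e\<in>E. S (L e) = S (R e)} \<subseteq> {\<lambda>f\<in>F. True, \<lambda>f\<in>F. False}"
    proof
      fix S assume "S \<in> {S \<in> F \<rightarrow>\<^sub>E (UNIV :: bool set). \<forall>e\<in>E. S (L e) = S (R e)}"
      then have S: "S \<in> F \<rightarrow>\<^sub>E UNIV" "\<And>e. e \<in> E \<Longrightarrow> S (L e) = S (R e)"
        by auto
      have side: "S (fst x) = S (L (side_edge D x))" if "x \<in> sides D" for x
      proof -
        note e = side_edge_in_edges[OF gl that]
        have "x = side_of D (side_edge D x, side_dir D x)"
          using side_of_label[OF gl that] by (simp add: side_label_def)
        then show ?thesis
          using S(2)[of "side_edge D x"] e unfolding L_def R_def E_def by (cases "side_dir D x") (metis, metis)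
      qed
      have all: "S f'" if "f \<in> F" "S f" "f' \<in> F" for f f'
        by (rule constant_on_faces[of S f f']) (use that side in \<open>simp_all add: F_def\<close>)
      show "S \<in> {\<lambda>f\<in>F. True, \<lambda>f\<in>F. False}"
      proof (cases "\<exists>f\<in>F. S f")
        case True
        then obtain f where f: "f \<in> F" "S f" by blast
        have "S = (\<lambda>f\<in>F. True)"
          by (rule PiE_ext[OF S(1)]) (simp_all add: all[OF f])
        then show ?thesis by simp
      next
        case False
        then have "S = (\<lambda>f\<in>F. False)"
          by (intro PiE_ext[OF S(1)]) simp_all
        then show ?thesis by simp
      qed
    qed
    have "L e \<in> F" "R e \<in> F" if "e \<in> E" for e
      using side_face[OF side_of_edge(1)] that by (simp_all add: L_def R_def F_def E_def)
    then show "{\<lambda>f\<in>F. True, \<lambda>f\<in>F. False} \<subseteq> {S \<in> F \<rightarrow>\<^sub>E (UNIV :: bool set). \<forall>e\<in>E. S (L e) = S (R e)}"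
      by auto
  qed
  have "(\<lambda>f\<in>F. True) \<noteq> (\<lambda>f\<in>F. False)"
    using faces_nonempty unfolding F_def by (metis ex_in_conv restrict_apply')
  then have two: "card {S \<in> F \<rightarrow>\<^sub>E (UNIV :: bool set). \<forall>e\<in>E. S (L e) = S (R e)} = 2"
    unfolding const by simp
  have "(\<Sum>y\<in>E \<rightarrow>\<^sub>E UNIV. \<Sum>S\<in>F \<rightarrow>\<^sub>E UNIV. bsign (\<Sum>f\<in>F. of_bool (S f) * face_parity D (cochain y) f)) =
      (\<Sum>y\<in>E \<rightarrow>\<^sub>E UNIV. if \<forall>f\<in>F. face_parity D (cochain y) f = 0 then 2 ^ card F else (0 :: real))"
    by (intro sum.cong refl character_sum fin)
  also have "\<dots> = 2 ^ card F * real (card closed_cochains)"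
    unfolding closed_cochains_def sum_if_const[OF finP(1)] by (simp only: F_def E_def)
  finally have 1: "(\<Sum>y\<in>E \<rightarrow>\<^sub>E UNIV. \<Sum>S\<in>F \<rightarrow>\<^sub>E UNIV. bsign (\<Sum>f\<in>F. of_bool (S f) * face_parity D (cochain y) f)) =
      2 ^ card F * real (card closed_cochains)" .
  have "(\<Sum>y\<in>E \<rightarrow>\<^sub>E UNIV. \<Sum>S\<in>F \<rightarrow>\<^sub>E UNIV. bsign (\<Sum>f\<in>F. of_bool (S f) * face_parity D (cochain y) f)) =
      (\<Sum>S\<in>F \<rightarrow>\<^sub>E UNIV. \<Sum>y\<in>E \<rightarrow>\<^sub>E UNIV. bsign (\<Sum>e\<in>E. of_bool (y e) * (of_bool (S (L e)) + of_bool (S (R e)))))"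
    unfolding F_def E_def L_def R_def sum_face_parity unfolding cochain_def by (rule sum.swap)
  also have "\<dots> = (\<Sum>S\<in>F \<rightarrow>\<^sub>E UNIV. if \<forall>e\<in>E. of_bool (S (L e)) + of_bool (S (R e)) = (0 :: bit) then 2 ^ card E else (0 :: real))"
    by (intro sum.cong refl character_sum fin)
  also have "\<dots> = (\<Sum>S\<in>F \<rightarrow>\<^sub>E (UNIV :: bool set). if \<forall>e\<in>E. S (L e) = S (R e) then 2 ^ card E else (0 :: real))"
  proof -
    have "of_bool a + of_bool b = (0 :: bit) \<longleftrightarrow> a = b" for a b
      by (cases a; cases b) simp_all
    then show ?thesis by simp
  qed
  also have "\<dots> = 2 ^ card E * 2"
    unfolding sum_if_const[OF finP(2)] two by simp
  finally have "real (2 ^ card F * card closed_cochains) = real (2 ^ card E * 2)"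
    using 1 by simp
  then show ?thesis
    unfolding F_def E_def by (simp only: of_nat_eq_iff)
qed

text \<open>An invariant function is determined by its coboundary and one value, so there are at most \<open>2\<^sup>V\<close> of them by the
  Euler formula, but the functions of the end points are already as many.\<close>

lemma invariant_facts:
  shows "invariant = (\<lambda>t. \<lambda>x\<in>sides D. t (end_point D x)) ` (verts D \<rightarrow>\<^sub>E UNIV)"
    and "closed_cochains \<subseteq> cobd ` invariant"
proof -
  obtain f0 where f0: "f0 \<in> faces D"
    using faces_nonempty by blast
  define x0 where "x0 = (f0, 1::nat)"
  have x0: "x0 \<in> sides D"
    using f0 plcw_cells_D(3)[OF cells f0] by (simp add: x0_def sides_def)
  \<comment> \<open>The difference \<open>w\<close> of two functions with equal coboundary agrees on
    opposite sides, by invariance also on consecutive ones, and is then constant by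
    connectedness.\<close>
  have inj: "inj_on (\<lambda>u. (u x0, cobd u)) invariant"
  proof (rule inj_onI)
    fix u u' assume u: "u \<in> invariant" "u' \<in> invariant" and eq: "(u x0, cobd u) = (u' x0, cobd u')"
    define w where "w = (\<lambda>x. u x \<noteq> u' x)"
    have w_opp: "w (opp D x) = w x" if "x \<in> sides D" for x
      using eq cobd_side[OF that, of u] cobd_side[OF that, of u'] by (auto simp: w_def)
    have w_next: "w (next_side D x) = w x" if x: "x \<in> sides D" for x
      using w_opp[OF next_side_in_sides[OF x]] u x by (simp add: w_def invariant_def)
    have w_face: "w (f, k) = w (f, 1)" if "(f, k) \<in> sides D" for f k
      using that
    proof (induction k)
      case (Suc k)
      show ?case
      proof (cases "k = 0")
        case False
        then have k: "(f, k) \<in> sides D" "next_side D (f, k) = (f, Suc k)"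
          using Suc.prems by (auto simp: sides_def next_side_def)
        then show ?thesis
          using Suc.IH w_next[OF k(1)] by simp
      qed simp
    qed (simp add: sides_def)
    have side: "w x = w (fst x, 1)" if "x \<in> sides D" for x
      using w_face[of "fst x" "snd x"] that by simp
    have "\<not> w x" if x: "x \<in> sides D" for x
    proof
      assume "w x"
      have "w (f0, 1)"
      proof (rule constant_on_faces[where P = "\<lambda>f. w (f, 1)" and f = "fst x"])
        fix x y assume xy: "x \<in> sides D" "y \<in> sides D" "side_edge D x = side_edge D y" "w (fst x, 1)"
        then have "w x" using side by simp
        then have "w y"
          using sides_edge_cases[OF xy(1-3)] w_opp[OF xy(1)] by auto
        then show "w (fst y, 1)" using side[OF xy(2)] by simp
      qed (use \<open>w x\<close> side[OF x] side_face[OF x] f0 in simp_all)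
      then show False
        using eq by (simp add: w_def x0_def)
    qed
    then show "u = u'"
      using u by (intro PiE_ext[of u "sides D" "\<lambda>_. UNIV" u']) (auto simp: invariant_def w_def)
  qed
  have fin: "finite (sides D)" "finite (edges D)" "finite (verts D)"
    using finite_sides[OF cells] plcw_cells_D(2)[OF cells] finite_verts[OF cells] by auto
  have finC: "finite closed_cochains"
    by (rule finite_subset[of _ "edges D \<rightarrow>\<^sub>E UNIV"]) (use fin in \<open>auto simp: closed_cochains_def intro: finite_PiE\<close>)
  have finI: "finite invariant"
    by (rule finite_subset[of _ "sides D \<rightarrow>\<^sub>E UNIV"]) (use fin in \<open>auto simp: invariant_def intro: finite_PiE\<close>)
  have sub: "(\<lambda>u. (u x0, cobd u)) ` invariant \<subseteq> UNIV \<times> closed_cochains"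
    using cobd_closed by blast
  define vf where "vf = (\<lambda>t :: 'a \<Rightarrow> bool. \<lambda>x\<in>sides D. t (end_point D x))"
  have vf_inj: "inj_on vf (verts D \<rightarrow>\<^sub>E UNIV)"
  proof (rule inj_onI)
    fix t t' assume t: "t \<in> verts D \<rightarrow>\<^sub>E UNIV" "t' \<in> verts D \<rightarrow>\<^sub>E UNIV" "vf t = vf t'"
    have "t v = t' v" if v: "v \<in> verts D" for v
    proof -
      obtain x where x: "x \<in> sides D" "v = end_point D x"
        using v end_point_image by blast
      then show ?thesis
        using fun_cong[OF t(3), of x] by (simp add: vf_def)
    qed
    then show "t = t'"
      by (rule PiE_ext[OF t(1,2)])
  qed
  have vf_sub: "vf ` (verts D \<rightarrow>\<^sub>E UNIV) \<subseteq> invariant"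
    unfolding vf_def using vertex_function_invariant by blast
  \<comment> \<open>Euler's formula turns the double count into the order \<open>2 ^ (V - 1)\<close>
    of the group of closed cochains.\<close>
  have "2 ^ card (faces D) * (2 * card closed_cochains) = 2 ^ (card (edges D) + 2)"
    using card_closed_cochains by (simp add: mult.commute)
  also have "\<dots> = 2 ^ card (faces D) * 2 ^ card (verts D)"
    unfolding euler[symmetric] by (simp add: power_add)
  finally have two: "2 * card closed_cochains = 2 ^ card (verts D)"
    by simp
  have 1: "card invariant \<le> 2 ^ card (verts D)"
  proof -
    have "card invariant = card ((\<lambda>u. (u x0, cobd u)) ` invariant)"
      using card_image[OF inj] by simp
    also have "\<dots> \<le> card ((UNIV :: bool set) \<times> closed_cochains)"
      by (rule card_mono[OF _ sub]) (use finC in simp)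
    also have "\<dots> = 2 ^ card (verts D)"
      using two by (simp add: card_cartesian_product)
    finally show ?thesis .
  qed
  have 2: "card (vf ` (verts D \<rightarrow>\<^sub>E UNIV)) = 2 ^ card (verts D)"
    using card_image[OF vf_inj] fin by (simp add: card_PiE)
  have eq: "vf ` (verts D \<rightarrow>\<^sub>E UNIV) = invariant"
    by (rule card_seteq[OF finI vf_sub]) (use 1 2 in simp)
  have "card ((\<lambda>u. (u x0, cobd u)) ` invariant) = 2 ^ card (verts D)"
    using card_image[OF inj] 2 eq by simp
  \<comment> \<open>Equal cardinalities make the injection surjective, so every closed cochain is a
    coboundary.\<close>
  then have "(\<lambda>u. (u x0, cobd u)) ` invariant = UNIV \<times> closed_cochains"
    using two finC by (intro card_subset_eq[OF _ sub]) (simp_all add: card_cartesian_product)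
  then have "(True, y) \<in> (\<lambda>u. (u x0, cobd u)) ` invariant" if "y \<in> closed_cochains" for y
    using that by simp
  then show "closed_cochains \<subseteq> cobd ` invariant"
    by blast
  show "invariant = (\<lambda>t. \<lambda>x\<in>sides D. t (end_point D x)) ` (verts D \<rightarrow>\<^sub>E UNIV)"
    unfolding vf_def[symmetric] by (rule eq[symmetric])
qed

lemma closed_cochain_vertices:
  assumes "y \<in> closed_cochains"
  shows "\<exists>T\<subseteq>verts D. \<forall>e\<in>edges D. cochain y e = vertex_cochain D T e"
proof -
  obtain t where t: "cobd (\<lambda>x\<in>sides D. t (end_point D x)) = y"
  proof -
    obtain u where "u \<in> invariant" "cobd u = y"
      using assms invariant_facts(2) by blast
    moreover then obtain t where "u = (\<lambda>x\<in>sides D. t (end_point D x))"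
      unfolding invariant_facts(1) by blast
    ultimately show ?thesis
      using that by blast
  qed
  show ?thesis
  proof (intro exI[of _ "{v \<in> verts D. t v}"] conjI ballI)
    fix e assume e: "e \<in> edges D"
    have "y e = (t (emap D e 1) \<noteq> t (emap D e 0))"
      using e by (simp add: t[symmetric] cobd_def side_of_edge end_points)
    then show "cochain y e = vertex_cochain D {v \<in> verts D. t v} e"
      using edge_ends_in_verts[OF e] by (simp add: cochain_def vertex_cochain_def bit_of_bool_neq add.commute)
  qed blast
qed

text \<open>The indicator of an orbit of the rotation is invariant, hence a function of the end
  point, and cannot separate two corners at one vertex. So the orbit of one corner enumerates all
  corners at \<open>v\<close>, as \<open>quad_vertex_corners\<close> requires.\<close>

lemma sign_exponent_single_vertex:
  assumes v: "v \<in> verts D"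
  shows "sign_exponent M D (vertex_cochain D {v}) = 0"
proof -
  \<comment> \<open>Extended by the identity outside \<open>sides D\<close>, so as to be injective
    everywhere.\<close>
  define rot where "rot = (\<lambda>x. if x \<in> sides D then opp D (next_side D x) else x)"
  have rot_in: "rot x \<in> sides D" if "x \<in> sides D" for x
    using that opp(1)[OF next_side_in_sides[OF that]] by (simp add: rot_def)
  have inj: "inj rot"
  proof (rule injI)
    fix x y assume eq: "rot x = rot y"
    show "x = y"
    proof (cases "x \<in> sides D \<longleftrightarrow> y \<in> sides D")
      case True
      show ?thesis
      proof (cases "x \<in> sides D")
        case x: True
        then have y: "y \<in> sides D" using True by simp
        have "opp D (next_side D x) = opp D (next_side D y)"
          using eq x y by (simp add: rot_def)
        then have "opp D (opp D (next_side D x)) = opp D (opp D (next_side D y))"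
          by (rule arg_cong)
        then have "next_side D x = next_side D y"
          unfolding opp_opp[OF next_side_in_sides[OF x]] opp_opp[OF next_side_in_sides[OF y]] .
        then show ?thesis
          by (rule inj_onD[OF next_side_inj _ x y])
      next
        case False
        then have r: "rot x = x" "rot y = y"
          using True by (simp_all add: rot_def)
        show ?thesis using eq unfolding r .
      qed
    next
      case False
      then show ?thesis
        using eq rot_in by (metis rot_def)
    qed
  qed
  obtain x0 where x0: "x0 \<in> sides D" "end_point D x0 = v"
    using v unfolding end_point_image[symmetric] by blast
  define X where "X = (\<lambda>i. (rot ^^ i) x0)"
  have X: "X i \<in> sides D" "end_point D (X i) = v" for i
  proof (induction i)
    case (Suc i)
    {
      case 1
      then show ?case using rot_in[OF Suc(1)] by (simp add: X_def)
    next
      case 2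
      have "X (Suc i) = opp D (next_side D (X i))"
        using Suc(1) by (simp add: X_def rot_def)
      then show ?case using end_point_rotate[OF Suc(1)] Suc(2) by simp
    }
  qed (simp_all add: X_def x0)
  have step: "X (Suc i) = opp D (next_side D (X i))" for i
    using X(1)[of i] by (simp add: X_def rot_def)
  have "finite {y. \<exists>n. y = (rot ^^ n) x0}"
    by (rule finite_subset[OF _ finite_sides[OF cells]]) (use X(1) in \<open>auto simp: X_def\<close>)
  then obtain p where p: "0 < p" "X p = x0"
    unfolding X_def by (rule funpow_inj_finite[OF inj])
  \<comment> \<open>The length of the orbit; its minimality makes \<open>X\<close> injective below
    \<open>n\<close>.\<close>
  define n where "n = (LEAST n. 0 < n \<and> X n = x0)"
  have n: "0 < n" "X n = x0"
    unfolding n_def using LeastI[of "\<lambda>n. 0 < n \<and> X n = x0" p] p by auto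
  have least: "n \<le> k" if "0 < k" "X k = x0" for k
    unfolding n_def by (rule Least_le) (use that in simp)
  have X0: "X 0 = x0"
    by (simp add: X_def)
  have shift_eq: "X (j - i) = x0" if "X i = X j" "i \<le> j" for i j
  proof -
    have "(rot ^^ i) x0 = (rot ^^ i) ((rot ^^ (j - i)) x0)"
      using that funpow_add[of i "j - i" rot] by (simp add: X_def)
    then show ?thesis
      using inj_fn[OF inj, of i] by (simp add: X_def inj_eq)
  qed
  have ne: "X i \<noteq> X j" if "i < j" "j < n" for i j
    using shift_eq[of i j] least[of "j - i"] that by auto
  have inj_X: "inj_on X {..<n}"
  proof (rule inj_onI)
    fix i j assume "i \<in> {..<n}" "j \<in> {..<n}" "X i = X j"
    then show "i = j"
      using ne[of i j] ne[of j i] by (cases i j rule: linorder_cases) auto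
  qed
  have rangeX: "X i \<in> X ` {..<n}" for i
  proof -
    have "X (i mod n) = X i"
      unfolding X_def by (rule funpow_mod_eq) (use n(2) in \<open>simp add: X_def\<close>)
    moreover have "i mod n < n" using n(1) by simp
    ultimately show ?thesis by (metis imageI lessThan_iff)
  qed
  have "X ` {..<n} = {x \<in> sides D. end_point D x = v}"
  proof
    show "X ` {..<n} \<subseteq> {x \<in> sides D. end_point D x = v}"
      using X by blast
    define u where "u = (\<lambda>x\<in>sides D. x \<in> range X)"
    have pull: "x \<in> range X" if x: "x \<in> sides D" "rot x = X i" for x i
    proof -
      obtain k where k: "rot x = X (Suc k)"
      proof (cases i)
        case 0
        obtain l where "n = Suc l" using n(1) by (cases n) auto
        then show ?thesis using that[of l] x(2) 0 n(2) X0 by simp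
      next
        case (Suc k)
        then show ?thesis using that x(2) by simp
      qed
      then have "rot x = rot (X k)"
        by (simp add: X_def)
      then have "x = X k"
        using inj by (simp add: inj_eq)
      then show ?thesis by blast
    qed
    have "u (opp D (next_side D x)) = u x" if x: "x \<in> sides D" for x
    proof -
      have r: "rot x = opp D (next_side D x)"
        using x by (simp add: rot_def)
      have "rot x \<in> range X \<longleftrightarrow> x \<in> range X"
      proof
        assume "rot x \<in> range X"
        then show "x \<in> range X" using pull[OF x] by blast
      next
        assume "x \<in> range X"
        then obtain i where "x = X i" by blast
        then have "rot x = X (Suc i)" by (simp add: X_def)
        then show "rot x \<in> range X" by blast
      qed
      then show ?thesis
        using x rot_in[OF x] unfolding u_def r by simp
    qed
    then have "u \<in> invariant"
      by (simp add: invariant_def u_def)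
    then obtain t where t: "u = (\<lambda>x\<in>sides D. t (end_point D x))"
      unfolding invariant_facts(1) by blast
    show "{x \<in> sides D. end_point D x = v} \<subseteq> X ` {..<n}"
    proof
      fix x assume "x \<in> {x \<in> sides D. end_point D x = v}"
      then have x: "x \<in> sides D" "end_point D x = end_point D x0"
        using x0(2) by auto
      have "x0 \<in> range X"
        unfolding X0[symmetric] by (rule rangeI)
      then have "u x0"
        using x0(1) by (simp add: u_def)
      then have "u x"
        using x x0(1) by (simp add: t)
      then have "x \<in> range X"
        using x(1) by (simp add: u_def)
      then show "x \<in> X ` {..<n}"
        using rangeX by blast
    qed
  qed
  moreover have "X n = X 0"
    using n(2) X0 by simp
  ultimately have "quad (vertex_cochain D {v}) =
      (\<Sum>x\<in>{x \<in> sides D. end_point D x = v}. 1 + of_bool (snd (next_side D x) = 1) + of_bool (side_dir D (next_side D x))) + 1"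
    by (intro quad_vertex_corners[OF n(1) inj_X _ step])
  then show ?thesis
    by (rule sign_exponent_vertex[OF v])
qed

text \<open>Coboundaries are closed, so \<open>quad_add_closed\<close> allows adding one vertex at a
  time; the linear part is additive.\<close>

lemma sign_exponent_vertices:
  assumes "T \<subseteq> verts D"
  shows "sign_exponent M D (vertex_cochain D T) = 0"
  using finite_subset[OF assms finite_verts[OF cells]] assms
proof (induction T rule: finite_induct)
  case empty
  then show ?case
    by (simp add: sign_exponent_quad quad_def vertex_cochain_def)
next
  case (insert v T)
  have add: "vertex_cochain D (insert v T) = (\<lambda>e. vertex_cochain D T e + vertex_cochain D {v} e)"
    using insert.hyps(2) by (auto simp: vertex_cochain_def fun_eq_iff)
  have "sign_exponent M D (vertex_cochain D (insert v T)) =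
      sign_exponent M D (vertex_cochain D T) + sign_exponent M D (vertex_cochain D {v})"
  proof -
    have "quad (\<lambda>e. vertex_cochain D T e + vertex_cochain D {v} e) = quad (vertex_cochain D T) + quad (vertex_cochain D {v})"
      by (rule quad_add_closed) (rule vertex_cochain_closed)
    then show ?thesis
      unfolding sign_exponent_quad add by (simp add: distrib_right sum.distrib)
  qed
  then show ?case
    using insert.IH insert.prems sign_exponent_single_vertex by simp
qed

text \<open>All closed cochains contribute with sign 1. Their number \<open>2 ^ (E - F + 1)\<close>,
  times \<open>2 ^ F\<close> from the faces and \<open>2 ^ (- E)\<close> from the edges, is
  2.\<close>

lemma value_sphere:
  fixes Z :: "((nat \<Rightarrow> bool) \<Rightarrow> 'k::field) \<Rightarrow> 'k"
  assumes k: "(2::'k) \<noteq> 0" and Z: "state_sum_value r (clifford :: (bool, 'k) frobenius) M Z"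
  shows "Z (\<lambda>i. \<Prod>j=1..nin M. theta_pow (lam M j) (i j)) = 2"
proof -
  have conf: "conf M D w e = cochain w e" if "e \<in> edges D" for w e
    using inner[OF that] by (simp add: conf_def cochain_def)
  have par: "face_parity D (conf M D w) f = face_parity D (cochain w) f" if "f \<in> faces D" for w f
    by (rule cong_face_parity[OF gl that conf])
  have fin: "finite (edges D \<rightarrow>\<^sub>E (UNIV :: bool set))"
    using plcw_cells_D(2)[OF cells] by (auto intro: finite_PiE)
  have "Z (\<lambda>i. \<Prod>j=1..nin M. theta_pow (lam M j) (i j)) =
      (\<Sum>w\<in>edges D \<rightarrow>\<^sub>E UNIV. if \<forall>f\<in>faces D. face_parity D (cochain w) f = 0
        then 2 ^ card (faces D) * (1 / 2) ^ card (edges D) else 0)"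
    unfolding state_sum_value_clifford[OF k M Z D] inner_edges_all
  proof (intro sum.cong refl)
    fix w :: "nat \<Rightarrow> bool" assume w: "w \<in> edges D \<rightarrow>\<^sub>E UNIV"
    show "(if \<forall>f\<in>faces D. face_parity D (conf M D w) f = 0
        then 2 ^ card (faces D) * (1 / 2) ^ card (edges D) * bsign (sign_exponent M D (conf M D w)) else 0) =
      (if \<forall>f\<in>faces D. face_parity D (cochain w) f = 0 then 2 ^ card (faces D) * (1 / 2) ^ card (edges D) else (0 :: 'k))"
    proof (cases "\<forall>f\<in>faces D. face_parity D (cochain w) f = 0")
      case True
      then have "w \<in> closed_cochains"
        using w by (simp add: closed_cochains_def)
      then obtain T where T: "T \<subseteq> verts D" "\<forall>e\<in>edges D. cochain w e = vertex_cochain D T e"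
        using closed_cochain_vertices by blast
      have "sign_exponent M D (conf M D w) = sign_exponent M D (vertex_cochain D T)"
        by (rule sign_exponent_cong) (simp add: conf T(2))
      then show ?thesis
        using True par sign_exponent_vertices[OF T(1)] by simp
    next
      case False
      then show ?thesis using par by auto
    qed
  qed
  also have "\<dots> = 2 ^ card (faces D) * (1 / 2) ^ card (edges D) * of_nat (card closed_cochains)"
    unfolding closed_cochains_def by (rule sum_if_const[OF fin])
  also have "\<dots> = (1 / 2) ^ card (edges D) * of_nat (2 ^ card (faces D) * card closed_cochains)"
    by (simp add: mult_ac)
  also have "\<dots> = 2"
    unfolding card_closed_cochains using k by (simp add: power_divide)
  finally show ?thesis .
qed

end

section \<open>The value in terms of the Arf invariant\<close>

lemma value_of_arf:
  fixes M :: "('p, 'q) rspin_surface" and Z :: "((nat \<Rightarrow> bool) \<Rightarrow> 'k::field) \<Rightarrow> 'k"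
  assumes r: "even r" and k: "(2::'k) \<noteq> 0" and M: "rspin r M" and gen: "genus M g"
    and Z: "state_sum_value r (clifford :: (bool, 'k) frobenius) M Z" and arf: "arf r M g x" and pos: "0 < g + nin M"
  shows "Z (\<lambda>i. \<Prod>j=1..nin M. theta_pow (lam M j) (i j)) = 2 powi (1 - int g) * (- 1) ^ x"
proof -
  have "g + nin M \<noteq> 0"
    using pos by simp
  from conjunct2[OF arf[unfolded arf_def]] obtain D f m se te re ca cb cc cd \<zeta>a \<zeta>b \<zeta>c \<zeta>d where D: "presents r M D"
    and std: "standard_polygon M D f m g se te re"
    and a: "\<forall>i\<in>{1..g}. crossing_curve D f (se i) (ca i) \<and> closed_holonomy M (ca i) (\<zeta>a i) \<and>
            crossing_curve D f (te i) (cb i) \<and> closed_holonomy M (cb i) (\<zeta>b i)"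
    and c: "\<forall>j\<in>{1..<nin M}. crossing_curve D f (re j) (cd j) \<and> closed_holonomy M (cd j) (\<zeta>d j) \<and>
            (\<exists>\<eta>. polygon_curve D f (bedge M D (nin M)) (bedge M D j) \<eta> (cc j)) \<and>
            arc_holonomy M (nin M) j (cc j) (\<zeta>c j)"
    and x: "[int x = (\<Sum>i\<in>{1..g}. (\<zeta>a i + 1) * (\<zeta>b i + 1)) + (\<Sum>j\<in>{1..<nin M}. (\<zeta>c j + 1) * (\<zeta>d j + 1))] (mod 2)"
    unfolding if_not_P[OF \<open>g + nin M \<noteq> 0\<close>] by (elim exE conjE)
  interpret standard_surface r g m f M D se te re
    by unfold_locales (use r M D std pos gen in simp_all)
  \<comment> \<open>The decomposition that computes the Arf invariant also presents
    \<open>M\<close>, so the state sum may be evaluated on it.\<close>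
  have "of_int (int x) = (\<Sum>i\<in>{1..g}. hA (se i) * hA (te i)) + (\<Sum>j\<in>{1..nin M}. lamb j * hU j)"
    using cong_imp_bit_eq[of "int x" _ 2] x
      arf_exponent[OF bspec[OF a] bspec[OF c]] by simp
  then show ?thesis
    unfolding value_standard[OF k Z] minus_one_power_bsign by simp
qed

theorem theorem1p3:
  fixes r g x :: nat
    and M :: "('p, 'q) rspin_surface"
    and Z :: "((nat \<Rightarrow> bool) \<Rightarrow> 'k::field) \<Rightarrow> 'k"
  assumes "even r"
    and "(2::'k) \<noteq> 0"
    and "rspin r M"
    and "compact_space (topo M)"
    and "connected_space (topo M)"
    and "topspace (topo M) \<noteq> {}"
    and "genus M g"
    and "state_sum_value r (clifford :: (bool, 'k) frobenius) M Z"
    and "arf r M g x"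
  shows "Z (\<lambda>i. \<Prod>j=1..nin M. theta_pow (lam M j) (i j)) = 2 powi (1 - int g) * (- 1) ^ x"
proof (cases "g + nin M = 0")
  case True
  then have x: "x = 0" and g: "g = 0" and nin: "nin M = 0"
    using assms(9) by (auto simp: arf_def)
  \<comment> \<open>For the sphere \<open>arf\<close> supplies no decomposition; the existence part
    of \<open>state_sum_value\<close> does.\<close>
  obtain D where D: "presents r M D"
    using assms(8) unfolding state_sum_value_def by (elim conjE exE)
  interpret closed_connected_surface r M D
    by unfold_locales (use assms D nin g in simp_all)
  show ?thesis
    using value_sphere[OF assms(2,8)] by (simp add: x g)
next
  case False
  then show ?thesis
    by (intro value_of_arf[OF assms(1-3,7-9)]) simp
qed

end
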